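(* Let $p\in(1,\infty)\setminus\{2\}$, let $\phi_p:=\arccos|1-2/p|$, and let $\phi\in(\phi_p,\pi/2)$. For $n\in\mathbb{N}$ write $A_n=e^{i\phi}I_n$, where $I_n$ is the $n\times n$ identity matrix (viewed as a constant matrix function on $\mathbb{R}^n$), and let $A_n^*=e^{-i\phi}I_n$. Then $$ \sup_{n\in\mathbb{N}}N_p(A_n,A_n^* )=\infty . $$
   Context: For a measurable $A:\mathbb{R}^n\to\mathbb{C}^{n\times n}$ which is bounded and uniformly strictly accretive (there is $\lambda>0$ with $\mathrm{Re}\langle A(x)\xi,\xi\rangle\geq\lambda|\xi|^2$ for a.e. $x$ and all $\xi\in\mathbb{C}^n$), $L_A$ denotes the operator $-\mathrm{div}(A\nabla)$ on $L^2(\mathbb{R}^n)$ associated with the sesquilinear form $\mathfrak{a}(u,v)=\int_{\mathbb{R}^n}\langle A\nabla u,\nabla v\rangle_{\mathbb{C}^n}$ with domain $H^1(\mathbb{R}^n)$, and $P_t^A=e^{-tL_A}$, $t>0$, is the semigroup on $L^2(\mathbb{R}^n)$ generated by $-L_A$. For two such matrix functions $A,B$ on $\mathbb{R}^n$ and $1/p+1/q=1$, $$ N_p(A,B):=\sup_{f,g\in C_c^\infty(\mathbb{R}^n)\setminus\{0\}}\frac{1}{\|f\|_p\|g\|_q}\int_0^\infty\int_{\mathbb{R}^n}|\nabla P_t^Af(x)|\,|\nabla P_t^Bg(x)|\,dx\,dt\in[0,\infty], $$ with $\nabla$ the spatial gradient. *)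

theory Defs
  imports "HOL-Analysis.Analysis" "Jordan_Normal_Form.Matrix" "Jordan_Normal_Form.Conjugate"
begin

text \<open>
  Since the dimension is quantified over, the points of \<open>\<real>\<^sup>n\<close> are the functions
  \<^typ>\<open>nat \<Rightarrow> real\<close> that are extensional on \<open>{..<n}\<close>; their topology is the subspace topology of
  the product topology, and their measure is the product of one-dimensional Lebesgue measures.
  Functions on \<open>\<real>\<^sup>n\<close> are only ever inspected on \<^term>\<open>space (Rn n)\<close>.  Elements of \<open>L\<^sup>p\<close> and
  \<open>H\<^sup>1\<close> are handled through Borel representatives, all identities between them being understood
  almost everywhere.
\<close>

abbreviation Rn :: "nat \<Rightarrow> (nat \<Rightarrow> real) measure" where
  "Rn n \<equiv> Pi\<^sub>M {..<n} (\<lambda>_. lborel)"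

type_synonym scalar_field = "(nat \<Rightarrow> real) \<Rightarrow> complex"
type_synonym vector_field = "(nat \<Rightarrow> real) \<Rightarrow> complex vec"
type_synonym matrix_field = "(nat \<Rightarrow> real) \<Rightarrow> complex mat"

section \<open>Test functions\<close>

definition partial :: "nat \<Rightarrow> scalar_field \<Rightarrow> scalar_field" where
  "partial i f x = vector_derivative (\<lambda>t. f (x(i := t))) (at (x i))"

text \<open>Continuous partial derivatives up to order \<open>k\<close>, that is, \<open>C\<^sup>k(\<real>\<^sup>n)\<close>.\<close>

primrec Ck_fun :: "nat \<Rightarrow> nat \<Rightarrow> scalar_field \<Rightarrow> bool" where
  "Ck_fun n 0 f \<longleftrightarrow> continuous_on (space (Rn n)) f"
| "Ck_fun n (Suc k) f \<longleftrightarrow>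
     continuous_on (space (Rn n)) f \<and>
     (\<forall>i<n. (\<forall>x\<in>space (Rn n). (\<lambda>t. f (x(i := t))) differentiable (at (x i))) \<and>
            Ck_fun n k (partial i f))"

definition test_functions :: "nat \<Rightarrow> scalar_field set" where
  "test_functions n =
     {f. (\<forall>k. Ck_fun n k f) \<and> compact (closure {x \<in> space (Rn n). f x \<noteq> 0})}"

section \<open>Lebesgue and Sobolev spaces\<close>

definition Lp :: "nat \<Rightarrow> real \<Rightarrow> scalar_field set" where
  "Lp n p = {f \<in> borel_measurable (Rn n). integrable (Rn n) (\<lambda>x. norm (f x) powr p)}"

definition Lp_norm :: "nat \<Rightarrow> real \<Rightarrow> scalar_field \<Rightarrow> real" where
  "Lp_norm n p f = (\<integral>x. norm (f x) powr p \<partial>Rn n) powr (1 / p)"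

definition L2_inner :: "nat \<Rightarrow> scalar_field \<Rightarrow> scalar_field \<Rightarrow> complex" where
  "L2_inner n f g = (\<integral>x. f x * cnj (g x) \<partial>Rn n)"

definition is_weak_gradient :: "nat \<Rightarrow> scalar_field \<Rightarrow> vector_field \<Rightarrow> bool" where
  "is_weak_gradient n u G \<longleftrightarrow>
     (\<forall>x\<in>space (Rn n). G x \<in> carrier_vec n) \<and>
     (\<forall>i<n. (\<lambda>x. vec_index (G x) i) \<in> Lp n 2 \<and>
        (\<forall>\<phi>\<in>test_functions n.
           (\<integral>x. u x * partial i \<phi> x \<partial>Rn n) = - (\<integral>x. vec_index (G x) i * \<phi> x \<partial>Rn n)))"

definition H1 :: "nat \<Rightarrow> scalar_field set" where
  "H1 n = {u \<in> Lp n 2. \<exists>G. is_weak_gradient n u G}"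

text \<open>For \<open>u\<close> in \<open>H\<^sup>1\<close> the weak gradient is unique up to null sets.\<close>

definition grad :: "nat \<Rightarrow> scalar_field \<Rightarrow> vector_field" where
  "grad n u = (SOME G. is_weak_gradient n u G)"

definition cvec_norm :: "complex vec \<Rightarrow> real" where
  "cvec_norm v = sqrt (\<Sum>i<dim_vec v. (cmod (vec_index v i))\<^sup>2)"

section \<open>The operator \<open>L\<^sub>A = - div (A \<nabla>)\<close> and its semigroup\<close>

text \<open>
  The coefficients for which the notions below are meant.  Here \<open>v \<bullet>c w = \<Sum>\<^sub>i v\<^sub>i cnj w\<^sub>i\<close>.
\<close>

definition accretive_coeff :: "nat \<Rightarrow> matrix_field \<Rightarrow> bool" where
  "accretive_coeff n A \<longleftrightarrow>
     (\<forall>x\<in>space (Rn n). A x \<in> carrier_mat n n) \<and>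
     (\<forall>i<n. \<forall>j<n. (\<lambda>x. A x $$ (i, j)) \<in> borel_measurable (Rn n)) \<and>
     (\<exists>M. \<forall>i<n. \<forall>j<n. AE x in Rn n. cmod (A x $$ (i, j)) \<le> M) \<and>
     (\<exists>c>0. AE x in Rn n. \<forall>\<xi>\<in>carrier_vec n. Re ((A x *\<^sub>v \<xi>) \<bullet>c \<xi>) \<ge> c * (cvec_norm \<xi>)\<^sup>2)"

definition div_form :: "nat \<Rightarrow> matrix_field \<Rightarrow> scalar_field \<Rightarrow> scalar_field \<Rightarrow> complex" where
  "div_form n A u v = (\<integral>x. (A x *\<^sub>v grad n u x) \<bullet>c grad n v x \<partial>Rn n)"

text \<open>
  The graph of the operator associated with the form \<^const>\<open>div_form\<close> with domain \<^const>\<open>H1\<close>: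
  \<open>u\<close> belongs to the domain of \<open>L\<^sub>A\<close> and \<open>L\<^sub>A u = w\<close>.
\<close>

definition div_op :: "nat \<Rightarrow> matrix_field \<Rightarrow> scalar_field \<Rightarrow> scalar_field \<Rightarrow> bool" where
  "div_op n A u w \<longleftrightarrow>
     u \<in> H1 n \<and> w \<in> Lp n 2 \<and> (\<forall>v\<in>H1 n. div_form n A u v = L2_inner n w v)"

definition L2_bounded_linear :: "nat \<Rightarrow> (scalar_field \<Rightarrow> scalar_field) \<Rightarrow> bool" where
  "L2_bounded_linear n T \<longleftrightarrow>
     (\<forall>f\<in>Lp n 2. T f \<in> Lp n 2) \<and>
     (\<forall>f\<in>Lp n 2. \<forall>g\<in>Lp n 2. \<forall>a b.
        AE x in Rn n. T (\<lambda>y. a * f y + b * g y) x = a * T f x + b * T g x) \<and>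
     (\<exists>C. \<forall>f\<in>Lp n 2. Lp_norm n 2 (T f) \<le> C * Lp_norm n 2 f)"

definition L2_C0_semigroup :: "nat \<Rightarrow> (real \<Rightarrow> scalar_field \<Rightarrow> scalar_field) \<Rightarrow> bool" where
  "L2_C0_semigroup n T \<longleftrightarrow>
     (\<forall>t\<ge>0. L2_bounded_linear n (T t)) \<and>
     (\<forall>f\<in>Lp n 2. AE x in Rn n. T 0 f x = f x) \<and>
     (\<forall>s\<ge>0. \<forall>t\<ge>0. \<forall>f\<in>Lp n 2. AE x in Rn n. T (s + t) f x = T s (T t f) x) \<and>
     (\<forall>f\<in>Lp n 2. ((\<lambda>t. Lp_norm n 2 (\<lambda>x. T t f x - f x)) \<longlongrightarrow> 0) (at_right 0))"

text \<open>The graph of the infinitesimal generator of \<open>T\<close>.\<close>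

definition L2_generator ::
    "nat \<Rightarrow> (real \<Rightarrow> scalar_field \<Rightarrow> scalar_field) \<Rightarrow> scalar_field \<Rightarrow> scalar_field \<Rightarrow> bool" where
  "L2_generator n T u w \<longleftrightarrow>
     u \<in> Lp n 2 \<and> w \<in> Lp n 2 \<and>
     ((\<lambda>h. Lp_norm n 2 (\<lambda>x. (T h u x - u x) / of_real h - w x)) \<longlongrightarrow> 0) (at_right 0)"

text \<open>
  \<open>heat_semigroup n A t = exp (-t L\<^sub>A)\<close> is the semigroup generated by \<open>- L\<^sub>A\<close>.  A semigroup is
  determined by its generator, so the choice only concerns representatives.
\<close>

definition heat_semigroup :: "nat \<Rightarrow> matrix_field \<Rightarrow> real \<Rightarrow> scalar_field \<Rightarrow> scalar_field" where
  "heat_semigroup n A =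
     (SOME T. L2_C0_semigroup n T \<and>
              (\<forall>u w. L2_generator n T u w \<longleftrightarrow> div_op n A u (\<lambda>x. - w x)))"

section \<open>The bilinear embedding constant\<close>

definition N_const :: "nat \<Rightarrow> real \<Rightarrow> matrix_field \<Rightarrow> matrix_field \<Rightarrow> ennreal" where
  "N_const n p A B =
     (let q = p / (p - 1); F = {f \<in> test_functions n. \<exists>x\<in>space (Rn n). f x \<noteq> 0} in
      SUP f\<in>F. SUP g\<in>F.
        (\<integral>\<^sup>+t\<in>{0<..}. (\<integral>\<^sup>+x. ennreal (cvec_norm (grad n (heat_semigroup n A t f) x) *
                                     cvec_norm (grad n (heat_semigroup n B t g) x)) \<partial>Rn n) \<partial>lborel)
        / ennreal (Lp_norm n p f * Lp_norm n q g))"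

lemma accretive_coeff_cis:
  assumes "\<bar>\<phi>\<bar> < pi / 2"
  shows "accretive_coeff n (\<lambda>_. cis \<phi> \<cdot>\<^sub>m 1\<^sub>m n)"
proof -
  have pos: "cos \<phi> > 0" using assms by (intro cos_gt_zero_pi) auto
  have "Re (((cis \<phi> \<cdot>\<^sub>m 1\<^sub>m n) *\<^sub>v \<xi>) \<bullet>c \<xi>) = cos \<phi> * (cvec_norm \<xi>)\<^sup>2"
    if \<xi>: "\<xi> \<in> carrier_vec n" for \<xi>
  proof -
    have "(cis \<phi> \<cdot>\<^sub>m 1\<^sub>m n) *\<^sub>v \<xi> = cis \<phi> \<cdot>\<^sub>v \<xi>"
      using \<xi> by (intro eq_vecI) auto
    then have "((cis \<phi> \<cdot>\<^sub>m 1\<^sub>m n) *\<^sub>v \<xi>) \<bullet>c \<xi> = cis \<phi> * (\<xi> \<bullet>c \<xi>)"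
      using \<xi> by simp
    also have "\<xi> \<bullet>c \<xi> = of_real ((cvec_norm \<xi>)\<^sup>2)"
      by (simp add: scalar_prod_def cvec_norm_def sum_nonneg atLeast0LessThan complex_norm_square
                    conjugate_complex_def del: of_real_power)
    finally show ?thesis by simp
  qed
  then have "\<exists>c>0. AE x in Rn n. \<forall>\<xi>\<in>carrier_vec n.
      Re (((cis \<phi> \<cdot>\<^sub>m 1\<^sub>m n) *\<^sub>v \<xi>) \<bullet>c \<xi>) \<ge> c * (cvec_norm \<xi>)\<^sup>2"
    using pos by (intro exI[of _ "cos \<phi>"]) simp
  moreover have "\<exists>M. \<forall>i<n. \<forall>j<n. AE x in Rn n. cmod ((cis \<phi> \<cdot>\<^sub>m 1\<^sub>m n) $$ (i, j)) \<le> M"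
    by (intro exI[of _ 1]) (auto simp: norm_mult)
  ultimately show ?thesis unfolding accretive_coeff_def by auto
qed

end

theory Submission
  imports Defs "HOL-Probability.Distributions" "HOL-Real_Asymp.Real_Asymp"
begin

text \<open>
  Let \<open>z = cis \<phi>\<close>, so that \<open>P\<^sub>t\<close> is convolution with the tensor power of the one-dimensional complex
  heat kernel of time \<open>z t\<close>.  The derivative of \<open>\<langle>P\<^sub>t f, P\<^sub>t\<^sup>* g\<rangle> = \<langle>P\<^sub>2\<^sub>t f, g\<rangle>\<close> is
  \<open>- 2 z \<langle>\<nabla> P\<^sub>t f, \<nabla> P\<^sub>t\<^sup>* g\<rangle>\<close>, so integrating in \<open>t\<close> bounds \<open>\<bar>\<langle>P\<^sub>2\<^sub>\<tau> f, g\<rangle> - \<langle>f, g\<rangle>\<bar> / 2\<close> by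
  \<open>N\<^sub>p \<parallel>f\<parallel>\<^sub>p \<parallel>g\<parallel>\<^sub>q\<close>.  If \<open>f\<close> and \<open>g\<close> are \<open>n\<close>-fold tensor powers, both pairings and both norms are
  \<open>n\<close>-th powers; hence it suffices to find one-dimensional \<open>f\<close>, \<open>g\<close> and a time for which
  \<open>\<bar>\<langle>P f, g\<rangle>\<bar>\<close> exceeds both \<open>\<parallel>f\<parallel>\<^sub>p \<parallel>g\<parallel>\<^sub>q\<close> and \<open>\<bar>\<langle>f, g\<rangle>\<bar>\<close>.  Suitable truncated complex Gaussians,
  nearly extremal in Hoelder's inequality, do this because \<open>cos \<phi> < \<bar>1 - 2 / p\<bar>\<close>.

  The semigroup in the definition of \<open>N\<^sub>p\<close> is only characterised by its generator; it agrees with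
  the convolution semigroup because both solve the same dissipative Cauchy problem.
\<close>

section \<open>Square integrable functions\<close>

text \<open>The condition on \<open>\<phi>\<close> enters through one explicit integral. If
  \<open>a + b = 1\<close> and \<open>p Re a = q Re b = 1\<close>, then \<open>exp (- a x^2)\<close>
  and \<open>exp (- b x^2)\<close> give equality in Hoelder's inequality, and their pairing after
  time \<open>t\<close> has modulus \<open>sqrt pi / sqrt |1 + 4 t z a b|\<close>. This increases
  for small \<open>t\<close> as soon as \<open>Re (z a b) < 0\<close>, and minimising over
  \<open>Im a\<close> yields
  \<open>Re (z a b) = (cos^2 \<phi> - (1 - 2/p)^2) / (4 cos \<phi>)\<close>. The gain in dimension
  one is a mere factor greater than 1, and taking \<open>n\<close>-th powers makes it unbounded.
  Being strict, it survives the truncation of the Gaussians to test functions.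

  The obstacle is the semigroup chosen by \<open>SOME\<close>. For the choice to be meaningful, the
  convolution semigroup must have exactly the form Laplacian as generator, with both inclusions of
  the domains. To identify the chosen semigroup, the squared norm of the difference of two solutions
  is shown not to increase. This needs continuity in time, while boundedness is assumed for each
  time separately; hence the uniform boundedness principle. It also needs initial data in the domain
  of the generator, which tensor products of bumps are.\<close>

definition L2 :: "'a measure \<Rightarrow> ('a \<Rightarrow> complex) set" where
  "L2 M = {f \<in> borel_measurable M. integrable M (\<lambda>x. (cmod (f x))\<^sup>2)}"

definition l2norm :: "'a measure \<Rightarrow> ('a \<Rightarrow> complex) \<Rightarrow> real" where
  "l2norm M f = sqrt (\<integral>x. (cmod (f x))\<^sup>2 \<partial>M)"

text \<open>Bilinear rather than sesquilinear, so that kernels, gradients and test functions enter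
  symmetrically; conjugates are inserted where a norm is wanted.\<close>

definition pairing :: "'a measure \<Rightarrow> ('a \<Rightarrow> complex) \<Rightarrow> ('a \<Rightarrow> complex) \<Rightarrow> complex" where
  "pairing M f g = (\<integral>x. f x * g x \<partial>M)"

lemma L2_measurable [measurable_dest]: "f \<in> L2 M \<Longrightarrow> f \<in> borel_measurable M"
  by (simp add: L2_def)

lemma L2_integrable_square: "f \<in> L2 M \<Longrightarrow> integrable M (\<lambda>x. (cmod (f x))\<^sup>2)"
  by (simp add: L2_def)

lemma L2I_bound:
  assumes "g \<in> borel_measurable M" "f \<in> L2 M"
    and "AE x in M. cmod (g x) \<le> C * cmod (f x)"
  shows "g \<in> L2 M"
proof -
  have "integrable M (\<lambda>x. (cmod (g x))\<^sup>2)"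
  proof (rule Bochner_Integration.integrable_bound)
    show "integrable M (\<lambda>x. C\<^sup>2 * (cmod (f x))\<^sup>2)"
      using L2_integrable_square[OF assms(2)] by simp
    show "AE x in M. norm ((cmod (g x))\<^sup>2) \<le> norm (C\<^sup>2 * (cmod (f x))\<^sup>2)"
      using assms(3)
    proof eventually_elim
      case (elim x)
      then have "(cmod (g x))\<^sup>2 \<le> (C * cmod (f x))\<^sup>2"
        by (intro power_mono) auto
      then show ?case by (simp add: power_mult_distrib)
    qed
  qed (use assms(1) in measurable)
  then show ?thesis using assms(1) by (simp add: L2_def)
qed

lemma L2_mult_integrable:
  assumes "f \<in> L2 M" "g \<in> L2 M"
  shows "integrable M (\<lambda>x. f x * g x)"
proof (rule Bochner_Integration.integrable_bound)
  show "integrable M (\<lambda>x. (cmod (f x))\<^sup>2 + (cmod (g x))\<^sup>2)"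
    using assms by (simp add: L2_integrable_square)
  have "cmod (f x * g x) \<le> (cmod (f x))\<^sup>2 + (cmod (g x))\<^sup>2" for x
  proof -
    have "2 * (cmod (f x) * cmod (g x)) \<le> (cmod (f x))\<^sup>2 + (cmod (g x))\<^sup>2"
      using sum_squares_bound[of "cmod (f x)" "cmod (g x)"] by simp
    moreover have "0 \<le> cmod (f x) * cmod (g x)" by simp
    ultimately show ?thesis unfolding norm_mult by linarith
  qed
  then show "AE x in M. norm (f x * g x) \<le> norm ((cmod (f x))\<^sup>2 + (cmod (g x))\<^sup>2)"
    by simp
qed (use assms in measurable)

lemma L2_cnj: "f \<in> L2 M \<Longrightarrow> (\<lambda>x. cnj (f x)) \<in> L2 M"
  by (auto simp: L2_def intro!: borel_measurable_continuous_on[of cnj] continuous_intros)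

lemma L2_cmult: "f \<in> L2 M \<Longrightarrow> (\<lambda>x. c * f x) \<in> L2 M"
  by (rule L2I_bound[of _ _ f "cmod c"]) (auto simp: norm_mult dest: L2_measurable)

lemma L2_add:
  assumes "f \<in> L2 M" "g \<in> L2 M"
  shows "(\<lambda>x. f x + g x) \<in> L2 M"
proof -
  have "integrable M (\<lambda>x. (cmod (f x + g x))\<^sup>2)"
  proof (rule Bochner_Integration.integrable_bound)
    show "integrable M (\<lambda>x. 2 * (cmod (f x))\<^sup>2 + 2 * (cmod (g x))\<^sup>2)"
      using assms by (simp add: L2_integrable_square)
    have "(cmod (f x + g x))\<^sup>2 \<le> 2 * (cmod (f x))\<^sup>2 + 2 * (cmod (g x))\<^sup>2" for x
    proof -
      have "(cmod (f x + g x))\<^sup>2 \<le> (cmod (f x) + cmod (g x))\<^sup>2"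
        by (intro power_mono norm_triangle_ineq) auto
      also have "\<dots> \<le> 2 * (cmod (f x))\<^sup>2 + 2 * (cmod (g x))\<^sup>2"
        using sum_squares_bound[of "cmod (f x)" "cmod (g x)"] by (simp add: power2_sum)
      finally show ?thesis .
    qed
    then show "AE x in M. norm ((cmod (f x + g x))\<^sup>2)
        \<le> norm (2 * (cmod (f x))\<^sup>2 + 2 * (cmod (g x))\<^sup>2)" by simp
  qed (use assms in measurable)
  then show ?thesis using assms by (auto simp: L2_def)
qed

lemma L2_uminus: "f \<in> L2 M \<Longrightarrow> (\<lambda>x. - f x) \<in> L2 M"
  using L2_cmult[of f M "-1"] by simp

lemma L2_diff: "f \<in> L2 M \<Longrightarrow> g \<in> L2 M \<Longrightarrow> (\<lambda>x. f x - g x) \<in> L2 M"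
  using L2_add[of f M "\<lambda>x. - g x"] L2_uminus[of g M] by simp

lemma L2_zero [simp]: "(\<lambda>x. 0) \<in> L2 M"
  by (simp add: L2_def)

lemma L2_divide: "f \<in> L2 M \<Longrightarrow> (\<lambda>x. f x / c) \<in> L2 M"
  using L2_cmult[of f M "1 / c"] by simp

lemma L2_sum: "(\<And>i. i \<in> I \<Longrightarrow> f i \<in> L2 M) \<Longrightarrow> (\<lambda>x. \<Sum>i\<in>I. f i x) \<in> L2 M"
  by (induction I rule: infinite_finite_induct) (auto intro: L2_add)

lemma L2_cong_AE:
  assumes "f \<in> L2 M" "g \<in> borel_measurable M" "AE x in M. g x = f x"
  shows "g \<in> L2 M"
  by (rule L2I_bound[OF assms(2,1), of 1]) (use assms(3) in auto)

section \<open>Norm, pairing and the basic inequalities of \<open>L\<^sup>2\<close>\<close>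

lemma l2norm_nonneg [simp]: "0 \<le> l2norm M f"
  by (simp add: l2norm_def)

lemma l2norm_power2: "(l2norm M f)\<^sup>2 = (\<integral>x. (cmod (f x))\<^sup>2 \<partial>M)"
  by (simp add: l2norm_def)

lemma l2norm_zero [simp]: "l2norm M (\<lambda>x. 0) = 0"
  by (simp add: l2norm_def)

lemma l2norm_cong_AE:
  assumes "f \<in> borel_measurable M" "g \<in> borel_measurable M" "AE x in M. f x = g x"
  shows "l2norm M f = l2norm M g"
  unfolding l2norm_def using assms
  by (intro arg_cong[of _ _ sqrt] integral_cong_AE) auto

lemma l2norm_cmult: "l2norm M (\<lambda>x. c * f x) = cmod c * l2norm M f"
  by (simp add: l2norm_def norm_mult power_mult_distrib real_sqrt_mult)

lemma l2norm_uminus [simp]: "l2norm M (\<lambda>x. - f x) = l2norm M f"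
  by (simp add: l2norm_def)

lemma l2norm_cnj [simp]: "l2norm M (\<lambda>x. cnj (f x)) = l2norm M f"
  by (simp add: l2norm_def)

lemma l2norm_minus_commute: "l2norm M (\<lambda>x. f x - g x) = l2norm M (\<lambda>x. g x - f x)"
  by (simp add: l2norm_def norm_minus_commute)

lemma l2norm_eq_0_AE:
  assumes "f \<in> L2 M" "l2norm M f = 0"
  shows "AE x in M. f x = 0"
proof -
  have "(\<integral>x. (cmod (f x))\<^sup>2 \<partial>M) = 0"
    using assms(2) by (simp add: l2norm_def)
  then show ?thesis
    using integral_nonneg_eq_0_iff_AE[OF L2_integrable_square[OF assms(1)]] by simp
qed

text \<open>The right-hand side is smallest for \<open>c = B / A\<close>, with value
  \<open>A * B\<close>. This is the source of every Cauchy-Schwarz type estimate below: such a bound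
  is linear in integrals and can be proved pointwise.\<close>

lemma amgm_bound:
  fixes X A B :: real
  assumes "0 \<le> A" "0 \<le> B" and X: "\<And>c. c > 0 \<Longrightarrow> X \<le> (c * A\<^sup>2 + B\<^sup>2 / c) / 2"
  shows "X \<le> A * B"
proof (rule field_le_epsilon)
  fix e :: real assume "e > 0"
  define d where "d = min 1 (e / (A + B + 1))"
  have d: "d > 0" "d \<le> 1" and de: "d * (A + B + 1) \<le> e"
  proof -
    have "A + B + 1 > 0" using assms by simp
    then show "d > 0" "d \<le> 1" using \<open>e > 0\<close> by (auto simp: d_def)
    have "d * (A + B + 1) \<le> (e / (A + B + 1)) * (A + B + 1)"
      using \<open>A + B + 1 > 0\<close> by (intro mult_right_mono) (auto simp: d_def)
    then show "d * (A + B + 1) \<le> e" using \<open>A + B + 1 > 0\<close> by simp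
  qed
  \<comment> \<open>The optimal \<open>B / A\<close>, shifted by \<open>d\<close> so that it stays
    positive and finite when \<open>A\<close> or \<open>B\<close> vanishes.\<close>
  define c where "c = (B + d) / (A + d)"
  have c: "c > 0" using d assms by (simp add: c_def)
  have "c * A\<^sup>2 \<le> (B + d) * (A + d)"
  proof -
    have "A\<^sup>2 \<le> (A + d) * (A + d)" using assms d by (simp add: power2_eq_square mult_mono)
    then have "c * A\<^sup>2 \<le> c * ((A + d) * (A + d))" using c by simp
    also have "\<dots> = (B + d) * (A + d)" using assms d by (simp add: c_def)
    finally show ?thesis .
  qed
  moreover have "B\<^sup>2 / c \<le> (B + d) * (A + d)"
  proof -
    have "B\<^sup>2 \<le> (B + d) * (B + d)" using assms d by (simp add: power2_eq_square mult_mono)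
    then have "B\<^sup>2 / c \<le> ((B + d) * (B + d)) / c" using c by (intro divide_right_mono) auto
    also have "\<dots> = (B + d) * (A + d)" using assms d by (simp add: c_def)
    finally show ?thesis .
  qed
  ultimately have "X \<le> (B + d) * (A + d)" using X[OF c] by simp
  also have "\<dots> \<le> A * B + d * (A + B + 1)"
    using d mult_left_mono[of d 1 d] by (simp add: algebra_simps)
  finally show "X \<le> A * B + e" using de by simp
qed

lemma L2_Cauchy_Schwarz_abs:
  assumes "f \<in> L2 M" "g \<in> L2 M"
  shows "(\<integral>x. cmod (f x) * cmod (g x) \<partial>M) \<le> l2norm M f * l2norm M g"
proof (rule amgm_bound)
  fix c :: real assume c: "c > 0"
  have "(\<integral>x. cmod (f x) * cmod (g x) \<partial>M)
      \<le> (\<integral>x. (c * (cmod (f x))\<^sup>2 + (cmod (g x))\<^sup>2 / c) / 2 \<partial>M)"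
  proof (rule integral_mono)
    show "integrable M (\<lambda>x. cmod (f x) * cmod (g x))"
      using integrable_norm[OF L2_mult_integrable[OF assms]] by (simp add: norm_mult)
    show "integrable M (\<lambda>x. (c * (cmod (f x))\<^sup>2 + (cmod (g x))\<^sup>2 / c) / 2)"
      using assms by (simp add: L2_integrable_square)
    fix x
    have "0 \<le> (c * cmod (f x) - cmod (g x))\<^sup>2 / c" using c by simp
    also have "\<dots> = c * (cmod (f x))\<^sup>2 + (cmod (g x))\<^sup>2 / c - 2 * (cmod (f x) * cmod (g x))"
      using c by (simp add: power2_eq_square field_simps)
    finally show "cmod (f x) * cmod (g x) \<le> (c * (cmod (f x))\<^sup>2 + (cmod (g x))\<^sup>2 / c) / 2"
      by simp
  qed
  also have "\<dots> = (c * (l2norm M f)\<^sup>2 + (l2norm M g)\<^sup>2 / c) / 2"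
    using assms by (simp add: L2_integrable_square l2norm_power2)
  finally show "(\<integral>x. cmod (f x) * cmod (g x) \<partial>M) \<le> \<dots>" .
qed simp_all

lemma pairing_bound:
  assumes "f \<in> L2 M" "g \<in> L2 M"
  shows "cmod (pairing M f g) \<le> l2norm M f * l2norm M g"
  unfolding pairing_def
  using integral_norm_bound[of M "\<lambda>x. f x * g x"] L2_Cauchy_Schwarz_abs[OF assms]
  by (simp add: norm_mult)

lemma pairing_commute: "pairing M f g = pairing M g f"
  by (simp add: pairing_def mult.commute)

lemma pairing_add_left:
  "f \<in> L2 M \<Longrightarrow> g \<in> L2 M \<Longrightarrow> h \<in> L2 M \<Longrightarrow>
     pairing M (\<lambda>x. f x + g x) h = pairing M f h + pairing M g h"
  by (simp add: pairing_def distrib_right L2_mult_integrable)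

lemma pairing_diff_left:
  "f \<in> L2 M \<Longrightarrow> g \<in> L2 M \<Longrightarrow> h \<in> L2 M \<Longrightarrow>
     pairing M (\<lambda>x. f x - g x) h = pairing M f h - pairing M g h"
  by (simp add: pairing_def left_diff_distrib L2_mult_integrable)

lemma pairing_cmult_left: "pairing M (\<lambda>x. c * f x) h = c * pairing M f h"
  by (simp add: pairing_def mult.assoc)

lemma pairing_add_right:
  "f \<in> L2 M \<Longrightarrow> g \<in> L2 M \<Longrightarrow> h \<in> L2 M \<Longrightarrow>
     pairing M h (\<lambda>x. f x + g x) = pairing M h f + pairing M h g"
  using pairing_add_left by (simp add: pairing_commute[of M h])

lemma pairing_diff_right:
  "f \<in> L2 M \<Longrightarrow> g \<in> L2 M \<Longrightarrow> h \<in> L2 M \<Longrightarrow>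
     pairing M h (\<lambda>x. f x - g x) = pairing M h f - pairing M h g"
  using pairing_diff_left by (simp add: pairing_commute[of M h])

lemma pairing_cmult_right: "pairing M h (\<lambda>x. c * f x) = c * pairing M h f"
  using pairing_cmult_left by (simp add: pairing_commute[of M h])

lemma pairing_cong_AE:
  assumes "f \<in> borel_measurable M" "f' \<in> borel_measurable M" "g \<in> borel_measurable M"
    and "g' \<in> borel_measurable M" "AE x in M. f x = f' x" "AE x in M. g x = g' x"
  shows "pairing M f g = pairing M f' g'"
  unfolding pairing_def using assms by (intro integral_cong_AE) auto

lemma pairing_cnj: "cnj (pairing M f g) = pairing M (\<lambda>x. cnj (f x)) (\<lambda>x. cnj (g x))"
proof -
  have "cnj (\<integral>x. f x * g x \<partial>M) = (\<integral>x. cnj (f x * g x) \<partial>M)"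
    by (rule Bochner_Integration.integral_cnj[symmetric])
  then show ?thesis by (simp add: pairing_def)
qed

lemma pairing_cnj_self: "pairing M f (\<lambda>x. cnj (f x)) = of_real ((l2norm M f)\<^sup>2)"
  unfolding pairing_def l2norm_power2 complex_norm_square[symmetric]
  by (rule integral_complex_of_real)

text \<open>Taking \<open>g\<close> to be the conjugate of \<open>f\<close> turns the hypothesis
  into \<open>|f|^2 \<le> C |f|\<close>. Norm estimates thereby reduce to estimates of pairings,
  which are accessible to Fubini and to differentiation in time.\<close>

lemma l2norm_le_dual:
  assumes "f \<in> L2 M" "C \<ge> 0"
    and "\<And>g. g \<in> L2 M \<Longrightarrow> cmod (pairing M f g) \<le> C * l2norm M g"
  shows "l2norm M f \<le> C"
proof -
  have "(l2norm M f)\<^sup>2 \<le> C * l2norm M f"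
    using assms(3)[OF L2_cnj[OF assms(1)]] unfolding pairing_cnj_self by (simp only: norm_of_real l2norm_cnj norm_power abs_power2 abs_norm_cancel power2_abs)
  then show ?thesis using assms(2)
    by (cases "l2norm M f = 0") (auto simp: power2_eq_square mult_le_cancel_right)
qed

lemma l2norm_triangle:
  assumes "f \<in> L2 M" "g \<in> L2 M"
  shows "l2norm M (\<lambda>x. f x + g x) \<le> l2norm M f + l2norm M g"
proof (rule l2norm_le_dual[OF L2_add[OF assms]])
  fix h assume h: "h \<in> L2 M"
  have "cmod (pairing M (\<lambda>x. f x + g x) h) \<le> cmod (pairing M f h) + cmod (pairing M g h)"
    using assms h by (simp add: pairing_add_left norm_triangle_ineq)
  also have "\<dots> \<le> l2norm M f * l2norm M h + l2norm M g * l2norm M h"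
    using assms h by (intro add_mono pairing_bound)
  finally show "cmod (pairing M (\<lambda>x. f x + g x) h) \<le> (l2norm M f + l2norm M g) * l2norm M h"
    by (simp add: distrib_right)
qed simp

lemma l2norm_triangle_diff:
  assumes "f \<in> L2 M" "g \<in> L2 M"
  shows "l2norm M (\<lambda>x. f x - g x) \<le> l2norm M f + l2norm M g"
  using l2norm_triangle[OF assms(1) L2_uminus[OF assms(2)]] by simp

lemma l2norm_triangle_mid:
  assumes "f \<in> L2 M" "g \<in> L2 M" "h \<in> L2 M"
  shows "l2norm M (\<lambda>x. f x - h x) \<le> l2norm M (\<lambda>x. f x - g x) + l2norm M (\<lambda>x. g x - h x)"
  using l2norm_triangle[OF L2_diff[OF assms(1,2)] L2_diff[OF assms(2,3)]] by simp

lemma l2norm_triangle_abs: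
  assumes "f \<in> L2 M" "g \<in> L2 M"
  shows "\<bar>l2norm M f - l2norm M g\<bar> \<le> l2norm M (\<lambda>x. f x - g x)"
  using l2norm_triangle[OF L2_diff[OF assms] assms(2)]
    l2norm_triangle[OF L2_diff[OF assms(2,1)] assms(1)]
  by (simp add: l2norm_minus_commute[of M g f] abs_le_iff)

section \<open>Dominated convergence and completeness in \<open>L\<^sup>2\<close>\<close>

lemma l2norm_dominated_tendsto:
  assumes "w \<in> L2 M" "f \<in> borel_measurable M" "\<And>k. s k \<in> borel_measurable M"
    and "AE x in M. (\<lambda>k. s k x) \<longlonglongrightarrow> f x" and "\<And>k. AE x in M. cmod (s k x - f x) \<le> cmod (w x)"
  shows "(\<lambda>k::nat. l2norm M (\<lambda>x. s k x - f x)) \<longlonglongrightarrow> 0"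
proof -
  have "(\<lambda>k. (\<integral>x. (cmod (s k x - f x))\<^sup>2 \<partial>M)) \<longlonglongrightarrow> (\<integral>x. 0 \<partial>M)"
  proof (rule integral_dominated_convergence)
    show "integrable M (\<lambda>x. (cmod (w x))\<^sup>2)" using assms(1) by (rule L2_integrable_square)
    show "AE x in M. (\<lambda>k. (cmod (s k x - f x))\<^sup>2) \<longlonglongrightarrow> 0"
      using assms(4)
    proof eventually_elim
      case (elim x)
      have "(\<lambda>k. (cmod (s k x - f x))\<^sup>2) \<longlonglongrightarrow> (cmod (f x - f x))\<^sup>2"
        using elim by (intro tendsto_intros)
      then show ?case by simp
    qed
    show "AE x in M. norm ((cmod (s k x - f x))\<^sup>2) \<le> (cmod (w x))\<^sup>2" for k
      using assms(5)[of k] by eventually_elim (simp add: power_mono)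
  qed (use assms in measurable)
  then have "(\<lambda>k. sqrt (\<integral>x. (cmod (s k x - f x))\<^sup>2 \<partial>M)) \<longlonglongrightarrow> sqrt 0"
    by (intro tendsto_real_sqrt) simp
  then show ?thesis by (simp add: l2norm_def)
qed

text \<open>
  Riesz--Fischer for rapidly converging sequences: the weights \<open>2 ^ k\<close> turn absolute convergence
  of the series of increments into integrability of the single series \<open>\<Sum>k. 2 ^ k \<bar>f\<^sub>k\<^sub>+\<^sub>1 - f\<^sub>k\<bar>\<^sup>2\<close>.
\<close>

lemma L2_complete_fast:
  assumes f: "\<And>k. f k \<in> L2 M" and fast: "\<And>k. l2norm M (\<lambda>x. f (Suc k) x - f k x) \<le> (1 / 3) ^ k"
  obtains g where "g \<in> L2 M" "(\<lambda>k. l2norm M (\<lambda>x. f k x - g x)) \<longlonglongrightarrow> 0"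
proof -
  note [measurable] = f[THEN L2_measurable]
  define d where "d k x = cmod (f (Suc k) x - f k x)" for k x
  have dm [measurable]: "d k \<in> borel_measurable M" for k unfolding d_def by measurable
  have di: "integrable M (\<lambda>x. (d k x)\<^sup>2)" for k
    unfolding d_def using L2_integrable_square[OF L2_diff[OF f f]] .
  have dn: "(\<integral>x. (d k x)\<^sup>2 \<partial>M) \<le> (1 / 9) ^ k" for k
  proof -
    have "(\<integral>x. (d k x)\<^sup>2 \<partial>M) = (l2norm M (\<lambda>x. f (Suc k) x - f k x))\<^sup>2"
      by (simp add: d_def l2norm_power2)
    also have "\<dots> \<le> ((1 / 3) ^ k)\<^sup>2" using fast by (intro power_mono) auto
    also have "((1 / 3) ^ k)\<^sup>2 = (1 / 9 :: real) ^ k"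
      by (simp add: power2_eq_square power_mult_distrib[symmetric])
    finally show ?thesis .
  qed
  \<comment> \<open>The squared increments have integral at most \<open>9^(-k)\<close>, so the
    weights still leave the summable bound \<open>(2/9)^k\<close>. Where \<open>S\<close> is finite,
    the increments decay like \<open>2^(-k/2)\<close>, so the sequence converges pointwise.\<close>
  define S where "S x = (\<Sum>k. ennreal (2 ^ k * (d k x)\<^sup>2))" for x
  have Sm [measurable]: "S \<in> borel_measurable M" unfolding S_def by measurable
  have "(\<integral>\<^sup>+x. S x \<partial>M) = (\<Sum>k. \<integral>\<^sup>+x. ennreal (2 ^ k * (d k x)\<^sup>2) \<partial>M)"
    unfolding S_def by (rule nn_integral_suminf) measurable
  also have "\<dots> \<le> (\<Sum>k. ennreal ((2 / 9) ^ k))"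
  proof (intro suminf_le summableI)
    fix k
    have "(\<integral>\<^sup>+x. ennreal (2 ^ k * (d k x)\<^sup>2) \<partial>M) = ennreal (\<integral>x. 2 ^ k * (d k x)\<^sup>2 \<partial>M)"
      using di by (intro nn_integral_eq_integral) auto
    also have "\<dots> \<le> ennreal ((2 / 9) ^ k)"
      using mult_left_mono[OF dn, of "2 ^ k" k] by (intro ennreal_leI) (simp add: power_divide)
    finally show "(\<integral>\<^sup>+x. ennreal (2 ^ k * (d k x)\<^sup>2) \<partial>M) \<le> ennreal ((2 / 9) ^ k)" .
  qed
  also have "\<dots> = ennreal (\<Sum>k. (2 / 9) ^ k)"
    by (rule suminf_ennreal2) (auto intro: summable_geometric)
  finally have Sfin: "(\<integral>\<^sup>+x. S x \<partial>M) < \<infinity>" by (auto intro: le_less_trans)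
  then have AES: "AE x in M. S x \<noteq> \<infinity>"
    by (intro nn_integral_noteq_infinite) auto
  define s where "s x = enn2real (S x)" for x
  have [measurable]: "s \<in> borel_measurable M" unfolding s_def by measurable
  have s_int: "integrable M s"
  proof (rule integrableI_nonneg)
    show "(\<integral>\<^sup>+x. ennreal (s x) \<partial>M) < \<infinity>"
      by (rule le_less_trans[OF nn_integral_mono Sfin]) (auto simp: s_def ennreal_enn2real_if)
  qed (auto simp: s_def)
  have d_le: "d k x \<le> sqrt (s x) * (1 / sqrt 2) ^ k" if "S x \<noteq> \<infinity>" for k x
  proof -
    have "ennreal (2 ^ k * (d k x)\<^sup>2) = (\<Sum>j\<in>{k}. ennreal (2 ^ j * (d j x)\<^sup>2))" by simp
    also have "\<dots> \<le> S x" unfolding S_def by (rule sum_le_suminf[OF summableI]) auto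
    also have "S x = ennreal (s x)" using that by (simp add: s_def less_top)
    finally have "2 ^ k * (d k x)\<^sup>2 \<le> s x"
      by (subst (asm) ennreal_le_iff) (auto simp: s_def)
    then have "(d k x)\<^sup>2 \<le> s x / 2 ^ k" by (simp add: field_simps)
    then have "sqrt ((d k x)\<^sup>2) \<le> sqrt (s x / 2 ^ k)" by (rule real_sqrt_le_mono)
    also have "sqrt (s x / 2 ^ k) = sqrt (s x) * (1 / sqrt 2) ^ k"
      unfolding real_sqrt_divide real_sqrt_power power_divide by simp
    finally show ?thesis unfolding real_sqrt_abs by (simp add: d_def)
  qed
  define q where "q = 1 / sqrt (2::real)"
  have q: "0 < q" "q < 1" by (auto simp: q_def)
  define g where "g x = lim (\<lambda>k. f k x)" for x
  have gm [measurable]: "g \<in> borel_measurable M"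
    unfolding g_def by measurable
  have conv: "(\<lambda>k. f k x) \<longlonglongrightarrow> g x" and dist: "cmod (f k x - g x) \<le> sqrt (s x) / (1 - q)"
    if "S x \<noteq> \<infinity>" for x k
  proof -
    have dq: "d k x \<le> sqrt (s x) * q ^ k" for k using d_le[OF that] by (simp add: q_def)
    have sm: "summable (\<lambda>k. sqrt (s x) * q ^ k)" using q by (intro summable_mult summable_geometric) auto
    have sd: "summable (\<lambda>k. norm (f (Suc k) x - f k x))"
      proof (rule summable_comparison_test'[OF sm, of 0])
      show "norm (norm (f (Suc k) x - f k x)) \<le> sqrt (s x) * q ^ k" for k
        using dq[of k] unfolding d_def by (simp only: norm_ge_zero real_norm_def abs_of_nonneg)
    qed
    have "(\<lambda>m. \<Sum>k<m. f (Suc k) x - f k x) \<longlonglongrightarrow> (\<Sum>k. f (Suc k) x - f k x)"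
      by (rule summable_LIMSEQ[OF summable_norm_cancel[OF sd]])
    then have "(\<lambda>m. f m x - f 0 x) \<longlonglongrightarrow> (\<Sum>k. f (Suc k) x - f k x)"
      by (simp only: sum_lessThan_telescope[of "\<lambda>k. f k x"])
    from tendsto_add[OF this tendsto_const[of "f 0 x"]]
    have "convergent (\<lambda>m. f m x)" by (auto simp: convergent_def)
    then show lim: "(\<lambda>k. f k x) \<longlonglongrightarrow> g x" unfolding g_def by (rule convergent_LIMSEQ_iff[THEN iffD1])
    have step: "cmod (f (k + m) x - f k x) \<le> sqrt (s x) / (1 - q)" for m
    proof -
      have "f (k + m) x - f k x = (\<Sum>j<m. f (Suc (k + j)) x - f (k + j) x)"
        using sum_lessThan_telescope[of "\<lambda>j. f (k + j) x" m] by simp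
      also have "cmod \<dots> \<le> (\<Sum>j<m. d (k + j) x)" unfolding d_def by (rule norm_sum)
      also have "\<dots> \<le> (\<Sum>j<m. sqrt (s x) * q ^ j)"
      proof (rule sum_mono)
        fix j
        have "sqrt (s x) * q ^ (k + j) \<le> sqrt (s x) * q ^ j"
          using q by (intro mult_left_mono power_decreasing) (auto simp: s_def)
        then show "d (k + j) x \<le> sqrt (s x) * q ^ j" using dq[of "k + j"] by linarith
      qed
      also have "\<dots> \<le> (\<Sum>j. sqrt (s x) * q ^ j)"
        by (rule sum_le_suminf[OF sm]) (use q in \<open>auto simp: s_def\<close>)
      also have "\<dots> = sqrt (s x) / (1 - q)"
        using q by (subst suminf_mult) (auto simp: suminf_geometric intro: summable_geometric)
      finally show ?thesis .
    qed
    have "(\<lambda>m. cmod (f (k + m) x - f k x)) \<longlonglongrightarrow> cmod (g x - f k x)"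
      using LIMSEQ_ignore_initial_segment[OF lim, of k] by (intro tendsto_intros) (simp add: add.commute)
    then have "cmod (g x - f k x) \<le> sqrt (s x) / (1 - q)"
      by (rule LIMSEQ_le_const2) (use step in blast)
    then show "cmod (f k x - g x) \<le> sqrt (s x) / (1 - q)" by (simp add: norm_minus_commute)
  qed
  \<comment> \<open>One function dominating all the distances \<open>f k - g\<close>; its square is
    a multiple of the integrable function \<open>s\<close>.\<close>
  define w where "w x = complex_of_real (sqrt (s x) / (1 - q))" for x
  have w: "w \<in> L2 M"
  proof -
    have "(cmod (w x))\<^sup>2 = s x / (1 - q)\<^sup>2" for x
      unfolding w_def norm_of_real by (simp add: power_divide s_def)
    moreover have "w \<in> borel_measurable M" unfolding w_def by measurable
    ultimately show ?thesis using s_int by (simp add: L2_def)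
  qed
  have cw: "cmod (w x) = sqrt (s x) / (1 - q)" for x
    using q by (simp only: w_def norm_of_real) (simp add: s_def)
  have AEd: "AE x in M. cmod (f k x - g x) \<le> cmod (w x)" for k
    using AES by eventually_elim (simp add: cw dist)
  have "(\<lambda>x. f 0 x - g x) \<in> L2 M"
  proof (rule L2I_bound[OF _ w])
    show "AE x in M. cmod (f 0 x - g x) \<le> 1 * cmod (w x)" using AEd[of 0] by simp
  qed measurable
  from L2_diff[OF f[of 0] this] have "g \<in> L2 M" by simp
  moreover have "(\<lambda>k. l2norm M (\<lambda>x. f k x - g x)) \<longlonglongrightarrow> 0"
  proof (rule l2norm_dominated_tendsto[OF w])
    show "AE x in M. (\<lambda>k. f k x) \<longlonglongrightarrow> g x"
      using AES by eventually_elim (rule conv)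
  qed (use AEd in measurable)
  ultimately show thesis by (rule that)
qed

section \<open>Smooth functions of one variable\<close>

abbreviation vderiv :: "(real \<Rightarrow> complex) \<Rightarrow> real \<Rightarrow> complex" where
  "vderiv f \<equiv> (\<lambda>x. vector_derivative f (at x))"

text \<open>One-variable counterpart of \<open>Ck_fun\<close>. Continuity is asked of the last
  derivative only, since differentiability supplies it for the earlier ones.\<close>

primrec nsmooth :: "nat \<Rightarrow> (real \<Rightarrow> complex) \<Rightarrow> bool" where
  "nsmooth 0 f \<longleftrightarrow> continuous_on UNIV f"
| "nsmooth (Suc k) f \<longleftrightarrow> (\<forall>x. f differentiable (at x)) \<and> nsmooth k (vderiv f)"

definition smooth :: "(real \<Rightarrow> complex) \<Rightarrow> bool" where
  "smooth f \<longleftrightarrow> (\<forall>k. nsmooth k f)"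

lemma nsmooth_Suc_D: "nsmooth (Suc k) f \<Longrightarrow> nsmooth k f"
proof (induction k arbitrary: f)
  case 0
  then show ?case
    by (auto intro!: continuous_at_imp_continuous_on differentiable_imp_continuous_within)
qed (metis nsmooth.simps(2))

lemma nsmoothI:
  assumes "\<And>x. (f has_vector_derivative f' x) (at x)" "nsmooth k f'"
  shows "nsmooth (Suc k) f"
proof -
  have "vderiv f = f'" using assms(1) by (auto intro: vector_derivative_at)
  then show ?thesis using assms by (auto intro: differentiableI_vector)
qed

lemma nsmoothD:
  assumes "nsmooth (Suc k) f"
  shows "(f has_vector_derivative vderiv f x) (at x)"
  using assms by (auto simp: vector_derivative_works)

lemma nsmooth_add: "nsmooth k f \<Longrightarrow> nsmooth k g \<Longrightarrow> nsmooth k (\<lambda>x. f x + g x)"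
proof (induction k arbitrary: f g)
  case (Suc k)
  show ?case
    by (rule nsmoothI[OF has_vector_derivative_add[OF nsmoothD[OF Suc.prems(1)] nsmoothD[OF Suc.prems(2)]]])
       (use Suc in auto)
qed (auto intro: continuous_intros)

lemma nsmooth_mult: "nsmooth k f \<Longrightarrow> nsmooth k g \<Longrightarrow> nsmooth k (\<lambda>x. f x * g x)"
proof (induction k arbitrary: f g)
  case (Suc k)
  show ?case
  proof (rule nsmoothI[OF has_vector_derivative_mult[OF nsmoothD[OF Suc.prems(1)] nsmoothD[OF Suc.prems(2)]]])
    show "nsmooth k (\<lambda>x. f x * vderiv g x + vderiv f x * g x)"
      using Suc.prems nsmooth_Suc_D[OF Suc.prems(1)] nsmooth_Suc_D[OF Suc.prems(2)]
      by (intro nsmooth_add Suc.IH) auto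
  qed
qed (auto intro: continuous_intros)

lemma smooth_mult: "smooth f \<Longrightarrow> smooth g \<Longrightarrow> smooth (\<lambda>x. f x * g x)"
  by (simp add: smooth_def nsmooth_mult)

lemma smooth_deriv: "smooth f \<Longrightarrow> smooth (vderiv f)"
  unfolding smooth_def using nsmooth.simps(2) by blast

lemma smooth_has_deriv: "smooth f \<Longrightarrow> (f has_vector_derivative vderiv f x) (at x)"
  unfolding smooth_def using nsmoothD by blast

lemma smooth_continuous: "smooth f \<Longrightarrow> continuous_on A f"
  unfolding smooth_def using nsmooth.simps(1) continuous_on_subset by blast

lemma smooth_measurable [measurable_dest]: "smooth f \<Longrightarrow> f \<in> borel_measurable borel"
  by (intro borel_measurable_continuous_onI smooth_continuous)

text \<open>If every member of a class has its derivative in the class, differentiation can be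
  repeated indefinitely. This suits families that are closed under differentiation although single
  members are not.\<close>

lemma smooth_coinduct:
  assumes "f \<in> S" and "\<And>g. g \<in> S \<Longrightarrow> \<exists>g'\<in>S. \<forall>x. (g has_vector_derivative g' x) (at x)"
  shows "smooth f"
proof -
  have "g \<in> S \<Longrightarrow> nsmooth k g" for g k
  proof (induction k arbitrary: g)
    case 0
    then obtain g' where "\<forall>x. (g has_vector_derivative g' x) (at x)" using assms(2) by blast
    then show ?case
      by (auto intro!: continuous_at_imp_continuous_on has_vector_derivative_continuous)
  next
    case (Suc k)
    then obtain g' where "g' \<in> S" "\<And>x. (g has_vector_derivative g' x) (at x)" using assms(2) by blast
    then show ?case using nsmoothI Suc.IH by blast
  qed
  then show ?thesis using assms(1) by (simp add: smooth_def)
qed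

lemma smooth_affine: "smooth (\<lambda>x. a + b * of_real x)"
proof (rule smooth_coinduct[where S = "range (\<lambda>(a, b) x. a + b * of_real x)"])
  fix g :: "real \<Rightarrow> complex" assume "g \<in> range (\<lambda>(a, b) x. a + b * of_real x)"
  then obtain a b where g: "g = (\<lambda>x. a + b * of_real x)" by auto
  have 1: "\<forall>x. (g has_vector_derivative (\<lambda>x. b + 0 * of_real x) x) (at x)"
    unfolding g by (auto intro!: derivative_eq_intros)
  have 2: "(\<lambda>x. b + 0 * of_real x) \<in> range (\<lambda>(a, b) x. a + b * of_real x)"
    by (rule range_eqI[of _ _ "(b, 0)"]) simp
  show "\<exists>g'\<in>range (\<lambda>(a, b) x. a + b * of_real x). \<forall>x. (g has_vector_derivative g' x) (at x)"
    using 1 by (intro bexI[OF _ 2]) auto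
qed auto

lemma smooth_const: "smooth (\<lambda>x. c)"
  using smooth_affine[of c 0] by simp

lemma smooth_cnj: 
  assumes "smooth f" shows "smooth (\<lambda>x. cnj (f x))"
proof (rule smooth_coinduct[where S = "{\<lambda>x. cnj (g x) | g. smooth g}"])
  fix h :: "real \<Rightarrow> complex" assume "h \<in> {\<lambda>x. cnj (g x) | g. smooth g}"
  then obtain g where g: "smooth g" "h = (\<lambda>x. cnj (g x))" by auto
  have "(h has_vector_derivative cnj (vderiv g x)) (at x)" for x
    unfolding g(2) by (intro has_vector_derivative_cnj smooth_has_deriv g(1))
  then show "\<exists>g'\<in>{\<lambda>x. cnj (g x) | g. smooth g}. \<forall>x. (h has_vector_derivative g' x) (at x)"
    using smooth_deriv[OF g(1)] by auto
qed (use assms in auto)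

lemma smooth_compose_affine:
  assumes "smooth f" shows "smooth (\<lambda>x. f (a + b * x))"
proof -
  \<comment> \<open>The scalar \<open>c\<close> is there for the induction: each derivative produces
    another factor \<open>b\<close>.\<close>
  have "nsmooth k (\<lambda>x. c * f (a + b * x))" if "nsmooth k f" for k f c
    using that
  proof (induction k arbitrary: f c)
    case 0
    then have "continuous_on UNIV f" by simp
    then have "continuous_on UNIV (\<lambda>x. f (a + b * x))"
      by (rule continuous_on_compose2) (auto intro!: continuous_intros)
    then show ?case by (auto intro!: continuous_intros)
  next
    case (Suc k)
    show ?case
    proof (rule nsmoothI)
      show "((\<lambda>x. c * f (a + b * x)) has_vector_derivative (c * of_real b) * vderiv f (a + b * x)) (at x)" for x
      proof -
        have 1: "((\<lambda>x. a + b * x) has_vector_derivative b) (at x)"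
          by (auto intro!: derivative_eq_intros)
        have "((f \<circ> (\<lambda>x. a + b * x)) has_vector_derivative b *\<^sub>R vderiv f (a + b * x)) (at x)"
          by (rule vector_diff_chain_at[OF 1 nsmoothD[OF Suc.prems]])
        then show ?thesis
          by (auto simp: o_def scaleR_conv_of_real mult.assoc intro: has_vector_derivative_mult_right)
      qed
      show "nsmooth k (\<lambda>x. c * of_real b * vderiv f (a + b * x))"
        using Suc.prems by (intro Suc.IH) auto
    qed
  qed
  from this[of _ f 1] assms show ?thesis by (simp add: smooth_def)
qed

section \<open>Bump functions\<close>

text \<open>The polynomial in \<open>1 / x\<close> is a parameter because differentiation changes
  it: \<open>exp (- 1 / x)\<close> alone is not closed under derivatives, this family is.\<close>

definition flat_exp :: "real poly \<Rightarrow> real \<Rightarrow> complex" where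
  "flat_exp P x = (if x > 0 then of_real (poly P (1 / x) * exp (- (1 / x))) else 0)"

lemma poly_exp_tendsto_0: "((\<lambda>y. poly P y * exp (- y)) \<longlongrightarrow> (0::real)) at_top"
proof -
  have "((\<lambda>y. \<Sum>i\<le>degree P. coeff P i * (y ^ i / exp y)) \<longlongrightarrow> (\<Sum>i\<le>degree P. coeff P i * 0)) at_top"
    by (intro tendsto_intros tendsto_power_div_exp_0)
  then show ?thesis by (simp add: poly_altdef sum_distrib_right exp_minus divide_inverse mult.assoc)
qed

text \<open>With \<open>y = 1 / x\<close>, the derivative of \<open>P(y) exp (- y)\<close> in
  \<open>x\<close> is \<open>y^2 (P(y) - P'(y)) exp (- y)\<close>, and \<open>[:0, 0, 1:]\<close> is
  the polynomial \<open>y^2\<close>.\<close>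

lemma flat_exp_deriv:
  "(flat_exp P has_vector_derivative flat_exp ([:0, 0, 1:] * (P - pderiv P)) x) (at x)"
proof -
  consider "x > 0" | "x < 0" | "x = 0" by linarith
  then show ?thesis
  proof cases
    case 1
    have "((\<lambda>x. poly P (1 / x) * exp (- (1 / x))) has_real_derivative
       poly ([:0, 0, 1:] * (P - pderiv P)) (1 / x) * exp (- (1 / x))) (at x)"
      using 1 by (auto intro!: derivative_eq_intros poly_DERIV[THEN DERIV_chain2] simp: field_simps power2_eq_square)
    then have "((\<lambda>x. complex_of_real (poly P (1 / x) * exp (- (1 / x)))) has_vector_derivative
       of_real (poly ([:0, 0, 1:] * (P - pderiv P)) (1 / x) * exp (- (1 / x)))) (at x)"
      by (intro has_vector_derivative_of_real) (simp add: has_real_derivative_iff_has_vector_derivative)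
    then have "(flat_exp P has_vector_derivative
       of_real (poly ([:0, 0, 1:] * (P - pderiv P)) (1 / x) * exp (- (1 / x)))) (at x)"
      by (rule has_vector_derivative_transform_within_open[of _ _ _ "{0<..}"]) (use 1 in \<open>auto simp: flat_exp_def\<close>)
    then show ?thesis using 1 by (simp add: flat_exp_def)
  next
    case 2
    have "((\<lambda>x. 0) has_vector_derivative 0) (at x)" by simp
    then have "(flat_exp P has_vector_derivative 0) (at x)"
      by (rule has_vector_derivative_transform_within_open[of _ _ _ "{..<0}"]) (use 2 in \<open>auto simp: flat_exp_def\<close>)
    then show ?thesis using 2 by (simp add: flat_exp_def)
  next
    case 3
    \<comment> \<open>At 0 the right difference quotient is \<open>y P(y) exp (- y)\<close> with
      \<open>y = 1 / h\<close>; the exponential wins.\<close>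
    have lim: "((\<lambda>h. of_real (poly ([:0, 1:] * P) (1 / h) * exp (- (1 / h)))) \<longlongrightarrow> (0::complex)) (at_right 0)"
      using tendsto_of_real[OF filterlim_compose[OF poly_exp_tendsto_0 filterlim_inverse_at_top_right], of "[:0, 1:] * P", where 'a = complex]
      by (simp add: inverse_eq_divide)
    have "((\<lambda>h. (flat_exp P (x + h) - flat_exp P x) /\<^sub>R h) \<longlongrightarrow> 0) (at 0)"
    proof (rule filterlim_split_at)
      show "((\<lambda>h. (flat_exp P (x + h) - flat_exp P x) /\<^sub>R h) \<longlongrightarrow> 0) (at_left 0)"
        by (rule tendsto_eventually) (use 3 in \<open>auto simp: flat_exp_def eventually_at_filter\<close>)
      show "((\<lambda>h. (flat_exp P (x + h) - flat_exp P x) /\<^sub>R h) \<longlongrightarrow> 0) (at_right 0)"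
        by (rule Lim_transform_eventually[OF lim])
           (use 3 in \<open>auto simp: flat_exp_def eventually_at_filter scaleR_conv_of_real field_simps\<close>)
    qed
    then have "(flat_exp P has_vector_derivative 0) (at x)"
      by (simp add: has_vector_derivative_def has_derivative_at)
         (simp add: LIM_def divide_inverse mult.commute)
    then show ?thesis using 3 by (simp add: flat_exp_def)
  qed
qed

lemma smooth_flat_exp: "smooth (flat_exp P)"
  by (rule smooth_coinduct[where S = "range flat_exp"]) (use flat_exp_deriv in blast)+

definition bumps :: "(real \<Rightarrow> complex) set" where
  "bumps = {f. smooth f \<and> (\<exists>R. \<forall>x. \<bar>x\<bar> > R \<longrightarrow> f x = 0)}"

lemma bumpsI: "smooth f \<Longrightarrow> (\<And>x. \<bar>x\<bar> > R \<Longrightarrow> f x = 0) \<Longrightarrow> f \<in> bumps"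
  by (auto simp: bumps_def)

lemma bumps_smooth: "f \<in> bumps \<Longrightarrow> smooth f"
  by (simp add: bumps_def)

lemma bumps_measurable [measurable_dest]: "f \<in> bumps \<Longrightarrow> f \<in> borel_measurable borel"
  using bumps_smooth smooth_measurable by blast

lemma bumps_support:
  assumes "f \<in> bumps" obtains R where "R > 0" "\<And>x. \<bar>x\<bar> > R \<Longrightarrow> f x = 0"
proof -
  from assms obtain R where "\<And>x. \<bar>x\<bar> > R \<Longrightarrow> f x = 0" by (auto simp: bumps_def)
  then show thesis by (intro that[of "max R 1"]) auto
qed

lemma bumps_mult: "f \<in> bumps \<Longrightarrow> smooth g \<Longrightarrow> (\<lambda>x. f x * g x) \<in> bumps"
  by (auto simp: bumps_def smooth_mult)

lemma bumps_cmult: "f \<in> bumps \<Longrightarrow> (\<lambda>x. c * f x) \<in> bumps"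
  by (auto simp: bumps_def smooth_mult[OF smooth_const])

lemma bumps_cnj: "f \<in> bumps \<Longrightarrow> (\<lambda>x. cnj (f x)) \<in> bumps"
  by (auto simp: bumps_def smooth_cnj)

lemma bumps_deriv:
  assumes "f \<in> bumps" shows "vderiv f \<in> bumps"
proof -
  obtain R where R: "R > 0" "\<And>x. \<bar>x\<bar> > R \<Longrightarrow> f x = 0" using bumps_support[OF assms] by blast
  show ?thesis
  proof (rule bumpsI[OF smooth_deriv[OF bumps_smooth[OF assms]]])
    fix x :: real assume x: "\<bar>x\<bar> > R"
    have "((\<lambda>x. 0) has_vector_derivative 0) (at x)" by simp
    then have "(f has_vector_derivative 0) (at x)"
      by (rule has_vector_derivative_transform_within_open[of _ _ _ "{x. \<bar>x\<bar> > R}"])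
         (use x R in \<open>auto intro!: open_Collect_less continuous_intros\<close>)
    then show "vderiv f x = 0" by (rule vector_derivative_at)
  qed
qed

lemma bumps_bounded:
  assumes "f \<in> bumps" obtains C where "C > 0" "\<And>x. cmod (f x) \<le> C"
proof -
  obtain R where R: "R > 0" "\<And>x. \<bar>x\<bar> > R \<Longrightarrow> f x = 0" using bumps_support[OF assms] by blast
  have "bounded (f ` {-R..R})"
    by (intro compact_imp_bounded compact_continuous_image smooth_continuous bumps_smooth assms) simp
  then obtain C where C: "C > 0" "\<And>x. x \<in> {-R..R} \<Longrightarrow> cmod (f x) \<le> C"
    by (auto simp: bounded_pos)
  have "cmod (f x) \<le> C" for x
    using C(1) C(2)[of x] R(2)[of x] by (cases "\<bar>x\<bar> > R") (auto simp: not_less abs_le_iff)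
  then show thesis using C(1) that by blast
qed

text \<open>Since \<open>exp (- 1 / (k s))\<close> tends to 1 for every \<open>s > 0\<close>, these
  bumps approximate the indicator of the interval from inside as \<open>k\<close> grows; for
  \<open>k = 0\<close> the bump vanishes.\<close>

definition bump_box :: "real \<Rightarrow> real \<Rightarrow> nat \<Rightarrow> real \<Rightarrow> complex" where
  "bump_box a b k x = flat_exp 1 (of_nat k * (x - a)) * flat_exp 1 (of_nat k * (b - x))"

lemma bump_box_bumps: "bump_box a b k \<in> bumps"
proof (rule bumpsI)
  show "smooth (bump_box a b k)"
    unfolding bump_box_def[abs_def]
    using smooth_mult[OF smooth_compose_affine[OF smooth_flat_exp, of 1 "- of_nat k * a" "of_nat k"]
        smooth_compose_affine[OF smooth_flat_exp, of 1 "of_nat k * b" "- of_nat k"]]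
    by (simp add: algebra_simps)
  show "bump_box a b k x = 0" if "\<bar>x\<bar> > \<bar>a\<bar> + \<bar>b\<bar>" for x
    using that by (auto simp: bump_box_def flat_exp_def zero_less_mult_iff)
qed

lemma cmod_flat_exp_1: "cmod (flat_exp 1 x) \<le> 1"
  by (auto simp: flat_exp_def norm_of_real)

lemma bump_box_le: "cmod (bump_box a b k x) \<le> indicator {a<..<b} x"
proof (cases "a < x \<and> x < b")
  case True
  then show ?thesis
    using mult_mono[OF cmod_flat_exp_1 cmod_flat_exp_1, of "of_nat k * (x - a)" "of_nat k * (b - x)"]
    by (simp add: bump_box_def norm_mult mult.commute)
qed (auto simp: bump_box_def flat_exp_def zero_less_mult_iff)

lemma bump_box_tendsto: "(\<lambda>k. bump_box a b k x) \<longlonglongrightarrow> indicator {a<..<b} x"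
proof (cases "a < x \<and> x < b")
  case True
  have *: "(\<lambda>k. flat_exp 1 (of_nat k * y)) \<longlonglongrightarrow> 1" if "y > 0" for y
  proof (rule Lim_transform_eventually)
    have "(\<lambda>k. of_real (exp (- ((1 / y) * (1 / of_nat k))))) \<longlonglongrightarrow> complex_of_real (exp (- ((1 / y) * 0)))"
      by (intro tendsto_intros lim_1_over_n)
    then show "(\<lambda>k. of_real (exp (- ((1 / y) * (1 / of_nat k))))) \<longlonglongrightarrow> (1::complex)" by simp
    show "\<forall>\<^sub>F k in sequentially. complex_of_real (exp (- ((1 / y) * (1 / of_nat k)))) = flat_exp 1 (of_nat k * y)"
      using eventually_gt_at_top[of 0] by eventually_elim (use that in \<open>auto simp: flat_exp_def field_simps\<close>)
  qed
  have "(\<lambda>k. bump_box a b k x) \<longlonglongrightarrow> 1 * 1"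
    unfolding bump_box_def using True by (intro tendsto_mult *) auto
  then show ?thesis using True by simp
qed (auto simp: bump_box_def flat_exp_def zero_less_mult_iff)

text \<open>The factor \<open>exp 2\<close> undoes the two factors \<open>exp (- 1)\<close> at the
  origin, so that dilations of this bump tend to 1 pointwise.\<close>

definition cutoff :: "real \<Rightarrow> complex" where
  "cutoff x = exp 2 * bump_box (-1) 1 1 x"

lemma cutoff_bumps: "cutoff \<in> bumps"
  unfolding cutoff_def[abs_def] by (intro bumps_cmult bump_box_bumps)

lemma cutoff_0: "cutoff 0 = 1"
proof -
  have "exp 2 * (exp (- 1) * exp (- 1)) = (1::complex)"
    by (simp only: mult_exp_exp) simp
  then show ?thesis by (simp add: cutoff_def bump_box_def flat_exp_def exp_of_real[symmetric])
qed

lemma bumps_scale: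
  assumes "f \<in> bumps" "b \<noteq> 0" shows "(\<lambda>x. f (a + b * x)) \<in> bumps"
proof -
  obtain R where R: "R > 0" "\<And>x. \<bar>x\<bar> > R \<Longrightarrow> f x = 0" using bumps_support[OF assms(1)] by blast
  show ?thesis
  proof (rule bumpsI[OF smooth_compose_affine[OF bumps_smooth[OF assms(1)]]])
    fix x assume "(R + \<bar>a\<bar>) / \<bar>b\<bar> < \<bar>x\<bar>"
    then have "R + \<bar>a\<bar> < \<bar>b * x\<bar>" using assms(2) by (simp add: field_simps abs_mult)
    then show "f (a + b * x) = 0" by (intro R(2)) linarith
  qed
qed

lemma bumps_integrable_powr:
  assumes "f \<in> bumps" "p > 0"
  shows "integrable lborel (\<lambda>x. cmod (f x) powr p)"
proof -
  obtain R where R: "R > 0" "\<And>x. \<bar>x\<bar> > R \<Longrightarrow> f x = 0" using bumps_support[OF assms(1)] by blast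
  obtain C where C: "C > 0" "\<And>x. cmod (f x) \<le> C" using bumps_bounded[OF assms(1)] by blast
  have [measurable]: "f \<in> borel_measurable borel" using assms by measurable
  show ?thesis
  proof (rule Bochner_Integration.integrable_bound)
    show "integrable lborel (\<lambda>x. indicator {-R..R} x * (C powr p))"
      using R(1) by (intro integrable_mult_left impI integrable_real_indicator) auto
    show "AE x in lborel. norm (cmod (f x) powr p) \<le> norm (indicator {-R..R} x * (C powr p))"
    proof (rule AE_I2)
      fix x
      show "norm (cmod (f x) powr p) \<le> norm (indicator {-R..R} x * (C powr p))"
        using R(2)[of x] C(2)[of x] assms(2)
        by (cases "\<bar>x\<bar> > R") (auto simp: not_less abs_le_iff indicator_def intro!: powr_mono2)
    qed
  qed measurable
qed

lemma bumps_integrable: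
  assumes "f \<in> bumps"
  shows "integrable lborel f"
proof -
  have "integrable lborel (\<lambda>x. norm (f x))" using bumps_integrable_powr[OF assms, of 1] by simp
  then show ?thesis using integrable_norm_iff[of f lborel] assms by simp
qed

section \<open>Differentiation under the integral sign\<close>

lemma has_vector_derivative_at_iff:
  fixes f :: "real \<Rightarrow> 'a::real_normed_vector"
  shows "(f has_vector_derivative D) (at x) \<longleftrightarrow> ((\<lambda>y. (f y - f x) /\<^sub>R (y - x)) \<longlongrightarrow> D) (at x)"
proof -
  have "(f has_vector_derivative D) (at x) \<longleftrightarrow>
      ((\<lambda>y. norm ((f y - f x) - (y - x) *\<^sub>R D) / norm (y - x)) \<longlongrightarrow> 0) (at x)"
    by (simp add: has_vector_derivative_def has_derivative_iff_norm bounded_linear_scaleR_left)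
  also have "\<dots> \<longleftrightarrow> ((\<lambda>y. norm ((f y - f x) /\<^sub>R (y - x) - D)) \<longlongrightarrow> 0) (at x)"
  proof (rule Lim_cong_within)
    fix y assume "y \<noteq> x"
    then have "(f y - f x) /\<^sub>R (y - x) - D = ((f y - f x) - (y - x) *\<^sub>R D) /\<^sub>R (y - x)"
      by (simp add: scaleR_diff_right)
    then show "norm ((f y - f x) - (y - x) *\<^sub>R D) / norm (y - x) = norm ((f y - f x) /\<^sub>R (y - x) - D)"
      by (simp add: divide_inverse mult.commute)
  qed auto
  finally show ?thesis by (simp add: tendsto_norm_zero_iff Lim_null[symmetric])
qed

lemma norm_diff_le_of_vector_derivative:
  fixes f :: "real \<Rightarrow> 'a::real_normed_vector"
  assumes "convex S" "x \<in> S" "y \<in> S"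
    and "\<And>s. s \<in> S \<Longrightarrow> (f has_vector_derivative f' s) (at s)" "\<And>s. s \<in> S \<Longrightarrow> norm (f' s) \<le> B"
  shows "norm (f x - f y) \<le> B * \<bar>x - y\<bar>"
proof -
  have "norm (f x - f y) \<le> B * norm (x - y)"
  proof (rule differentiable_bound[OF assms(1) _ _ assms(2,3)])
    show "(f has_derivative (\<lambda>h. h *\<^sub>R f' s)) (at s within S)" if "s \<in> S" for s
      using assms(4)[OF that] by (auto simp: has_vector_derivative_def intro: has_derivative_at_withinI)
    show "onorm (\<lambda>h. h *\<^sub>R f' s) \<le> B" if "s \<in> S" for s
      using assms(5)[OF that] by (intro onorm_le) (auto simp: mult.commute[of B] intro!: mult_left_mono)
  qed
  then show ?thesis by simp
qed

text \<open>The difference quotients converge pointwise to the derivative and the mean value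
  inequality bounds them by \<open>w\<close>; dominated convergence along an arbitrary sequence of
  times does the rest.\<close>

lemma has_vector_derivative_integral:
  fixes f :: "real \<Rightarrow> 'a \<Rightarrow> 'b::{banach, second_countable_topology}"
  assumes "e > 0"
    and deriv: "\<And>s x. \<bar>s - t\<bar> < e \<Longrightarrow> x \<in> space M \<Longrightarrow> ((\<lambda>s. f s x) has_vector_derivative f' s x) (at s)"
    and bound: "\<And>s x. \<bar>s - t\<bar> < e \<Longrightarrow> x \<in> space M \<Longrightarrow> norm (f' s x) \<le> w x"
    and w: "integrable M w" and int: "\<And>s. \<bar>s - t\<bar> < e \<Longrightarrow> integrable M (f s)"
    and f': "f' t \<in> borel_measurable M"
  shows "((\<lambda>s. \<integral>x. f s x \<partial>M) has_vector_derivative (\<integral>x. f' t x \<partial>M)) (at t)"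
  unfolding has_vector_derivative_at_iff tendsto_at_iff_sequentially
proof safe
  fix X :: "nat \<Rightarrow> real" assume X: "\<forall>i. X i \<in> UNIV - {t}" and lim: "X \<longlonglongrightarrow> t"
  from LIMSEQ_D[OF lim \<open>e > 0\<close>] obtain N where N: "\<And>n. n \<ge> N \<Longrightarrow> \<bar>X n - t\<bar> < e"
    by auto
  \<comment> \<open>Dropping finitely many terms keeps the whole sequence in the interval on which
    the hypotheses hold.\<close>
  define Y where "Y n = X (n + N)" for n
  have Y: "\<bar>Y n - t\<bar> < e" "Y n \<noteq> t" for n using N X by (auto simp: Y_def)
  have Ylim: "Y \<longlonglongrightarrow> t" unfolding Y_def using lim by (rule LIMSEQ_ignore_initial_segment)
  have it: "integrable M (f t)" using int \<open>e > 0\<close> by simp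
  have "(\<lambda>n. \<integral>x. (f (Y n) x - f t x) /\<^sub>R (Y n - t) \<partial>M) \<longlonglongrightarrow> (\<integral>x. f' t x \<partial>M)"
  proof (rule integral_dominated_convergence[OF f' _ w])
    show "(\<lambda>x. (f (Y n) x - f t x) /\<^sub>R (Y n - t)) \<in> borel_measurable M" for n
      using int[OF Y(1)] it by measurable
    show "AE x in M. (\<lambda>n. (f (Y n) x - f t x) /\<^sub>R (Y n - t)) \<longlonglongrightarrow> f' t x"
    proof (rule AE_I2)
      fix x assume x: "x \<in> space M"
      have "((\<lambda>s. f s x) has_vector_derivative f' t x) (at t)" using \<open>e > 0\<close> x by (intro deriv) auto
      then show "(\<lambda>n. (f (Y n) x - f t x) /\<^sub>R (Y n - t)) \<longlonglongrightarrow> f' t x"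
        unfolding has_vector_derivative_at_iff tendsto_at_iff_sequentially
        using Y(2) Ylim by (auto simp: o_def)
    qed
    show "AE x in M. norm ((f (Y n) x - f t x) /\<^sub>R (Y n - t)) \<le> w x" for n
    proof (rule AE_I2)
      fix x assume x: "x \<in> space M"
      have "norm (f (Y n) x - f t x) \<le> w x * \<bar>Y n - t\<bar>"
      proof (rule norm_diff_le_of_vector_derivative[of "{t - e<..<t + e}" _ _ "\<lambda>s. f s x" "\<lambda>s. f' s x"])
        fix s assume "s \<in> {t - e<..<t + e}"
        then have "\<bar>s - t\<bar> < e" by (auto simp: abs_less_iff)
        then show "((\<lambda>s. f s x) has_vector_derivative f' s x) (at s)" "norm (f' s x) \<le> w x"
          using deriv bound x by auto
      qed (use Y(1)[of n] \<open>e > 0\<close> in \<open>auto simp: abs_less_iff convex_real_interval\<close>)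
      then show "norm ((f (Y n) x - f t x) /\<^sub>R (Y n - t)) \<le> w x"
        using Y(2)[of n] by (simp add: divide_inverse[symmetric] mult.commute[of "inverse _"] pos_divide_le_eq)
    qed
  qed
  moreover have "(\<integral>x. (f (Y n) x - f t x) /\<^sub>R (Y n - t) \<partial>M) = ((\<integral>x. f (Y n) x \<partial>M) - (\<integral>x. f t x \<partial>M)) /\<^sub>R (Y n - t)" for n
    using int[OF Y(1)] it
    by (subst integral_scaleR_right, subst Bochner_Integration.integral_diff) auto
  ultimately have "(\<lambda>n. ((\<integral>x. f (X (n + N)) x \<partial>M) - (\<integral>x. f t x \<partial>M)) /\<^sub>R (X (n + N) - t)) \<longlonglongrightarrow> (\<integral>x. f' t x \<partial>M)"
    by (simp only: Y_def)
  from LIMSEQ_offset[OF this]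
  show "((\<lambda>y. ((\<integral>x. f y x \<partial>M) - (\<integral>x. f t x \<partial>M)) /\<^sub>R (y - t)) \<circ> X) \<longlonglongrightarrow> (\<integral>x. f' t x \<partial>M)"
    by (simp add: o_def)
qed

section \<open>Complex Gaussian integrals\<close>

lemma gauss_moment_integrable:
  fixes c :: real assumes "c > 0"
  shows "integrable lborel (\<lambda>x. \<bar>x\<bar> ^ k * exp (- (c * x\<^sup>2)))"
proof -
  \<comment> \<open>The normal density with this deviation is a multiple of
    \<open>exp (- c x^2)\<close>, so its absolute moments can be used.\<close>
  define \<sigma> where "\<sigma> = sqrt (1 / (2 * c))"
  have s: "\<sigma> > 0" "\<sigma>\<^sup>2 = 1 / (2 * c)" using assms by (auto simp: \<sigma>_def)
  have "integrable lborel (\<lambda>x. sqrt (2 * pi * \<sigma>\<^sup>2) * (normal_density 0 \<sigma> x * \<bar>x - 0\<bar> ^ k))"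
    by (intro integrable_mult_right impI integrable_normal_moment_abs s)
  moreover have "(\<lambda>x. sqrt (2 * pi * \<sigma>\<^sup>2) * (normal_density 0 \<sigma> x * \<bar>x - 0\<bar> ^ k)) = (\<lambda>x. \<bar>x\<bar> ^ k * exp (- (c * x\<^sup>2)))"
    using assms s by (simp add: fun_eq_iff normal_density_def real_sqrt_mult real_sqrt_divide)
  ultimately show ?thesis by (simp only:)
qed

text \<open>Half of the quadratic term absorbs the linear one after completing the square, at the
  cost of the constant \<open>exp (d^2 / (2 c))\<close>.\<close>

lemma gauss_linear_moment_integrable:
  fixes c d :: real assumes "c > 0"
  shows "integrable lborel (\<lambda>x. \<bar>x\<bar> ^ k * exp (- (c * x\<^sup>2) + d * \<bar>x\<bar>))"
proof (rule Bochner_Integration.integrable_bound)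
  show "integrable lborel (\<lambda>x. exp (d\<^sup>2 / (2 * c)) * (\<bar>x\<bar> ^ k * exp (- (c / 2 * x\<^sup>2))))"
    using assms by (intro integrable_mult_right impI gauss_moment_integrable) auto
  show "AE x in lborel. norm (\<bar>x\<bar> ^ k * exp (- (c * x\<^sup>2) + d * \<bar>x\<bar>))
      \<le> norm (exp (d\<^sup>2 / (2 * c)) * (\<bar>x\<bar> ^ k * exp (- (c / 2 * x\<^sup>2))))"
  proof (rule AE_I2)
    fix x :: real
    have "0 \<le> c / 2 * (\<bar>x\<bar> - d / c)\<^sup>2" using assms by simp
    also have "\<dots> = c / 2 * x\<^sup>2 - d * \<bar>x\<bar> + d\<^sup>2 / (2 * c)"
      using assms by (simp add: power2_diff field_simps power2_eq_square)
    finally have "- (c * x\<^sup>2) + d * \<bar>x\<bar> \<le> d\<^sup>2 / (2 * c) + - (c / 2 * x\<^sup>2)" by simp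
    then have "exp (- (c * x\<^sup>2) + d * \<bar>x\<bar>) \<le> exp (d\<^sup>2 / (2 * c)) * exp (- (c / 2 * x\<^sup>2))"
      by (subst exp_add[symmetric]) simp
    then have "\<bar>x\<bar> ^ k * exp (- (c * x\<^sup>2) + d * \<bar>x\<bar>) \<le> \<bar>x\<bar> ^ k * (exp (d\<^sup>2 / (2 * c)) * exp (- (c / 2 * x\<^sup>2)))"
      by (rule mult_left_mono) simp
    then show "norm (\<bar>x\<bar> ^ k * exp (- (c * x\<^sup>2) + d * \<bar>x\<bar>))
      \<le> norm (exp (d\<^sup>2 / (2 * c)) * (\<bar>x\<bar> ^ k * exp (- (c / 2 * x\<^sup>2))))"
      by (simp add: abs_mult mult_ac)
  qed
qed measurable

definition cgauss :: "complex \<Rightarrow> complex \<Rightarrow> real \<Rightarrow> complex" where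
  "cgauss a b x = exp (- a * of_real (x\<^sup>2) + b * of_real x)"

lemma cgauss_measurable [measurable]: "cgauss a b \<in> borel_measurable borel"
  unfolding cgauss_def[abs_def] by measurable

lemma cgauss_bound: "cmod (cgauss a b x) \<le> exp (- (Re a * x\<^sup>2) + cmod b * \<bar>x\<bar>)"
proof -
  have "Re b * x \<le> cmod b * \<bar>x\<bar>"
    by (rule order_trans[OF abs_ge_self]) (auto simp: abs_mult intro!: mult_right_mono abs_Re_le_cmod)
  then show ?thesis by (simp add: cgauss_def norm_exp_eq_Re)
qed

lemma cgauss_moment_integrable:
  assumes "Re a > 0"
  shows "integrable lborel (\<lambda>x. of_real x ^ k * cgauss a b x)"
proof (rule Bochner_Integration.integrable_bound[OF gauss_linear_moment_integrable[OF assms, of k "cmod b"]])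
  show "AE x in lborel. norm (of_real x ^ k * cgauss a b x) \<le> norm (\<bar>x\<bar> ^ k * exp (- (Re a * x\<^sup>2) + cmod b * \<bar>x\<bar>))"
    using cgauss_bound[of a b] by (intro AE_I2) (auto simp: norm_mult norm_power abs_mult intro!: mult_left_mono)
qed measurable

lemma integral_deriv_eq_0:
  fixes F :: "real \<Rightarrow> complex"
  assumes "\<And>x. (F has_vector_derivative f x) (at x)" "continuous_on UNIV f" "integrable lborel f"
    and "(F \<longlongrightarrow> 0) at_top" "(F \<longlongrightarrow> 0) at_bot"
  shows "(\<integral>x. f x \<partial>lborel) = 0"
proof -
  have "(LBINT x=-\<infinity>..\<infinity>. f x) = 0 - 0"
    using assms by (intro interval_integral_FTC_integrable[of _ _ F])
      (auto simp: ereal_tendsto_simps set_integrable_def continuous_on_eq_continuous_at)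
  then show ?thesis by (simp add: interval_lebesgue_integral_def set_lebesgue_integral_def)
qed

section \<open>Moments and total integral of a complex Gaussian\<close>

lemma cgauss_deriv:
  "(cgauss a b has_vector_derivative (- 2 * a * of_real x + b) * cgauss a b x) (at x)"
proof -
  have "((\<lambda>z. exp (- a * z\<^sup>2 + b * z)) has_field_derivative (- 2 * a * of_real x + b) * cgauss a b x) (at (of_real x))"
    unfolding cgauss_def by (auto intro!: derivative_eq_intros simp: power2_eq_square)
  then show ?thesis
    using has_vector_derivative_real_field[of "\<lambda>z. exp (- a * z\<^sup>2 + b * z)"]
    by (simp add: cgauss_def[abs_def])
qed

lemma cgauss_tendsto:
  assumes "Re a > 0"
  shows "((\<lambda>x. of_real x ^ k * cgauss a b x) \<longlongrightarrow> 0) at_top"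
    and "((\<lambda>x. of_real x ^ k * cgauss a b x) \<longlongrightarrow> 0) at_bot"
proof -
  define c d where "c = Re a" and "d = cmod b"
  have c: "c > 0" using assms by (simp add: c_def)
  have bd: "norm (of_real x ^ k * cgauss a b x) \<le> \<bar>x\<bar> ^ k * exp (- (c * x\<^sup>2) + d * \<bar>x\<bar>)" for x
    using cgauss_bound[of a b x] by (simp add: c_def d_def norm_mult norm_power mult_left_mono)
  have 1: "((\<lambda>x. x ^ k * exp (- (c * x\<^sup>2) + d * x)) \<longlongrightarrow> 0) at_top"
    using c by real_asymp
  then have top: "((\<lambda>x. \<bar>x\<bar> ^ k * exp (- (c * x\<^sup>2) + d * \<bar>x\<bar>)) \<longlongrightarrow> 0) at_top"
    by (rule Lim_transform_eventually) (use eventually_ge_at_top[of 0] in eventually_elim, simp)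
  then show "((\<lambda>x. of_real x ^ k * cgauss a b x) \<longlongrightarrow> 0) at_top"
    by (rule Lim_null_comparison[rotated]) (use bd in simp)
  have "((\<lambda>x. \<bar>x\<bar> ^ k * exp (- (c * x\<^sup>2) + d * \<bar>x\<bar>)) \<longlongrightarrow> 0) at_bot"
    using top by (subst filterlim_at_bot_mirror) simp
  then show "((\<lambda>x. of_real x ^ k * cgauss a b x) \<longlongrightarrow> 0) at_bot"
    by (rule Lim_null_comparison[rotated]) (use bd in simp)
qed

text \<open>The derivative of the Gaussian has integral 0, which is a linear relation between its
  moments of orders 0 and 1.\<close>

lemma cgauss_moment_1:
  assumes "Re a > 0"
  shows "(\<integral>x. of_real x * cgauss a b x \<partial>lborel) = b / (2 * a) * (\<integral>x. cgauss a b x \<partial>lborel)"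
proof -
  have i0: "integrable lborel (cgauss a b)" and i1: "integrable lborel (\<lambda>x. of_real x * cgauss a b x)"
    using cgauss_moment_integrable[OF assms, of 0] cgauss_moment_integrable[OF assms, of 1] by auto
  have "(\<integral>x. (- 2 * a * of_real x + b) * cgauss a b x \<partial>lborel) = 0"
  proof (rule integral_deriv_eq_0[OF cgauss_deriv])
    show "continuous_on UNIV (\<lambda>x. (- 2 * a * of_real x + b) * cgauss a b x)"
      unfolding cgauss_def by (intro continuous_intros)
    have "integrable lborel (\<lambda>x. - 2 * a * (of_real x * cgauss a b x) + b * cgauss a b x)"
      using i0 i1 by (intro Bochner_Integration.integrable_add integrable_mult_right) auto
    then show "integrable lborel (\<lambda>x. (- 2 * a * of_real x + b) * cgauss a b x)"
      by (simp add: algebra_simps)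
  qed (use cgauss_tendsto[OF assms, of 0 b] in auto)
  moreover have "(\<integral>x. (- 2 * a * of_real x + b) * cgauss a b x \<partial>lborel)
      = - 2 * a * (\<integral>x. of_real x * cgauss a b x \<partial>lborel) + b * (\<integral>x. cgauss a b x \<partial>lborel)"
  proof -
    have "(\<integral>x. (- 2 * a * of_real x + b) * cgauss a b x \<partial>lborel)
      = (\<integral>x. - 2 * a * (of_real x * cgauss a b x) + b * cgauss a b x \<partial>lborel)"
      by (simp add: algebra_simps)
    also have "\<dots> = - 2 * a * (\<integral>x. of_real x * cgauss a b x \<partial>lborel) + b * (\<integral>x. cgauss a b x \<partial>lborel)"
      using i0 i1 by (subst Bochner_Integration.integral_add) auto
    finally show ?thesis .
  qed
  moreover have "a \<noteq> 0" using assms by auto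
  ultimately show ?thesis by (simp add: field_simps)
qed

text \<open>The derivative of \<open>x\<close> times the Gaussian has integral 0; this relates the
  moments of orders 0, 1 and 2.\<close>

lemma cgauss_moment_2:
  assumes "Re a > 0"
  shows "(\<integral>x. of_real x ^ 2 * cgauss a b x \<partial>lborel)
    = (1 / (2 * a) + b\<^sup>2 / (4 * a\<^sup>2)) * (\<integral>x. cgauss a b x \<partial>lborel)"
proof -
  have i0: "integrable lborel (cgauss a b)" and i1: "integrable lborel (\<lambda>x. of_real x * cgauss a b x)"
    and i2: "integrable lborel (\<lambda>x. of_real x ^ 2 * cgauss a b x)"
    using cgauss_moment_integrable[OF assms, of 0] cgauss_moment_integrable[OF assms, of 1]
      cgauss_moment_integrable[OF assms, of 2] by auto
  let ?f = "\<lambda>x. cgauss a b x + of_real x * ((- 2 * a * of_real x + b) * cgauss a b x)"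
  have feq: "?f = (\<lambda>x. cgauss a b x + b * (of_real x * cgauss a b x) - 2 * a * (of_real x ^ 2 * cgauss a b x))"
    by (simp add: fun_eq_iff algebra_simps power2_eq_square)
  have "(\<integral>x. ?f x \<partial>lborel) = 0"
  proof (rule integral_deriv_eq_0[where F = "\<lambda>x. of_real x * cgauss a b x"])
    show "((\<lambda>x. of_real x * cgauss a b x) has_vector_derivative ?f x) (at x)" for x
      by (rule has_vector_derivative_eq_rhs[OF has_vector_derivative_mult[OF has_vector_derivative_of_real[OF DERIV_ident] cgauss_deriv]])
         simp
    show "continuous_on UNIV ?f" unfolding cgauss_def by (intro continuous_intros)
    show "integrable lborel ?f" unfolding feq
      using i0 i1 i2 by (intro Bochner_Integration.integrable_add Bochner_Integration.integrable_diff integrable_mult_right) auto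
  qed (use cgauss_tendsto[OF assms, of 1 b] in auto)
  moreover have "(\<integral>x. ?f x \<partial>lborel) = (\<integral>x. cgauss a b x \<partial>lborel) + b * (\<integral>x. of_real x * cgauss a b x \<partial>lborel)
     - 2 * a * (\<integral>x. of_real x ^ 2 * cgauss a b x \<partial>lborel)"
    unfolding feq using i0 i1 i2 by simp
  moreover have a: "a \<noteq> 0" using assms by auto
  ultimately have "2 * a * (\<integral>x. of_real x ^ 2 * cgauss a b x \<partial>lborel)
     = (1 + b\<^sup>2 / (2 * a)) * (\<integral>x. cgauss a b x \<partial>lborel)"
    unfolding cgauss_moment_1[OF assms] by (simp add: algebra_simps power2_eq_square)
  then have "(\<integral>x. of_real x ^ 2 * cgauss a b x \<partial>lborel)
     = (1 + b\<^sup>2 / (2 * a)) / (2 * a) * (\<integral>x. cgauss a b x \<partial>lborel)"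
    using a by (simp add: field_simps)
  also have "(1 + b\<^sup>2 / (2 * a)) / (2 * a) = 1 / (2 * a) + b\<^sup>2 / (4 * a\<^sup>2)"
    using a by (simp add: field_simps power2_eq_square)
  finally show ?thesis .
qed

lemma cgauss_integral_1: "(\<integral>x. cgauss 1 0 x \<partial>lborel) = of_real (sqrt pi)"
proof -
  have "(\<integral>x. sqrt pi * normal_density 0 (sqrt (1/2)) x \<partial>lborel) = sqrt pi" by simp
  moreover have "sqrt pi * normal_density 0 (sqrt (1/2)) x = exp (- x\<^sup>2)" for x
    by (simp add: normal_density_def)
  ultimately have "(\<integral>x. exp (- x\<^sup>2) \<partial>lborel) = sqrt pi" by simp
  then have "(\<integral>x. complex_of_real (exp (- x\<^sup>2)) \<partial>lborel) = of_real (sqrt pi)"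
    by (simp only: integral_complex_of_real)
  then show ?thesis by (simp add: cgauss_def exp_of_real[symmetric])
qed

text \<open>
  Deform \<open>(1, 0)\<close> to \<open>(a, b)\<close> along \<open>(1 + s (a - 1), s b)\<close>: by the moment formulas, the product of
  the integral with the inverse of its expected value has derivative \<open>0\<close> in \<open>s\<close>.
\<close>

lemma cgauss_integral:
  assumes "Re a > 0"
  shows "(\<integral>x. cgauss a b x \<partial>lborel) = of_real (sqrt pi) / csqrt a * exp (b\<^sup>2 / (4 * a))"
proof -
  define A where "A s = 1 + of_real s * (a - 1)" for s :: real
  define F where "F s = (\<integral>x. cgauss (A s) (of_real s * b) x \<partial>lborel)" for s :: real
  \<comment> \<open>\<open>Re (A s)\<close> is a convex combination of 1 and \<open>Re a\<close>, so
    \<open>m\<close> bounds it from below and the path stays in the right half-plane.\<close>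
  define m where "m = min 1 (Re a)"
  have m: "m > 0" "m \<le> 1" using assms by (auto simp: m_def)
  have ReA: "Re (A s) = (1 - s) * 1 + s * Re a" for s by (simp add: A_def algebra_simps)
  have ReA_ge: "Re (A s) \<ge> m" if "0 \<le> s" "s \<le> 1" for s
  proof -
    have "(1 - s) * m + s * m \<le> (1 - s) * 1 + s * Re a"
      using that by (intro add_mono mult_left_mono) (auto simp: m_def)
    then show ?thesis by (simp add: ReA algebra_simps)
  qed
  have nz: "A s \<noteq> 0" "A s \<notin> \<real>\<^sub>\<le>\<^sub>0" if "0 \<le> s" "s \<le> 1" for s
    using ReA_ge[OF that] m by (auto simp: complex_nonpos_Reals_iff)
  have dF: "(F has_vector_derivative
      (- (a - 1) * (1 / (2 * A s) + (of_real s * b)\<^sup>2 / (4 * (A s)\<^sup>2)) + b * (of_real s * b / (2 * A s))) * F s) (at s)"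
    if s: "0 \<le> s" "s \<le> 1" for s
  proof -
    \<comment> \<open>Within distance \<open>e\<close> of \<open>s\<close> the real part of
      \<open>A\<close> loses at most \<open>m / 2\<close>, and \<open>|r| \<le> 2\<close>; these two
      bounds shape the dominating function.\<close>
    define e where "e = min 1 (m / (2 * (\<bar>Re a - 1\<bar> + 1)))"
    have e: "e > 0" "e \<le> 1" using m by (auto simp: e_def intro!: divide_pos_pos mult_pos_pos add_nonneg_pos simp del: distrib_left_numeral)
    have e2: "e * \<bar>Re a - 1\<bar> \<le> m / 2"
    proof -
      have "e * \<bar>Re a - 1\<bar> \<le> m / (2 * (\<bar>Re a - 1\<bar> + 1)) * (\<bar>Re a - 1\<bar> + 1)"
        using e m by (intro mult_mono) (auto simp: e_def)
      also have "\<dots> = m / 2"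
      proof -
        have "\<bar>Re a - 1\<bar> + 1 \<noteq> 0" by (simp add: add_nonneg_eq_0_iff)
        then show ?thesis by (metis divide_divide_eq_left nonzero_mult_div_cancel_right times_divide_eq_left)
      qed
      finally show ?thesis .
    qed
    have ReA2: "Re (A r) \<ge> m / 2" if "\<bar>r - s\<bar> < e" for r
    proof -
      have "Re (A s) - Re (A r) = (s - r) * (Re a - 1)" by (simp add: ReA algebra_simps)
      also have "\<dots> \<le> \<bar>s - r\<bar> * \<bar>Re a - 1\<bar>" by (metis abs_ge_self abs_mult)
      also have "\<dots> \<le> e * \<bar>Re a - 1\<bar>" using that by (intro mult_right_mono) auto
      finally show ?thesis using ReA_ge[OF s] e2 by simp
    qed
    have "(F has_vector_derivative
        (\<integral>x. (- (a - 1) * of_real x ^ 2 + b * of_real x) * cgauss (A s) (of_real s * b) x \<partial>lborel)) (at s)"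
      unfolding F_def
    proof (rule has_vector_derivative_integral[OF e(1), where f' = "\<lambda>r x. (- (a - 1) * of_real x ^ 2 + b * of_real x) * cgauss (A r) (of_real r * b) x"
          and w = "\<lambda>x. cmod (a - 1) * (\<bar>x\<bar> ^ 2 * exp (- (m / 2 * x\<^sup>2) + 2 * cmod b * \<bar>x\<bar>))
              + cmod b * (\<bar>x\<bar> ^ 1 * exp (- (m / 2 * x\<^sup>2) + 2 * cmod b * \<bar>x\<bar>))"])
      fix r x assume r: "\<bar>r - s\<bar> < e"
      have "((\<lambda>r. exp (- (1 + r * (a - 1)) * of_real (x\<^sup>2) + (r * b) * of_real x)) has_field_derivative
          (- (a - 1) * of_real x ^ 2 + b * of_real x) * cgauss (A r) (of_real r * b) x) (at (of_real r))"
        unfolding cgauss_def A_def by (auto intro!: derivative_eq_intros simp: algebra_simps)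
      from has_vector_derivative_real_field[OF this]
      show "((\<lambda>r. cgauss (A r) (of_real r * b) x) has_vector_derivative
          (- (a - 1) * of_real x ^ 2 + b * of_real x) * cgauss (A r) (of_real r * b) x) (at r)"
        by (simp only: cgauss_def A_def)
      have "cmod (of_real r * b) * \<bar>x\<bar> \<le> 2 * cmod b * \<bar>x\<bar>"
        using r e s by (auto simp: norm_mult intro!: mult_right_mono)
      moreover have "m / 2 * x\<^sup>2 \<le> Re (A r) * x\<^sup>2" using ReA2[OF r] by (intro mult_right_mono) auto
      ultimately have "cmod (cgauss (A r) (of_real r * b) x) \<le> exp (- (m / 2 * x\<^sup>2) + 2 * cmod b * \<bar>x\<bar>)"
        by (intro order_trans[OF cgauss_bound]) simp
      moreover have "cmod (- (a - 1) * of_real x ^ 2 + b * of_real x) \<le> cmod (a - 1) * \<bar>x\<bar> ^ 2 + cmod b * \<bar>x\<bar>"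
        by (rule order_trans[OF norm_triangle_ineq]) (simp add: norm_mult norm_power norm_minus_commute)
      ultimately have "cmod ((- (a - 1) * of_real x ^ 2 + b * of_real x) * cgauss (A r) (of_real r * b) x)
        \<le> (cmod (a - 1) * \<bar>x\<bar> ^ 2 + cmod b * \<bar>x\<bar>) * exp (- (m / 2 * x\<^sup>2) + 2 * cmod b * \<bar>x\<bar>)"
        unfolding norm_mult by (intro mult_mono) auto
      then show "cmod ((- (a - 1) * of_real x ^ 2 + b * of_real x) * cgauss (A r) (of_real r * b) x)
        \<le> cmod (a - 1) * (\<bar>x\<bar> ^ 2 * exp (- (m / 2 * x\<^sup>2) + 2 * cmod b * \<bar>x\<bar>))
              + cmod b * (\<bar>x\<bar> ^ 1 * exp (- (m / 2 * x\<^sup>2) + 2 * cmod b * \<bar>x\<bar>))"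
        by (simp add: algebra_simps)
    next
      show "integrable lborel (\<lambda>x. cmod (a - 1) * (\<bar>x\<bar> ^ 2 * exp (- (m / 2 * x\<^sup>2) + 2 * cmod b * \<bar>x\<bar>))
              + cmod b * (\<bar>x\<bar> ^ 1 * exp (- (m / 2 * x\<^sup>2) + 2 * cmod b * \<bar>x\<bar>)))"
        using m by (intro Bochner_Integration.integrable_add integrable_mult_right impI gauss_linear_moment_integrable) auto
      show "integrable lborel (cgauss (A r) (of_real r * b))" if "\<bar>r - s\<bar> < e" for r
        using cgauss_moment_integrable[of "A r" 0] ReA2[OF that] m by simp
    qed measurable
    also have "(\<integral>x. (- (a - 1) * of_real x ^ 2 + b * of_real x) * cgauss (A s) (of_real s * b) x \<partial>lborel)
      = - (a - 1) * (\<integral>x. of_real x ^ 2 * cgauss (A s) (of_real s * b) x \<partial>lborel)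
        + b * (\<integral>x. of_real x * cgauss (A s) (of_real s * b) x \<partial>lborel)"
    proof -
      have RA: "Re (A s) > 0" using ReA_ge[OF s] m by simp
      have "(\<lambda>x. (- (a - 1) * of_real x ^ 2 + b * of_real x) * cgauss (A s) (of_real s * b) x)
        = (\<lambda>x. - (a - 1) * (of_real x ^ 2 * cgauss (A s) (of_real s * b) x) + b * (of_real x * cgauss (A s) (of_real s * b) x))"
        by (simp add: fun_eq_iff algebra_simps)
      then show ?thesis
        using cgauss_moment_integrable[OF RA, of 1 "of_real s * b"] cgauss_moment_integrable[OF RA, of 2 "of_real s * b"]
        by (simp only: Bochner_Integration.integral_add integrable_mult_right integral_mult_right_zero power_one_right)
    qed
    also have "\<dots> = (- (a - 1) * (1 / (2 * A s) + (of_real s * b)\<^sup>2 / (4 * (A s)\<^sup>2)) + b * (of_real s * b / (2 * A s))) * F s"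
      using ReA_ge[OF s] m unfolding F_def
      by (subst cgauss_moment_1, simp, subst cgauss_moment_2, simp) (simp only: ring_distribs mult.assoc)
    finally show ?thesis .
  qed
  \<comment> \<open>Up to the constant \<open>sqrt pi\<close>, the integral divided by its expected
    value.\<close>
  define Q where "Q s = csqrt (A s) * exp (- ((of_real s * b)\<^sup>2 / (4 * A s))) * F s" for s
  have dQ: "(Q has_vector_derivative 0) (at s)" if s: "0 \<le> s" "s \<le> 1" for s
  proof -
    define E where "E s = csqrt (A s) * exp (- ((of_real s * b)\<^sup>2 / (4 * A s)))" for s
    define D where "D = (a - 1) / (2 * A s) - (2 * of_real s * b\<^sup>2 * (4 * A s) - (of_real s * b)\<^sup>2 * (4 * (a - 1))) / (4 * A s)\<^sup>2"
    have cs: "csqrt (A s) * csqrt (A s) = A s" by (metis power2_csqrt power2_eq_square)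
    have cs0: "csqrt (A s) \<noteq> 0" using nz[OF s] by simp
    have A': "((\<lambda>r. 1 + r * (a - 1)) has_field_derivative (a - 1)) (at (of_real s))"
      by (auto intro!: derivative_eq_intros)
    \<comment> \<open>The principal root is differentiable here because \<open>A s\<close> avoids
      the branch cut along the nonpositive reals.\<close>
    have d1: "((\<lambda>r. csqrt (1 + r * (a - 1))) has_field_derivative (a - 1) / (2 * csqrt (A s))) (at (of_real s))"
      using has_field_derivative_csqrt'[OF A'] nz[OF s] by (simp add: A_def)
    define N where "N = 2 * of_real s * b\<^sup>2 * (4 * A s) - (of_real s * b)\<^sup>2 * (4 * (a - 1))"
    have n: "((\<lambda>r. (r * b)\<^sup>2) has_field_derivative 2 * of_real s * b\<^sup>2) (at (of_real s))"
      by (auto intro!: derivative_eq_intros simp: power2_eq_square)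
    have dn: "((\<lambda>r. 4 * (1 + r * (a - 1))) has_field_derivative 4 * (a - 1)) (at (of_real s))"
      by (auto intro!: derivative_eq_intros)
    have "4 * (1 + of_real s * (a - 1)) \<noteq> 0" using nz(1)[OF s] by (simp only: A_def mult_eq_0_iff) simp
    from DERIV_divide[OF n dn this]
    have "((\<lambda>r. (r * b)\<^sup>2 / (4 * (1 + r * (a - 1)))) has_field_derivative N / (4 * A s)\<^sup>2) (at (of_real s))"
      unfolding N_def A_def power2_eq_square[of "4 * _"] .
    from DERIV_fun_exp[OF DERIV_minus[OF this]]
    have d2: "((\<lambda>r. exp (- ((r * b)\<^sup>2 / (4 * (1 + r * (a - 1)))))) has_field_derivative
       exp (- ((of_real s * b)\<^sup>2 / (4 * A s))) * - (N / (4 * A s)\<^sup>2)) (at (of_real s))"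
      by (simp only: A_def)
    have "((\<lambda>r. csqrt (1 + r * (a - 1)) * exp (- ((r * b)\<^sup>2 / (4 * (1 + r * (a - 1)))))) has_field_derivative D * E s) (at (of_real s))"
    proof (rule DERIV_cong[OF DERIV_mult[OF d1 d2]])
      define X where "X = exp (- ((of_real s * b)\<^sup>2 / (4 * A s)))"
      have "(a - 1) / (2 * w) = (a - 1) / (2 * (w * w)) * w" if "w \<noteq> 0" for w
        using that by (simp add: field_simps)
      from this[OF cs0] have "(a - 1) / (2 * csqrt (A s)) = (a - 1) / (2 * A s) * csqrt (A s)"
        unfolding cs .
      then have "(a - 1) / (2 * csqrt (A s)) * X + X * - (N / (4 * A s)\<^sup>2) * csqrt (A s)
          = ((a - 1) / (2 * A s) - N / (4 * A s)\<^sup>2) * (csqrt (A s) * X)"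
        by (simp only: ring_distribs) (simp add: mult_ac)
      then show "(a - 1) / (2 * csqrt (A s)) * exp (- ((of_real s * b)\<^sup>2 / (4 * (1 + of_real s * (a - 1))))) +
        exp (- ((of_real s * b)\<^sup>2 / (4 * A s))) * - (N / (4 * A s)\<^sup>2) * csqrt (1 + of_real s * (a - 1)) = D * E s"
        unfolding A_def[symmetric] E_def D_def N_def[symmetric] X_def[symmetric] .
    qed
    then have dE: "(E has_vector_derivative D * E s) (at s)"
      using has_vector_derivative_real_field[of "\<lambda>r. csqrt (1 + r * (a - 1)) * exp (- ((r * b)\<^sup>2 / (4 * (1 + r * (a - 1)))))"]
      by (simp add: E_def[abs_def] A_def)
    \<comment> \<open>\<open>K\<close> and \<open>D\<close> are the logarithmic derivatives of the
      integral and of the normalising factor; they cancel.\<close>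
    define K where "K = - (a - 1) * (1 / (2 * A s) + (of_real s * b)\<^sup>2 / (4 * (A s)\<^sup>2)) + b * (of_real s * b / (2 * A s))"
    have KD: "K + D = 0"
    proof -
      have "(w::complex) \<noteq> 0 \<Longrightarrow> - c * (1 / (2 * w) + (r * b)\<^sup>2 / (4 * w\<^sup>2)) + b * (r * b / (2 * w))
        + (c / (2 * w) - (2 * r * b\<^sup>2 * (4 * w) - (r * b)\<^sup>2 * (4 * c)) / (4 * w)\<^sup>2) = 0" for w c r
        by (simp add: field_simps power2_eq_square)
      from this[OF nz(1)[OF s]] show ?thesis unfolding K_def D_def .
    qed
    have "(Q has_vector_derivative E s * (K * F s) + D * E s * F s) (at s)"
      unfolding Q_def[abs_def] E_def[symmetric]
      using has_vector_derivative_mult[OF dE dF[OF s, folded K_def]] by simp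
    moreover have "E s * (K * F s) + D * E s * F s = (K + D) * (E s * F s)" by (simp add: algebra_simps)
    ultimately show ?thesis unfolding KD by simp
  qed
  have "Q 1 = Q 0"
  proof -
    obtain c where "\<And>x. x \<in> {0..1} \<Longrightarrow> Q x = c"
      by (rule has_vector_derivative_zero_constant[of "{0..1::real}" Q])
         (use dQ in \<open>auto intro: has_vector_derivative_at_within\<close>)
    then show ?thesis by simp
  qed
  then have "csqrt a * exp (- (b\<^sup>2 / (4 * a))) * (\<integral>x. cgauss a b x \<partial>lborel) = of_real (sqrt pi)"
    by (simp add: Q_def F_def A_def cgauss_integral_1)
  moreover have "csqrt a \<noteq> 0" using assms by auto
  ultimately show ?thesis by (simp add: exp_minus field_simps)
qed

section \<open>The one-dimensional complex heat kernel\<close>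

lemma Re_one_divide_pos: "Re z > 0 \<Longrightarrow> Re (1 / z) > 0"
  by (simp add: Re_divide) (intro divide_pos_pos add_pos_nonneg, auto)

text \<open>A positive real factor leaves the candidate root among the principal ones. In general
  \<open>csqrt\<close> is not multiplicative, so every product of complex roots below is traced back
  to such a case.\<close>

lemma csqrt_of_real_mult:
  assumes "r > 0" "Re z > 0"
  shows "csqrt (of_real r * z) = of_real (sqrt r) * csqrt z"
proof (rule csqrt_unique)
  show "(of_real (sqrt r) * csqrt z)\<^sup>2 = of_real r * z"
    using assms by (simp add: power_mult_distrib flip: of_real_power)
  show "0 < Re (of_real (sqrt r) * csqrt z) \<or> Re (of_real (sqrt r) * csqrt z) = 0 \<and> 0 \<le> Im (of_real (sqrt r) * csqrt z)"
    using csqrt_principal[of z] assms by auto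
qed

text \<open>The kernel \<open>(4 pi z t)^(-1/2) exp (- x^2 / (4 z t))\<close> of the evolution
  \<open>u_t = z u_xx\<close>, with the branch fixed by taking the principal root of
  \<open>z\<close> alone.\<close>

definition gk :: "complex \<Rightarrow> real \<Rightarrow> real \<Rightarrow> complex" where
  "gk z t x = cgauss (1 / (4 * z * of_real t)) 0 x / (2 * csqrt z * of_real (sqrt (pi * t)))"

text \<open>\<open>gk1\<close> and \<open>gk2\<close> are the closed forms of the first and second
  derivatives of \<open>gk\<close> in space.\<close>

definition gk1 :: "complex \<Rightarrow> real \<Rightarrow> real \<Rightarrow> complex" where
  "gk1 z t x = - (of_real x / (2 * z * of_real t)) * gk z t x"

definition gk2 :: "complex \<Rightarrow> real \<Rightarrow> real \<Rightarrow> complex" where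
  "gk2 z t x = ((of_real x)\<^sup>2 / (4 * z\<^sup>2 * (of_real t)\<^sup>2) - 1 / (2 * z * of_real t)) * gk z t x"

lemma gk_measurable [measurable]: "gk z t \<in> borel_measurable borel" "gk1 z t \<in> borel_measurable borel"
    "gk2 z t \<in> borel_measurable borel"
  unfolding gk_def[abs_def] gk1_def[abs_def] gk2_def[abs_def] by measurable

lemma gk_minus: "gk z t (- x) = gk z t x" "gk1 z t (- x) = - gk1 z t x" "gk2 z t (- x) = gk2 z t x"
  by (simp_all add: gk_def gk1_def gk2_def cgauss_def)

lemma smooth_cgauss: "smooth (cgauss a b)"
proof -
  have "nsmooth k (cgauss a b)" for k
  proof (induction k)
    case 0
    show ?case unfolding nsmooth.simps cgauss_def by (intro continuous_intros)
  next
    case (Suc k)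
    have "nsmooth k (\<lambda>x. b + (- 2 * a) * of_real x)"
      using smooth_affine[of b "- 2 * a"] by (simp only: smooth_def)
    from nsmooth_mult[OF this Suc] have "nsmooth k (\<lambda>x. (- 2 * a * of_real x + b) * cgauss a b x)"
      by (simp only: add.commute)
    then show ?case by (rule nsmoothI[OF cgauss_deriv])
  qed
  then show ?thesis by (simp add: smooth_def)
qed

lemma smooth_gk: "smooth (gk z t)"
  unfolding gk_def[abs_def] divide_inverse
  by (intro smooth_mult smooth_cgauss smooth_const)

lemma gk_deriv:
  assumes "z \<noteq> 0" "t > 0"
  shows "(gk z t has_vector_derivative gk1 z t x) (at x)"
    and "(gk1 z t has_vector_derivative gk2 z t x) (at x)"
proof -
  have 1: "(gk z t has_vector_derivative gk1 z t x) (at x)" for x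
  proof -
  have "(gk z t has_vector_derivative (- 2 * (1 / (4 * z * of_real t)) * of_real x + 0) * cgauss (1 / (4 * z * of_real t)) 0 x
      / (2 * csqrt z * of_real (sqrt (pi * t)))) (at x)"
    unfolding gk_def[abs_def] by (intro has_vector_derivative_divide cgauss_deriv)
  then show ?thesis by (simp add: gk1_def gk_def)
  qed
  then show "(gk z t has_vector_derivative gk1 z t x) (at x)" .
  have "((\<lambda>x. - (of_real x / (2 * z * of_real t))) has_vector_derivative - (1 / (2 * z * of_real t))) (at x)"
    by (intro has_vector_derivative_minus has_vector_derivative_divide has_vector_derivative_of_real[OF DERIV_ident, simplified])
  from has_vector_derivative_mult[OF this 1]
  have "(gk1 z t has_vector_derivative - (of_real x / (2 * z * of_real t)) * gk1 z t x + - (1 / (2 * z * of_real t)) * gk z t x) (at x)"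
    by (simp only: gk1_def[abs_def])
  then show "(gk1 z t has_vector_derivative gk2 z t x) (at x)"
    by (rule has_vector_derivative_eq_rhs)
       (use assms in \<open>simp add: gk1_def gk2_def algebra_simps power2_eq_square\<close>)
qed

lemma vderiv_gk:
  assumes "z \<noteq> 0" "t > 0" shows "vderiv (gk z t) = gk1 z t" "vderiv (gk1 z t) = gk2 z t"
  using gk_deriv[OF assms] by (auto intro: vector_derivative_at)

lemma smooth_gk1: "z \<noteq> 0 \<Longrightarrow> t > 0 \<Longrightarrow> smooth (gk1 z t)"
  using smooth_deriv[OF smooth_gk, of z t] by (simp add: vderiv_gk)

lemma heat_equation_1D:
  assumes "z \<noteq> 0" "t > 0"
  shows "((\<lambda>t. gk z t x) has_vector_derivative z * gk2 z t x) (at t)"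
proof -
  have sq: "sqrt t * sqrt t = t" using assms by simp
  have "((\<lambda>s. of_real (1 / sqrt s)) has_vector_derivative complex_of_real (- (1 / (2 * t)) * (1 / sqrt t))) (at t)"
  proof (rule has_vector_derivative_of_real)
    show "((\<lambda>s. 1 / sqrt s) has_real_derivative - (1 / (2 * t)) * (1 / sqrt t)) (at t)"
      using assms sq by (auto intro!: derivative_eq_intros simp: field_simps)
  qed
  then have 1: "((\<lambda>s. of_real (1 / sqrt s)) has_vector_derivative - (1 / (2 * of_real t)) * complex_of_real (1 / sqrt t)) (at t)"
    by simp
  \<comment> \<open>With this \<open>k\<close>, the dependence on time is isolated in the product
    \<open>exp (- k / t) / sqrt t\<close>.\<close>
  define k where "k = (of_real x)\<^sup>2 / (4 * z)"
  have "((\<lambda>s. exp (- (k / s))) has_field_derivative (k / (of_real t)\<^sup>2) * exp (- (k / of_real t))) (at (of_real t))"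
    using assms by (auto intro!: derivative_eq_intros simp: power2_eq_square)
  from has_vector_derivative_real_field[OF this]
  have 2: "((\<lambda>s. exp (- (k / of_real s))) has_vector_derivative (k / (of_real t)\<^sup>2) * exp (- (k / of_real t))) (at t)" .
  have eq: "gk z s x = (1 / (2 * csqrt z * of_real (sqrt pi))) * (exp (- (k / of_real s)) * of_real (1 / sqrt s))" for s
    by (simp add: gk_def cgauss_def k_def real_sqrt_mult field_simps)
  have "((\<lambda>s. gk z s x) has_vector_derivative (1 / (2 * csqrt z * of_real (sqrt pi))) *
     (exp (- (k / of_real t)) * (- (1 / (2 * of_real t)) * complex_of_real (1 / sqrt t)) + (k / (of_real t)\<^sup>2) * exp (- (k / of_real t)) * of_real (1 / sqrt t))) (at t)"
    unfolding eq by (intro has_vector_derivative_mult_right has_vector_derivative_mult 1 2)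
  also have "(1 / (2 * csqrt z * of_real (sqrt pi))) *
     (exp (- (k / of_real t)) * (- (1 / (2 * of_real t)) * complex_of_real (1 / sqrt t)) + (k / (of_real t)\<^sup>2) * exp (- (k / of_real t)) * of_real (1 / sqrt t))
     = (k / (of_real t)\<^sup>2 - 1 / (2 * of_real t)) * gk z t x"
  proof -
    have "P * (E * (- b * S) + a * E * S) = (a - b) * (P * (E * S))" for P E S a b :: complex
      by (simp add: algebra_simps)
    from this show ?thesis unfolding eq .
  qed
  also have "k / (of_real t)\<^sup>2 - 1 / (2 * of_real t) = z * ((of_real x)\<^sup>2 / (4 * z\<^sup>2 * (of_real t)\<^sup>2) - 1 / (2 * z * of_real t))"
    using assms by (simp add: k_def field_simps power2_eq_square)
  finally show ?thesis by (simp add: gk2_def mult.assoc)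
qed

subsection \<open>Integrable bounded kernels\<close>

text \<open>Integrability is what Schur's test wants. Boundedness adds square integrability, so a
  convolution with an \<open>L\<^sup>2\<close> function is given by a convergent integral at every
  point, not merely almost everywhere.\<close>

definition kern :: "(real \<Rightarrow> complex) \<Rightarrow> bool" where
  "kern h \<longleftrightarrow> h \<in> borel_measurable borel \<and> integrable lborel h \<and> (\<exists>C. \<forall>x. cmod (h x) \<le> C)"

lemma kern_measurable [measurable_dest]: "kern h \<Longrightarrow> h \<in> borel_measurable borel"
  by (simp add: kern_def)

lemma kern_integrable: "kern h \<Longrightarrow> integrable lborel h"
  by (simp add: kern_def)

lemma kern_bounded:
  assumes "kern h" obtains C where "C > 0" "\<And>x. cmod (h x) \<le> C"
proof -
  from assms obtain C where "\<And>x. cmod (h x) \<le> C" by (auto simp: kern_def)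
  then show thesis by (intro that[of "max C 1"]) (auto intro: le_max_iff_disj[THEN iffD2])
qed

text \<open>A common envelope for \<open>gk\<close>, \<open>gk1\<close> and \<open>gk2\<close>,
  uniform over an interval of times; the factor \<open>1 + x^2\<close> takes care of the polynomial
  factors of the derivatives.\<close>

definition env :: "real \<Rightarrow> real \<Rightarrow> real \<Rightarrow> real" where
  "env A c x = A * (1 + x\<^sup>2) * exp (- (c * x\<^sup>2))"

lemma kern_env:
  assumes "c > 0" "A \<ge> 0" shows "kern (\<lambda>x. of_real (env A c x))"
  unfolding kern_def
proof safe
  show "(\<lambda>x. complex_of_real (env A c x)) \<in> borel_measurable borel"
    unfolding env_def by measurable
  have "integrable lborel (\<lambda>x. A * (\<bar>x\<bar> ^ 0 * exp (- (c * x\<^sup>2))) + A * (\<bar>x\<bar> ^ 2 * exp (- (c * x\<^sup>2))))"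
    by (intro Bochner_Integration.integrable_add integrable_mult_right gauss_moment_integrable assms)
  then have "integrable lborel (env A c)"
    by (simp add: env_def[abs_def] algebra_simps)
  then show "integrable lborel (\<lambda>x. complex_of_real (env A c x))"
    by (rule integrable_of_real)
  have "cmod (of_real (env A c x)) \<le> A * (1 + 1 / c)" for x
  proof -
    have "exp (- (c * x\<^sup>2)) \<le> 1" using assms by simp
    moreover have "x\<^sup>2 * exp (- (c * x\<^sup>2)) \<le> 1 / c"
    proof -
      have "c * x\<^sup>2 \<le> exp (c * x\<^sup>2)" using exp_ge_add_one_self[of "c * x\<^sup>2"] by linarith
      then show ?thesis using assms by (simp add: exp_minus field_simps)
    qed
    ultimately have "(1 + x\<^sup>2) * exp (- (c * x\<^sup>2)) \<le> 1 + 1 / c" unfolding distrib_right mult_1 by (rule add_mono)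
    then have "A * ((1 + x\<^sup>2) * exp (- (c * x\<^sup>2))) \<le> A * (1 + 1 / c)" using assms by (intro mult_left_mono)
    then show ?thesis using assms by (simp only: norm_of_real) (simp add: env_def mult.assoc)
  qed
  then show "\<exists>C. \<forall>x. cmod (complex_of_real (env A c x)) \<le> C" by blast
qed

lemma kern_dominated:
  assumes "kern g" "h \<in> borel_measurable borel" "\<And>x. cmod (h x) \<le> cmod (g x)"
  shows "kern h"
  using assms unfolding kern_def
  by (auto intro: Bochner_Integration.integrable_bound[of lborel g h] order_trans)

text \<open>The prefactor is largest at the earliest time \<open>t / 2\<close> and the decay is
  slowest at the latest time \<open>2 t\<close>, which gives \<open>B\<close> and \<open>c\<close>.
  The factors brought in by the two derivatives are at most \<open>(1 + D + D^2) (1 + x^2)\<close>,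
  where \<open>D\<close> bounds \<open>1 / (2 |z| s)\<close>.\<close>

lemma gk_envelope:
  assumes "Re z > 0" "t > 0"
  obtains A c where "A > 0" "c > 0"
    "\<And>s x. t / 2 \<le> s \<Longrightarrow> s \<le> 2 * t \<Longrightarrow> cmod (gk z s x) \<le> env A c x"
    "\<And>s x. t / 2 \<le> s \<Longrightarrow> s \<le> 2 * t \<Longrightarrow> cmod (gk1 z s x) \<le> env A c x"
    "\<And>s x. t / 2 \<le> s \<Longrightarrow> s \<le> 2 * t \<Longrightarrow> cmod (gk2 z s x) \<le> env A c x"
proof -
  define \<kappa> where "\<kappa> = Re (1 / z) / 4"
  have "Re (1 / z) > 0" using assms by (intro Re_one_divide_pos)
  then have \<kappa>: "\<kappa> > 0" by (simp add: \<kappa>_def)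
  have z: "z \<noteq> 0" using assms by auto
  define B where "B = 1 / (2 * sqrt (cmod z) * sqrt (pi * (t / 2)))"
  have B: "B > 0" using z assms by (simp add: B_def)
  define D where "D = 1 / (cmod z * t)"
  have D: "D > 0" using z assms by (simp add: D_def)
  define c where "c = \<kappa> / (2 * t)"
  have c: "c > 0" using \<kappa> assms by (simp add: c_def)
  define A where "A = B * (1 + D + D\<^sup>2)"
  have A: "A > 0" unfolding A_def using B D by (intro mult_pos_pos add_pos_nonneg) auto
  have g: "cmod (gk z s x) \<le> B * exp (- (c * x\<^sup>2))" if s: "t / 2 \<le> s" "s \<le> 2 * t" for s x
  proof -
    have s0: "s > 0" using s assms by simp
    have "1 / (4 * z * of_real s) = of_real (1 / (4 * s)) * (1 / z)" by (simp add: field_simps)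
    then have "Re (1 / (4 * z * of_real s)) = Re (of_real (1 / (4 * s)) * (1 / z))" by (simp only:)
    also have "\<dots> = 1 / (4 * s) * Re (1 / z)" by (simp only: times_complex.sel Re_complex_of_real Im_complex_of_real mult_zero_left diff_zero)
    also have "\<dots> = \<kappa> / s" by (simp add: \<kappa>_def)
    finally have Re: "Re (1 / (4 * z * of_real s)) = \<kappa> / s" .
    have "cmod (cgauss (1 / (4 * z * of_real s)) 0 x) = exp (- (\<kappa> / s * x\<^sup>2))"
    proof -
      have "Re (- w * of_real y + 0 * of_real u) = - (Re w * y)" for w y u by simp
      from this show ?thesis unfolding cgauss_def norm_exp_eq_Re Re[symmetric] by (rule arg_cong)
    qed
    then have "cmod (gk z s x) = exp (- (\<kappa> / s * x\<^sup>2)) / (2 * sqrt (cmod z) * sqrt (pi * s))"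
      using s0 by (simp add: gk_def norm_divide norm_mult)
    also have "\<dots> \<le> exp (- (c * x\<^sup>2)) / (2 * sqrt (cmod z) * sqrt (pi * (t / 2)))"
    proof (rule frac_le)
      have "c \<le> \<kappa> / s" unfolding c_def using \<kappa> s s0 by (intro divide_left_mono) auto
      then have "c * x\<^sup>2 \<le> \<kappa> / s * x\<^sup>2" by (rule mult_right_mono) simp
      then show "exp (- (\<kappa> / s * x\<^sup>2)) \<le> exp (- (c * x\<^sup>2))" by simp
      show "2 * sqrt (cmod z) * sqrt (pi * (t / 2)) \<le> 2 * sqrt (cmod z) * sqrt (pi * s)"
        using s by (intro mult_left_mono real_sqrt_le_mono) auto
    qed (use z assms in auto)
    finally show ?thesis by (simp add: B_def)
  qed
  have dle: "1 / (2 * cmod z * s) \<le> D" if s: "t / 2 \<le> s" for s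
    unfolding D_def using s z assms by (intro divide_left_mono) (auto simp: mult_left_mono)
  have x1: "\<bar>x\<bar> \<le> 1 + x\<^sup>2" for x :: real
    using sum_squares_bound[of "\<bar>x\<bar>" 1] by simp
  have D0: "1 \<le> 1 + D + D\<^sup>2" "D \<le> 1 + D + D\<^sup>2" using D by auto
  show thesis
  proof (rule that[OF A c])
    fix s x assume s: "t / 2 \<le> s" "s \<le> 2 * t"
    have s0: "s > 0" using s assms by simp
    have key: "cmod q * cmod (gk z s x) \<le> env A c x" if "cmod q \<le> (1 + D + D\<^sup>2) * (1 + x\<^sup>2)" for q
    proof -
      have "cmod q * cmod (gk z s x) \<le> ((1 + D + D\<^sup>2) * (1 + x\<^sup>2)) * (B * exp (- (c * x\<^sup>2)))"
        using that g[OF s, of x] B D by (intro mult_mono) auto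
      also have "\<dots> = env A c x" by (simp add: env_def A_def mult_ac)
      finally show ?thesis .
    qed
    have "1 * 1 \<le> (1 + D + D\<^sup>2) * (1 + x\<^sup>2)" using D0 by (intro mult_mono) auto
    then show "cmod (gk z s x) \<le> env A c x" using key[of 1] by simp
    have "\<bar>x\<bar> * (1 / (2 * cmod z * s)) \<le> (1 + x\<^sup>2) * (1 + D + D\<^sup>2)"
      using x1 s0 order_trans[OF dle[OF s(1)] D0(2)] by (intro mult_mono) auto
    then show "cmod (gk1 z s x) \<le> env A c x"
      using key[of "- (of_real x / (2 * z * of_real s))"] s0
      by (simp add: gk1_def norm_mult norm_divide mult.commute)
    have "cmod ((of_real x)\<^sup>2 / (4 * z\<^sup>2 * (of_real s)\<^sup>2) - 1 / (2 * z * of_real s))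
       \<le> x\<^sup>2 * (1 / (2 * cmod z * s))\<^sup>2 + 1 / (2 * cmod z * s)"
      by (rule order_trans[OF norm_triangle_ineq4])
         (use s0 in \<open>simp add: norm_divide norm_mult norm_power power_mult_distrib power_divide\<close>)
    also have "\<dots> \<le> x\<^sup>2 * D\<^sup>2 + D"
      using dle[OF s(1)] s0 by (intro add_mono mult_left_mono power_mono) auto
    also have "\<dots> \<le> (1 + D + D\<^sup>2) * (1 + x\<^sup>2)" using D by (simp add: algebra_simps)
    finally show "cmod (gk2 z s x) \<le> env A c x"
      unfolding gk2_def norm_mult by (rule key)
  qed
qed

lemma kern_gk:
  assumes "Re z > 0" "t > 0" shows "kern (gk z t)" "kern (gk1 z t)" "kern (gk2 z t)"
proof -
  obtain A c where *: "A > 0" "c > 0"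
    "\<And>s x. t / 2 \<le> s \<Longrightarrow> s \<le> 2 * t \<Longrightarrow> cmod (gk z s x) \<le> env A c x"
    "\<And>s x. t / 2 \<le> s \<Longrightarrow> s \<le> 2 * t \<Longrightarrow> cmod (gk1 z s x) \<le> env A c x"
    "\<And>s x. t / 2 \<le> s \<Longrightarrow> s \<le> 2 * t \<Longrightarrow> cmod (gk2 z s x) \<le> env A c x"
    using gk_envelope[OF assms] by metis
  have k: "kern (\<lambda>x. of_real (env A c x))" using * by (intro kern_env) auto
  have t: "t / 2 \<le> t" "t \<le> 2 * t" using assms by auto
  show "kern (gk z t)" "kern (gk1 z t)" "kern (gk2 z t)"
    by (rule kern_dominated[OF k]; use *(3-5)[OF t] gk_measurable in \<open>auto intro: order_trans[OF _ abs_ge_self]\<close>)+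
qed

subsection \<open>Convolution\<close>

text \<open>The complex times \<open>z s\<close> and \<open>z' r\<close> add up. The identity
  \<open>nrm\<close> between the normalising roots is a hypothesis because the branches have to be
  checked case by case: once for two times on the same ray, once for two conjugate times.\<close>

lemma gk_convolution:
  assumes z: "Re z > 0" "Re z' > 0" and t: "s > 0" "r > 0"
    and c: "z * of_real s + z' * of_real r = w * of_real q"
    and nrm: "csqrt (1 / (4 * z * of_real s) + 1 / (4 * z' * of_real r)) *
      (2 * csqrt z * of_real (sqrt (pi * s))) * (2 * csqrt z' * of_real (sqrt (pi * r)))
      = of_real (sqrt pi) * (2 * csqrt w * of_real (sqrt (pi * q)))"
  shows "(\<integral>u. gk z s (x - u) * gk z' r (u - y) \<partial>lborel) = gk w q (x - y)"
proof -
  define \<alpha> \<beta> d where "\<alpha> = 1 / (4 * z * of_real s)" and "\<beta> = 1 / (4 * z' * of_real r)" and "d = x - y"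
  define N N' where "N = 2 * csqrt z * of_real (sqrt (pi * s))" and "N' = 2 * csqrt z' * of_real (sqrt (pi * r))"
  have z0: "z \<noteq> 0" "z' \<noteq> 0" using z by auto
  have "z * of_real s + z' * of_real r \<noteq> 0"
  proof
    assume "z * of_real s + z' * of_real r = 0"
    then have "Re (z * of_real s + z' * of_real r) = 0" by simp
    then have "Re z * s + Re z' * r = 0" by simp
    moreover have "Re z * s > 0" "Re z' * r > 0" using z t by auto
    ultimately show False by linarith
  qed
  have Rea: "Re \<alpha> > 0" "Re \<beta> > 0" unfolding \<alpha>_def \<beta>_def using z t by (auto intro!: Re_one_divide_pos)
  have ab: "\<alpha> + \<beta> \<noteq> 0" using Rea by (metis add_pos_pos less_irrefl plus_complex.sel(1) zero_complex.sel(1))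
  have "(\<integral>u. gk z s (x - u) * gk z' r (u - y) \<partial>lborel) = (\<integral>u. gk z s (x - (y + 1 * u)) * gk z' r ((y + 1 * u) - y) \<partial>lborel)"
    using lborel_integral_real_affine[of 1 "\<lambda>u. gk z s (x - u) * gk z' r (u - y)" y] by simp
  also have "\<dots> = (\<integral>u. exp (- \<alpha> * of_real (d\<^sup>2)) / (N * N') * cgauss (\<alpha> + \<beta>) (2 * \<alpha> * of_real d) u \<partial>lborel)"
  proof (rule Bochner_Integration.integral_cong[OF refl])
    fix u :: real
    have "cgauss \<alpha> 0 (x - (y + 1 * u)) * cgauss \<beta> 0 u = exp (- \<alpha> * of_real (d\<^sup>2)) * cgauss (\<alpha> + \<beta>) (2 * \<alpha> * of_real d) u"
      unfolding cgauss_def mult_exp_exp d_def by (rule arg_cong[of _ _ exp]) (simp add: algebra_simps power2_eq_square)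
    then show "gk z s (x - (y + 1 * u)) * gk z' r ((y + 1 * u) - y) = exp (- \<alpha> * of_real (d\<^sup>2)) / (N * N') * cgauss (\<alpha> + \<beta>) (2 * \<alpha> * of_real d) u"
      by (simp add: gk_def \<alpha>_def[symmetric] \<beta>_def[symmetric] N_def[symmetric] N'_def[symmetric])
  qed
  also have "\<dots> = exp (- \<alpha> * of_real (d\<^sup>2)) / (N * N') * (of_real (sqrt pi) / csqrt (\<alpha> + \<beta>) * exp ((2 * \<alpha> * of_real d)\<^sup>2 / (4 * (\<alpha> + \<beta>))))"
    using Rea by (simp add: cgauss_integral)
  also have "\<dots> = of_real (sqrt pi) / (csqrt (\<alpha> + \<beta>) * N * N') * (exp (- \<alpha> * of_real (d\<^sup>2)) * exp ((2 * \<alpha> * of_real d)\<^sup>2 / (4 * (\<alpha> + \<beta>))))"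
  proof -
    have "E / (a * b) * (P / c * X) = P / (c * a * b) * (E * X)" for E P X a b c :: complex by (simp add: mult_ac)
    from this show ?thesis .
  qed
  \<comment> \<open>Completing the square leaves the rate
    \<open>\<alpha> \<beta> / (\<alpha> + \<beta>)\<close>, whose reciprocal is
    \<open>1 / \<alpha> + 1 / \<beta>\<close>, that is, four times the sum of the complex
    times.\<close>
  also have "exp (- \<alpha> * of_real (d\<^sup>2)) * exp ((2 * \<alpha> * of_real d)\<^sup>2 / (4 * (\<alpha> + \<beta>))) = cgauss (1 / (4 * w * of_real q)) 0 d"
  proof -
    have "1 / (4 * w * of_real q) = 1 / (4 * (z * of_real s + z' * of_real r))" by (simp add: c)
    also have "\<dots> = \<alpha> * \<beta> / (\<alpha> + \<beta>)"
    proof -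
      have *: "1 / (4 * (1 / (4 * a) + 1 / (4 * b))) = a * b / (a + b)"
        if "a \<noteq> 0" "b \<noteq> 0" "a + b \<noteq> 0" for a b :: complex
      proof -
        have "4 * (1 / (4 * a) + 1 / (4 * b)) = (a + b) / (a * b)" using that by (simp add: field_simps)
        then show ?thesis by simp
      qed
      have "z * of_real s = 1 / (4 * \<alpha>)" "z' * of_real r = 1 / (4 * \<beta>)" by (simp_all add: \<alpha>_def \<beta>_def)
      moreover have "\<alpha> \<noteq> 0" "\<beta> \<noteq> 0" using Rea by auto
      ultimately show ?thesis using *[OF _ _ ab] by simp
    qed
    finally have "1 / (4 * w * of_real q) = \<alpha> * \<beta> / (\<alpha> + \<beta>)" .
    moreover have "- \<alpha> * of_real (d\<^sup>2) + (2 * \<alpha> * of_real d)\<^sup>2 / (4 * (\<alpha> + \<beta>)) = - (\<alpha> * \<beta> / (\<alpha> + \<beta>)) * of_real (d\<^sup>2)"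
    proof -
      have "- a * y\<^sup>2 + (2 * a * y)\<^sup>2 / (4 * e) = - (a * b / e) * y\<^sup>2" if "a + b = e" "e \<noteq> 0" for a b e y :: complex
      proof -
        have "(2 * a * y)\<^sup>2 / (4 * e) = a\<^sup>2 / e * y\<^sup>2" by (simp add: power_mult_distrib)
        moreover have "a\<^sup>2 = a * e - a * b" using that(1) by (auto simp: algebra_simps power2_eq_square)
        then have "a\<^sup>2 / e = a - a * b / e" using that(2) by (simp add: diff_divide_distrib)
        ultimately show ?thesis by (simp add: algebra_simps)
      qed
      from this[OF refl ab, of "of_real d"] show ?thesis by simp
    qed
    ultimately show ?thesis by (simp only: mult_exp_exp cgauss_def) simp
  qed
  also have "of_real (sqrt pi) / (csqrt (\<alpha> + \<beta>) * N * N') = 1 / (2 * csqrt w * of_real (sqrt (pi * q)))"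
    unfolding N_def N'_def \<alpha>_def \<beta>_def nrm by simp
  finally show ?thesis by (simp add: gk_def d_def)
qed

lemma gk_semigroup:
  assumes "Re z > 0" "s > 0" "r > 0"
  shows "(\<integral>u. gk z s (x - u) * gk z r (u - y) \<partial>lborel) = gk z (s + r) (x - y)"
proof (rule gk_convolution[OF assms(1,1,2,3)])
  show "z * of_real s + z * of_real r = z * of_real (s + r)" by (simp add: distrib_left)
  have z: "z \<noteq> 0" "csqrt z \<noteq> 0" using assms by auto
  have "1 / (4 * z * of_real s) + 1 / (4 * z * of_real r) = of_real ((s + r) / (4 * s * r)) * (1 / z)"
    using assms z by (simp add: field_simps)
  then have "csqrt (1 / (4 * z * of_real s) + 1 / (4 * z * of_real r)) = csqrt (of_real ((s + r) / (4 * s * r)) * (1 / z))"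
    by (simp only:)
  also have "\<dots> = of_real (sqrt ((s + r) / (4 * s * r))) * csqrt (1 / z)"
    using assms by (intro csqrt_of_real_mult Re_one_divide_pos) auto
  finally have "csqrt (1 / (4 * z * of_real s) + 1 / (4 * z * of_real r)) = of_real (sqrt ((s + r) / (4 * s * r))) * csqrt (1 / z)" .
  moreover have "csqrt (1 / z) = 1 / csqrt z"
    using csqrt_inverse[of z] assms by (simp add: inverse_eq_divide complex_nonpos_Reals_iff)
  moreover have "complex_of_real (sqrt ((s + r) / (4 * s * r))) * of_real (sqrt (pi * s)) * of_real (sqrt (pi * r)) * 2
     = of_real (sqrt pi) * of_real (sqrt (pi * (s + r)))"
  proof -
    have "sqrt ((s + r) / (4 * s * r)) * sqrt (pi * s) * sqrt (pi * r) * 2 = sqrt pi * sqrt (pi * (s + r))"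
      unfolding real_sqrt_mult real_sqrt_divide using assms by (simp add: field_simps)
    then show ?thesis by (metis of_real_mult of_real_numeral)
  qed
  ultimately show "csqrt (1 / (4 * z * of_real s) + 1 / (4 * z * of_real r)) *
      (2 * csqrt z * of_real (sqrt (pi * s))) * (2 * csqrt z * of_real (sqrt (pi * r)))
      = of_real (sqrt pi) * (2 * csqrt z * of_real (sqrt (pi * (s + r))))"
    using z by (simp add: mult_ac)
qed

text \<open>Conjugate complex times add up to a real time. Composing the complex semigroup with its
  adjoint therefore gives the ordinary heat semigroup, whose kernel is positive with integral
  1.\<close>

lemma gk_cnj_convolution:
  assumes "Re z > 0" "s > 0"
  shows "(\<integral>u. gk z s (x - u) * gk (cnj z) s (u - y) \<partial>lborel) = gk (of_real (Re z)) (2 * s) (x - y)"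
proof (rule gk_convolution)
  show "z * of_real s + cnj z * of_real s = of_real (Re z) * of_real (2 * s)"
    by (simp add: complex_eq_iff)
  have z: "z \<noteq> 0" "z \<notin> \<real>\<^sub>\<le>\<^sub>0" using assms by (auto simp: complex_nonpos_Reals_iff)
  define a where "a = Re z"
  define m where "m = cmod z"
  have am: "a > 0" "m > 0" using assms z by (auto simp: a_def m_def)
  have zz: "z * cnj z = of_real (m\<^sup>2)" by (simp only: m_def complex_norm_square)
  have "1 / (4 * z * of_real s) + 1 / (4 * cnj z * of_real s) = (z + cnj z) / (4 * (z * cnj z) * of_real s)"
    using z assms by (simp add: field_simps)
  also have "\<dots> = of_real (a / (2 * m\<^sup>2 * s))"
    unfolding zz complex_add_cnj a_def by (simp add: field_simps)
  finally have 1: "csqrt (1 / (4 * z * of_real s) + 1 / (4 * cnj z * of_real s)) = of_real (sqrt (a / (2 * m\<^sup>2 * s)))"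
    using am assms by (simp add: csqrt_of_real_nonneg)
  have "csqrt z * csqrt (cnj z) = csqrt z * cnj (csqrt z)" using cnj_csqrt[OF z(2)] by simp
  also have "\<dots> = of_real ((cmod (csqrt z))\<^sup>2)" by (simp only: complex_norm_square)
  also have "(cmod (csqrt z))\<^sup>2 = cmod z" by (metis norm_power power2_csqrt)
  finally have 2: "csqrt z * csqrt (cnj z) = of_real m" by (simp add: m_def)
  have 3: "csqrt (of_real a) = of_real (sqrt a)" using am by (simp add: csqrt_of_real_nonneg)
  have "csqrt (1 / (4 * z * of_real s) + 1 / (4 * cnj z * of_real s)) *
      (2 * csqrt z * of_real (sqrt (pi * s))) * (2 * csqrt (cnj z) * of_real (sqrt (pi * s)))
     = of_real (sqrt (a / (2 * m\<^sup>2 * s))) * 4 * (csqrt z * csqrt (cnj z)) * of_real (sqrt (pi * s)) * of_real (sqrt (pi * s))"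
    unfolding 1 by (simp add: mult_ac)
  also have "\<dots> = of_real (sqrt (a / (2 * m\<^sup>2 * s)) * 4 * m * sqrt (pi * s) * sqrt (pi * s))"
    unfolding 2 by simp
  also have "sqrt (a / (2 * m\<^sup>2 * s)) * 4 * m * sqrt (pi * s) * sqrt (pi * s) = sqrt pi * (2 * sqrt a * sqrt (pi * (2 * s)))"
    using am assms by (simp add: real_sqrt_mult real_sqrt_divide field_simps)
  also have "complex_of_real \<dots> = of_real (sqrt pi) * (2 * csqrt (of_real (Re z)) * of_real (sqrt (pi * (2 * s))))"
    using 3 by (simp add: a_def)
  finally show "csqrt (1 / (4 * z * of_real s) + 1 / (4 * cnj z * of_real s)) *
      (2 * csqrt z * of_real (sqrt (pi * s))) * (2 * csqrt (cnj z) * of_real (sqrt (pi * s)))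
     = of_real (sqrt pi) * (2 * csqrt (of_real (Re z)) * of_real (sqrt (pi * (2 * s))))" .
qed (use assms in auto)

lemma cnj_gk: 
  assumes "Re z > 0" shows "cnj (gk z t x) = gk (cnj z) t x"
proof -
  have "z \<notin> \<real>\<^sub>\<le>\<^sub>0" using assms by (auto simp: complex_nonpos_Reals_iff)
  then show ?thesis by (simp add: gk_def cgauss_def exp_cnj cnj_csqrt)
qed

lemma gk_integral:
  assumes "Re z > 0" "t > 0" shows "(\<integral>x. gk z t x \<partial>lborel) = 1"
proof -
  have z: "z \<noteq> 0" "csqrt z \<noteq> 0" using assms by auto
  have Re: "Re (1 / (4 * z * of_real t)) > 0" using assms by (auto intro!: Re_one_divide_pos)
  have "1 / (4 * z * of_real t) = of_real (1 / (4 * t)) * (1 / z)" by (simp add: field_simps)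
  then have "csqrt (1 / (4 * z * of_real t)) = csqrt (of_real (1 / (4 * t)) * (1 / z))"
    by (simp only:)
  also have "\<dots> = of_real (sqrt (1 / (4 * t))) * csqrt (1 / z)"
    using assms by (intro csqrt_of_real_mult Re_one_divide_pos) auto
  also have "csqrt (1 / z) = 1 / csqrt z"
    using csqrt_inverse[of z] assms by (simp add: inverse_eq_divide complex_nonpos_Reals_iff)
  finally have "csqrt (1 / (4 * z * of_real t)) * (2 * csqrt z * of_real (sqrt (pi * t))) = of_real (sqrt (1 / (4 * t)) * 2 * sqrt (pi * t))"
    using z by simp
  also have "sqrt (1 / (4 * t)) * 2 * sqrt (pi * t) = sqrt pi"
    using assms by (simp add: real_sqrt_mult real_sqrt_divide)
  finally have "csqrt (1 / (4 * z * of_real t)) * (2 * csqrt z * of_real (sqrt (pi * t))) = of_real (sqrt pi)" .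
  then show ?thesis using cgauss_integral[OF Re, of 0]
    by (simp add: gk_def[abs_def] mult.commute)
qed

lemma gk_real_nonneg:
  assumes "c > 0" "t > 0"
  shows "cmod (gk (of_real c) t x) = Re (gk (of_real c) t x)"
proof -
  have "gk (of_real c) t x = of_real (exp (- (x\<^sup>2 / (4 * c * t))) / (2 * sqrt c * sqrt (pi * t)))"
    using assms by (simp add: gk_def cgauss_def csqrt_of_real_nonneg exp_of_real[symmetric])
  moreover have "exp (- (x\<^sup>2 / (4 * c * t))) / (2 * sqrt c * sqrt (pi * t)) \<ge> 0" using assms by simp
  ultimately show ?thesis by (simp only: norm_of_real Re_complex_of_real abs_of_nonneg)
qed

lemma gk_real_integral_norm:
  assumes "c > 0" "t > 0"
  shows "(\<integral>x. cmod (gk (of_real c) t x) \<partial>lborel) = 1"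
proof -
  have i: "integrable lborel (gk (of_real c) t)" using assms by (intro kern_integrable kern_gk) auto
  have "(\<integral>x. cmod (gk (of_real c) t x) \<partial>lborel) = (\<integral>x. Re (gk (of_real c) t x) \<partial>lborel)"
    using assms by (simp add: gk_real_nonneg)
  also have "\<dots> = Re (\<integral>x. gk (of_real c) t x \<partial>lborel)"
    using i by (rule integral_Re)
  finally show ?thesis using assms by (simp add: gk_integral)
qed

subsection \<open>Convergence to the identity\<close>

lemma gk_scale:
  assumes "t > 0" shows "of_real (sqrt t) * gk z t (sqrt t * w) = gk z 1 w"
  using assms by (simp add: gk_def cgauss_def real_sqrt_mult power_mult_distrib flip: of_real_power)

text \<open>Substituting \<open>y = x - sqrt t w\<close> moves the time from the kernel, which
  degenerates as \<open>t\<close> tends to 0, into the argument of \<open>f\<close>.\<close>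

lemma gk_conv_bump:
  assumes "Re z > 0" "t > 0"
  shows "(\<integral>y. gk z t (x - y) * f y \<partial>lborel) = (\<integral>w. gk z 1 w * f (x - sqrt t * w) \<partial>lborel)"
proof -
  have "(\<integral>y. gk z t (x - y) * f y \<partial>lborel) = \<bar>- sqrt t\<bar> *\<^sub>R (\<integral>w. gk z t (x - (x + (- sqrt t) * w)) * f (x + (- sqrt t) * w) \<partial>lborel)"
    by (rule lborel_integral_real_affine) (use assms in simp)
  also have "\<dots> = (\<integral>w. of_real (sqrt t) * gk z t (sqrt t * w) * f (x - sqrt t * w) \<partial>lborel)"
    using assms by (simp add: scaleR_conv_of_real mult.assoc)
  finally show ?thesis using assms by (simp add: gk_scale)
qed

text \<open>After rescaling, the kernel is fixed with integral 1 and only the argument of the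
  continuous bounded \<open>f\<close> moves; dominated convergence applies to the inner and then to
  the outer integral.\<close>

lemma gk_weak_tendsto:
  assumes z: "Re z > 0" and f: "f \<in> bumps" and g: "g \<in> bumps"
  shows "((\<lambda>t. \<integral>x. (\<integral>y. gk z t (x - y) * f y \<partial>lborel) * g x \<partial>lborel) \<longlongrightarrow> (\<integral>x. f x * g x \<partial>lborel)) (at_right 0)"
  unfolding tendsto_at_iff_sequentially
proof safe
  fix X :: "nat \<Rightarrow> real" assume X: "\<forall>i. X i \<in> {0<..} - {0}" "X \<longlonglongrightarrow> 0"
  have Xp: "X i > 0" for i using X(1) by auto
  have [measurable]: "f \<in> borel_measurable borel" "g \<in> borel_measurable borel" using f g by measurable
  obtain C where C: "C > 0" "\<And>x. cmod (f x) \<le> C" using bumps_bounded[OF f] by blast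
  have ik: "integrable lborel (gk z 1)" using z by (intro kern_integrable kern_gk) auto
  define I where "I i x = (\<integral>w. gk z 1 w * f (x - sqrt (X i) * w) \<partial>lborel)" for i x
  have bd: "cmod (gk z 1 w * f y) \<le> C * cmod (gk z 1 w)" for w y
    using C(2)[of y] by (simp add: norm_mult mult.commute[of C] mult_left_mono)
  have lim: "(\<lambda>i. I i x) \<longlonglongrightarrow> f x" for x
  proof -
    have "(\<lambda>i. I i x) \<longlonglongrightarrow> (\<integral>w. gk z 1 w * f x \<partial>lborel)"
      unfolding I_def
    proof (rule integral_dominated_convergence[where w = "\<lambda>w. C * cmod (gk z 1 w)"])
      show "integrable lborel (\<lambda>w. C * cmod (gk z 1 w))" using ik by simp
      show "AE w in lborel. (\<lambda>i. gk z 1 w * f (x - sqrt (X i) * w)) \<longlonglongrightarrow> gk z 1 w * f x"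
      proof (rule AE_I2)
        fix w :: real
        have "(\<lambda>i. x - sqrt (X i) * w) \<longlonglongrightarrow> x - sqrt 0 * w" by (intro tendsto_intros X(2))
        then have "(\<lambda>i. f (x - sqrt (X i) * w)) \<longlonglongrightarrow> f x"
          using smooth_continuous[OF bumps_smooth[OF f], of UNIV]
          by (intro isCont_tendsto_compose[of _ f]) (auto simp: continuous_on_eq_continuous_at)
        then show "(\<lambda>i. gk z 1 w * f (x - sqrt (X i) * w)) \<longlonglongrightarrow> gk z 1 w * f x" by (intro tendsto_intros)
      qed
      show "AE w in lborel. norm (gk z 1 w * f (x - sqrt (X i) * w)) \<le> C * cmod (gk z 1 w)" for i
        using bd by simp
    qed measurable
    then show ?thesis using z by (simp add: gk_integral)
  qed
  have "(\<lambda>i. \<integral>x. I i x * g x \<partial>lborel) \<longlonglongrightarrow> (\<integral>x. f x * g x \<partial>lborel)"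
  proof (rule integral_dominated_convergence[where w = "\<lambda>x. (\<integral>w. C * cmod (gk z 1 w) \<partial>lborel) * cmod (g x)"])
    show "integrable lborel (\<lambda>x. (\<integral>w. C * cmod (gk z 1 w) \<partial>lborel) * cmod (g x))"
      using bumps_integrable[OF g] by simp
    show "(\<lambda>x. I i x * g x) \<in> borel_measurable lborel" for i
      unfolding I_def by measurable
    show "AE x in lborel. (\<lambda>i. I i x * g x) \<longlonglongrightarrow> f x * g x" by (intro AE_I2 tendsto_intros lim)
    show "AE x in lborel. norm (I i x * g x) \<le> (\<integral>w. C * cmod (gk z 1 w) \<partial>lborel) * cmod (g x)" for i
    proof (rule AE_I2)
      fix x
      have "cmod (I i x) \<le> (\<integral>w. C * cmod (gk z 1 w) \<partial>lborel)"
        unfolding I_def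
      proof (rule Bochner_Integration.integral_norm_bound_integral)
        show "integrable lborel (\<lambda>w. C * cmod (gk z 1 w))" using ik by simp
        then show "integrable lborel (\<lambda>w. gk z 1 w * f (x - sqrt (X i) * w))"
          by (rule Bochner_Integration.integrable_bound) (use bd C(1) in \<open>auto intro: order_trans[OF bd]\<close>)
      qed (rule bd)
      then show "norm (I i x * g x) \<le> (\<integral>w. C * cmod (gk z 1 w) \<partial>lborel) * cmod (g x)"
        by (simp only: norm_mult mult_right_mono norm_ge_zero)
    qed
  qed measurable
  then show "((\<lambda>t. \<integral>x. (\<integral>y. gk z t (x - y) * f y \<partial>lborel) * g x \<partial>lborel) \<circ> X) \<longlonglongrightarrow> (\<integral>x. f x * g x \<partial>lborel)"
    using z Xp by (simp add: o_def gk_conv_bump I_def)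
qed

section \<open>Tensor products and test functions on \<open>\<real>\<^sup>n\<close>\<close>

interpretation Rn_product: product_sigma_finite "\<lambda>_ :: nat. lborel :: real measure"
  by standard

lemma sigma_finite_Rn: "sigma_finite_measure (Rn n)"
proof -
  interpret finite_product_sigma_finite "\<lambda>_ :: nat. lborel :: real measure" "{..<n}" by standard simp
  show ?thesis by unfold_locales
qed

lemma pair_sigma_finite_Rn: "pair_sigma_finite (Rn n) (Rn n)"
  by (intro pair_sigma_finite.intro sigma_finite_Rn)

lemma space_Rn: "space (Rn n) = ({..<n} \<rightarrow>\<^sub>E UNIV)"
  by (simp add: space_PiM)

lemma space_Rn_update: "x \<in> space (Rn n) \<Longrightarrow> i < n \<Longrightarrow> x(i := t) \<in> space (Rn n)"
  by (auto simp: space_Rn PiE_iff extensional_def)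

definition tens :: "nat \<Rightarrow> (nat \<Rightarrow> real \<Rightarrow> complex) \<Rightarrow> scalar_field" where
  "tens n h x = (\<Prod>i<n. h i (x i))"

lemma tens_measurable:
  "(\<And>i. i < n \<Longrightarrow> h i \<in> borel_measurable borel) \<Longrightarrow> tens n h \<in> borel_measurable (Rn n)"
  unfolding tens_def[abs_def]
  by (intro borel_measurable_prod) (auto intro!: measurable_compose[OF measurable_component_singleton])

lemma tens_integrable:
  "(\<And>i. i < n \<Longrightarrow> integrable lborel (h i)) \<Longrightarrow> integrable (Rn n) (tens n h)"
  unfolding tens_def[abs_def] by (rule Rn_product.product_integrable_prod) auto

lemma tens_integral:
  "(\<And>i. i < n \<Longrightarrow> integrable lborel (h i)) \<Longrightarrow> (\<integral>x. tens n h x \<partial>Rn n) = (\<Prod>i<n. \<integral>s. h i s \<partial>lborel)"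
  unfolding tens_def[abs_def] by (rule Rn_product.product_integral_prod) auto

lemma tens_mult: "tens n h x * tens n k x = tens n (\<lambda>i s. h i s * k i s) x"
  by (simp add: tens_def prod.distrib)

lemma tens_cnj: "cnj (tens n h x) = tens n (\<lambda>i s. cnj (h i s)) x"
  by (simp add: tens_def)

lemma norm_tens: "cmod (tens n h x) = (\<Prod>i<n. cmod (h i (x i)))"
  by (simp add: tens_def prod_norm)

lemma tens_update:
  assumes "i < n"
  shows "tens n h (x(i := t)) = h i t * (\<Prod>j\<in>{..<n} - {i}. h j (x j))"
proof -
  have "tens n h (x(i := t)) = h i t * (\<Prod>j\<in>{..<n} - {i}. h j ((x(i := t)) j))"
    unfolding tens_def using assms by (subst prod.remove[of _ i]) auto
  also have "(\<Prod>j\<in>{..<n} - {i}. h j ((x(i := t)) j)) = (\<Prod>j\<in>{..<n} - {i}. h j (x j))"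
    by (rule prod.cong) auto
  finally show ?thesis .
qed

lemma tens_fun_update:
  assumes "i < n"
  shows "tens n (h(i := g)) x = g (x i) * (\<Prod>j\<in>{..<n} - {i}. h j (x j))"
proof -
  have "tens n (h(i := g)) (x(i := x i)) = g (x i) * (\<Prod>j\<in>{..<n} - {i}. (h(i := g)) j (x j))"
    using tens_update[OF assms, of "h(i := g)" x "x i"] by (simp only: fun_upd_same fun_upd_triv)
  also have "(\<Prod>j\<in>{..<n} - {i}. (h(i := g)) j (x j)) = (\<Prod>j\<in>{..<n} - {i}. h j (x j))"
    by (rule prod.cong) auto
  finally show ?thesis by (simp only: fun_upd_triv)
qed

lemma tens_L2:
  assumes "\<And>i. i < n \<Longrightarrow> h i \<in> borel_measurable borel"
    and "\<And>i. i < n \<Longrightarrow> integrable lborel (\<lambda>s. (cmod (h i s))\<^sup>2)"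
  shows "tens n h \<in> L2 (Rn n)"
proof -
  have "integrable (Rn n) (\<lambda>x. \<Prod>i<n. (cmod (h i (x i)))\<^sup>2)"
    using assms(2) by (intro Rn_product.product_integrable_prod) auto
  then have "integrable (Rn n) (\<lambda>x. (cmod (tens n h x))\<^sup>2)"
    by (simp add: norm_tens prod_power_distrib)
  then show ?thesis using tens_measurable[of n h] assms(1) by (simp add: L2_def)
qed

lemma kern_square_integrable:
  assumes "kern h" shows "integrable lborel (\<lambda>s. (cmod (h s))\<^sup>2)"
proof -
  obtain C where C: "C > 0" "\<And>x. cmod (h x) \<le> C" using kern_bounded[OF assms] by blast
  have [measurable]: "h \<in> borel_measurable borel" using assms by measurable
  show ?thesis
  proof (rule Bochner_Integration.integrable_bound)
    show "integrable lborel (\<lambda>s. C * cmod (h s))"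
      using kern_integrable[OF assms] by simp
    show "AE s in lborel. norm ((cmod (h s))\<^sup>2) \<le> norm (C * cmod (h s))"
      using C by (auto simp: power2_eq_square intro!: mult_right_mono)
  qed measurable
qed

lemma tens_kern_L2: "(\<And>i. i < n \<Longrightarrow> kern (h i)) \<Longrightarrow> tens n h \<in> L2 (Rn n)"
  by (intro tens_L2 kern_square_integrable) (auto dest: kern_measurable)

lemma bumps_kern:
  assumes "f \<in> bumps" shows "kern f"
proof -
  obtain C where "\<And>x. cmod (f x) \<le> C" using bumps_bounded[OF assms] by metis
  then show ?thesis
    unfolding kern_def using bumps_measurable[OF assms] bumps_integrable[OF assms] by auto
qed

subsection \<open>Functions of class \<open>C\<^sup>k\<close>\<close>

lemma partial_cong:
  assumes "\<And>x. x \<in> space (Rn n) \<Longrightarrow> f x = g x" "i < n" "x \<in> space (Rn n)"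
  shows "partial i f x = partial i g x"
  unfolding partial_def using assms space_Rn_update by (intro arg_cong2[of _ _ _ _ vector_derivative]) auto

lemma Ck_fun_cong:
  "(\<And>x. x \<in> space (Rn n) \<Longrightarrow> f x = g x) \<Longrightarrow> Ck_fun n k f = Ck_fun n k g"
proof (induction k arbitrary: f g)
  case 0
  then show ?case by (simp cong: continuous_on_cong)
next
  case (Suc k)
  have "Ck_fun n k (partial i f) = Ck_fun n k (partial i g)" if "i < n" for i
    by (rule Suc.IH) (rule partial_cong[OF Suc.prems that])
  moreover have "(\<lambda>t. f (x(i := t))) = (\<lambda>t. g (x(i := t)))" if "x \<in> space (Rn n)" "i < n" for x i
    using Suc.prems space_Rn_update[OF that] by auto
  moreover have "continuous_on (space (Rn n)) f = continuous_on (space (Rn n)) g"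
    using Suc.prems by (intro continuous_on_cong) auto
  ultimately show ?case by auto
qed

lemma Ck_fun_continuous: "Ck_fun n k f \<Longrightarrow> continuous_on (space (Rn n)) f"
  by (cases k) auto

lemma Ck_fun_SucD: "Ck_fun n (Suc k) f \<Longrightarrow> Ck_fun n k f"
  by (induction k arbitrary: f) auto

lemma Ck_fun_deriv:
  assumes "Ck_fun n (Suc k) f" "i < n" "x \<in> space (Rn n)"
  shows "((\<lambda>t. f (x(i := t))) has_vector_derivative partial i f x) (at (x i))"
  using assms by (auto simp: partial_def vector_derivative_works)

lemma Ck_funI:
  assumes "continuous_on (space (Rn n)) f"
    and "\<And>i x. i < n \<Longrightarrow> x \<in> space (Rn n) \<Longrightarrow> ((\<lambda>t. f (x(i := t))) has_vector_derivative f' i x) (at (x i))"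
    and "\<And>i. i < n \<Longrightarrow> Ck_fun n k (f' i)"
  shows "Ck_fun n (Suc k) f"
proof -
  have "partial i f x = f' i x" if "i < n" "x \<in> space (Rn n)" for i x
    unfolding partial_def using assms(2)[OF that] by (rule vector_derivative_at)
  then have "Ck_fun n k (partial i f) = Ck_fun n k (f' i)" if "i < n" for i
    using that by (intro Ck_fun_cong) auto
  then show ?thesis using assms by (auto intro: differentiableI_vector)
qed

lemma Ck_fun_add: "Ck_fun n k f \<Longrightarrow> Ck_fun n k g \<Longrightarrow> Ck_fun n k (\<lambda>x. f x + g x)"
proof (induction k arbitrary: f g)
  case (Suc k)
  show ?case
  proof (rule Ck_funI)
    show "((\<lambda>t. f (x(i := t)) + g (x(i := t))) has_vector_derivative partial i f x + partial i g x) (at (x i))"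
      if "i < n" "x \<in> space (Rn n)" for i x
      using Ck_fun_deriv[OF Suc.prems(1) that] Ck_fun_deriv[OF Suc.prems(2) that] by (rule has_vector_derivative_add)
  qed (use Suc in \<open>auto intro!: continuous_intros\<close>)
qed (auto intro: continuous_intros)

lemma partial_mult:
  assumes "Ck_fun n (Suc k) f" "Ck_fun n (Suc k) g" "i < n" "x \<in> space (Rn n)"
  shows "((\<lambda>t. f (x(i := t)) * g (x(i := t))) has_vector_derivative f x * partial i g x + partial i f x * g x) (at (x i))"
  using has_vector_derivative_mult[OF Ck_fun_deriv[OF assms(1,3,4)] Ck_fun_deriv[OF assms(2,3,4)]] by simp

lemma Ck_fun_mult: "Ck_fun n k f \<Longrightarrow> Ck_fun n k g \<Longrightarrow> Ck_fun n k (\<lambda>x. f x * g x)"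
proof (induction k arbitrary: f g)
  case (Suc k)
  show ?case
  proof (rule Ck_funI)
    show "continuous_on (space (Rn n)) (\<lambda>x. f x * g x)" using Suc.prems by (auto intro!: continuous_intros)
    show "Ck_fun n k (\<lambda>x. f x * partial i g x + partial i f x * g x)" if "i < n" for i
      using Suc.prems Suc.prems[THEN Ck_fun_SucD] that by (intro Ck_fun_add Suc.IH) auto
  qed (rule partial_mult[OF Suc.prems])
qed (auto intro: continuous_intros)

lemma Ck_fun_cnj: "Ck_fun n k f \<Longrightarrow> Ck_fun n k (\<lambda>x. cnj (f x))"
proof (induction k arbitrary: f)
  case (Suc k)
  show ?case
  proof (rule Ck_funI)
    show "((\<lambda>t. cnj (f (x(i := t)))) has_vector_derivative cnj (partial i f x)) (at (x i))"
      if "i < n" "x \<in> space (Rn n)" for i x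
      by (rule has_vector_derivative_cnj[OF Ck_fun_deriv[OF Suc.prems that]])
  qed (use Suc in \<open>auto intro!: continuous_intros\<close>)
qed (auto intro: continuous_intros)

lemma tens_continuous:
  assumes "\<And>i. i < n \<Longrightarrow> continuous_on UNIV (h i)"
  shows "continuous_on A (tens n h)"
  unfolding tens_def[abs_def]
proof (intro continuous_on_prod)
  fix i assume i: "i \<in> {..<n}"
  have "continuous_on UNIV (\<lambda>x. h i (x i))"
    using assms i by (intro continuous_on_compose2[of UNIV "h i" _ "\<lambda>x. x i"]) auto
  then show "continuous_on A (\<lambda>x. h i (x i))" by (rule continuous_on_subset) simp
qed

lemma tens_deriv:
  assumes "i < n" "(h i has_vector_derivative d (x i)) (at (x i))"
  shows "((\<lambda>t. tens n h (x(i := t))) has_vector_derivative tens n (h(i := d)) x) (at (x i))"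
  unfolding tens_update[OF assms(1)] tens_fun_update[OF assms(1)]
  by (rule has_vector_derivative_mult_left[OF assms(2)])

lemma tens_partial:
  assumes "i < n" "\<And>s. (h i has_vector_derivative d s) (at s)"
  shows "partial i (tens n h) = tens n (h(i := d))"
  unfolding partial_def using tens_deriv[where h = h and d = d, OF assms] by (auto intro: vector_derivative_at)

lemma tens_Ck_fun: "(\<And>i. i < n \<Longrightarrow> smooth (h i)) \<Longrightarrow> Ck_fun n k (tens n h)"
proof (induction k arbitrary: h)
  case 0
  then show ?case by (auto intro!: tens_continuous smooth_continuous)
next
  case (Suc k)
  show ?case
  proof (rule Ck_funI)
    show "Ck_fun n k (tens n (h(i := vderiv (h i))))" if "i < n" for i
      using Suc.prems that by (intro Suc.IH) (auto intro: smooth_deriv)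
    show "((\<lambda>t. tens n h (x(i := t))) has_vector_derivative tens n (h(i := vderiv (h i))) x) (at (x i))"
      if "i < n" for i x
      by (rule tens_deriv[OF that]) (rule smooth_has_deriv[OF Suc.prems[OF that]])
  qed (use Suc.prems in \<open>auto intro!: tens_continuous smooth_continuous\<close>)
qed

subsection \<open>Test functions\<close>

text \<open>The closure in \<open>test_functions\<close> is taken in the space of all functions on
  the naturals; closedness keeps supports among the points of \<open>Rn n\<close>.\<close>

lemma closed_space_Rn: "closed (space (Rn n))"
proof -
  have "x \<in> space (Rn n) \<longleftrightarrow> (\<forall>i\<ge>n. x i = undefined)" for x
    by (auto simp: space_Rn PiE_iff extensional_def not_less)
  then have "space (Rn n) = (\<Inter>i\<in>{n..}. {x. x i = undefined})" by blast
  moreover have "closed {x :: nat \<Rightarrow> real. x i = undefined}" for i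
    by (rule closed_Collect_eq[OF continuous_on_product_coordinates continuous_on_const])
  ultimately show ?thesis by (simp only:) (rule closed_INT, blast)
qed

text \<open>Tychonoff's theorem; the coordinates beyond \<open>n\<close> contribute the single point
  \<open>undefined\<close>.\<close>

lemma compact_box:
  "compact (Pi\<^sub>E UNIV (\<lambda>i. if i < n then {-R..R} else {undefined}) :: (nat \<Rightarrow> real) set)"
proof -
  have "compactin (product_topology (\<lambda>i. euclidean) UNIV) (Pi\<^sub>E UNIV (\<lambda>i. if i < n then {-R..R} else {undefined :: real}) :: (nat \<Rightarrow> real) set)"
    by (subst compactin_PiE) auto
  then show ?thesis by (simp add: euclidean_product_topology)
qed

lemma test_functionsI:
  assumes "\<And>k. Ck_fun n k f" "\<And>x. x \<in> space (Rn n) \<Longrightarrow> f x \<noteq> 0 \<Longrightarrow> \<forall>i<n. \<bar>x i\<bar> \<le> R"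
  shows "f \<in> test_functions n"
proof -
  define K where "K = (Pi\<^sub>E UNIV (\<lambda>i. if i < n then {-R..R} else {undefined}) :: (nat \<Rightarrow> real) set)"
  have K: "compact K" unfolding K_def by (rule compact_box)
  have "{x \<in> space (Rn n). f x \<noteq> 0} \<subseteq> K"
    using assms(2) by (fastforce simp: K_def space_Rn PiE_iff extensional_def abs_le_iff)
  then have "closure {x \<in> space (Rn n). f x \<noteq> 0} \<subseteq> K"
    by (rule closure_minimal[OF _ compact_imp_closed[OF K]])
  then have "compact (closure {x \<in> space (Rn n). f x \<noteq> 0})"
    using compact_Int_closed[OF K closed_closure] by (metis Int_absorb1)
  then show ?thesis using assms(1) by (simp add: test_functions_def)
qed

lemma test_functions_Ck: "f \<in> test_functions n \<Longrightarrow> Ck_fun n k f"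
  by (simp add: test_functions_def)

lemma test_functions_support:
  assumes "f \<in> test_functions n"
  obtains R where "R > 0" "\<And>x. x \<in> space (Rn n) \<Longrightarrow> f x \<noteq> 0 \<Longrightarrow> \<forall>i<n. \<bar>x i\<bar> \<le> R"
proof -
  let ?K = "closure {x \<in> space (Rn n). f x \<noteq> 0}"
  have K: "compact ?K" using assms by (simp add: test_functions_def)
  have "\<exists>r. \<forall>x\<in>?K. \<bar>x i\<bar> \<le> r" for i
  proof -
    have "compact ((\<lambda>x. x i) ` ?K)"
      by (intro compact_continuous_image K continuous_on_subset[OF continuous_on_product_coordinates]) simp
    then have "bounded ((\<lambda>x. x i) ` ?K)" by (rule compact_imp_bounded)
    then show ?thesis by (auto simp: bounded_iff)
  qed
  then obtain r where r: "\<And>i x. x \<in> ?K \<Longrightarrow> \<bar>x i\<bar> \<le> r i" by metis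
  have rM: "r i \<le> max 1 (Max (r ` {..<n}))" if "i < n" for i
    using that by (intro max.coboundedI2 Max_ge) auto
  then have "\<bar>x i\<bar> \<le> max 1 (Max (r ` {..<n}))" if "x \<in> space (Rn n)" "f x \<noteq> 0" "i < n" for x i
  proof -
    have "x \<in> ?K" by (rule subsetD[OF closure_subset]) (use that in simp)
    from order_trans[OF r[OF this] rM[OF that(3)]] show ?thesis .
  qed
  then show thesis by (intro that[of "max 1 (Max (r ` {..<n}))"]) auto
qed

lemma test_functions_bounded:
  assumes "f \<in> test_functions n"
  obtains C where "C > 0" "\<And>x. x \<in> space (Rn n) \<Longrightarrow> cmod (f x) \<le> C"
proof -
  let ?K = "closure {x \<in> space (Rn n). f x \<noteq> 0}"
  have K: "compact ?K" using assms by (simp add: test_functions_def)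
  have "?K \<subseteq> space (Rn n)" by (rule closure_minimal[OF _ closed_space_Rn]) auto
  then have "continuous_on ?K f"
    using Ck_fun_continuous[OF test_functions_Ck[OF assms, of 0]] continuous_on_subset by blast
  then have "bounded (f ` ?K)" by (intro compact_imp_bounded compact_continuous_image K)
  then obtain C where C: "C > 0" "\<And>x. x \<in> ?K \<Longrightarrow> cmod (f x) \<le> C" by (auto simp: bounded_pos)
  have "cmod (f x) \<le> C" if "x \<in> space (Rn n)" for x
  proof (cases "f x = 0")
    case False
    then have "x \<in> ?K" by (intro subsetD[OF closure_subset]) (use that in simp)
    then show ?thesis by (rule C(2))
  qed (use C in simp)
  then show thesis using C(1) that by blast
qed

text \<open>Continuity is known on the subspace only. Composing with the retraction
  \<open>r\<close>, which resets the coordinates beyond \<open>n\<close>, gives a continuous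
  function on the whole countable product, where the Borel and the product sigma-algebras
  agree.\<close>

lemma continuous_measurable_Rn:
  fixes f :: scalar_field
  assumes "continuous_on (space (Rn n)) f"
  shows "f \<in> borel_measurable (Rn n)"
proof -
  define r where "r x i = (if i < n then x i else undefined)" for x :: "nat \<Rightarrow> real" and i
  have "continuous_on UNIV r"
  proof (rule continuous_on_coordinatewise_then_product)
    show "continuous_on UNIV (\<lambda>x. r x i)" for i
      by (cases "i < n") (auto simp: r_def intro: continuous_intros)
  qed
  moreover have r: "r x \<in> space (Rn n)" for x by (auto simp: r_def space_Rn PiE_iff extensional_def)
  ultimately have "continuous_on UNIV (\<lambda>x. f (r x))"
    using assms by (intro continuous_on_compose2[of "space (Rn n)" f UNIV r]) auto
  then have "(\<lambda>x. f (r x)) \<in> borel_measurable borel" by (rule borel_measurable_continuous_onI)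
  then have m1: "(\<lambda>x. f (r x)) \<in> borel_measurable (Pi\<^sub>M UNIV (\<lambda>_. borel))"
    by (simp add: measurable_cong_sets[OF sets_PiM_equal_borel refl])
  have m2: "(\<lambda>x. x) \<in> measurable (Rn n) (Pi\<^sub>M UNIV (\<lambda>_. borel))"
  proof (rule measurable_PiM_single')
    fix i :: nat
    show "(\<lambda>x. x i) \<in> borel_measurable (Rn n)"
    proof (cases "i < n")
      case True
      then have "(\<lambda>x. x i) \<in> measurable (Rn n) lborel" by (intro measurable_component_singleton) auto
      then show ?thesis by simp
    next
      case False
      then have "(\<lambda>x. x i) \<in> borel_measurable (Rn n) \<longleftrightarrow> (\<lambda>x. undefined :: real) \<in> borel_measurable (Rn n)"
        by (intro measurable_cong) (auto simp: space_Rn PiE_iff extensional_def)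
      then show ?thesis by simp
    qed
  qed auto
  have "(\<lambda>x. f (r x)) \<in> borel_measurable (Rn n)" using measurable_compose[OF m2 m1] .
  moreover have "f (r x) = f x" if "x \<in> space (Rn n)" for x
  proof -
    have "r x = x" using that by (auto simp: r_def space_Rn PiE_iff extensional_def)
    then show ?thesis by simp
  qed
  ultimately show ?thesis by (metis (no_types, lifting) measurable_cong)
qed

lemma test_functions_measurable [measurable_dest]:
  "f \<in> test_functions n \<Longrightarrow> f \<in> borel_measurable (Rn n)"
  by (intro continuous_measurable_Rn Ck_fun_continuous[of n 0] test_functions_Ck)

lemma test_functions_kern_bound:
  assumes "f \<in> test_functions n"
  obtains C R where "C > 0" "R > 0"
    "\<And>x. x \<in> space (Rn n) \<Longrightarrow> cmod (f x) \<le> C * cmod (tens n (\<lambda>_. indicator {-R..R}) x)"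
proof -
  obtain C where C: "C > 0" "\<And>x. x \<in> space (Rn n) \<Longrightarrow> cmod (f x) \<le> C"
    using test_functions_bounded[OF assms] by blast
  obtain R where R: "R > 0" "\<And>x. x \<in> space (Rn n) \<Longrightarrow> f x \<noteq> 0 \<Longrightarrow> \<forall>i<n. \<bar>x i\<bar> \<le> R"
    using test_functions_support[OF assms] by blast
  have "cmod (f x) \<le> C * cmod (tens n (\<lambda>_. indicator {-R..R}) x)" if x: "x \<in> space (Rn n)" for x
  proof (cases "f x = 0")
    case False
    then have "tens n (\<lambda>_. indicator {-R..R}) x = 1"
      unfolding tens_def using R(2)[OF x] by (intro prod.neutral) (auto simp: abs_le_iff)
    then show ?thesis using C(2)[OF x] by simp
  qed (use C in simp)
  then show thesis using C R that by blast
qed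

lemma kern_indicator: "kern (indicator {-R..R :: real})"
proof -
  have "integrable lborel (\<lambda>x. complex_of_real (indicator {-R..R} x))"
    by (intro integrable_of_real integrable_real_indicator) (auto simp: emeasure_lborel_Icc_eq)
  moreover have "(\<lambda>x. complex_of_real (indicator {-R..R} x)) = indicator {-R..R}"
    by (auto simp: indicator_def)
  ultimately have "integrable lborel (indicator {-R..R} :: real \<Rightarrow> complex)" by simp
  then show ?thesis
    unfolding kern_def by (auto intro!: exI[of _ 1] simp: indicator_def)
qed

lemma test_functions_L2:
  assumes "f \<in> test_functions n" shows "f \<in> L2 (Rn n)"
proof -
  obtain C R where "\<And>x. x \<in> space (Rn n) \<Longrightarrow> cmod (f x) \<le> C * cmod (tens n (\<lambda>_. indicator {-R..R}) x)"
    using test_functions_kern_bound[OF assms] by metis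
  then show ?thesis
    using assms by (intro L2I_bound[OF _ tens_kern_L2[of n "\<lambda>_. indicator {-R..R}", OF kern_indicator], of _ C]) auto
qed

lemma test_functions_integrable:
  assumes "f \<in> test_functions n" shows "integrable (Rn n) f"
proof -
  obtain C R where *: "\<And>x. x \<in> space (Rn n) \<Longrightarrow> cmod (f x) \<le> C * cmod (tens n (\<lambda>_. indicator {-R..R}) x)" "C > 0"
    using test_functions_kern_bound[OF assms] by metis
  have "integrable (Rn n) (tens n (\<lambda>_. indicator {-R..R}))"
    by (intro tens_integrable kern_integrable kern_indicator)
  then have "integrable (Rn n) (\<lambda>x. C * cmod (tens n (\<lambda>_. indicator {-R..R}) x))" by simp
  then show ?thesis
    by (rule Bochner_Integration.integrable_bound) (use * assms in \<open>auto intro: order_trans[OF _ abs_ge_self]\<close>)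
qed

lemma test_functions_partial:
  assumes "f \<in> test_functions n" "i < n" shows "partial i f \<in> test_functions n"
proof -
  obtain R where R: "R > 0" "\<And>x. x \<in> space (Rn n) \<Longrightarrow> f x \<noteq> 0 \<Longrightarrow> \<forall>i<n. \<bar>x i\<bar> \<le> R"
    using test_functions_support[OF assms(1)] by blast
  show ?thesis
  proof (rule test_functionsI)
    show "Ck_fun n k (partial i f)" for k
      using test_functions_Ck[OF assms(1), of "Suc k"] assms(2) by simp
    fix x assume x: "x \<in> space (Rn n)" "partial i f x \<noteq> 0"
    show "\<forall>j<n. \<bar>x j\<bar> \<le> R"
    proof (rule ccontr)
      assume "\<not> ?thesis"
      then obtain j where j: "j < n" "\<bar>x j\<bar> > R" by auto
      \<comment> \<open>Near a point outside the box the function vanishes along the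
        \<open>i\<close>-th line, whether the coordinate that leaves the box is \<open>i\<close>
        itself or another one.\<close>
      have "eventually (\<lambda>t. f (x(i := t)) = 0) (nhds (x i))"
      proof -
        have "eventually (\<lambda>t. \<bar>(x(i := t)) j\<bar> > R) (nhds (x i))"
        proof (cases "i = j")
          case True
          have "open {t. \<bar>t\<bar> > R}" by (intro open_Collect_less continuous_intros)
          then show ?thesis using j True by (auto simp: eventually_nhds intro!: exI[of _ "{t. \<bar>t\<bar> > R}"])
        qed (use j in auto)
        then show ?thesis
          by eventually_elim (use R(2) space_Rn_update[OF x(1) assms(2)] j(1) in force)
      qed
      then obtain S where S: "open S" "x i \<in> S" "\<And>t. t \<in> S \<Longrightarrow> f (x(i := t)) = 0"
        by (auto simp: eventually_nhds)
      have "((\<lambda>t. 0) has_vector_derivative 0) (at (x i))" by simp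
      then have "((\<lambda>t. f (x(i := t))) has_vector_derivative 0) (at (x i))"
        by (rule has_vector_derivative_transform_within_open[OF _ S(1,2)]) (simp add: S(3))
      then have "partial i f x = 0" unfolding partial_def by (rule vector_derivative_at)
      with x(2) show False by simp
    qed
  qed
qed

lemma test_functions_mult:
  assumes "f \<in> test_functions n" "\<And>k. Ck_fun n k g" shows "(\<lambda>x. f x * g x) \<in> test_functions n"
proof -
  obtain R where R: "R > 0" "\<And>x. x \<in> space (Rn n) \<Longrightarrow> f x \<noteq> 0 \<Longrightarrow> \<forall>i<n. \<bar>x i\<bar> \<le> R"
    using test_functions_support[OF assms(1)] by blast
  show ?thesis
    by (rule test_functionsI[of _ _ R]) (use assms R in \<open>auto intro: Ck_fun_mult test_functions_Ck\<close>)
qed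

lemma test_functions_cnj:
  assumes "f \<in> test_functions n" shows "(\<lambda>x. cnj (f x)) \<in> test_functions n"
proof -
  obtain R where R: "R > 0" "\<And>x. x \<in> space (Rn n) \<Longrightarrow> f x \<noteq> 0 \<Longrightarrow> \<forall>i<n. \<bar>x i\<bar> \<le> R"
    using test_functions_support[OF assms(1)] by blast
  show ?thesis
    by (rule test_functionsI[of _ _ R]) (use assms R in \<open>auto intro: Ck_fun_cnj test_functions_Ck\<close>)
qed

lemma partial_cnj:
  assumes "f \<in> test_functions n" "i < n" "x \<in> space (Rn n)"
  shows "partial i (\<lambda>x. cnj (f x)) x = cnj (partial i f x)"
  using has_vector_derivative_cnj[OF Ck_fun_deriv[OF test_functions_Ck[OF assms(1), of "Suc 0"] assms(2,3)]]
  unfolding partial_def[of _ "\<lambda>x. cnj (f x)"] by (rule vector_derivative_at)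

lemma tens_bumps_test:
  assumes "\<And>i. i < n \<Longrightarrow> h i \<in> bumps" shows "tens n h \<in> test_functions n"
proof -
  have "\<exists>r. \<forall>i<n. \<forall>x. \<bar>x\<bar> > r i \<longrightarrow> h i x = 0"
    using assms unfolding bumps_def by (intro choice) auto
  then obtain r where r: "\<And>i x. i < n \<Longrightarrow> \<bar>x\<bar> > r i \<Longrightarrow> h i x = 0" by auto
  show ?thesis
  proof (rule test_functionsI[of _ _ "Max (r ` {..<n})"])
    fix x assume x: "x \<in> space (Rn n)" "tens n h x \<noteq> 0"
    show "\<forall>i<n. \<bar>x i\<bar> \<le> Max (r ` {..<n})"
    proof safe
      fix i assume i: "i < n"
      then have "h i (x i) \<noteq> 0" using x(2) by (auto simp: tens_def)
      then have "\<bar>x i\<bar> \<le> r i" using r[OF i] not_less by blast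
      also have "\<dots> \<le> Max (r ` {..<n})" using i by (intro Max_ge) auto
      finally show "\<bar>x i\<bar> \<le> Max (r ` {..<n})" .
    qed
  qed (use assms in \<open>auto intro: tens_Ck_fun bumps_smooth\<close>)
qed

subsection \<open>Integration by parts\<close>

text \<open>Integrate in the \<open>i\<close>-th variable first, where the fundamental theorem of
  calculus gives 0. The case distinctions on integrability rely on the convention that a
  non-integrable function has integral 0.\<close>

lemma integral_partial_eq_0:
  assumes f: "f \<in> test_functions n" and i: "i < n"
  shows "(\<integral>x. partial i f x \<partial>Rn n) = 0"
proof (cases "integrable (Rn n) (partial i f)")
  case True
  let ?I = "{..<n} - {i}"
  have I: "{..<n} = insert i ?I" using i by auto
  obtain R where R: "R > 0" "\<And>x. x \<in> space (Rn n) \<Longrightarrow> f x \<noteq> 0 \<Longrightarrow> \<forall>i<n. \<bar>x i\<bar> \<le> R"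
    using test_functions_support[OF f] by blast
  have "(\<integral>x. partial i f x \<partial>Rn n) = (\<integral>x. (\<integral>y. partial i f (x(i := y)) \<partial>lborel) \<partial>Pi\<^sub>M ?I (\<lambda>_. lborel))"
    using Rn_product.product_integral_insert[of ?I i "partial i f"] True I by simp
  also have "\<dots> = (\<integral>x. 0 \<partial>Pi\<^sub>M ?I (\<lambda>_. lborel :: real measure))"
  proof (rule Bochner_Integration.integral_cong[OF refl])
    fix x assume "x \<in> space (Pi\<^sub>M ?I (\<lambda>_. lborel :: real measure))"
    then have x: "x(i := y) \<in> space (Rn n)" for y
      using i by (auto simp: space_PiM PiE_iff extensional_def)
    show "(\<integral>y. partial i f (x(i := y)) \<partial>lborel) = 0"
    proof (cases "integrable lborel (\<lambda>y. partial i f (x(i := y)))")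
      case True
      show ?thesis
      proof (rule integral_deriv_eq_0[where F = "\<lambda>y. f (x(i := y))", OF _ _ True])
        show "((\<lambda>y. f (x(i := y))) has_vector_derivative partial i f (x(i := y))) (at y)" for y
          using Ck_fun_deriv[OF test_functions_Ck[OF f, of "Suc 0"] i x[of y]] by simp
        have "continuous_on UNIV (\<lambda>y. x(i := y))"
        proof (rule continuous_on_coordinatewise_then_product)
          show "continuous_on UNIV (\<lambda>y. (x(i := y)) j)" for j
            by (cases "j = i") (simp_all add: continuous_on_id continuous_on_const)
        qed
        from continuous_on_compose2[OF Ck_fun_continuous[OF test_functions_Ck[OF test_functions_partial[OF f i], of 0]] this image_subsetI[OF x]]
        show "continuous_on UNIV (\<lambda>y. partial i f (x(i := y)))" .
        have 0: "f (x(i := y)) = 0" if "\<bar>y\<bar> > R" for y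
        proof (rule ccontr)
          assume "f (x(i := y)) \<noteq> 0"
          from R(2)[OF x this, rule_format, OF i] that show False by simp
        qed
        show "((\<lambda>y. f (x(i := y))) \<longlongrightarrow> 0) at_top"
          by (rule tendsto_eventually, rule eventually_mono[OF eventually_gt_at_top[of R]]) (use 0 in auto)
        show "((\<lambda>y. f (x(i := y))) \<longlongrightarrow> 0) at_bot"
          by (rule tendsto_eventually, unfold eventually_at_bot_dense, rule exI[of _ "- R"]) (use 0 in auto)
      qed
    qed (rule not_integrable_integral_eq)
  qed
  finally show ?thesis by simp
qed (rule not_integrable_integral_eq)

lemma integral_by_parts:
  assumes f: "f \<in> test_functions n" and g: "\<And>k. Ck_fun n k g" and i: "i < n"
  shows "(\<integral>x. f x * partial i g x \<partial>Rn n) = - (\<integral>x. partial i f x * g x \<partial>Rn n)"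
proof -
  have f': "partial i f \<in> test_functions n" by (rule test_functions_partial[OF f i])
  have g': "Ck_fun n k (partial i g)" for k using g[of "Suc k"] i by simp
  have 1: "integrable (Rn n) (\<lambda>x. f x * partial i g x)" and 2: "integrable (Rn n) (\<lambda>x. partial i f x * g x)"
    by (intro test_functions_integrable test_functions_mult f g' f' g)+
  have "(\<integral>x. partial i (\<lambda>x. f x * g x) x \<partial>Rn n) = (\<integral>x. f x * partial i g x + partial i f x * g x \<partial>Rn n)"
  proof (rule Bochner_Integration.integral_cong[OF refl])
    fix x assume "x \<in> space (Rn n)"
    from partial_mult[OF test_functions_Ck[OF f, of "Suc 0"] g i this]
    show "partial i (\<lambda>x. f x * g x) x = f x * partial i g x + partial i f x * g x"
      unfolding partial_def[of _ "\<lambda>x. f x * g x"] by (rule vector_derivative_at)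
  qed
  then have "(\<integral>x. f x * partial i g x + partial i f x * g x \<partial>Rn n) = 0"
    using integral_partial_eq_0[OF test_functions_mult[OF f g] i] by simp
  then show ?thesis using 1 2 by (simp add: eq_neg_iff_add_eq_0)
qed

lemma weak_gradient_carrier: "is_weak_gradient n u G \<Longrightarrow> x \<in> space (Rn n) \<Longrightarrow> G x \<in> carrier_vec n"
  by (simp add: is_weak_gradient_def)

section \<open>Density of tensor products of bump functions\<close>

lemma borel_generated_open_intervals: "sets (lborel :: real measure) = sets (sigma UNIV (range (\<lambda>(a, b). {a<..<b :: real})))"
  by (simp add: borel_eq_box box_real)

definition open_boxes :: "nat \<Rightarrow> (nat \<Rightarrow> real) set set" where
  "open_boxes n = {{x \<in> space (Rn n). \<forall>i<n. a i < x i \<and> x i < b i} | a b. True}"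

text \<open>Passing from generators of the factors to boxes requires that countably many generating
  intervals exhaust the line; the intervals \<open>{- k<..<k}\<close> do.\<close>

lemma sets_Rn: "sets (Rn n) = sigma_sets (space (Rn n)) (open_boxes n)"
proof -
  let ?E = "range (\<lambda>(a, b). {a<..<b :: real})"
  let ?P = "{{f\<in>(\<Pi>\<^sub>E i\<in>{..<n}. UNIV). \<forall>i\<in>j. f i \<in> A i} | A j. j \<in> {{..<n}} \<and> A \<in> Pi j (\<lambda>_. ?E)}"
  have P: "?P = open_boxes n"
  proof safe
    fix A :: "nat \<Rightarrow> real set" assume A: "A \<in> {..<n} \<rightarrow> ?E"
    have "\<exists>a b. i < n \<longrightarrow> A i = {a<..<b}" for i
    proof (cases "i < n")
      case True
      then have "A i \<in> ?E" using A by (auto simp: Pi_iff)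
      then show ?thesis by auto
    qed simp
    then obtain a b where "\<And>i. i < n \<Longrightarrow> A i = {a i<..<b i}" by metis
    then show "{f \<in> {..<n} \<rightarrow>\<^sub>E UNIV. \<forall>i\<in>{..<n}. f i \<in> A i} \<in> open_boxes n"
      unfolding open_boxes_def space_Rn by (intro CollectI exI[of _ a] exI[of _ b]) auto
  next
    fix B assume "B \<in> open_boxes n"
    then obtain a b where B: "B = {x \<in> space (Rn n). \<forall>i<n. a i < x i \<and> x i < b i}" by (auto simp: open_boxes_def)
    show "\<exists>A j. B = {f \<in> {..<n} \<rightarrow>\<^sub>E UNIV. \<forall>i\<in>j. f i \<in> A i} \<and> j \<in> {{..<n}} \<and> A \<in> j \<rightarrow> ?E"
      by (rule exI[of _ "\<lambda>i. {a i<..<b i}"], rule exI[of _ "{..<n}"]) (auto simp: B space_Rn)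
  qed
  have "sets (Rn n) = sets (\<Pi>\<^sub>M i\<in>{..<n}. sigma UNIV ?E)"
    by (rule sets_PiM_cong[OF refl borel_generated_open_intervals])
  also have "\<dots> = sets (sigma (\<Pi>\<^sub>E i\<in>{..<n}. UNIV) ?P)"
  proof (rule sets_PiM_sigma)
    show "\<exists>S\<subseteq>?E. countable S \<and> (UNIV :: real set) = \<Union>S"
    proof (intro exI[of _ "range (\<lambda>k. {- real k<..<real k})"] conjI)
      show "(UNIV :: real set) = \<Union>(range (\<lambda>k. {- real k<..<real k}))"
      proof safe
        fix x :: real
        obtain k where "\<bar>x\<bar> < real k" using reals_Archimedean2 by blast
        then show "x \<in> \<Union>(range (\<lambda>k. {- real k<..<real k}))" by (auto simp: abs_less_iff intro!: exI[of _ k])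
      qed auto
    qed auto
  qed auto
  also have "\<dots> = sigma_sets (space (Rn n)) (open_boxes n)"
    unfolding P unfolding space_Rn[symmetric]
    by (rule sets_measure_of) (auto simp: open_boxes_def)
  finally show ?thesis .
qed

lemma Int_stable_open_boxes: "Int_stable (open_boxes n)"
proof (rule Int_stableI)
  fix A B assume "A \<in> open_boxes n" "B \<in> open_boxes n"
  then obtain a b c d where
    A: "A = {x \<in> space (Rn n). \<forall>i<n. a i < x i \<and> x i < b i}" and
    B: "B = {x \<in> space (Rn n). \<forall>i<n. c i < x i \<and> x i < d i}"
    unfolding open_boxes_def by blast
  have "A \<inter> B = {x \<in> space (Rn n). \<forall>i<n. max (a i) (c i) < x i \<and> x i < min (b i) (d i)}"
    unfolding A B by auto
  then show "A \<inter> B \<in> open_boxes n"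
    unfolding open_boxes_def
    by (intro CollectI exI[of _ "\<lambda>i. max (a i) (c i)"] exI[of _ "\<lambda>i. min (b i) (d i)"]) auto
qed

lemma indicator_L2_iff_tens:
  assumes "x \<in> space (Rn n)"
  shows "indicator {x \<in> space (Rn n). \<forall>i<n. a i < x i \<and> x i < b i} x
    = tens n (\<lambda>i. indicator {a i<..<b i}) x"
  using assms by (auto simp: tens_def indicator_def)

lemma kern_indicator_open: "kern (indicator {a<..<b :: real})"
proof (rule kern_dominated[OF kern_indicator[of "\<bar>a\<bar> + \<bar>b\<bar>"]])
  show "cmod (indicator {a<..<b} x) \<le> cmod (indicator {- (\<bar>a\<bar> + \<bar>b\<bar>)..\<bar>a\<bar> + \<bar>b\<bar>} x)" for x
    by (auto simp: indicator_def)
qed simp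

text \<open>Density as an induction rule. The property climbs from bumps to open boxes, by Dynkin's
  argument to measurable subsets of a cube, then to square-integrable indicators, simple functions
  and finally all of \<open>L\<^sup>2\<close>.\<close>

lemma L2_dense_induct [consumes 1, case_names lin lim tens]:
  assumes f: "f \<in> L2 (Rn n)"
    and lin: "\<And>f g a b. f \<in> L2 (Rn n) \<Longrightarrow> g \<in> L2 (Rn n) \<Longrightarrow> P f \<Longrightarrow> P g \<Longrightarrow> P (\<lambda>x. a * f x + b * g x)"
    and lim: "\<And>s f. f \<in> L2 (Rn n) \<Longrightarrow> (\<And>k. s k \<in> L2 (Rn n)) \<Longrightarrow> (\<And>k. P (s k)) \<Longrightarrow>
        (\<lambda>k::nat. l2norm (Rn n) (\<lambda>x. s k x - f x)) \<longlonglongrightarrow> 0 \<Longrightarrow> P f"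
    and tens: "\<And>h. (\<And>i. i < n \<Longrightarrow> h i \<in> bumps) \<Longrightarrow> P (tens n h)"
  shows "P f"
proof -
  let ?M = "Rn n"
  \<comment> \<open>A constant sequence in \<open>lim\<close> makes \<open>P\<close> insensitive to
    values outside the space, where functions are arbitrary.\<close>
  have cong: "P g" if "P f" "f \<in> L2 ?M" "g \<in> L2 ?M" "\<And>x. x \<in> space ?M \<Longrightarrow> g x = f x" for f g
  proof (rule lim[of g "\<lambda>_. f"])
    have "l2norm ?M (\<lambda>x. f x - g x) = l2norm ?M (\<lambda>x. 0)"
      using that(2-4) by (intro l2norm_cong_AE) (auto dest: L2_measurable)
    then show "(\<lambda>k::nat. l2norm ?M (\<lambda>x. f x - g x)) \<longlonglongrightarrow> 0" by simp
  qed (use that in auto)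
  \<comment> \<open>Pointwise limits under a square-integrable bound are \<open>L\<^sup>2\<close>
    limits; every later passage to the limit has this form.\<close>
  have dom: "P f" if dom: "\<And>k. P (s k)" "\<And>k. s k \<in> L2 ?M" "f \<in> borel_measurable ?M" "w \<in> L2 ?M"
      "\<And>x. x \<in> space ?M \<Longrightarrow> (\<lambda>k. s k x) \<longlonglongrightarrow> f x" "\<And>k x. x \<in> space ?M \<Longrightarrow> cmod (s k x) \<le> C * cmod (w x)"
    for s f w C
  proof -
    have bf: "cmod (f x) \<le> C * cmod (w x)" if "x \<in> space ?M" for x
      by (rule LIMSEQ_le_const2[OF tendsto_norm[OF dom(5)[OF that]]]) (use dom(6)[OF that] in blast)
    have fL: "f \<in> L2 ?M" by (rule L2I_bound[OF that(3,4)]) (use bf in auto)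
    have "(\<lambda>k. l2norm ?M (\<lambda>x. s k x - f x)) \<longlonglongrightarrow> 0"
    proof (rule l2norm_dominated_tendsto[OF L2_cmult[OF that(4), of "2 * of_real \<bar>C\<bar>"] that(3) L2_measurable[OF that(2)]])
      show "AE x in ?M. (\<lambda>k. s k x) \<longlonglongrightarrow> f x" using that(5) by simp
      show "AE x in ?M. cmod (s k x - f x) \<le> cmod (2 * of_real \<bar>C\<bar> * w x)" for k
      proof (rule AE_I2)
        fix x assume x: "x \<in> space ?M"
        have "cmod (s k x - f x) \<le> cmod (s k x) + cmod (f x)" by (rule norm_triangle_ineq4)
        also have "\<dots> \<le> 2 * (C * cmod (w x))" using that(6)[OF x, of k] bf[OF x] by linarith
        also have "\<dots> \<le> 2 * (\<bar>C\<bar> * cmod (w x))" by (intro mult_left_mono mult_right_mono) auto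
        finally show "cmod (s k x - f x) \<le> cmod (2 * of_real \<bar>C\<bar> * w x)" by (simp add: norm_mult)
      qed
    qed
    then show "P f" using lim[of f s] fL that(1,2) by blast
  qed
  have zero: "P (\<lambda>x. 0)"
  proof -
    have "(\<lambda>_. bump_box 0 0 0) i \<in> bumps" for i :: nat by (simp add: bump_box_bumps)
    then have "P (tens n (\<lambda>_. bump_box 0 0 0))" "tens n (\<lambda>_. bump_box 0 0 0) \<in> L2 ?M"
      using tens[of "\<lambda>_. bump_box 0 0 0"] by (auto intro!: test_functions_L2 tens_bumps_test)
    from lin[OF this(2,2,1,1), of 0 0] show ?thesis by simp
  qed
  have box_tens: "P (tens n (\<lambda>i. indicator {a i<..<b i}))" for a b
  proof (rule dom[where s = "\<lambda>k. tens n (\<lambda>i. bump_box (a i) (b i) k)" and w = "tens n (\<lambda>i. indicator {a i<..<b i})" and C = 1])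
    show "P (tens n (\<lambda>i. bump_box (a i) (b i) k))" for k by (intro tens bump_box_bumps)
    show "tens n (\<lambda>i. bump_box (a i) (b i) k) \<in> L2 ?M" for k
      by (intro test_functions_L2 tens_bumps_test bump_box_bumps)
    show w: "tens n (\<lambda>i. indicator {a i<..<b i}) \<in> L2 ?M" by (intro tens_kern_L2 kern_indicator_open)
    show "tens n (\<lambda>i. indicator {a i<..<b i}) \<in> borel_measurable ?M" using w by measurable
    show "(\<lambda>k. tens n (\<lambda>i. bump_box (a i) (b i) k) x) \<longlonglongrightarrow> tens n (\<lambda>i. indicator {a i<..<b i}) x" for x
      unfolding tens_def by (intro tendsto_prod bump_box_tendsto)
    show "cmod (tens n (\<lambda>i. bump_box (a i) (b i) k) x) \<le> 1 * cmod (tens n (\<lambda>i. indicator {a i<..<b i}) x)" for k x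
      unfolding norm_tens mult_1
      by (intro prod_mono conjI norm_ge_zero) (rule order_trans[OF bump_box_le], auto simp: indicator_def)
  qed
  \<comment> \<open>Cubes of finite measure: for a fixed cube, the complement step subtracts one
    square-integrable indicator from another, which fails in the whole space.\<close>
  define Q where "Q k = {x \<in> space ?M. \<forall>i<n. - real k < x i \<and> x i < real k}" for k
  have Q_box: "Q k \<in> open_boxes n" for k
    unfolding Q_def open_boxes_def
    by (intro CollectI exI[of _ "\<lambda>_. - real k"] exI[of _ "\<lambda>_. real k"] conjI refl TrueI)
  then have Qs: "Q k \<in> sets ?M" for k unfolding sets_Rn by blast
  have QL: "indicator (Q k) \<in> L2 ?M" for k
  proof (rule L2_cong_AE[OF tens_kern_L2[of n "\<lambda>i. indicator {- real k<..<real k}", OF kern_indicator_open]])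
    show "AE x in ?M. indicator (Q k) x = tens n (\<lambda>i. indicator {- real k<..<real k}) x"
      unfolding Q_def by (intro AE_I2 indicator_L2_iff_tens)
  qed (use Qs in measurable)
  have AQL: "indicator (A \<inter> Q k) \<in> L2 ?M" if "A \<in> sets ?M" for A k
    by (rule L2I_bound[OF _ QL[of k], of _ 1]) (use that Qs in \<open>auto simp: indicator_def\<close>)
  have pow: "open_boxes n \<subseteq> Pow (space ?M)" by (auto simp: open_boxes_def)
  have AQ: "P (indicator (A \<inter> Q k))" if "A \<in> sets ?M" for A k
    using Int_stable_open_boxes[of n] pow that[unfolded sets_Rn]
  proof (induct A rule: sigma_sets_induct_disjoint)
    case (basic A)
    then have "A \<inter> Q k \<in> open_boxes n" using Int_stable_open_boxes[of n] Q_box[of k] unfolding Int_stable_def by blast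
    then obtain a b where ab: "A \<inter> Q k = {x \<in> space ?M. \<forall>i<n. a i < x i \<and> x i < b i}" unfolding open_boxes_def by blast
    have "A \<in> sets ?M" using basic unfolding sets_Rn by blast
    show ?case
      by (rule cong[OF box_tens[of a b] tens_kern_L2[OF kern_indicator_open] AQL[OF \<open>A \<in> sets ?M\<close>]])
         (simp add: ab indicator_L2_iff_tens)
  next
    case empty
    then show ?case using zero by (simp add: indicator_def)
  next
    case (compl A)
    have A: "A \<in> sets ?M" using compl(1) unfolding sets_Rn .
    have Q: "P (indicator (Q k))"
      by (rule cong[OF box_tens[of "\<lambda>_. - real k" "\<lambda>_. real k"] tens_kern_L2[OF kern_indicator_open] QL])
         (simp add: Q_def indicator_L2_iff_tens)
    have "P (\<lambda>x. 1 * indicator (Q k) x + (-1) * indicator (A \<inter> Q k) x)"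
      by (rule lin[OF QL AQL[OF A] Q compl(2)])
    moreover have "(\<lambda>x. 1 * indicator (Q k) x + (-1) * indicator (A \<inter> Q k) x) = (indicator ((space ?M - A) \<inter> Q k) :: _ \<Rightarrow> complex)"
      by (auto simp: indicator_def Q_def fun_eq_iff)
    ultimately show ?case by simp
  next
    case (union A)
    have As: "A i \<in> sets ?M" for i using union(2) unfolding sets_Rn by blast
    have S: "P (\<lambda>x. \<Sum>i<m. indicator (A i \<inter> Q k) x)" for m
    proof (induction m)
      case (Suc m)
      have "P (\<lambda>x. 1 * (\<Sum>i<m. indicator (A i \<inter> Q k) x) + 1 * indicator (A m \<inter> Q k) x)"
        by (rule lin[OF L2_sum[OF AQL[OF As]] AQL[OF As] Suc union(3)])
      then show ?case by simp
    qed (use zero in simp)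
    have eq: "(\<Sum>i<m. indicator (A i \<inter> Q k) x) = (indicator (\<Union>i<m. A i \<inter> Q k) x :: complex)" for m x
      using union(1) by (subst indicator_UN_disjoint) (auto simp: disjoint_family_on_def)
    show ?case
    proof (rule dom[where s = "\<lambda>m x. \<Sum>i<m. indicator (A i \<inter> Q k) x" and w = "indicator (Q k)" and C = 1])
      show "(\<lambda>x. \<Sum>i<m. indicator (A i \<inter> Q k) x) \<in> L2 ?M" for m by (intro L2_sum AQL As)
      show "indicator ((\<Union>i. A i) \<inter> Q k) \<in> borel_measurable ?M" using As Qs by measurable
      show "(\<lambda>m. \<Sum>i<m. indicator (A i \<inter> Q k) x) \<longlonglongrightarrow> (indicator ((\<Union>i. A i) \<inter> Q k) x :: complex)" for x
      proof (rule tendsto_eventually)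
        show "\<forall>\<^sub>F m in sequentially. (\<Sum>i<m. indicator (A i \<inter> Q k) x) = (indicator ((\<Union>i. A i) \<inter> Q k) x :: complex)"
        proof (cases "x \<in> (\<Union>i. A i) \<inter> Q k")
          case True
          then obtain j where "x \<in> A j" "x \<in> Q k" by auto
          then show ?thesis unfolding eq
            by (intro eventually_mono[OF eventually_gt_at_top[of j]]) (auto simp: indicator_def)
        qed (auto simp: eq indicator_def)
      qed
      show "cmod (\<Sum>i<m. indicator (A i \<inter> Q k) x) \<le> 1 * cmod (indicator (Q k) x)" for m x
        unfolding eq by (auto simp: indicator_def)
    qed (use S QL in auto)
  qed
  have ind: "P (indicator A)" if A: "A \<in> sets ?M" "indicator A \<in> L2 ?M" for A
  proof (rule dom[where s = "\<lambda>k. indicator (A \<inter> Q k)" and w = "indicator A" and C = 1])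
    show "(\<lambda>k. indicator (A \<inter> Q k) x) \<longlonglongrightarrow> (indicator A x :: complex)" if x: "x \<in> space ?M" for x
    proof (rule tendsto_eventually)
      obtain m where m: "real m > (\<Sum>i<n. \<bar>x i\<bar>)" using reals_Archimedean2 by blast
      have "x \<in> Q k" if "k \<ge> m" for k
      proof -
        have "\<bar>x i\<bar> < real k" if "i < n" for i
        proof -
          have "\<bar>x i\<bar> \<le> (\<Sum>i<n. \<bar>x i\<bar>)" using that by (intro member_le_sum) auto
          then show ?thesis using m \<open>k \<ge> m\<close> by linarith
        qed
        then show ?thesis using x by (auto simp: Q_def abs_less_iff minus_less_iff)
      qed
      then show "\<forall>\<^sub>F k in sequentially. indicator (A \<inter> Q k) x = (indicator A x :: complex)"
        by (intro eventually_mono[OF eventually_ge_at_top[of m]]) (auto simp: indicator_def)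
    qed
  qed (use A AQ AQL in \<open>auto simp: indicator_def\<close>)
  have simple: "P s" if s: "simple_function ?M s" "s \<in> L2 ?M" for s
  proof -
    define A where "A c = s -` {c} \<inter> space ?M" for c
    have As: "A c \<in> sets ?M" for c using simple_functionD(2)[OF s(1)] by (simp add: A_def)
    have tm: "P (\<lambda>x. c * indicator (A c) x) \<and> (\<lambda>x. c * indicator (A c) x) \<in> L2 ?M" for c
    proof (cases "c = 0")
      case False
      have L: "indicator (A c) \<in> L2 ?M"
        by (rule L2I_bound[OF _ s(2), of _ "1 / cmod c"]) (use False As in \<open>auto simp: indicator_def A_def\<close>)
      from lin[OF L L ind[OF As L] ind[OF As L], of c 0] show ?thesis using L2_cmult[OF L, of c] by simp
    qed (use zero in simp)
    have "P (\<lambda>x. \<Sum>c\<in>C. c * indicator (A c) x)" if "finite C" for C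
      using that
    proof induction
      case (insert c C)
      have "P (\<lambda>x. 1 * (c * indicator (A c) x) + 1 * (\<Sum>c\<in>C. c * indicator (A c) x))"
        by (rule lin[OF conjunct2[OF tm] L2_sum[OF conjunct2[OF tm]] conjunct1[OF tm] insert.IH])
      then show ?case by (simp only: sum.insert[OF insert.hyps] mult_1)
    qed (use zero in simp)
    from this[of "s ` space ?M"] have *: "P (\<lambda>x. \<Sum>c\<in>s ` space ?M. c * indicator (A c) x)"
      using simple_functionD(1)[OF s(1)] by simp
    show ?thesis
    proof (rule cong[OF * _ s(2)])
      show "(\<lambda>x. \<Sum>c\<in>s ` space ?M. c * indicator (A c) x) \<in> L2 ?M" using tm by (intro L2_sum) auto
      show "s x = (\<Sum>c\<in>s ` space ?M. c * indicator (A c) x)" if "x \<in> space ?M" for x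
      proof -
        have "(\<Sum>c\<in>s ` space ?M. c * indicator (A c) x) = (\<Sum>c\<in>s ` space ?M. if c = s x then s x else 0)"
          by (rule sum.cong) (use that in \<open>auto simp: A_def indicator_def\<close>)
        also have "\<dots> = s x" using simple_functionD(1)[OF s(1)] that by (simp add: sum.delta)
        finally show ?thesis by simp
      qed
    qed
  qed
  obtain F where F0: "(\<forall>i. simple_function ?M (F i)) \<and> (\<forall>x\<in>space ?M. (\<lambda>i. F i x) \<longlonglongrightarrow> f x) \<and>
      (\<forall>i. \<forall>x\<in>space ?M. dist (F i x) 0 \<le> 2 * dist (f x) 0)"
    using borel_measurable_implies_sequence_metric[OF L2_measurable[OF f], of 0] by blast
  then have F: "\<And>i. simple_function ?M (F i)" "\<And>x. x \<in> space ?M \<Longrightarrow> (\<lambda>i. F i x) \<longlonglongrightarrow> f x"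
    "\<And>i x. x \<in> space ?M \<Longrightarrow> cmod (F i x) \<le> 2 * cmod (f x)"
    by auto
  have FL: "F i \<in> L2 ?M" for i
    by (rule L2I_bound[OF borel_measurable_simple_function[OF F(1)] f, of _ 2]) (use F(3) in auto)
  show "P f"
    by (rule dom[where s = F and w = f and C = 2]) (use simple[OF F(1) FL] FL F f in \<open>auto dest: L2_measurable\<close>)
qed

lemma pairing_tendsto:
  assumes "f \<in> L2 M" "\<And>k. s k \<in> L2 M" "g \<in> L2 M" "(\<lambda>k. l2norm M (\<lambda>x. s k x - f x)) \<longlonglongrightarrow> 0"
  shows "(\<lambda>k. pairing M (s k) g) \<longlonglongrightarrow> pairing M f g"
proof -
  have "(\<lambda>k. pairing M (s k) g - pairing M f g) \<longlonglongrightarrow> 0"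
  proof (rule Lim_null_comparison)
    show "\<forall>\<^sub>F k in sequentially. norm (pairing M (s k) g - pairing M f g) \<le> l2norm M (\<lambda>x. s k x - f x) * l2norm M g"
      using assms pairing_bound[OF L2_diff[OF assms(2,1)] assms(3)] by (simp add: pairing_diff_left)
    show "(\<lambda>k. l2norm M (\<lambda>x. s k x - f x) * l2norm M g) \<longlonglongrightarrow> 0"
      using tendsto_mult_left_zero[OF assms(4)] by simp
  qed
  then show ?thesis by (simp add: LIM_zero_iff)
qed

text \<open>Vanishing pairings extend from tensor products of bumps to all of
  \<open>L\<^sup>2\<close> by density, and in particular to the conjugate of
  \<open>f\<close>.\<close>

lemma L2_eq_0_of_test:
  assumes f: "f \<in> L2 (Rn n)" and 0: "\<And>\<phi>. \<phi> \<in> test_functions n \<Longrightarrow> pairing (Rn n) f \<phi> = 0"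
  shows "AE x in Rn n. f x = 0"
proof -
  have "pairing (Rn n) f g = 0" if "g \<in> L2 (Rn n)" for g
    using that
  proof (induction g rule: L2_dense_induct)
    case (lin g h a b)
    then show ?case
      using pairing_add_right[OF L2_cmult[of g _ a] L2_cmult[of h _ b] f] by (simp add: pairing_cmult_right)
  next
    case (lim s g)
    have "(\<lambda>k. pairing (Rn n) (s k) f) \<longlonglongrightarrow> pairing (Rn n) g f" using lim f by (intro pairing_tendsto) auto
    then show ?case using lim by (simp add: pairing_commute[of _ _ f] LIMSEQ_const_iff)
  next
    case (tens h)
    then show ?case by (intro 0 tens_bumps_test)
  qed
  from this[OF L2_cnj[OF f]] have "l2norm (Rn n) f = 0" by (simp add: pairing_cnj_self)
  then show ?thesis by (rule l2norm_eq_0_AE[OF f])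
qed

section \<open>Weak gradients\<close>

lemma norm_powr_2: "norm x powr 2 = (norm x)\<^sup>2"
  by (cases "norm x = 0") (auto simp: powr_realpow[of _ 2, simplified])

lemma Lp_2: "Lp n 2 = L2 (Rn n)"
  by (simp add: Lp_def L2_def norm_powr_2)

lemma Lp_norm_2: "Lp_norm n 2 f = l2norm (Rn n) f"
  by (simp add: Lp_norm_def l2norm_def norm_powr_2 powr_half_sqrt)

text \<open>The weak gradient as a family of scalar components, related to the vector field of
  \<open>is_weak_gradient\<close> in both directions by the next two lemmas. Being a relation, it
  avoids the choice made in \<open>grad\<close>.\<close>

definition wgrad :: "nat \<Rightarrow> scalar_field \<Rightarrow> (nat \<Rightarrow> scalar_field) \<Rightarrow> bool" where
  "wgrad n u g \<longleftrightarrow> (\<forall>i<n. g i \<in> L2 (Rn n) \<and>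
     (\<forall>\<phi>\<in>test_functions n. pairing (Rn n) u (partial i \<phi>) = - pairing (Rn n) (g i) \<phi>))"

lemma wgrad_of_weak: "is_weak_gradient n u G \<Longrightarrow> wgrad n u (\<lambda>i x. vec_index (G x) i)"
  by (auto simp: is_weak_gradient_def wgrad_def Lp_2 pairing_def)

lemma weak_of_wgrad:
  assumes "wgrad n u g" shows "is_weak_gradient n u (\<lambda>x. vec n (\<lambda>i. g i x))"
  using assms by (auto simp: is_weak_gradient_def wgrad_def Lp_2 pairing_def)

lemma H1_iff: "u \<in> H1 n \<longleftrightarrow> u \<in> L2 (Rn n) \<and> (\<exists>g. wgrad n u g)"
  using wgrad_of_weak weak_of_wgrad by (auto simp: H1_def Lp_2) blast+

lemma H1_L2: "u \<in> H1 n \<Longrightarrow> u \<in> L2 (Rn n)"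
  by (simp add: H1_iff)

lemma grad_weak:
  assumes "u \<in> H1 n" shows "is_weak_gradient n u (grad n u)"
proof -
  obtain G where "is_weak_gradient n u G" using assms by (auto simp: H1_def)
  then show ?thesis unfolding grad_def by (rule someI[where P = "is_weak_gradient n u"])
qed

lemma wgrad_grad: "u \<in> H1 n \<Longrightarrow> wgrad n u (\<lambda>i x. vec_index (grad n u x) i)"
  by (intro wgrad_of_weak grad_weak)

lemma wgrad_L2: "wgrad n u g \<Longrightarrow> i < n \<Longrightarrow> g i \<in> L2 (Rn n)"
  by (simp add: wgrad_def)

lemma wgrad_test: "wgrad n u g \<Longrightarrow> i < n \<Longrightarrow> \<phi> \<in> test_functions n \<Longrightarrow>
    pairing (Rn n) u (partial i \<phi>) = - pairing (Rn n) (g i) \<phi>"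
  by (simp add: wgrad_def)

lemma wgrad_unique:
  assumes "wgrad n u g" "wgrad n u h" "i < n"
  shows "AE x in Rn n. g i x = h i x"
proof -
  have "AE x in Rn n. g i x - h i x = 0"
  proof (rule L2_eq_0_of_test)
    show "(\<lambda>x. g i x - h i x) \<in> L2 (Rn n)" using assms by (intro L2_diff wgrad_L2)
    show "pairing (Rn n) (\<lambda>x. g i x - h i x) \<phi> = 0" if "\<phi> \<in> test_functions n" for \<phi>
      using assms wgrad_test[OF assms(1,3) that] wgrad_test[OF assms(2,3) that] that
      by (simp add: pairing_diff_left wgrad_L2 test_functions_L2)
  qed
  then show ?thesis by simp
qed

lemma wgrad_cong_AE:
  assumes "wgrad n u g" "u \<in> borel_measurable (Rn n)" "v \<in> borel_measurable (Rn n)" "AE x in Rn n. v x = u x"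
  shows "wgrad n v g"
proof -
  have "pairing (Rn n) v (partial i \<phi>) = pairing (Rn n) u (partial i \<phi>)" if "i < n" "\<phi> \<in> test_functions n" for i \<phi>
    using assms(2-4) test_functions_measurable[OF test_functions_partial[OF that(2,1)]]
    by (intro pairing_cong_AE) auto
  then show ?thesis using assms(1) by (simp add: wgrad_def)
qed

lemma wgrad_lin:
  assumes "wgrad n u g" "wgrad n v h" "u \<in> L2 (Rn n)" "v \<in> L2 (Rn n)"
  shows "wgrad n (\<lambda>x. a * u x + b * v x) (\<lambda>i x. a * g i x + b * h i x)"
  unfolding wgrad_def
proof safe
  fix i assume i: "i < n"
  note gh = wgrad_L2[OF assms(1) i] wgrad_L2[OF assms(2) i]
  show "(\<lambda>x. a * g i x + b * h i x) \<in> L2 (Rn n)" using gh by (intro L2_add L2_cmult)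
  fix \<phi> assume p: "\<phi> \<in> test_functions n"
  show "pairing (Rn n) (\<lambda>x. a * u x + b * v x) (partial i \<phi>) = - pairing (Rn n) (\<lambda>x. a * g i x + b * h i x) \<phi>"
    using assms(3,4) gh test_functions_L2[OF p] test_functions_L2[OF test_functions_partial[OF p i]]
      wgrad_test[OF assms(1) i p] wgrad_test[OF assms(2) i p]
    by (simp add: pairing_add_left L2_cmult pairing_cmult_left)
qed

lemma wgrad_diff:
  assumes "wgrad n u g" "wgrad n v h" "u \<in> L2 (Rn n)" "v \<in> L2 (Rn n)"
  shows "wgrad n (\<lambda>x. u x - v x) (\<lambda>i x. g i x - h i x)"
  using wgrad_lin[OF assms, of 1 "-1"] by simp

lemma wgrad_cnj:
  assumes "wgrad n u g" shows "wgrad n (\<lambda>x. cnj (u x)) (\<lambda>i x. cnj (g i x))"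
  unfolding wgrad_def
proof safe
  fix i assume i: "i < n"
  show "(\<lambda>x. cnj (g i x)) \<in> L2 (Rn n)" by (intro L2_cnj wgrad_L2[OF assms i])
  fix \<phi> assume p: "\<phi> \<in> test_functions n"
  have "pairing (Rn n) (\<lambda>x. cnj (u x)) (partial i \<phi>) = cnj (pairing (Rn n) u (partial i (\<lambda>x. cnj (\<phi> x))))"
    unfolding pairing_cnj unfolding pairing_def
    by (rule Bochner_Integration.integral_cong[OF refl]) (simp add: partial_cnj[OF p i])
  also have "\<dots> = cnj (- pairing (Rn n) (g i) (\<lambda>x. cnj (\<phi> x)))"
    by (subst wgrad_test[OF assms i test_functions_cnj[OF p]]) simp
  finally show "pairing (Rn n) (\<lambda>x. cnj (u x)) (partial i \<phi>) = - pairing (Rn n) (\<lambda>x. cnj (g i x)) \<phi>"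
    by (simp add: pairing_cnj)
qed

text \<open>The defining identity pairs \<open>u\<close> and \<open>g\<close> with fixed test
  functions, so both sides survive \<open>L\<^sup>2\<close> limits: the weak gradient is a closed
  operator.\<close>

lemma wgrad_closed:
  assumes "\<And>k. wgrad n (u k) (g k)" "\<And>k. u k \<in> L2 (Rn n)" "v \<in> L2 (Rn n)" "\<And>i. i < n \<Longrightarrow> h i \<in> L2 (Rn n)"
    and "(\<lambda>k. l2norm (Rn n) (\<lambda>x. u k x - v x)) \<longlonglongrightarrow> 0"
    and "\<And>i. i < n \<Longrightarrow> (\<lambda>k. l2norm (Rn n) (\<lambda>x. g k i x - h i x)) \<longlonglongrightarrow> 0"
  shows "wgrad n v h"
  unfolding wgrad_def
proof safe
  fix i \<phi> assume i: "i < n" and p: "\<phi> \<in> test_functions n"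
  have "(\<lambda>k. pairing (Rn n) (u k) (partial i \<phi>)) \<longlonglongrightarrow> pairing (Rn n) v (partial i \<phi>)"
    using assms by (intro pairing_tendsto test_functions_L2[OF test_functions_partial[OF p i]]) auto
  moreover have "(\<lambda>k. - pairing (Rn n) (g k i) \<phi>) \<longlonglongrightarrow> - pairing (Rn n) (h i) \<phi>"
    using assms i by (intro tendsto_minus pairing_tendsto test_functions_L2[OF p]) (auto intro: wgrad_L2)
  ultimately show "pairing (Rn n) v (partial i \<phi>) = - pairing (Rn n) (h i) \<phi>"
    using wgrad_test[OF assms(1) i p] by (simp add: LIMSEQ_unique)
qed (use assms in auto)

lemma wgrad_test_function:
  assumes "f \<in> test_functions n" shows "wgrad n f (\<lambda>i. partial i f)"
  unfolding wgrad_def pairing_def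
  using assms by (auto intro!: test_functions_L2 test_functions_partial integral_by_parts dest: test_functions_Ck)

text \<open>
  The weak gradient may be tested against tensor products of kernels that are not compactly
  supported, by truncating every factor with a dilated cutoff.
\<close>

lemma wgrad_tens_kern:
  assumes u: "wgrad n u g" "u \<in> L2 (Rn n)" and i: "i < n"
    and h: "\<And>j. j < n \<Longrightarrow> smooth (h j)" "\<And>j. j < n \<Longrightarrow> kern (h j)"
    and d: "kern d" "\<And>s. (h i has_vector_derivative d s) (at s)"
  shows "pairing (Rn n) u (tens n (h(i := d))) = - pairing (Rn n) (g i) (tens n h)"
proof -
  let ?M = "Rn n"
  define c where "c k s = cutoff (0 + (1 / real (Suc k)) * s)" for k s
  have cb: "c k \<in> bumps" for k unfolding c_def[abs_def] by (intro bumps_scale cutoff_bumps) simp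
  obtain C0 where C0: "\<And>s. cmod (cutoff s) \<le> C0" using bumps_bounded[OF cutoff_bumps] by metis
  obtain C1 where C1: "\<And>s. cmod (vderiv cutoff s) \<le> C1" using bumps_bounded[OF bumps_deriv[OF cutoff_bumps]] by metis
  define C where "C = max 1 (max C0 C1)"
  have C: "C \<ge> 1" "\<And>s. cmod (cutoff s) \<le> C" "\<And>s. cmod (vderiv cutoff s) \<le> C"
    using C0 C1 by (auto simp: C_def intro: le_max_iff_disj[THEN iffD2])
  have c_lim: "(\<lambda>k. c k s) \<longlonglongrightarrow> 1" for s
  proof -
    have 1: "(\<lambda>k. 0 + (1 / real (Suc k)) * s) \<longlonglongrightarrow> 0 + 0 * s"
      using LIMSEQ_Suc[OF lim_1_over_n[where 'a = real]] by (intro tendsto_intros) simp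
    have "isCont cutoff 0"
      using smooth_continuous[OF bumps_smooth[OF cutoff_bumps], of UNIV] by (simp add: continuous_on_eq_continuous_at)
    from isCont_tendsto_compose[OF this, of "\<lambda>k. 0 + (1 / real (Suc k)) * s"] 1
    show ?thesis unfolding c_def by (simp add: cutoff_0)
  qed
  \<comment> \<open>The derivative of the dilated cutoff carries the factor
    \<open>1 / (k + 1)\<close>, so the extra term of the product rule disappears in the
    limit.\<close>
  define c' where "c' k s = of_real (1 / real (Suc k)) * vderiv cutoff (0 + (1 / real (Suc k)) * s)" for k s
  have c_deriv: "(c k has_vector_derivative c' k s) (at s)" for k s
  proof -
    have "((\<lambda>s. 0 + (1 / real (Suc k)) * s) has_vector_derivative 1 / real (Suc k)) (at s)"
      by (auto intro!: derivative_eq_intros)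
    from vector_diff_chain_at[OF this smooth_has_deriv[OF bumps_smooth[OF cutoff_bumps]]]
    show ?thesis by (simp add: o_def c_def[abs_def] c'_def scaleR_conv_of_real)
  qed
  have c'_bound: "cmod (c' k s) \<le> C * (1 / real (Suc k))" for k s
    using mult_left_mono[OF C(3)[of "0 + (1 / real (Suc k)) * s"], of "1 / real (Suc k)"]
    by (simp add: c'_def norm_mult norm_divide mult.commute del: of_nat_Suc)
  have c'_bound1: "cmod (c' k s) \<le> C" for k s
  proof -
    have "C * (1 / real (Suc k)) \<le> C * 1" using C(1) by (intro mult_left_mono) auto
    then show ?thesis using c'_bound[of k s] by simp
  qed
  have c'_lim: "(\<lambda>k. c' k s) \<longlonglongrightarrow> 0" for s
  proof (rule Lim_null_comparison)
    show "\<forall>\<^sub>F k in sequentially. norm (c' k s) \<le> C * (1 / real (Suc k))" using c'_bound by simp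
    show "(\<lambda>k. C * (1 / real (Suc k))) \<longlonglongrightarrow> 0"
      using tendsto_mult_right_zero[OF LIMSEQ_Suc[OF lim_1_over_n[where 'a = real]], of C] by simp
  qed
  define H where "H k j s = c k s * h j s" for k j s
  have Hb: "H k j \<in> bumps" if "j < n" for k j
    unfolding H_def[abs_def] by (intro bumps_mult cb h that)
  define d' where "d' k s = c k s * d s + c' k s * h i s" for k s
  have Hd: "(H k i has_vector_derivative d' k s) (at s)" for k s
    unfolding H_def[abs_def] d'_def by (rule has_vector_derivative_mult[OF c_deriv d(2)])
  have test: "tens n (H k) \<in> test_functions n" for k by (intro tens_bumps_test Hb)
  have par: "partial i (tens n (H k)) = tens n ((H k)(i := d' k))" for k
    by (rule tens_partial[where h = "H k" and d = "d' k", OF i Hd])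
  have eq: "pairing ?M u (tens n ((H k)(i := d' k))) = - pairing ?M (g i) (tens n (H k))" for k
    using wgrad_test[OF u(1) i test] by (simp only: par)
  \<comment> \<open>One-dimensional factors dominating all truncated factors at once; the
    \<open>i\<close>-th must also dominate the differentiated factor \<open>d' k\<close>.\<close>
  define W where "W j s = C * (cmod (h j s) + (if j = i then cmod (d s) else 0))" for j s
  have Wk: "kern (\<lambda>s. of_real (W j s))" if j: "j < n" for j
  proof -
    obtain A where A: "\<And>s. cmod (h j s) \<le> A" using kern_bounded[OF h(2)[OF j]] by metis
    obtain B where B: "\<And>s. cmod (d s) \<le> B" using kern_bounded[OF d(1)] by metis
    have "0 \<le> B" using B[of 0] norm_ge_zero order_trans by blast
    have "integrable lborel (W j)"
      unfolding W_def[abs_def] using kern_integrable[OF h(2)[OF j]] kern_integrable[OF d(1)]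
      by (cases "j = i") auto
    moreover have "cmod (of_real (W j s)) \<le> C * (A + B)" for s
    proof -
      have "cmod (of_real (W j s)) = C * (cmod (h j s) + (if j = i then cmod (d s) else 0))"
        unfolding norm_of_real W_def using C(1) by (intro abs_of_nonneg) simp
      also have "\<dots> \<le> C * (A + B)" using A[of s] B[of s] C(1) \<open>0 \<le> B\<close> by (intro mult_left_mono add_mono) auto
      finally show ?thesis .
    qed
    moreover have "(\<lambda>s. complex_of_real (W j s)) \<in> borel_measurable borel"
      unfolding W_def[abs_def] using kern_measurable[OF h(2)[OF j]] kern_measurable[OF d(1)] by measurable
    ultimately show ?thesis unfolding kern_def by (auto intro: integrable_of_real)
  qed
  have WL: "tens n (\<lambda>j s. of_real (W j s)) \<in> L2 ?M" by (intro tens_kern_L2 Wk)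
  have nW: "cmod (tens n (\<lambda>j s. of_real (W j s)) x) = (\<Prod>j<n. W j (x j))" for x
    unfolding norm_tens norm_of_real W_def using C(1) by (intro prod.cong abs_of_nonneg) auto
  have bnd: "cmod (tens n q x) \<le> cmod (tens n (\<lambda>j s. of_real (W j s)) x)"
    if "\<And>j. j < n \<Longrightarrow> cmod (q j (x j)) \<le> W j (x j)" for q x
    unfolding nW unfolding norm_tens using that by (intro prod_mono conjI norm_ge_zero) auto
  have bH: "cmod (H k j s) \<le> W j s" for k j s
  proof -
    have "cmod (H k j s) \<le> C * cmod (h j s)"
      unfolding H_def norm_mult c_def by (intro mult_right_mono C) auto
    also have "\<dots> \<le> W j s" unfolding W_def using C(1) by (intro mult_left_mono) auto
    finally show ?thesis .
  qed
  have bd: "cmod (d' k s) \<le> W i s" for k s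
  proof -
    have "cmod (d' k s) \<le> cmod (c k s) * cmod (d s) + cmod (c' k s) * cmod (h i s)"
      unfolding d'_def by (rule order_trans[OF norm_triangle_ineq]) (simp add: norm_mult)
    also have "\<dots> \<le> C * cmod (d s) + C * cmod (h i s)"
      using c'_bound1 C(2) by (intro add_mono mult_right_mono) (auto simp: c_def)
    finally show ?thesis by (simp add: W_def algebra_simps)
  qed
  have L: "(\<lambda>k. pairing ?M v (tens n (q k))) \<longlonglongrightarrow> pairing ?M v (tens n r)"
    if v: "v \<in> L2 ?M" and qm: "\<And>k j. j < n \<Longrightarrow> q k j \<in> borel_measurable borel" "\<And>j. j < n \<Longrightarrow> r j \<in> borel_measurable borel"
      and qb: "\<And>k j s. j < n \<Longrightarrow> cmod (q k j s) \<le> W j s" and ql: "\<And>j s. j < n \<Longrightarrow> (\<lambda>k. q k j s) \<longlonglongrightarrow> r j s" for v q r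
    unfolding pairing_def
  proof (rule integral_dominated_convergence)
    show "integrable ?M (\<lambda>x. cmod (v x * tens n (\<lambda>j s. of_real (W j s)) x))"
      using L2_mult_integrable[OF v WL] by (rule integrable_norm)
    show "AE x in ?M. (\<lambda>k. v x * tens n (q k) x) \<longlonglongrightarrow> v x * tens n r x"
      unfolding tens_def by (intro AE_I2 tendsto_mult tendsto_const tendsto_prod ql) simp
    show "AE x in ?M. norm (v x * tens n (q k) x) \<le> cmod (v x * tens n (\<lambda>j s. of_real (W j s)) x)" for k
      unfolding norm_mult by (intro AE_I2 mult_left_mono bnd qb) auto
    have vm: "v \<in> borel_measurable ?M" by (rule L2_measurable[OF v])
    show "(\<lambda>x. v x * tens n r x) \<in> borel_measurable ?M"
      using vm tens_measurable[of n r] qm(2) by auto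
    show "(\<lambda>x. v x * tens n (q k) x) \<in> borel_measurable ?M" for k
      using vm tens_measurable[of n "q k"] qm(1) by auto
  qed
  have cm: "c k \<in> borel_measurable borel" for k using cb by measurable
  have c'm: "c' k \<in> borel_measurable borel" for k
    unfolding c'_def[abs_def] using smooth_measurable[OF smooth_deriv[OF bumps_smooth[OF cutoff_bumps]]] by measurable
  have "(\<lambda>k. pairing ?M u (tens n ((H k)(i := d' k)))) \<longlonglongrightarrow> pairing ?M u (tens n (h(i := d)))"
  proof (rule L[OF u(2)])
    show "((H k)(i := d' k)) j \<in> borel_measurable borel" if "j < n" for k j
      using kern_measurable[OF h(2)[OF that]] kern_measurable[OF h(2)[OF i]] kern_measurable[OF d(1)] cm c'm
      by (auto simp: H_def[abs_def] d'_def[abs_def])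
    show "(h(i := d)) j \<in> borel_measurable borel" if "j < n" for j
      using kern_measurable[OF h(2)[OF that]] kern_measurable[OF d(1)] by auto
    show "cmod (((H k)(i := d' k)) j s) \<le> W j s" for k j s using bH bd by auto
    show "(\<lambda>k. ((H k)(i := d' k)) j s) \<longlonglongrightarrow> (h(i := d)) j s" for j s
      using tendsto_mult[OF c_lim[of s] tendsto_const[of "h j s"]]
        tendsto_add[OF tendsto_mult[OF c_lim[of s] tendsto_const[of "d s"]] tendsto_mult[OF c'_lim[of s] tendsto_const[of "h i s"]]]
      by (auto simp: H_def d'_def)
  qed
  moreover have "(\<lambda>k. - pairing ?M (g i) (tens n (H k))) \<longlonglongrightarrow> - pairing ?M (g i) (tens n h)"
  proof (intro tendsto_minus L[OF wgrad_L2[OF u(1) i]])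
    show "H k j \<in> borel_measurable borel" if "j < n" for k j using Hb[OF that] by measurable
    show "h j \<in> borel_measurable borel" if "j < n" for j using kern_measurable[OF h(2)[OF that]] .
    show "(\<lambda>k. H k j s) \<longlonglongrightarrow> h j s" for j s
      using tendsto_mult[OF c_lim[of s] tendsto_const[of "h j s"]] by (simp add: H_def)
  qed (rule bH)
  ultimately show ?thesis unfolding eq by (rule LIMSEQ_unique)
qed

section \<open>Convolution with tensor product kernels\<close>

definition tk :: "nat \<Rightarrow> (nat \<Rightarrow> real \<Rightarrow> complex) \<Rightarrow> (nat \<Rightarrow> real) \<Rightarrow> (nat \<Rightarrow> real) \<Rightarrow> complex" where
  "tk n h x y = (\<Prod>i<n. h i (x i - y i))"

text \<open>The \<open>L\<^sup>1\<close> norm of the kernel in either variable, hence the constant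
  in Schur's test.\<close>

definition tk_mass :: "nat \<Rightarrow> (nat \<Rightarrow> real \<Rightarrow> complex) \<Rightarrow> real" where
  "tk_mass n h = (\<Prod>i<n. \<integral>s. cmod (h i s) \<partial>lborel)"

definition conv :: "nat \<Rightarrow> (nat \<Rightarrow> real \<Rightarrow> complex) \<Rightarrow> scalar_field \<Rightarrow> scalar_field" where
  "conv n h f x = (\<integral>y. tk n h x y * f y \<partial>Rn n)"

lemma tk_mass_nonneg [simp]: "0 \<le> tk_mass n h"
  by (simp add: tk_mass_def prod_nonneg)

lemma tk_fst: "tk n h x y = tens n (\<lambda>i s. h i (s - y i)) x"
  by (simp add: tk_def tens_def)

lemma tk_snd: "tk n h x y = tens n (\<lambda>i s. h i (x i - s)) y"
  by (simp add: tk_def tens_def)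

lemma tk_reflect: "tk n h x y = tk n (\<lambda>i s. h i (- s)) y x"
  by (simp add: tk_def)

lemma kern_shift:
  assumes "kern h" shows "kern (\<lambda>s. h (s - a))" "kern (\<lambda>s. h (a - s))"
proof -
  obtain C where C: "\<And>s. cmod (h s) \<le> C" using kern_bounded[OF assms] by metis
  have [measurable]: "h \<in> borel_measurable borel" using assms by measurable
  have "integrable lborel (\<lambda>s. h (- a + 1 * s))" "integrable lborel (\<lambda>s. h (a + (-1) * s))"
    using kern_integrable[OF assms] by (intro lborel_integrable_real_affine; simp)+
  then have "integrable lborel (\<lambda>s. h (s - a))" "integrable lborel (\<lambda>s. h (a - s))" by simp_all
  then show "kern (\<lambda>s. h (s - a))" "kern (\<lambda>s. h (a - s))" using C by (auto simp: kern_def)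
qed

lemma kern_reflect: "kern h \<Longrightarrow> kern (\<lambda>s. h (- s))"
  using kern_shift(2)[of h 0] by simp

lemma integral_shift:
  fixes h :: "real \<Rightarrow> 'a::{banach, second_countable_topology}"
  shows "(\<integral>s. h (s - a) \<partial>lborel) = (\<integral>s. h s \<partial>lborel)" "(\<integral>s. h (a - s) \<partial>lborel) = (\<integral>s. h s \<partial>lborel)"
  using lborel_integral_real_affine[of 1 h "- a"] lborel_integral_real_affine[of "-1" h a] by simp_all

lemma tk_mass_reflect: "tk_mass n (\<lambda>i s. h i (- s)) = tk_mass n h"
  using integral_shift(2)[of "\<lambda>s. cmod (h _ s)" 0] by (simp add: tk_mass_def)

context
  fixes n :: nat and h :: "nat \<Rightarrow> real \<Rightarrow> complex"
  assumes h: "\<And>i. i < n \<Longrightarrow> kern (h i)"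
begin

lemma tk_L2_fst: "(\<lambda>x. tk n h x y) \<in> L2 (Rn n)"
  unfolding tk_fst by (intro tens_kern_L2 kern_shift h)

lemma tk_L2_snd: "tk n h x \<in> L2 (Rn n)"
  using tens_kern_L2[of n "\<lambda>i s. h i (x i - s)"] kern_shift(2)[OF h] by (simp add: tk_snd[abs_def])

lemma tk_norm_integrable_snd: "integrable (Rn n) (\<lambda>y. cmod (tk n h x y))"
  unfolding tk_snd using kern_shift(2)[OF h, THEN kern_integrable] by (intro integrable_norm tens_integrable)

lemma tk_norm_integral_snd: "(\<integral>y. cmod (tk n h x y) \<partial>Rn n) = tk_mass n h"
proof -
  have "(\<integral>y. (\<Prod>i<n. cmod (h i (x i - y i))) \<partial>Rn n) = (\<Prod>i<n. \<integral>s. cmod (h i (x i - s)) \<partial>lborel)"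
    using kern_shift(2)[OF h, THEN kern_integrable] by (intro Rn_product.product_integral_prod) auto
  then show ?thesis by (simp add: tk_def prod_norm tk_mass_def integral_shift(2)[of "\<lambda>s. cmod (h _ s)"])
qed

section \<open>Schur's test for tensor product kernels\<close>

lemma tk_measurable: "(\<lambda>(x, y). tk n h x y) \<in> borel_measurable (Rn n \<Otimes>\<^sub>M Rn n)"
proof -
  have "(\<lambda>p. \<Prod>i<n. h i (fst p i - snd p i)) \<in> borel_measurable (Rn n \<Otimes>\<^sub>M Rn n)"
  proof (rule borel_measurable_prod)
    fix i assume i: "i \<in> {..<n}"
    have [measurable]: "h i \<in> borel_measurable borel" using h i by (auto dest: kern_measurable)
    have "(\<lambda>x. x i) \<in> measurable (Rn n) lborel" by (rule measurable_component_singleton[OF i])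
    then have [measurable]: "(\<lambda>x. x i) \<in> borel_measurable (Rn n)" by simp
    have "(\<lambda>p. fst p i) \<in> borel_measurable (Rn n \<Otimes>\<^sub>M Rn n)" "(\<lambda>p. snd p i) \<in> borel_measurable (Rn n \<Otimes>\<^sub>M Rn n)"
      by (auto intro: measurable_compose[OF measurable_fst] measurable_compose[OF measurable_snd])
    then show "(\<lambda>p. h i (fst p i - snd p i)) \<in> borel_measurable (Rn n \<Otimes>\<^sub>M Rn n)" by measurable
  qed
  then show ?thesis by (simp add: tk_def split_beta')
qed

lemma tk_mult_integrable: "f \<in> L2 (Rn n) \<Longrightarrow> integrable (Rn n) (\<lambda>y. tk n h x y * f y)"
  using L2_mult_integrable[OF tk_L2_snd] .

text \<open>Integrating out \<open>y\<close> first leaves \<open>tk_mass n h\<close> times the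
  square of \<open>g\<close>; Fubini turns this into integrability on the product.\<close>

lemma tk_square_integrable_fst:
  assumes "g \<in> L2 (Rn n)"
  shows "integrable (Rn n \<Otimes>\<^sub>M Rn n) (\<lambda>(x, y). cmod (tk n h x y) * (cmod (g x))\<^sup>2)"
    and "integral\<^sup>L (Rn n \<Otimes>\<^sub>M Rn n) (\<lambda>(x, y). cmod (tk n h x y) * (cmod (g x))\<^sup>2) = tk_mass n h * (l2norm (Rn n) g)\<^sup>2"
proof -
  interpret pair_sigma_finite "Rn n" "Rn n" by (rule pair_sigma_finite_Rn)
  note tk_measurable [measurable]
  have [measurable]: "g \<in> borel_measurable (Rn n)" using assms by measurable
  have eq: "(\<integral>y. cmod (tk n h x y) * (cmod (g x))\<^sup>2 \<partial>Rn n) = tk_mass n h * (cmod (g x))\<^sup>2" for x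
    by (simp add: tk_norm_integral_snd)
  show 1: "integrable (Rn n \<Otimes>\<^sub>M Rn n) (\<lambda>(x, y). cmod (tk n h x y) * (cmod (g x))\<^sup>2)"
  proof (rule Fubini_integrable)
    have "(\<lambda>p. cmod (case p of (x, y) \<Rightarrow> tk n h x y)) \<in> borel_measurable (Rn n \<Otimes>\<^sub>M Rn n)"
      using tk_measurable by measurable
    moreover have "(\<lambda>p. (cmod (g (fst p)))\<^sup>2) \<in> borel_measurable (Rn n \<Otimes>\<^sub>M Rn n)" by measurable
    ultimately have "(\<lambda>p. cmod (case p of (x, y) \<Rightarrow> tk n h x y) * (cmod (g (fst p)))\<^sup>2) \<in> borel_measurable (Rn n \<Otimes>\<^sub>M Rn n)"
      by (rule borel_measurable_times)
    then show "(\<lambda>(x, y). cmod (tk n h x y) * (cmod (g x))\<^sup>2) \<in> borel_measurable (Rn n \<Otimes>\<^sub>M Rn n)"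
      by (simp add: split_beta')
    show "integrable (Rn n) (\<lambda>x. \<integral>y. norm (case (x, y) of (x, y) \<Rightarrow> cmod (tk n h x y) * (cmod (g x))\<^sup>2) \<partial>Rn n)"
      using L2_integrable_square[OF assms] by (simp add: tk_norm_integral_snd)
    show "AE x in Rn n. integrable (Rn n) (\<lambda>y. case (x, y) of (x, y) \<Rightarrow> cmod (tk n h x y) * (cmod (g x))\<^sup>2)"
      using tk_norm_integrable_snd by simp
  qed
  have "integral\<^sup>L (Rn n \<Otimes>\<^sub>M Rn n) (\<lambda>(x, y). cmod (tk n h x y) * (cmod (g x))\<^sup>2)
      = (\<integral>x. (\<integral>y. cmod (tk n h x y) * (cmod (g x))\<^sup>2 \<partial>Rn n) \<partial>Rn n)"
    by (rule integral_fst[OF 1, symmetric])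
  then show "integral\<^sup>L (Rn n \<Otimes>\<^sub>M Rn n) (\<lambda>(x, y). cmod (tk n h x y) * (cmod (g x))\<^sup>2) = tk_mass n h * (l2norm (Rn n) g)\<^sup>2"
    unfolding eq by (simp add: l2norm_power2)
qed

end

context
  fixes n :: nat and h :: "nat \<Rightarrow> real \<Rightarrow> complex"
  assumes h: "\<And>i. i < n \<Longrightarrow> kern (h i)"
begin

text \<open>Exchanging the variables reflects the kernel, so the preceding estimate is applied to
  the reflected factors. It has to be general in \<open>h\<close> for this, hence the second
  context.\<close>

lemma tk_square_integrable_snd:
  assumes "f \<in> L2 (Rn n)"
  shows "integrable (Rn n \<Otimes>\<^sub>M Rn n) (\<lambda>(x, y). cmod (tk n h x y) * (cmod (f y))\<^sup>2)"
    and "integral\<^sup>L (Rn n \<Otimes>\<^sub>M Rn n) (\<lambda>(x, y). cmod (tk n h x y) * (cmod (f y))\<^sup>2) = tk_mass n h * (l2norm (Rn n) f)\<^sup>2"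
proof -
  interpret pair_sigma_finite "Rn n" "Rn n" by (rule pair_sigma_finite_Rn)
  have r: "kern (\<lambda>s. h i (- s))" if "i < n" for i using kern_reflect[OF h[OF that]] .
  note * = tk_square_integrable_fst[of n "\<lambda>i s. h i (- s)", OF r assms]
  from integrable_product_swap[OF *(1)]
  show "integrable (Rn n \<Otimes>\<^sub>M Rn n) (\<lambda>(x, y). cmod (tk n h x y) * (cmod (f y))\<^sup>2)"
    by (simp add: tk_reflect[of n h])
  have "integral\<^sup>L (Rn n \<Otimes>\<^sub>M Rn n) (\<lambda>(x, y). cmod (tk n h x y) * (cmod (f y))\<^sup>2)
      = integral\<^sup>L (Rn n \<Otimes>\<^sub>M Rn n) (\<lambda>(x, y). cmod (tk n (\<lambda>i s. h i (- s)) x y) * (cmod (f x))\<^sup>2)"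
    using integral_product_swap[OF borel_measurable_integrable[OF *(1)]] by (simp add: tk_reflect[of n h])
  then show "integral\<^sup>L (Rn n \<Otimes>\<^sub>M Rn n) (\<lambda>(x, y). cmod (tk n h x y) * (cmod (f y))\<^sup>2) = tk_mass n h * (l2norm (Rn n) f)\<^sup>2"
    using *(2) by (simp add: tk_mass_reflect)
qed

lemma pair_measurable_mult:
  assumes "f \<in> borel_measurable (Rn n)" "g \<in> borel_measurable (Rn n)"
  shows "(\<lambda>(x, y). tk n h x y * f y * g x) \<in> borel_measurable (Rn n \<Otimes>\<^sub>M Rn n)"
proof -
  have "(\<lambda>p. (case p of (x, y) \<Rightarrow> tk n h x y) * f (snd p) * g (fst p)) \<in> borel_measurable (Rn n \<Otimes>\<^sub>M Rn n)"
    by (intro borel_measurable_times tk_measurable h measurable_compose[OF measurable_snd assms(1)]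
        measurable_compose[OF measurable_fst assms(2)])
  then show ?thesis by (simp add: split_beta')
qed

lemma schur_integrable:
  assumes "f \<in> L2 (Rn n)" "g \<in> L2 (Rn n)"
  shows "integrable (Rn n \<Otimes>\<^sub>M Rn n) (\<lambda>(x, y). tk n h x y * f y * g x)"
proof (rule Bochner_Integration.integrable_bound)
  let ?w = "\<lambda>p. (case p of (x, y) \<Rightarrow> cmod (tk n h x y) * (cmod (f y))\<^sup>2) + (case p of (x, y) \<Rightarrow> cmod (tk n h x y) * (cmod (g x))\<^sup>2)"
  show "integrable (Rn n \<Otimes>\<^sub>M Rn n) ?w"
    by (intro Bochner_Integration.integrable_add tk_square_integrable_fst[OF h] tk_square_integrable_snd assms)
  show "(\<lambda>(x, y). tk n h x y * f y * g x) \<in> borel_measurable (Rn n \<Otimes>\<^sub>M Rn n)"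
    using assms by (intro pair_measurable_mult L2_measurable)
  have "cmod (tk n h x y * f y * g x) \<le> cmod (tk n h x y) * (cmod (f y))\<^sup>2 + cmod (tk n h x y) * (cmod (g x))\<^sup>2" for x y
  proof -
    have "0 \<le> cmod (f y) * cmod (g x)" by simp
    then have "cmod (f y) * cmod (g x) \<le> (cmod (f y))\<^sup>2 + (cmod (g x))\<^sup>2"
      using sum_squares_bound[of "cmod (f y)" "cmod (g x)"] by linarith
    then have "cmod (tk n h x y) * (cmod (f y) * cmod (g x)) \<le> cmod (tk n h x y) * ((cmod (f y))\<^sup>2 + (cmod (g x))\<^sup>2)"
      by (rule mult_left_mono) simp
    then show ?thesis by (simp only: norm_mult distrib_left mult.assoc)
  qed
  then show "AE p in Rn n \<Otimes>\<^sub>M Rn n. norm (case p of (x, y) \<Rightarrow> tk n h x y * f y * g x) \<le> norm (?w p)"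
    by (intro AE_I2) (auto simp: split_beta' intro: order_trans[OF _ abs_ge_self])
qed

text \<open>Schur's test: the weight \<open>|tk|\<close> is shared between the squares of
  \<open>f\<close> and \<open>g\<close>, each of which integrates to the mass times a squared norm,
  and \<open>amgm_bound\<close> optimises the ratio.\<close>

lemma schur_bound:
  assumes "f \<in> L2 (Rn n)" "g \<in> L2 (Rn n)"
  shows "cmod (integral\<^sup>L (Rn n \<Otimes>\<^sub>M Rn n) (\<lambda>(x, y). tk n h x y * f y * g x)) \<le> tk_mass n h * (l2norm (Rn n) f * l2norm (Rn n) g)"
proof -
  let ?MM = "Rn n \<Otimes>\<^sub>M Rn n"
  let ?F = "\<lambda>p. case p of (x, y) \<Rightarrow> cmod (tk n h x y) * (cmod (f y))\<^sup>2"
  let ?G = "\<lambda>p. case p of (x, y) \<Rightarrow> cmod (tk n h x y) * (cmod (g x))\<^sup>2"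
  note F = tk_square_integrable_snd[OF assms(1)] and G = tk_square_integrable_fst[OF h assms(2)]
  have "cmod (integral\<^sup>L ?MM (\<lambda>(x, y). tk n h x y * f y * g x)) \<le> (sqrt (tk_mass n h) * l2norm (Rn n) f) * (sqrt (tk_mass n h) * l2norm (Rn n) g)"
  proof (rule amgm_bound)
    fix c :: real assume c: "c > 0"
    have "cmod (integral\<^sup>L ?MM (\<lambda>(x, y). tk n h x y * f y * g x)) \<le> integral\<^sup>L ?MM (\<lambda>p. cmod (case p of (x, y) \<Rightarrow> tk n h x y * f y * g x))"
      by (rule integral_norm_bound)
    also have "\<dots> \<le> integral\<^sup>L ?MM (\<lambda>p. (c * ?F p + ?G p / c) / 2)"
    proof (rule integral_mono)
      show "integrable ?MM (\<lambda>p. cmod (case p of (x, y) \<Rightarrow> tk n h x y * f y * g x))"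
        by (rule integrable_norm[OF schur_integrable[OF assms]])
      show "integrable ?MM (\<lambda>p. (c * ?F p + ?G p / c) / 2)"
        using F(1) G(1) by (intro integrable_divide_zero Bochner_Integration.integrable_add integrable_mult_right) auto
      fix p :: "(nat \<Rightarrow> real) \<times> (nat \<Rightarrow> real)"
      obtain x y where p: "p = (x, y)" by (cases p)
      have "0 \<le> (c * cmod (f y) - cmod (g x))\<^sup>2 / c" using c by simp
      also have "\<dots> = c * (cmod (f y))\<^sup>2 + (cmod (g x))\<^sup>2 / c - 2 * (cmod (f y) * cmod (g x))"
        using c by (simp add: power2_eq_square field_simps)
      finally have "cmod (f y) * cmod (g x) \<le> (c * (cmod (f y))\<^sup>2 + (cmod (g x))\<^sup>2 / c) / 2" by simp
      then have "cmod (tk n h x y) * (cmod (f y) * cmod (g x)) \<le> cmod (tk n h x y) * ((c * (cmod (f y))\<^sup>2 + (cmod (g x))\<^sup>2 / c) / 2)"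
        by (rule mult_left_mono) simp
      then show "cmod (case p of (x, y) \<Rightarrow> tk n h x y * f y * g x) \<le> (c * ?F p + ?G p / c) / 2"
        unfolding p by (simp add: norm_mult algebra_simps)
    qed
    also have "\<dots> = (c * (tk_mass n h * (l2norm (Rn n) f)\<^sup>2) + (tk_mass n h * (l2norm (Rn n) g)\<^sup>2) / c) / 2"
      using F G by simp
    finally show "cmod (integral\<^sup>L ?MM (\<lambda>(x, y). tk n h x y * f y * g x))
      \<le> (c * (sqrt (tk_mass n h) * l2norm (Rn n) f)\<^sup>2 + (sqrt (tk_mass n h) * l2norm (Rn n) g)\<^sup>2 / c) / 2"
      by (simp add: power_mult_distrib)
  qed simp_all
  also have "\<dots> = tk_mass n h * (l2norm (Rn n) f * l2norm (Rn n) g)"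
  proof -
    have "(r * a) * (r * b) = (r * r) * (a * b)" for r a b :: real by (simp only: mult_ac)
    from this[of "sqrt (tk_mass n h)"] show ?thesis by simp
  qed
  finally show ?thesis .
qed

section \<open>Convolution as a bounded operator on \<open>L\<^sup>2\<close>\<close>

lemma conv_measurable:
  assumes "f \<in> L2 (Rn n)" shows "conv n h f \<in> borel_measurable (Rn n)"
proof -
  interpret sigma_finite_measure "Rn n" by (rule sigma_finite_Rn)
  have "(\<lambda>(x, y). tk n h x y * f y * 1) \<in> borel_measurable (Rn n \<Otimes>\<^sub>M Rn n)"
    by (rule pair_measurable_mult[OF L2_measurable[OF assms] borel_measurable_const])
  then show ?thesis unfolding conv_def[abs_def] by (intro borel_measurable_lebesgue_integral) simp
qed

text \<open>Cauchy-Schwarz for the measure with density \<open>|tk n h x y|\<close> in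
  \<open>y\<close>, applied to \<open>f\<close> and the constant 1.\<close>

lemma conv_square_le:
  assumes "f \<in> L2 (Rn n)" "integrable (Rn n) (\<lambda>y. cmod (tk n h x y) * (cmod (f y))\<^sup>2)"
  shows "(cmod (conv n h f x))\<^sup>2 \<le> tk_mass n h * (\<integral>y. cmod (tk n h x y) * (cmod (f y))\<^sup>2 \<partial>Rn n)"
proof -
  let ?I = "\<integral>y. cmod (tk n h x y) * (cmod (f y))\<^sup>2 \<partial>Rn n"
  have I: "?I \<ge> 0" by simp
  have "cmod (conv n h f x) \<le> sqrt ?I * sqrt (tk_mass n h)"
  proof (rule amgm_bound)
    fix c :: real assume c: "c > 0"
    have "cmod (conv n h f x) \<le> (\<integral>y. cmod (tk n h x y * f y) \<partial>Rn n)"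
      unfolding conv_def by (rule integral_norm_bound)
    also have "\<dots> \<le> (\<integral>y. (c * (cmod (tk n h x y) * (cmod (f y))\<^sup>2) + cmod (tk n h x y) / c) / 2 \<partial>Rn n)"
    proof (rule integral_mono)
      show "integrable (Rn n) (\<lambda>y. cmod (tk n h x y * f y))" by (rule integrable_norm[OF tk_mult_integrable[OF h assms(1)]])
      show "integrable (Rn n) (\<lambda>y. (c * (cmod (tk n h x y) * (cmod (f y))\<^sup>2) + cmod (tk n h x y) / c) / 2)"
        using assms(2) tk_norm_integrable_snd[where x = x, OF h] by simp
      fix y
      have "0 \<le> (c * cmod (f y) - 1)\<^sup>2 / c" using c by simp
      also have "\<dots> = c * (cmod (f y))\<^sup>2 + 1 / c - 2 * cmod (f y)" using c by (simp add: power2_eq_square field_simps)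
      finally have "cmod (f y) \<le> (c * (cmod (f y))\<^sup>2 + 1 / c) / 2" by simp
      then have "cmod (tk n h x y) * cmod (f y) \<le> cmod (tk n h x y) * ((c * (cmod (f y))\<^sup>2 + 1 / c) / 2)"
        by (rule mult_left_mono) simp
      then show "cmod (tk n h x y * f y) \<le> (c * (cmod (tk n h x y) * (cmod (f y))\<^sup>2) + cmod (tk n h x y) / c) / 2"
        by (simp add: norm_mult algebra_simps)
    qed
    also have "\<dots> = (c * ?I + tk_mass n h / c) / 2"
      using assms(2) tk_norm_integrable_snd[where x = x, OF h] tk_norm_integral_snd[where x = x, OF h] by simp
    finally show "cmod (conv n h f x) \<le> (c * (sqrt ?I)\<^sup>2 + (sqrt (tk_mass n h))\<^sup>2 / c) / 2" using I by simp
  qed (use I in auto)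
  then have "(cmod (conv n h f x))\<^sup>2 \<le> (sqrt ?I * sqrt (tk_mass n h))\<^sup>2" by (intro power_mono) auto
  then show ?thesis using I by (simp add: power_mult_distrib mult.commute)
qed

lemma conv_L2:
  assumes "f \<in> L2 (Rn n)" shows "conv n h f \<in> L2 (Rn n)"
proof -
  interpret pair_sigma_finite "Rn n" "Rn n" by (rule pair_sigma_finite_Rn)
  note I = tk_square_integrable_snd(1)[OF assms]
  have "integrable (Rn n) (\<lambda>x. (cmod (conv n h f x))\<^sup>2)"
  proof (rule Bochner_Integration.integrable_bound)
    show "integrable (Rn n) (\<lambda>x. tk_mass n h * (\<integral>y. cmod (tk n h x y) * (cmod (f y))\<^sup>2 \<partial>Rn n))"
      using integrable_fst[OF I] by simp
    show "AE x in Rn n. norm ((cmod (conv n h f x))\<^sup>2) \<le> norm (tk_mass n h * (\<integral>y. cmod (tk n h x y) * (cmod (f y))\<^sup>2 \<partial>Rn n))"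
      using AE_integrable_fst[OF I]
    proof eventually_elim
      case (elim x)
      from conv_square_le[OF assms this] show ?case by (simp add: abs_mult)
    qed
  qed (use conv_measurable[OF assms] in measurable)
  then show ?thesis using conv_measurable[OF assms] by (simp add: L2_def)
qed

text \<open>Fubini, justified by \<open>schur_integrable\<close>. In the second form the kernel acts
  on \<open>g\<close> through its first argument, so operations on the kernel in \<open>x\<close>
  can be carried out for each fixed \<open>y\<close>.\<close>

lemma pairing_conv:
  assumes "f \<in> L2 (Rn n)" "g \<in> L2 (Rn n)"
  shows "pairing (Rn n) (conv n h f) g = integral\<^sup>L (Rn n \<Otimes>\<^sub>M Rn n) (\<lambda>(x, y). tk n h x y * f y * g x)"
    and "pairing (Rn n) (conv n h f) g = (\<integral>y. f y * (\<integral>x. tk n h x y * g x \<partial>Rn n) \<partial>Rn n)"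
proof -
  interpret pair_sigma_finite "Rn n" "Rn n" by (rule pair_sigma_finite_Rn)
  note I = schur_integrable[OF assms]
  have "pairing (Rn n) (conv n h f) g = (\<integral>x. (\<integral>y. tk n h x y * f y * g x \<partial>Rn n) \<partial>Rn n)"
    unfolding pairing_def conv_def
    using tk_mult_integrable[OF h assms(1)] by (intro Bochner_Integration.integral_cong[OF refl]) simp
  also have "\<dots> = integral\<^sup>L (Rn n \<Otimes>\<^sub>M Rn n) (\<lambda>(x, y). tk n h x y * f y * g x)"
    by (rule integral_fst[OF I])
  finally show 1: "pairing (Rn n) (conv n h f) g = integral\<^sup>L (Rn n \<Otimes>\<^sub>M Rn n) (\<lambda>(x, y). tk n h x y * f y * g x)" .
  also have "\<dots> = (\<integral>y. (\<integral>x. tk n h x y * f y * g x \<partial>Rn n) \<partial>Rn n)"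
    by (rule integral_snd[OF I, symmetric])
  also have "\<dots> = (\<integral>y. f y * (\<integral>x. tk n h x y * g x \<partial>Rn n) \<partial>Rn n)"
  proof (intro Bochner_Integration.integral_cong[OF refl])
    fix y
    have "(\<integral>x. tk n h x y * f y * g x \<partial>Rn n) = (\<integral>x. f y * (tk n h x y * g x) \<partial>Rn n)"
      by (intro Bochner_Integration.integral_cong[OF refl]) simp
    also have "\<dots> = f y * (\<integral>x. tk n h x y * g x \<partial>Rn n)"
      using L2_mult_integrable[OF tk_L2_fst[OF h] assms(2)] by simp
    finally show "(\<integral>x. tk n h x y * f y * g x \<partial>Rn n) = f y * (\<integral>x. tk n h x y * g x \<partial>Rn n)" .
  qed
  finally show "pairing (Rn n) (conv n h f) g = (\<integral>y. f y * (\<integral>x. tk n h x y * g x \<partial>Rn n) \<partial>Rn n)" .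
qed

lemma l2norm_conv_le:
  assumes "f \<in> L2 (Rn n)" shows "l2norm (Rn n) (conv n h f) \<le> tk_mass n h * l2norm (Rn n) f"
proof (rule l2norm_le_dual[OF conv_L2[OF assms]])
  fix g assume "g \<in> L2 (Rn n)"
  from schur_bound[OF assms this] pairing_conv(1)[OF assms this]
  show "cmod (pairing (Rn n) (conv n h f) g) \<le> tk_mass n h * l2norm (Rn n) f * l2norm (Rn n) g"
    by (simp add: mult.assoc)
qed simp

lemma conv_lin:
  assumes "f \<in> L2 (Rn n)" "g \<in> L2 (Rn n)"
  shows "conv n h (\<lambda>y. a * f y + b * g y) x = a * conv n h f x + b * conv n h g x"
proof -
  have "conv n h (\<lambda>y. a * f y + b * g y) x = (\<integral>y. a * (tk n h x y * f y) + b * (tk n h x y * g y) \<partial>Rn n)"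
    unfolding conv_def by (intro Bochner_Integration.integral_cong[OF refl]) (simp add: algebra_simps)
  then show ?thesis using tk_mult_integrable[OF h assms(1)] tk_mult_integrable[OF h assms(2)]
    by (simp add: conv_def)
qed

lemma conv_diff:
  "f \<in> L2 (Rn n) \<Longrightarrow> g \<in> L2 (Rn n) \<Longrightarrow> conv n h (\<lambda>y. f y - g y) x = conv n h f x - conv n h g x"
  using conv_lin[of f g 1 "-1" x] by simp

end

lemma conv_cnj: "cnj (conv n h f x) = conv n (\<lambda>i s. cnj (h i s)) (\<lambda>y. cnj (f y)) x"
proof -
  have "cnj (\<integral>y. tk n h x y * f y \<partial>Rn n) = (\<integral>y. cnj (tk n h x y * f y) \<partial>Rn n)"
    by (rule Bochner_Integration.integral_cnj[symmetric])
  then show ?thesis by (simp add: conv_def tk_def)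
qed

text \<open>An even kernel is symmetric, so the convolution is its own transpose for the bilinear
  pairing.\<close>

lemma pairing_conv_even:
  assumes "\<And>i. i < n \<Longrightarrow> kern (h i)" "\<And>i s. i < n \<Longrightarrow> h i (- s) = h i s" "f \<in> L2 (Rn n)" "g \<in> L2 (Rn n)"
  shows "pairing (Rn n) (conv n h f) g = pairing (Rn n) f (conv n h g)"
proof -
  have "h i (x i - y i) = h i (y i - x i)" if "i < n" for i and x y :: "nat \<Rightarrow> real"
    using assms(2)[OF that, of "y i - x i"] by simp
  then have "tk n h x y = tk n h y x" for x y
    unfolding tk_def by (intro prod.cong) auto
  then show ?thesis using pairing_conv(2)[OF assms(1,3,4)] by (simp add: pairing_def conv_def)
qed

text \<open>Read the outer convolution as a pairing with the slice \<open>tk n h x\<close> and move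
  the inner kernel across; the resulting kernel factors into one-dimensional convolutions.\<close>

lemma conv_conv:
  assumes h: "\<And>i. i < n \<Longrightarrow> kern (h i)" and k: "\<And>i. i < n \<Longrightarrow> kern (k i)"
    and l: "\<And>i a b. i < n \<Longrightarrow> (\<integral>u. h i (a - u) * k i (u - b) \<partial>lborel) = l i (a - b)"
    and f: "f \<in> L2 (Rn n)"
  shows "conv n h (conv n k f) x = conv n l f x"
proof -
  have "conv n h (conv n k f) x = pairing (Rn n) (conv n k f) (tk n h x)"
    by (simp add: conv_def[of n h] pairing_def mult.commute)
  also have "\<dots> = (\<integral>y. f y * (\<integral>u. tk n k u y * tk n h x u \<partial>Rn n) \<partial>Rn n)"
    by (rule pairing_conv(2)[OF k f tk_L2_snd[OF h]])
  also have "\<dots> = (\<integral>y. tk n l x y * f y \<partial>Rn n)"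
  proof (intro Bochner_Integration.integral_cong[OF refl])
    fix y
    have "(\<integral>u. tk n k u y * tk n h x u \<partial>Rn n) = (\<integral>u. tens n (\<lambda>i s. h i (x i - s) * k i (s - y i)) u \<partial>Rn n)"
      by (intro Bochner_Integration.integral_cong[OF refl]) (simp add: tk_def tens_def prod.distrib mult.commute)
    also have "\<dots> = (\<Prod>i<n. \<integral>s. h i (x i - s) * k i (s - y i) \<partial>lborel)"
    proof (rule tens_integral)
      fix i assume i: "i < n"
      have "(\<lambda>s. h i (x i - s)) \<in> L2 lborel" "(\<lambda>s. k i (s - y i)) \<in> L2 lborel"
        using kern_shift(2)[OF h[OF i], of "x i"] kern_shift(1)[OF k[OF i], of "y i"]
        by (auto simp: L2_def intro: kern_square_integrable dest: kern_measurable)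
      then show "integrable lborel (\<lambda>s. h i (x i - s) * k i (s - y i))" by (rule L2_mult_integrable)
    qed
    also have "\<dots> = tk n l x y" using l by (simp add: tk_def)
    finally show "f y * (\<integral>u. tk n k u y * tk n h x u \<partial>Rn n) = tk n l x y * f y" by simp
  qed
  finally show ?thesis by (simp add: conv_def)
qed

section \<open>The complex heat semigroup on \<open>L\<^sup>2\<close>\<close>

text \<open>The kernel degenerates at time 0, where the identity is put in by hand; negative times
  merely receive a default.\<close>

definition heat :: "nat \<Rightarrow> complex \<Rightarrow> real \<Rightarrow> scalar_field \<Rightarrow> scalar_field" where
  "heat n z t f = (if t > 0 then conv n (\<lambda>_. gk z t) f else f)"

text \<open>The gradient of the evolved function, with the derivative placed on the
  \<open>i\<close>-th factor of the kernel; hence it exists for every \<open>f\<close> in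
  \<open>L\<^sup>2\<close>.\<close>

definition hgrad :: "nat \<Rightarrow> complex \<Rightarrow> real \<Rightarrow> scalar_field \<Rightarrow> nat \<Rightarrow> scalar_field" where
  "hgrad n z t f i = conv n ((\<lambda>_. gk z t)(i := gk1 z t)) f"

lemma heat_0 [simp]: "heat n z 0 f = f"
  by (simp add: heat_def)

lemma heat_L2: "Re z > 0 \<Longrightarrow> f \<in> L2 (Rn n) \<Longrightarrow> heat n z t f \<in> L2 (Rn n)"
  by (auto simp: heat_def intro: conv_L2 kern_gk)

lemma heat_lin:
  "Re z > 0 \<Longrightarrow> f \<in> L2 (Rn n) \<Longrightarrow> g \<in> L2 (Rn n) \<Longrightarrow>
     heat n z t (\<lambda>y. a * f y + b * g y) x = a * heat n z t f x + b * heat n z t g x"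
  by (auto simp: heat_def intro!: conv_lin kern_gk)

lemma heat_diff:
  "Re z > 0 \<Longrightarrow> f \<in> L2 (Rn n) \<Longrightarrow> g \<in> L2 (Rn n) \<Longrightarrow>
     heat n z t (\<lambda>y. f y - g y) x = heat n z t f x - heat n z t g x"
  by (auto simp: heat_def intro!: conv_diff kern_gk)

lemma heat_cnj: "Re z > 0 \<Longrightarrow> cnj (heat n z t f x) = heat n (cnj z) t (\<lambda>x. cnj (f x)) x"
  by (simp add: heat_def conv_cnj cnj_gk)

lemma heat_pairing:
  "Re z > 0 \<Longrightarrow> f \<in> L2 (Rn n) \<Longrightarrow> g \<in> L2 (Rn n) \<Longrightarrow>
     pairing (Rn n) (heat n z t f) g = pairing (Rn n) f (heat n z t g)"
  by (auto simp: heat_def gk_minus intro!: pairing_conv_even kern_gk)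

lemma heat_heat:
  assumes "Re z > 0" "s \<ge> 0" "t \<ge> 0" "f \<in> L2 (Rn n)"
  shows "heat n z s (heat n z t f) x = heat n z (s + t) f x"
proof (cases "s > 0 \<and> t > 0")
  case True
  then show ?thesis using assms
    by (auto simp: heat_def intro!: conv_conv kern_gk gk_semigroup)
next
  case False
  then show ?thesis using assms by (auto simp: heat_def)
qed

section \<open>Contractivity of the complex heat semigroup\<close>

lemma heat_cnj_heat:
  assumes "Re z > 0" "s > 0" "f \<in> L2 (Rn n)"
  shows "heat n z s (heat n (cnj z) s f) x = heat n (of_real (Re z)) (2 * s) f x"
  using assms by (auto simp: heat_def intro!: conv_conv kern_gk gk_cnj_convolution)

text \<open>The adjoint of the evolution with \<open>z\<close> is the evolution with the conjugate
  of \<open>z\<close>, and the two compose to the real heat semigroup at time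
  \<open>2 t Re z\<close>.\<close>

lemma heat_norm_power2:
  assumes "Re z > 0" "t > 0" "f \<in> L2 (Rn n)"
  shows "of_real ((l2norm (Rn n) (heat n z t f))\<^sup>2) = pairing (Rn n) f (heat n (of_real (Re z)) (2 * t) (\<lambda>x. cnj (f x)))"
proof -
  have "of_real ((l2norm (Rn n) (heat n z t f))\<^sup>2) = pairing (Rn n) (heat n z t f) (heat n (cnj z) t (\<lambda>x. cnj (f x)))"
    unfolding pairing_cnj_self[symmetric] using assms by (simp add: heat_cnj)
  also have "\<dots> = pairing (Rn n) f (heat n z t (heat n (cnj z) t (\<lambda>x. cnj (f x))))"
    using assms by (intro heat_pairing heat_L2 L2_cnj) auto
  also have "heat n z t (heat n (cnj z) t (\<lambda>x. cnj (f x))) = heat n (of_real (Re z)) (2 * t) (\<lambda>x. cnj (f x))"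
    using assms by (intro ext heat_cnj_heat L2_cnj)
  finally show ?thesis .
qed

text \<open>Schur's test for the complex kernel gives only the constant
  \<open>(|z| / Re z)^(n/2)\<close>. The squared norm, however, is a pairing with a real heat
  evolution, whose kernel has mass 1.\<close>

lemma heat_contraction:
  assumes "Re z > 0" "f \<in> L2 (Rn n)"
  shows "l2norm (Rn n) (heat n z t f) \<le> l2norm (Rn n) f"
proof (cases "t > 0")
  case True
  let ?c = "complex_of_real (Re z)"
  have mass: "tk_mass n (\<lambda>_. gk ?c (2 * t)) = 1"
    using assms True by (simp add: tk_mass_def gk_real_integral_norm)
  have k: "kern (gk ?c (2 * t))" using assms True by (intro kern_gk) auto
  have "(l2norm (Rn n) (heat n z t f))\<^sup>2 = cmod (of_real ((l2norm (Rn n) (heat n z t f))\<^sup>2))"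
    by (simp only: norm_of_real) simp
  also have "\<dots> \<le> l2norm (Rn n) f * l2norm (Rn n) (heat n ?c (2 * t) (\<lambda>x. cnj (f x)))"
    unfolding heat_norm_power2[OF assms(1) True assms(2)] using assms
    by (intro pairing_bound heat_L2 L2_cnj) auto
  also have "l2norm (Rn n) (heat n ?c (2 * t) (\<lambda>x. cnj (f x))) \<le> l2norm (Rn n) f"
    using l2norm_conv_le[of n "\<lambda>_. gk ?c (2 * t)" "\<lambda>x. cnj (f x)", OF k L2_cnj[OF assms(2)]] True mass
    by (simp add: heat_def)
  finally have "(l2norm (Rn n) (heat n z t f))\<^sup>2 \<le> (l2norm (Rn n) f)\<^sup>2"
    by (simp add: power2_eq_square mult_left_mono)
  then show ?thesis by (rule power2_le_imp_le) simp
qed (simp add: heat_def)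

subsection \<open>Strong continuity\<close>

lemma gk_conv_bump_integrable:
  assumes "Re z > 0" "t > 0" "f \<in> bumps" "g \<in> bumps"
  shows "integrable lborel (\<lambda>x. (\<integral>y. gk z t (x - y) * f y \<partial>lborel) * g x)"
proof -
  have [measurable]: "f \<in> borel_measurable borel" "g \<in> borel_measurable borel" using assms by measurable
  obtain C where C: "C > 0" "\<And>x. cmod (f x) \<le> C" using bumps_bounded[OF assms(3)] by blast
  have k: "kern (gk z t)" using assms by (intro kern_gk)
  let ?B = "\<integral>y. C * cmod (gk z t y) \<partial>lborel"
  have b: "cmod (\<integral>y. gk z t (x - y) * f y \<partial>lborel) \<le> ?B" for x
  proof -
    have i: "integrable lborel (\<lambda>y. C * cmod (gk z t (x - y)))"
      using kern_integrable[OF kern_shift(2)[OF k, of x]] by simp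
    have bd: "cmod (gk z t (x - y) * f y) \<le> C * cmod (gk z t (x - y))" for y
      using C(2)[of y] by (simp add: norm_mult mult.commute[of C] mult_left_mono)
    have "cmod (\<integral>y. gk z t (x - y) * f y \<partial>lborel) \<le> (\<integral>y. C * cmod (gk z t (x - y)) \<partial>lborel)"
    proof (rule Bochner_Integration.integral_norm_bound_integral[OF _ i bd])
      show "integrable lborel (\<lambda>y. gk z t (x - y) * f y)"
        by (rule Bochner_Integration.integrable_bound[OF i]) (use bd C(1) in \<open>auto intro: order_trans[OF bd]\<close>)
    qed
    also have "\<dots> = ?B" by (rule integral_shift(2)[of "\<lambda>s. C * cmod (gk z t s)"])
    finally show ?thesis .
  qed
  have [measurable]: "(\<lambda>x. \<integral>y. gk z t (x - y) * f y \<partial>lborel) \<in> borel_measurable borel" by measurable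
  show ?thesis
  proof (rule Bochner_Integration.integrable_bound)
    show "integrable lborel (\<lambda>x. ?B * cmod (g x))" using bumps_integrable[OF assms(4)] by simp
    have "cmod ((\<integral>y. gk z t (x - y) * f y \<partial>lborel) * g x) \<le> ?B * cmod (g x)" for x
      unfolding norm_mult by (intro mult_right_mono b) simp
    then show "AE x in lborel. norm ((\<integral>y. gk z t (x - y) * f y \<partial>lborel) * g x) \<le> norm (?B * cmod (g x))"
      by (intro AE_I2) (simp add: order_trans[OF _ abs_ge_self])
  qed measurable
qed

lemma heat_tens:
  assumes "Re z > 0" "t > 0" "\<And>i. i < n \<Longrightarrow> h i \<in> bumps"
  shows "heat n z t (tens n h) x = tens n (\<lambda>i s. \<integral>y. gk z t (s - y) * h i y \<partial>lborel) x"
proof -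
  have "heat n z t (tens n h) x = (\<integral>y. tens n (\<lambda>i s. gk z t (x i - s) * h i s) y \<partial>Rn n)"
    using assms by (simp add: heat_def conv_def tk_snd tens_mult)
  also have "\<dots> = (\<Prod>i<n. \<integral>s. gk z t (x i - s) * h i s \<partial>lborel)"
  proof (rule tens_integral)
    fix i assume i: "i < n"
    have "(\<lambda>s. gk z t (x i - s)) \<in> L2 lborel" "h i \<in> L2 lborel"
      using kern_shift(2)[OF kern_gk(1)[OF assms(1,2)], of "x i"] bumps_kern[OF assms(3)[OF i]]
      by (auto simp: L2_def intro: kern_square_integrable dest: kern_measurable)
    then show "integrable lborel (\<lambda>s. gk z t (x i - s) * h i s)" by (rule L2_mult_integrable)
  qed
  finally show ?thesis by (simp add: tens_def)
qed

lemma pairing_heat_tens: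
  assumes "Re z > 0" "t > 0" "\<And>i. i < n \<Longrightarrow> h i \<in> bumps" "\<And>i. i < n \<Longrightarrow> k i \<in> bumps"
  shows "pairing (Rn n) (heat n z t (tens n h)) (tens n k)
    = (\<Prod>i<n. \<integral>x. (\<integral>y. gk z t (x - y) * h i y \<partial>lborel) * k i x \<partial>lborel)"
proof -
  have "pairing (Rn n) (heat n z t (tens n h)) (tens n k)
      = (\<integral>x. tens n (\<lambda>i s. (\<integral>y. gk z t (s - y) * h i y \<partial>lborel) * k i s) x \<partial>Rn n)"
    using assms by (simp add: pairing_def heat_tens tens_mult)
  also have "\<dots> = (\<Prod>i<n. \<integral>x. (\<integral>y. gk z t (x - y) * h i y \<partial>lborel) * k i x \<partial>lborel)"
    using assms by (intro tens_integral gk_conv_bump_integrable) auto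
  finally show ?thesis .
qed

lemma pairing_tens:
  assumes "\<And>i. i < n \<Longrightarrow> h i \<in> bumps" "\<And>i. i < n \<Longrightarrow> k i \<in> bumps"
  shows "pairing (Rn n) (tens n h) (tens n k) = (\<Prod>i<n. \<integral>x. h i x * k i x \<partial>lborel)"
  unfolding pairing_def tens_mult
  using assms by (intro tens_integral bumps_integrable bumps_mult bumps_smooth)

lemma pairing_heat_tens_tendsto:
  assumes "Re z > 0" "\<And>i. i < n \<Longrightarrow> h i \<in> bumps" "\<And>i. i < n \<Longrightarrow> k i \<in> bumps"
  shows "((\<lambda>t. pairing (Rn n) (heat n z t (tens n h)) (tens n k)) \<longlongrightarrow> pairing (Rn n) (tens n h) (tens n k)) (at_right 0)"
proof (rule Lim_transform_eventually)
  have "pairing (Rn n) (tens n h) (tens n k) = (\<Prod>i<n. \<integral>x. h i x * k i x \<partial>lborel)"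
    by (rule pairing_tens[OF assms(2,3)])
  then show "((\<lambda>t. \<Prod>i<n. \<integral>x. (\<integral>y. gk z t (x - y) * h i y \<partial>lborel) * k i x \<partial>lborel) \<longlongrightarrow> pairing (Rn n) (tens n h) (tens n k)) (at_right 0)"
    using assms by (auto intro!: tendsto_prod gk_weak_tendsto)
  show "\<forall>\<^sub>F t in at_right 0. (\<Prod>i<n. \<integral>x. (\<integral>y. gk z t (x - y) * h i y \<partial>lborel) * k i x \<partial>lborel)
      = pairing (Rn n) (heat n z t (tens n h)) (tens n k)"
    using eventually_at_right_less[of "0::real"] by eventually_elim (use assms in \<open>simp add: pairing_heat_tens\<close>)
qed

text \<open>Expanding the squared norm of the difference leaves pairings only, since the norm of the
  evolved function is itself a pairing at time \<open>2 t\<close>. Each of them tends to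
  \<open>|f|^2\<close>, so weak convergence already gives strong convergence.\<close>

lemma heat_tens_continuous:
  assumes "Re z > 0" "\<And>i. i < n \<Longrightarrow> h i \<in> bumps"
  shows "((\<lambda>t. l2norm (Rn n) (\<lambda>x. heat n z t (tens n h) x - tens n h x)) \<longlongrightarrow> 0) (at_right 0)"
proof -
  let ?f = "tens n h" and ?P = "pairing (Rn n)"
  let ?fc = "\<lambda>x. cnj (?f x)"
  have f: "?f \<in> L2 (Rn n)" by (intro test_functions_L2 tens_bumps_test assms)
  have fc: "?fc \<in> L2 (Rn n)" by (rule L2_cnj[OF f])
  have fct: "?fc = tens n (\<lambda>i s. cnj (h i s))" by (simp add: fun_eq_iff tens_cnj)
  have hc: "(\<lambda>s. cnj (h i s)) \<in> bumps" if "i < n" for i by (rule bumps_cnj[OF assms(2)[OF that]])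
  define a where "a t = ?P ?f (heat n (of_real (Re z)) (2 * t) ?fc)" for t
  define b where "b t = ?P (heat n z t ?f) ?fc" for t
  have "((\<lambda>t. ?P (heat n (of_real (Re z)) t ?fc) ?f) \<longlongrightarrow> ?P ?fc ?f) (at_right 0)"
    unfolding fct using assms hc by (intro pairing_heat_tens_tendsto) auto
  moreover have "filterlim (\<lambda>t::real. 2 * t) (at_right 0) (at_right 0)"
    unfolding filterlim_at by (auto intro!: tendsto_eq_intros eventually_at_right_less[THEN eventually_mono])
  ultimately have a: "(a \<longlongrightarrow> ?P ?f ?fc) (at_right 0)"
    unfolding a_def pairing_commute[of _ ?f] by (rule filterlim_compose)
  have b: "(b \<longlongrightarrow> ?P ?f ?fc) (at_right 0)"
    unfolding b_def fct using assms hc by (intro pairing_heat_tens_tendsto) auto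
  have c: "((\<lambda>t. cnj (b t)) \<longlongrightarrow> ?P ?f ?fc) (at_right 0)"
  proof -
    have "cnj (?P ?f ?fc) = ?P ?f ?fc" unfolding pairing_cnj by (simp add: pairing_commute)
    then show ?thesis using tendsto_cnj[OF b] by simp
  qed
  have "((\<lambda>t. a t - b t - (cnj (b t) - ?P ?f ?fc)) \<longlongrightarrow> ?P ?f ?fc - ?P ?f ?fc - (?P ?f ?fc - ?P ?f ?fc)) (at_right 0)"
    by (intro tendsto_diff a b c tendsto_const)
  then have "((\<lambda>t. Re (a t - b t - (cnj (b t) - ?P ?f ?fc))) \<longlongrightarrow> Re 0) (at_right 0)"
    by (intro tendsto_Re) simp
  moreover have "\<forall>\<^sub>F t in at_right 0. Re (a t - b t - (cnj (b t) - ?P ?f ?fc)) = (l2norm (Rn n) (\<lambda>x. heat n z t ?f x - ?f x))\<^sup>2"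
    using eventually_at_right_less[of "0::real"]
  proof eventually_elim
    case (elim t)
    let ?K = "heat n z t ?f"
    have K: "?K \<in> L2 (Rn n)" by (rule heat_L2[OF assms(1) f])
    have "of_real ((l2norm (Rn n) (\<lambda>x. ?K x - ?f x))\<^sup>2) = ?P (\<lambda>x. ?K x - ?f x) (\<lambda>x. cnj (?K x) - ?fc x)"
      unfolding pairing_cnj_self[symmetric] by simp
    also have "\<dots> = ?P ?K (\<lambda>x. cnj (?K x)) - ?P ?K ?fc - (?P ?f (\<lambda>x. cnj (?K x)) - ?P ?f ?fc)"
      using K f fc L2_cnj[OF K] by (simp add: pairing_diff_left pairing_diff_right L2_diff)
    also have "?P ?K (\<lambda>x. cnj (?K x)) = a t"
      unfolding pairing_cnj_self a_def by (rule heat_norm_power2[OF assms(1) elim f])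
    also have "?P ?f (\<lambda>x. cnj (?K x)) = cnj (b t)"
      unfolding b_def pairing_cnj by (simp add: pairing_commute)
    finally have "of_real ((l2norm (Rn n) (\<lambda>x. ?K x - ?f x))\<^sup>2) = a t - b t - (cnj (b t) - ?P ?f ?fc)"
      by (simp add: b_def)
    then show ?case by (metis Re_complex_of_real)
  qed
  ultimately have "((\<lambda>t. (l2norm (Rn n) (\<lambda>x. heat n z t ?f x - ?f x))\<^sup>2) \<longlongrightarrow> 0) (at_right 0)"
    by (simp add: Lim_transform_eventually)
  from tendsto_real_sqrt[OF this] show ?thesis by simp
qed

text \<open>Contractivity makes the set of good \<open>f\<close> closed, so continuity passes from
  tensor products of bumps to all of \<open>L\<^sup>2\<close>.\<close>

lemma heat_continuous_0:
  assumes z: "Re z > 0" and "f \<in> L2 (Rn n)"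
  shows "((\<lambda>t. l2norm (Rn n) (\<lambda>x. heat n z t f x - f x)) \<longlongrightarrow> 0) (at_right 0)"
  using assms(2)
proof (induct f rule: L2_dense_induct)
  case (lin f g a b)
  have "((\<lambda>t. cmod a * l2norm (Rn n) (\<lambda>x. heat n z t f x - f x) + cmod b * l2norm (Rn n) (\<lambda>x. heat n z t g x - g x))
      \<longlongrightarrow> cmod a * 0 + cmod b * 0) (at_right 0)"
    by (intro tendsto_intros lin)
  then have lim: "((\<lambda>t. cmod a * l2norm (Rn n) (\<lambda>x. heat n z t f x - f x) + cmod b * l2norm (Rn n) (\<lambda>x. heat n z t g x - g x))
      \<longlongrightarrow> 0) (at_right 0)" by simp
  show ?case
  proof (rule Lim_null_comparison[OF _ lim])
    show "\<forall>\<^sub>F t in at_right 0. norm (l2norm (Rn n) (\<lambda>x. heat n z t (\<lambda>x. a * f x + b * g x) x - (a * f x + b * g x)))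
        \<le> cmod a * l2norm (Rn n) (\<lambda>x. heat n z t f x - f x) + cmod b * l2norm (Rn n) (\<lambda>x. heat n z t g x - g x)"
    proof (rule always_eventually, rule allI)
      fix t
      have F: "(\<lambda>x. heat n z t f x - f x) \<in> L2 (Rn n)" and G: "(\<lambda>x. heat n z t g x - g x) \<in> L2 (Rn n)"
        using lin z by (auto intro!: L2_diff heat_L2)
      have "(\<lambda>x. heat n z t (\<lambda>x. a * f x + b * g x) x - (a * f x + b * g x))
         = (\<lambda>x. a * (heat n z t f x - f x) + b * (heat n z t g x - g x))"
        using lin z by (simp add: heat_lin algebra_simps)
      then show "norm (l2norm (Rn n) (\<lambda>x. heat n z t (\<lambda>x. a * f x + b * g x) x - (a * f x + b * g x)))
        \<le> cmod a * l2norm (Rn n) (\<lambda>x. heat n z t f x - f x) + cmod b * l2norm (Rn n) (\<lambda>x. heat n z t g x - g x)"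
        using l2norm_triangle[OF L2_cmult[OF F, of a] L2_cmult[OF G, of b]] by (simp add: l2norm_cmult)
    qed
  qed
next
  case (lim s f)
  show ?case
  proof (rule tendstoI)
    fix e :: real assume "e > 0"
    then have "e / 3 > 0" by simp
    from LIMSEQ_D[OF lim(4) this] obtain k where "l2norm (Rn n) (\<lambda>x. s k x - f x) < e / 3" by auto
    note k = this
    have "\<forall>\<^sub>F t in at_right 0. l2norm (Rn n) (\<lambda>x. heat n z t (s k) x - s k x) < e / 3"
      using tendstoD[OF lim(3)[of k] \<open>e / 3 > 0\<close>] by (simp add: dist_real_def)
    then show "\<forall>\<^sub>F t in at_right 0. dist (l2norm (Rn n) (\<lambda>x. heat n z t f x - f x)) 0 < e"
    proof eventually_elim
      case (elim t)
      have L: "f \<in> L2 (Rn n)" "s k \<in> L2 (Rn n)" "heat n z t f \<in> L2 (Rn n)" "heat n z t (s k) \<in> L2 (Rn n)"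
        using lim z by (auto intro: heat_L2)
      have "l2norm (Rn n) (\<lambda>x. heat n z t f x - f x)
        \<le> l2norm (Rn n) (\<lambda>x. heat n z t f x - heat n z t (s k) x) + (l2norm (Rn n) (\<lambda>x. heat n z t (s k) x - s k x) + l2norm (Rn n) (\<lambda>x. s k x - f x))"
        using l2norm_triangle_mid[OF L(3,4,1)] l2norm_triangle_mid[OF L(4,2,1)] by linarith
      also have "l2norm (Rn n) (\<lambda>x. heat n z t f x - heat n z t (s k) x) = l2norm (Rn n) (heat n z t (\<lambda>x. f x - s k x))"
        using heat_diff[OF z L(1,2)] by (intro arg_cong[of _ _ "l2norm (Rn n)"] ext) simp
      also have "\<dots> \<le> l2norm (Rn n) (\<lambda>x. f x - s k x)" by (intro heat_contraction z L2_diff L)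
      also have "\<dots> = l2norm (Rn n) (\<lambda>x. s k x - f x)" by (rule l2norm_minus_commute)
      finally show ?case using k elim by simp
    qed
  qed
next
  case (tens h)
  then show ?case by (intro heat_tens_continuous z)
qed

subsection \<open>Derivatives\<close>

lemma tk_fun_update:
  assumes "i < n"
  shows "tk n (h(i := q)) x y = q (x i - y i) * (\<Prod>j\<in>{..<n} - {i}. h j (x j - y j))"
proof -
  have "tk n (h(i := q)) x y = q (x i - y i) * (\<Prod>j\<in>{..<n} - {i}. (h(i := q)) j (x j - y j))"
    unfolding tk_def using assms by (subst prod.remove[of _ i]) auto
  also have "(\<Prod>j\<in>{..<n} - {i}. (h(i := q)) j (x j - y j)) = (\<Prod>j\<in>{..<n} - {i}. h j (x j - y j))"
    by (rule prod.cong) auto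
  finally show ?thesis .
qed

lemma tk_fst_update: "tk n (h(i := q)) x y = tens n ((\<lambda>j s. h j (s - y j))(i := (\<lambda>s. q (s - y i)))) x"
  unfolding tk_def tens_def by (rule prod.cong) auto

lemma has_vector_derivative_shift:
  assumes "\<And>s. (f has_vector_derivative f' s) (at s)"
  shows "((\<lambda>s. f (s - a)) has_vector_derivative f' (s - a)) (at s)"
proof -
  have "((\<lambda>s. s - a) has_vector_derivative 1) (at s)" by (auto intro!: derivative_eq_intros)
  from vector_diff_chain_at[OF this assms] show ?thesis by (simp add: o_def)
qed

lemma smooth_shift: "smooth f \<Longrightarrow> smooth (\<lambda>s. f (s - a))"
  using smooth_compose_affine[of f "- a" 1] by simp

text \<open>For each fixed \<open>y\<close> the kernel is smooth in \<open>x\<close>, so the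
  derivative moves from the test function to the kernel by parts; \<open>pairing_conv\<close>
  provides the change of order on either side.\<close>

lemma heat_wgrad:
  assumes z: "Re z > 0" and t: "t > 0" and f: "f \<in> L2 (Rn n)"
  shows "wgrad n (heat n z t f) (hgrad n z t f)"
  unfolding wgrad_def
proof safe
  have z0: "z \<noteq> 0" using z by auto
  fix i assume i: "i < n"
  have k: "kern (((\<lambda>_. gk z t)(i := gk1 z t)) j)" for j using kern_gk[OF z t] by auto
  show "hgrad n z t f i \<in> L2 (Rn n)" unfolding hgrad_def by (rule conv_L2[OF k f])
  fix \<phi> assume p: "\<phi> \<in> test_functions n"
  have "pairing (Rn n) (heat n z t f) (partial i \<phi>) = (\<integral>y. f y * (\<integral>x. tk n (\<lambda>_. gk z t) x y * partial i \<phi> x \<partial>Rn n) \<partial>Rn n)"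
    using t kern_gk(1)[OF z t] test_functions_L2[OF test_functions_partial[OF p i]]
    by (simp add: heat_def pairing_conv(2)[OF _ f])
  also have "\<dots> = (\<integral>y. - (f y * (\<integral>x. tk n ((\<lambda>_. gk z t)(i := gk1 z t)) x y * \<phi> x \<partial>Rn n)) \<partial>Rn n)"
  proof (rule Bochner_Integration.integral_cong[OF refl])
    fix y :: "nat \<Rightarrow> real"
    let ?h = "\<lambda>j s. gk z t (s - y j)"
    have "partial i (tens n ?h) = tens n (?h(i := (\<lambda>s. gk1 z t (s - y i))))"
      by (rule tens_partial[where h = ?h and d = "\<lambda>s. gk1 z t (s - y i)", OF i has_vector_derivative_shift[OF gk_deriv(1)[OF z0 t]]])
    moreover have "Ck_fun n k (tens n ?h)" for k by (intro tens_Ck_fun smooth_shift smooth_gk)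
    ultimately have "(\<integral>x. \<phi> x * tens n (?h(i := (\<lambda>s. gk1 z t (s - y i)))) x \<partial>Rn n) = - (\<integral>x. partial i \<phi> x * tens n ?h x \<partial>Rn n)"
      using integral_by_parts[OF p _ i, of "tens n ?h"] by simp
    then have "(\<integral>x. tk n (\<lambda>_. gk z t) x y * partial i \<phi> x \<partial>Rn n) = - (\<integral>x. tk n ((\<lambda>_. gk z t)(i := gk1 z t)) x y * \<phi> x \<partial>Rn n)"
      unfolding tk_fst_update tk_fst[of n "\<lambda>_. gk z t"] by (simp add: mult.commute)
    then show "f y * (\<integral>x. tk n (\<lambda>_. gk z t) x y * partial i \<phi> x \<partial>Rn n) = - (f y * (\<integral>x. tk n ((\<lambda>_. gk z t)(i := gk1 z t)) x y * \<phi> x \<partial>Rn n))"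
      by simp
  qed
  also have "\<dots> = - pairing (Rn n) (hgrad n z t f i) \<phi>"
    unfolding hgrad_def by (subst pairing_conv(2)[OF k f test_functions_L2[OF p]]) simp
  finally show "pairing (Rn n) (heat n z t f) (partial i \<phi>) = - pairing (Rn n) (hgrad n z t f i) \<phi>" .
qed

lemma tk_gk_deriv:
  assumes "z \<noteq> 0" "s > 0"
  shows "((\<lambda>s. tk n (\<lambda>_. gk z s) x y) has_vector_derivative (\<Sum>i<n. z * tk n ((\<lambda>_. gk z s)(i := gk2 z s)) x y)) (at s)"
proof -
  have "((\<lambda>s. \<Prod>i<n. gk z s (x i - y i)) has_derivative
     (\<lambda>h. \<Sum>i<n. (h *\<^sub>R (z * gk2 z s (x i - y i))) * (\<Prod>j\<in>{..<n} - {i}. gk z s (x j - y j)))) (at s)"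
    using heat_equation_1D[OF assms] by (intro has_derivative_prod) (simp add: has_vector_derivative_def)
  moreover have "(\<Sum>i<n. (h *\<^sub>R (z * gk2 z s (x i - y i))) * (\<Prod>j\<in>{..<n} - {i}. gk z s (x j - y j)))
     = h *\<^sub>R (\<Sum>i<n. z * tk n ((\<lambda>_. gk z s)(i := gk2 z s)) x y)" for h
    unfolding scaleR_sum_right by (rule sum.cong) (auto simp: tk_fun_update)
  ultimately show ?thesis unfolding has_vector_derivative_def tk_def[of n "\<lambda>_. gk z _"] by simp
qed

text \<open>By the heat equation the time derivative of the kernel is \<open>z\<close> times a sum
  of second derivatives in space, and one of the two is handed over to \<open>v\<close>. The pairing
  is written as a double integral so that differentiation under the integral sign applies.\<close>

lemma heat_deriv:
  assumes z: "Re z > 0" and t: "t > 0" and f: "f \<in> L2 (Rn n)" and v: "v \<in> L2 (Rn n)" "wgrad n v g"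
  shows "((\<lambda>t. pairing (Rn n) (heat n z t f) v) has_vector_derivative
     - z * (\<Sum>i<n. pairing (Rn n) (hgrad n z t f i) (g i))) (at t)"
proof -
  have z0: "z \<noteq> 0" using z by auto
  let ?MM = "Rn n \<Otimes>\<^sub>M Rn n"
  obtain A c where Ac: "A > 0" "c > 0"
    "\<And>s x. t / 2 \<le> s \<Longrightarrow> s \<le> 2 * t \<Longrightarrow> cmod (gk z s x) \<le> env A c x"
    "\<And>s x. t / 2 \<le> s \<Longrightarrow> s \<le> 2 * t \<Longrightarrow> cmod (gk1 z s x) \<le> env A c x"
    "\<And>s x. t / 2 \<le> s \<Longrightarrow> s \<le> 2 * t \<Longrightarrow> cmod (gk2 z s x) \<le> env A c x"
    using gk_envelope[OF z t] by metis
  have kE: "kern (\<lambda>x. complex_of_real (env A c x))" using Ac by (intro kern_env) auto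
  have E: "cmod (tk n (\<lambda>_ x. complex_of_real (env A c x)) x y) = (\<Prod>i<n. env A c (x i - y i))" for x y
  proof -
    have "cmod (complex_of_real (env A c u)) = env A c u" for u
      using Ac(1) by (simp only: norm_of_real) (simp add: env_def)
    then show ?thesis by (simp only: tk_def prod_norm[symmetric])
  qed
  have k2: "kern (((\<lambda>_. gk z s)(i := gk2 z s)) j)" if "s > 0" for s i j using kern_gk[OF z that] by auto
  define F where "F s p = (case p of (x, y) \<Rightarrow> tk n (\<lambda>_. gk z s) x y * f y * v x)" for s p
  define F' where "F' s p = (\<Sum>i<n. z * (case p of (x, y) \<Rightarrow> tk n ((\<lambda>_. gk z s)(i := gk2 z s)) x y * f y * v x))" for s p
  have F'_eq: "F' s (x, y) = (\<Sum>i<n. z * tk n ((\<lambda>_. gk z s)(i := gk2 z s)) x y) * (f y * v x)" for s x y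
    by (simp add: F'_def sum_distrib_right mult.assoc)
  have F'_int: "integrable ?MM (\<lambda>p. z * (case p of (x, y) \<Rightarrow> tk n ((\<lambda>_. gk z s)(i := gk2 z s)) x y * f y * v x))" if "s > 0" for s i
    by (intro integrable_mult_right impI schur_integrable k2 that f v)
  have D: "((\<lambda>s. \<integral>p. F s p \<partial>?MM) has_vector_derivative (\<integral>p. F' t p \<partial>?MM)) (at t)"
  \<comment> \<open>Radius \<open>t / 2\<close> keeps all times between \<open>t / 2\<close> and
    \<open>2 t\<close>, the range of the envelope.\<close>
  proof (rule has_vector_derivative_integral[of "t / 2" t])
    show "t / 2 > 0" using t by simp
    fix s assume s: "\<bar>s - t\<bar> < t / 2"
    then have s0: "s > 0" "t / 2 \<le> s" "s \<le> 2 * t" using t by (auto simp: abs_if split: if_splits)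
    show "integrable ?MM (F s)" unfolding F_def by (intro schur_integrable kern_gk z s0 f v)
    fix p :: "(nat \<Rightarrow> real) \<times> (nat \<Rightarrow> real)"
    obtain x y where p: "p = (x, y)" by (cases p)
    show "((\<lambda>s. F s p) has_vector_derivative F' s p) (at s)"
      unfolding p F'_eq unfolding F_def split_conv mult.assoc
      by (intro has_vector_derivative_mult_left tk_gk_deriv z0 s0)
    have "cmod (\<Sum>i<n. z * tk n ((\<lambda>_. gk z s)(i := gk2 z s)) x y) \<le> (\<Sum>i<n. cmod z * (\<Prod>i<n. env A c (x i - y i)))"
    proof (rule sum_norm_le)
      fix i assume "i \<in> {..<n}"
      have "cmod (tk n ((\<lambda>_. gk z s)(i := gk2 z s)) x y) \<le> (\<Prod>i<n. env A c (x i - y i))"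
        unfolding tk_def prod_norm[symmetric] using Ac(3,5)[OF s0(2,3)] by (intro prod_mono) auto
      then show "cmod (z * tk n ((\<lambda>_. gk z s)(i := gk2 z s)) x y) \<le> cmod z * (\<Prod>i<n. env A c (x i - y i))"
        unfolding norm_mult by (rule mult_left_mono) simp
    qed
    also have "\<dots> = real n * cmod z * cmod (tk n (\<lambda>_ x. complex_of_real (env A c x)) x y)" by (simp add: E)
    finally have "cmod (F' s p) \<le> real n * cmod z * cmod (tk n (\<lambda>_ x. complex_of_real (env A c x)) x y) * cmod (f y * v x)"
      unfolding p F'_eq norm_mult[of "sum _ _"] by (rule mult_right_mono) simp
    then show "norm (F' s p) \<le> real n * cmod z * cmod (case p of (x, y) \<Rightarrow> tk n (\<lambda>_ x. complex_of_real (env A c x)) x y * f y * v x)"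
      by (simp add: p norm_mult mult.assoc)
  next
    show "integrable ?MM (\<lambda>p. real n * cmod z * cmod (case p of (x, y) \<Rightarrow> tk n (\<lambda>_ x. complex_of_real (env A c x)) x y * f y * v x))"
      by (intro integrable_mult_right impI integrable_norm schur_integrable kE f v)
    show "F' t \<in> borel_measurable ?MM"
      unfolding F'_def[abs_def] using F'_int[OF t] by (intro borel_measurable_sum borel_measurable_integrable)
  qed
  \<comment> \<open>The weak derivative of \<open>v\<close> is tested against a kernel without
    compact support; \<open>wgrad_tens_kern\<close> permits this.\<close>
  have tm: "pairing (Rn n) (conv n ((\<lambda>_. gk z t)(i := gk2 z t)) f) v = - pairing (Rn n) (hgrad n z t f i) (g i)" if i: "i < n" for i
  proof -
    have k1: "kern (((\<lambda>_. gk z t)(i := gk1 z t)) j)" for j using kern_gk[OF z t] by auto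
    have "pairing (Rn n) (conv n ((\<lambda>_. gk z t)(i := gk2 z t)) f) v
        = (\<integral>y. f y * (\<integral>x. tk n ((\<lambda>_. gk z t)(i := gk2 z t)) x y * v x \<partial>Rn n) \<partial>Rn n)"
      by (rule pairing_conv(2)[OF k2[OF t] f v(1)])
    also have "\<dots> = (\<integral>y. - (f y * (\<integral>x. tk n ((\<lambda>_. gk z t)(i := gk1 z t)) x y * g i x \<partial>Rn n)) \<partial>Rn n)"
    proof (rule Bochner_Integration.integral_cong[OF refl])
      fix y :: "nat \<Rightarrow> real"
      let ?h = "(\<lambda>j s. gk z t (s - y j))(i := (\<lambda>s. gk1 z t (s - y i)))"
      have "pairing (Rn n) v (tens n (?h(i := (\<lambda>s. gk2 z t (s - y i))))) = - pairing (Rn n) (g i) (tens n ?h)"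
      proof (rule wgrad_tens_kern[OF v(2,1) i])
        show "smooth (?h j)" "kern (?h j)" for j
          using smooth_shift[OF smooth_gk] smooth_shift[OF smooth_gk1[OF z0 t]] kern_shift(1)[OF kern_gk(1)[OF z t]] kern_shift(1)[OF kern_gk(2)[OF z t]]
          by auto
        show "kern (\<lambda>s. gk2 z t (s - y i))" by (rule kern_shift(1)[OF kern_gk(3)[OF z t]])
        show "(?h i has_vector_derivative gk2 z t (s - y i)) (at s)" for s
          using has_vector_derivative_shift[OF gk_deriv(2)[OF z0 t]] by simp
      qed
      then have "(\<integral>x. tk n ((\<lambda>_. gk z t)(i := gk2 z t)) x y * v x \<partial>Rn n) = - (\<integral>x. tk n ((\<lambda>_. gk z t)(i := gk1 z t)) x y * g i x \<partial>Rn n)"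
        unfolding tk_fst_update by (simp add: pairing_def mult.commute)
      then show "f y * (\<integral>x. tk n ((\<lambda>_. gk z t)(i := gk2 z t)) x y * v x \<partial>Rn n) = - (f y * (\<integral>x. tk n ((\<lambda>_. gk z t)(i := gk1 z t)) x y * g i x \<partial>Rn n))"
        by simp
    qed
    also have "\<dots> = - pairing (Rn n) (hgrad n z t f i) (g i)"
      unfolding hgrad_def by (subst pairing_conv(2)[OF k1 f wgrad_L2[OF v(2) i]]) simp
    finally show ?thesis .
  qed
  have "(\<integral>p. F' t p \<partial>?MM) = (\<Sum>i<n. z * pairing (Rn n) (conv n ((\<lambda>_. gk z t)(i := gk2 z t)) f) v)"
    unfolding F'_def
    by (subst Bochner_Integration.integral_sum, rule F'_int[OF t], simp only: integral_mult_right_zero pairing_conv(1)[OF k2[OF t] f v(1)])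
  also have "\<dots> = - z * (\<Sum>i<n. pairing (Rn n) (hgrad n z t f i) (g i))"
    by (simp add: tm sum_distrib_left sum_negf)
  finally have "((\<lambda>s. \<integral>p. F s p \<partial>?MM) has_vector_derivative - z * (\<Sum>i<n. pairing (Rn n) (hgrad n z t f i) (g i))) (at t)"
    using D by simp
  then show ?thesis
  proof (rule has_vector_derivative_transform_within_open[of _ _ _ "{0<..}"])
    fix s :: real assume "s \<in> {0<..}"
    then show "(\<integral>p. F s p \<partial>?MM) = pairing (Rn n) (heat n z s f) v"
      unfolding F_def using pairing_conv(1)[OF kern_gk(1)[OF z, of s] f v(1)] \<open>s \<in> {0<..}\<close> by (simp add: heat_def)
  qed (use t in auto)
qed

section \<open>The generator\<close>

lemma pairing_divide_left: "pairing M (\<lambda>x. f x / c) h = pairing M f h / c"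
  using pairing_cmult_left[of M "1 / c" f h] by simp

text \<open>\<open>w = z \<Delta> u\<close> in the sense of forms, with \<open>g = \<nabla> u\<close>.\<close>

definition lapg :: "nat \<Rightarrow> complex \<Rightarrow> scalar_field \<Rightarrow> (nat \<Rightarrow> scalar_field) \<Rightarrow> scalar_field \<Rightarrow> bool" where
  "lapg n z u g w \<longleftrightarrow> u \<in> L2 (Rn n) \<and> w \<in> L2 (Rn n) \<and> wgrad n u g \<and>
     (\<forall>v h. v \<in> L2 (Rn n) \<longrightarrow> wgrad n v h \<longrightarrow>
        z * (\<Sum>i<n. pairing (Rn n) (g i) (h i)) = - pairing (Rn n) w v)"

lemma lapgD:
  assumes "lapg n z u g w"
  shows "u \<in> L2 (Rn n)" "w \<in> L2 (Rn n)" "wgrad n u g"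
    "\<And>v h. v \<in> L2 (Rn n) \<Longrightarrow> wgrad n v h \<Longrightarrow> z * (\<Sum>i<n. pairing (Rn n) (g i) (h i)) = - pairing (Rn n) w v"
  using assms by (auto simp: lapg_def)

lemma lapg_diff:
  assumes "lapg n z u g w" "lapg n z u' g' w'"
  shows "lapg n z (\<lambda>x. u x - u' x) (\<lambda>i x. g i x - g' i x) (\<lambda>x. w x - w' x)"
  unfolding lapg_def
proof safe
  note a = lapgD[OF assms(1)] and b = lapgD[OF assms(2)]
  show "(\<lambda>x. u x - u' x) \<in> L2 (Rn n)" "(\<lambda>x. w x - w' x) \<in> L2 (Rn n)"
    using a(1,2) b(1,2) by (auto intro: L2_diff)
  show "wgrad n (\<lambda>x. u x - u' x) (\<lambda>i x. g i x - g' i x)" by (rule wgrad_diff[OF a(3) b(3) a(1) b(1)])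
  fix v h assume v: "v \<in> L2 (Rn n)" "wgrad n v h"
  have "z * (\<Sum>i<n. pairing (Rn n) (\<lambda>x. g i x - g' i x) (h i))
      = z * (\<Sum>i<n. pairing (Rn n) (g i) (h i)) - z * (\<Sum>i<n. pairing (Rn n) (g' i) (h i))"
    using wgrad_L2[OF a(3)] wgrad_L2[OF b(3)] wgrad_L2[OF v(2)]
    by (simp add: pairing_diff_left sum_subtractf algebra_simps)
  also have "\<dots> = - pairing (Rn n) (\<lambda>x. w x - w' x) v"
    unfolding a(4)[OF v] b(4)[OF v] using a(2) b(2) v(1) by (simp add: pairing_diff_left)
  finally show "z * (\<Sum>i<n. pairing (Rn n) (\<lambda>x. g i x - g' i x) (h i)) = - pairing (Rn n) (\<lambda>x. w x - w' x) v" .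
qed

lemma lapg_cong:
  assumes "lapg n z u g w" "wgrad n u g'" shows "lapg n z u g' w"
proof -
  note a = lapgD[OF assms(1)]
  have "pairing (Rn n) (g' i) (h i) = pairing (Rn n) (g i) (h i)" if "wgrad n v h" "i < n" for v h i
    using wgrad_L2[OF assms(2) that(2)] wgrad_L2[OF a(3) that(2)] wgrad_L2[OF that] wgrad_unique[OF assms(2) a(3) that(2)]
    by (intro pairing_cong_AE) auto
  then have "(\<Sum>i<n. pairing (Rn n) (g' i) (h i)) = (\<Sum>i<n. pairing (Rn n) (g i) (h i))" if "wgrad n v h" for v h
    using that by (intro sum.cong) auto
  then show ?thesis using a assms(2) unfolding lapg_def by auto
qed

text \<open>Testing with the conjugate of \<open>u\<close> itself. This identity supplies both the
  control of gradients by \<open>u\<close> and \<open>w\<close> and the dissipativity.\<close>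

lemma lapg_energy:
  assumes "lapg n z u g w"
  shows "z * of_real (\<Sum>i<n. (l2norm (Rn n) (g i))\<^sup>2) = - pairing (Rn n) w (\<lambda>x. cnj (u x))"
  using lapgD(4)[OF assms L2_cnj[OF lapgD(1)[OF assms]] wgrad_cnj[OF lapgD(3)[OF assms]]]
  by (simp add: pairing_cnj_self)

lemma lapg_tens:
  assumes "\<And>i. i < n \<Longrightarrow> h i \<in> bumps"
  shows "\<exists>g w. lapg n z (tens n h) g w"
proof -
  let ?u = "tens n h"
  \<comment> \<open>For a smooth tensor product the operator acts classically, as \<open>z\<close>
    times the sum of second derivatives.\<close>
  let ?w = "\<lambda>x. \<Sum>i<n. z * partial i (partial i ?u) x"
  have u: "?u \<in> test_functions n" by (intro tens_bumps_test assms)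
  have p: "partial i ?u \<in> test_functions n" "partial i (partial i ?u) \<in> test_functions n" if "i < n" for i
    using test_functions_partial[OF u that] test_functions_partial[OF test_functions_partial[OF u that] that] .
  have "lapg n z ?u (\<lambda>i. partial i ?u) ?w"
    unfolding lapg_def
  proof safe
    show "?u \<in> L2 (Rn n)" by (rule test_functions_L2[OF u])
    show "?w \<in> L2 (Rn n)" using p by (intro L2_sum L2_cmult test_functions_L2) auto
    show "wgrad n ?u (\<lambda>i. partial i ?u)" by (rule wgrad_test_function[OF u])
    fix v k assume v: "v \<in> L2 (Rn n)" "wgrad n v k"
    have "z * (\<Sum>i<n. pairing (Rn n) (partial i ?u) (k i)) = (\<Sum>i<n. - (z * pairing (Rn n) (partial i (partial i ?u)) v))"
      unfolding sum_distrib_left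
    proof (rule sum.cong[OF refl])
      fix i assume "i \<in> {..<n}"
      then show "z * pairing (Rn n) (partial i ?u) (k i) = - (z * pairing (Rn n) (partial i (partial i ?u)) v)"
        using wgrad_test[OF v(2) _ p(1), of i] by (simp add: pairing_commute)
    qed
    also have "\<dots> = - pairing (Rn n) ?w v"
    proof -
      have "pairing (Rn n) ?w v = (\<Sum>i<n. pairing (Rn n) (\<lambda>x. z * partial i (partial i ?u) x) v)"
        unfolding pairing_def sum_distrib_right
        by (intro Bochner_Integration.integral_sum L2_mult_integrable[OF L2_cmult[OF test_functions_L2[OF p(2)]] v(1)]) auto
      then show ?thesis by (simp add: pairing_cmult_left sum_negf)
    qed
    finally show "z * (\<Sum>i<n. pairing (Rn n) (partial i ?u) (k i)) = - pairing (Rn n) ?w v" .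
  qed
  then show ?thesis by blast
qed

section \<open>The generator of the heat semigroup is the form Laplacian\<close>

lemma pairing_heat_tendsto_0:
  assumes z: "Re z > 0" and f: "f \<in> L2 (Rn n)" and v: "v \<in> L2 (Rn n)"
  shows "((\<lambda>t. pairing (Rn n) (heat n z t f) v) \<longlongrightarrow> pairing (Rn n) f v) (at_right 0)"
proof -
  have "((\<lambda>t. pairing (Rn n) (heat n z t f) v - pairing (Rn n) f v) \<longlongrightarrow> 0) (at_right 0)"
  proof (rule Lim_null_comparison)
    show "\<forall>\<^sub>F t in at_right 0. norm (pairing (Rn n) (heat n z t f) v - pairing (Rn n) f v)
        \<le> l2norm (Rn n) (\<lambda>x. heat n z t f x - f x) * l2norm (Rn n) v"
      using pairing_bound[OF L2_diff[OF heat_L2[OF z f] f] v] heat_L2[OF z f] f v by (simp add: pairing_diff_left)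
    show "((\<lambda>t. l2norm (Rn n) (\<lambda>x. heat n z t f x - f x) * l2norm (Rn n) v) \<longlongrightarrow> 0) (at_right 0)"
      using tendsto_mult_left_zero[OF heat_continuous_0[OF z f]] by simp
  qed
  then show ?thesis by (simp add: LIM_zero_iff)
qed

lemma lapg_heat_deriv:
  assumes z: "Re z > 0" and t: "t > 0" and f: "f \<in> L2 (Rn n)" and u: "lapg n z u g w"
  shows "((\<lambda>t. pairing (Rn n) (heat n z t f) u) has_vector_derivative pairing (Rn n) (heat n z t f) w) (at t)"
proof -
  have "z * (\<Sum>i<n. pairing (Rn n) (hgrad n z t f i) (g i)) = - pairing (Rn n) (heat n z t f) w"
    using lapgD(4)[OF u heat_L2[OF z f] heat_wgrad[OF z t f]]
    by (simp add: pairing_commute)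
  then show ?thesis using heat_deriv[OF z t f lapgD(1,3)[OF u]] by simp
qed

text \<open>Argue by duality. For each \<open>f\<close> the pairing of \<open>f\<close> with the
  error of the difference quotient is an increment of \<open>\<phi>\<close>, divided by
  \<open>h\<close>; the derivative of \<open>\<phi>\<close> is at most \<open>|f|\<close> times the
  norm of \<open>heat n z t w - w\<close>, so the bound is uniform in \<open>f\<close>.\<close>

lemma heat_generator_of_lapg:
  assumes z: "Re z > 0" and u: "lapg n z u g w"
  shows "((\<lambda>h. l2norm (Rn n) (\<lambda>x. (heat n z h u x - u x) / of_real h - w x)) \<longlongrightarrow> 0) (at_right 0)"
proof (rule tendstoI)
  fix e :: real assume e: "e > 0"
  note uL = lapgD(1)[OF u] and wL = lapgD(2)[OF u]
  have "\<forall>\<^sub>F t in at_right 0. l2norm (Rn n) (\<lambda>x. heat n z t w x - w x) < e / 2"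
    using tendstoD[OF heat_continuous_0[OF z wL], of "e / 2"] e by (simp add: dist_real_def)
  then obtain d where d: "d > 0" "\<And>t. 0 < t \<Longrightarrow> t < d \<Longrightarrow> l2norm (Rn n) (\<lambda>x. heat n z t w x - w x) < e / 2"
    by (auto simp: eventually_at_right_field)
  have small: "l2norm (Rn n) (\<lambda>x. (heat n z h u x - u x) / of_real h - w x) \<le> e / 2" if h: "0 < h" "h < d" for h
  proof (rule l2norm_le_dual)
    show "(\<lambda>x. (heat n z h u x - u x) / of_real h - w x) \<in> L2 (Rn n)"
      by (intro L2_diff L2_divide heat_L2 z uL wL)
    show "0 \<le> e / 2" using e by simp
    fix f assume f: "f \<in> L2 (Rn n)"
    \<comment> \<open>The linear term \<open>t \<langle>f, w\<rangle>\<close> removes the expected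
      derivative, leaving the small one of \<open>d\<phi>\<close>.\<close>
    define \<phi> where "\<phi> t = pairing (Rn n) (heat n z t f) u - of_real t * pairing (Rn n) f w" for t
    have d\<phi>: "(\<phi> has_vector_derivative pairing (Rn n) f (\<lambda>x. heat n z t w x - w x)) (at t)" if t: "t > 0" for t
    proof -
      have "((\<lambda>t. of_real t * pairing (Rn n) f w) has_vector_derivative 1 * pairing (Rn n) f w) (at t)"
        by (intro has_vector_derivative_mult_left has_vector_derivative_of_real[OF DERIV_ident, simplified])
      from has_vector_derivative_diff[OF lapg_heat_deriv[OF z t f u] this]
      have "(\<phi> has_vector_derivative pairing (Rn n) (heat n z t f) w - pairing (Rn n) f w) (at t)"
        unfolding \<phi>_def[abs_def] by simp
      then show ?thesis using heat_pairing[OF z f wL] pairing_diff_right[OF heat_L2[OF z wL] wL f] by simp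
    qed
    have bd: "cmod (\<phi> h - \<phi> s) \<le> (l2norm (Rn n) f * (e / 2)) * h" if s: "0 < s" "s < h" for s
    proof -
      have "cmod (\<phi> h - \<phi> s) \<le> (l2norm (Rn n) f * (e / 2)) * \<bar>h - s\<bar>"
      proof (rule norm_diff_le_of_vector_derivative[of "{s..h}"])
        fix t assume t: "t \<in> {s..h}"
        then show "(\<phi> has_vector_derivative pairing (Rn n) f (\<lambda>x. heat n z t w x - w x)) (at t)" using s by (intro d\<phi>) simp
        have "cmod (pairing (Rn n) f (\<lambda>x. heat n z t w x - w x)) \<le> l2norm (Rn n) f * l2norm (Rn n) (\<lambda>x. heat n z t w x - w x)"
          by (intro pairing_bound f L2_diff heat_L2 z wL)
        also have "\<dots> \<le> l2norm (Rn n) f * (e / 2)"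
          using t s h by (intro mult_left_mono less_imp_le[OF d(2)]) auto
        finally show "cmod (pairing (Rn n) f (\<lambda>x. heat n z t w x - w x)) \<le> l2norm (Rn n) f * (e / 2)" .
      qed (use s in auto)
      also have "\<dots> \<le> (l2norm (Rn n) f * (e / 2)) * h" using s e by (intro mult_left_mono) auto
      finally show ?thesis .
    qed
    have "(\<phi> \<longlongrightarrow> pairing (Rn n) f u - of_real 0 * pairing (Rn n) f w) (at_right 0)"
      unfolding \<phi>_def[abs_def] by (intro tendsto_intros pairing_heat_tendsto_0 z f uL)
    then have "((\<lambda>s. cmod (\<phi> h - \<phi> s)) \<longlongrightarrow> cmod (\<phi> h - pairing (Rn n) f u)) (at_right 0)"
      by (intro tendsto_intros) simp
    moreover have "\<forall>\<^sub>F s in at_right 0. cmod (\<phi> h - \<phi> s) \<le> (l2norm (Rn n) f * (e / 2)) * h"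
      using eventually_at_right_real[OF h(1)] by eventually_elim (use bd in auto)
    ultimately have "cmod (\<phi> h - pairing (Rn n) f u) \<le> (l2norm (Rn n) f * (e / 2)) * h"
      by (intro tendsto_upperbound) auto
    moreover have "\<phi> h - pairing (Rn n) f u = of_real h * pairing (Rn n) (\<lambda>x. (heat n z h u x - u x) / of_real h - w x) f"
    proof -
      have "pairing (Rn n) (\<lambda>x. (heat n z h u x - u x) / of_real h - w x) f
        = (pairing (Rn n) (heat n z h u) f - pairing (Rn n) u f) / of_real h - pairing (Rn n) w f"
        using heat_L2[OF z uL] uL wL f
        by (subst pairing_diff_left) (auto intro!: L2_divide L2_diff simp: pairing_divide_left pairing_diff_left)
      then show ?thesis using h(1) heat_pairing[OF z f uL] by (simp add: \<phi>_def pairing_commute[of _ f] field_simps)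
    qed
    ultimately show "cmod (pairing (Rn n) (\<lambda>x. (heat n z h u x - u x) / of_real h - w x) f) \<le> e / 2 * l2norm (Rn n) f"
      using h(1) by (simp add: norm_mult mult_ac)
  qed
  have "l2norm (Rn n) (\<lambda>x. (heat n z h u x - u x) / of_real h - w x) < e" if "0 < h" "h < d" for h
    using small[OF that] e by linarith
  then show "\<forall>\<^sub>F h in at_right 0. dist (l2norm (Rn n) (\<lambda>x. (heat n z h u x - u x) / of_real h - w x)) 0 < e"
    using d(1) by (auto simp: eventually_at_right_field dist_real_def)
qed

text \<open>The right derivative of the pairing with \<open>v\<close> at time \<open>t\<close> is
  computed twice: through \<open>heat_deriv\<close>, and from the generator limit pushed forward by
  the contraction at time \<open>t\<close>. Working at \<open>t > 0\<close> supplies a gradient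
  before \<open>u\<close> itself is known to have one.\<close>

lemma lapg_heat_of_generator:
  assumes z: "Re z > 0" and uL: "u \<in> L2 (Rn n)" and wL: "w \<in> L2 (Rn n)" and t: "t > 0"
    and gen: "((\<lambda>h. l2norm (Rn n) (\<lambda>x. (heat n z h u x - u x) / of_real h - w x)) \<longlongrightarrow> 0) (at_right 0)"
  shows "lapg n z (heat n z t u) (hgrad n z t u) (heat n z t w)"
  unfolding lapg_def
proof safe
  show "heat n z t u \<in> L2 (Rn n)" "heat n z t w \<in> L2 (Rn n)" by (intro heat_L2 z uL wL)+
  show "wgrad n (heat n z t u) (hgrad n z t u)" by (rule heat_wgrad[OF z t uL])
  fix v h assume v: "v \<in> L2 (Rn n)" "wgrad n v h"
  define \<phi> where "\<phi> s = pairing (Rn n) (heat n z s u) v" for s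
  have "((\<lambda>y. (\<phi> y - \<phi> t) /\<^sub>R (y - t)) \<longlongrightarrow> - z * (\<Sum>i<n. pairing (Rn n) (hgrad n z t u i) (h i))) (at t)"
    using heat_deriv[OF z t uL v] unfolding \<phi>_def[abs_def] has_vector_derivative_at_iff .
  then have 1: "((\<lambda>y. (\<phi> y - \<phi> t) /\<^sub>R (y - t)) \<longlongrightarrow> - z * (\<Sum>i<n. pairing (Rn n) (hgrad n z t u i) (h i))) (at_right t)"
    by (rule filterlim_mono) (auto simp: at_le)
  have 2: "((\<lambda>y. (\<phi> y - \<phi> t) /\<^sub>R (y - t)) \<longlongrightarrow> pairing (Rn n) (heat n z t w) v) (at_right t)"
  proof -
    have shift: "filterlim (\<lambda>y. y - t) (at_right 0) (at_right t)"
      unfolding filterlim_at by (auto intro!: tendsto_eq_intros eventually_at_right_less[THEN eventually_mono])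
    have "((\<lambda>y. (\<phi> y - \<phi> t) /\<^sub>R (y - t) - pairing (Rn n) (heat n z t w) v) \<longlongrightarrow> 0) (at_right t)"
    proof (rule Lim_null_comparison)
      show "((\<lambda>y. l2norm (Rn n) (\<lambda>x. (heat n z (y - t) u x - u x) / of_real (y - t) - w x) * l2norm (Rn n) v) \<longlongrightarrow> 0) (at_right t)"
        using tendsto_mult_left_zero[OF filterlim_compose[OF gen shift]] by simp
      show "\<forall>\<^sub>F y in at_right t. norm ((\<phi> y - \<phi> t) /\<^sub>R (y - t) - pairing (Rn n) (heat n z t w) v)
          \<le> l2norm (Rn n) (\<lambda>x. (heat n z (y - t) u x - u x) / of_real (y - t) - w x) * l2norm (Rn n) v"
        using eventually_at_right_less[of t]
      proof eventually_elim
        case (elim y)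
        let ?q = "\<lambda>x. (heat n z (y - t) u x - u x) / of_real (y - t) - w x"
        have q1: "(\<lambda>x. heat n z (y - t) u x - u x) \<in> L2 (Rn n)" by (intro L2_diff heat_L2 z uL)
        have q: "?q \<in> L2 (Rn n)" by (intro L2_diff L2_divide q1 wL)
        have "heat n z t ?q x = (heat n z y u x - heat n z t u x) / of_real (y - t) - heat n z t w x" for x
        proof -
          have "heat n z t ?q x = heat n z t (\<lambda>x. (1 / of_real (y - t)) * (heat n z (y - t) u x - u x) + (-1) * w x) x"
            by simp
          also have "\<dots> = (1 / of_real (y - t)) * heat n z t (\<lambda>x. heat n z (y - t) u x - u x) x + (-1) * heat n z t w x"
            by (rule heat_lin[OF z q1 wL])
          also have "heat n z t (\<lambda>x. heat n z (y - t) u x - u x) x = heat n z t (heat n z (y - t) u) x - heat n z t u x"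
            by (rule heat_diff[OF z heat_L2[OF z uL] uL])
          also have "heat n z t (heat n z (y - t) u) x = heat n z y u x"
            using heat_heat[OF z _ _ uL, of t "y - t"] t elim by simp
          finally show ?thesis by simp
        qed
        then have eq: "heat n z t ?q = (\<lambda>x. (heat n z y u x - heat n z t u x) / of_real (y - t) - heat n z t w x)" by (rule ext)
        have "pairing (Rn n) (heat n z t ?q) v = (\<phi> y - \<phi> t) /\<^sub>R (y - t) - pairing (Rn n) (heat n z t w) v"
        proof -
          have "pairing (Rn n) (heat n z t ?q) v
            = (pairing (Rn n) (heat n z y u) v - pairing (Rn n) (heat n z t u) v) / of_real (y - t) - pairing (Rn n) (heat n z t w) v"
            unfolding eq using heat_L2[OF z uL] heat_L2[OF z wL] v(1)
            by (subst pairing_diff_left) (auto intro!: L2_divide L2_diff simp: pairing_divide_left pairing_diff_left)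
          then show ?thesis unfolding \<phi>_def by (simp add: scaleR_conv_of_real divide_inverse mult.commute)
        qed
        then have "norm ((\<phi> y - \<phi> t) /\<^sub>R (y - t) - pairing (Rn n) (heat n z t w) v) \<le> l2norm (Rn n) (heat n z t ?q) * l2norm (Rn n) v"
          using pairing_bound[OF heat_L2[OF z q] v(1), of t] by simp
        also have "\<dots> \<le> l2norm (Rn n) ?q * l2norm (Rn n) v"
          by (intro mult_right_mono heat_contraction z q) simp
        finally show ?case .
      qed
    qed
    then show ?thesis by (simp add: LIM_zero_iff)
  qed
  have "- z * (\<Sum>i<n. pairing (Rn n) (hgrad n z t u i) (h i)) = pairing (Rn n) (heat n z t w) v"
    by (rule tendsto_unique[OF _ 1 2]) simp
  then show "z * (\<Sum>i<n. pairing (Rn n) (hgrad n z t u i) (h i)) = - pairing (Rn n) (heat n z t w) v"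
    by (simp add: minus_equation_iff)
qed

text \<open>Along times tending to 0 the smoothed pairs converge to \<open>u\<close> and
  \<open>w\<close>. The energy identity makes their gradients a Cauchy sequence, and closedness of
  the weak gradient gives the relation in the limit.\<close>

lemma lapg_of_heat_generator:
  assumes z: "Re z > 0" "cmod z = 1" and uL: "u \<in> L2 (Rn n)" and wL: "w \<in> L2 (Rn n)"
    and gen: "((\<lambda>h. l2norm (Rn n) (\<lambda>x. (heat n z h u x - u x) / of_real h - w x)) \<longlongrightarrow> 0) (at_right 0)"
  shows "\<exists>g. lapg n z u g w"
proof -
  \<comment> \<open>Half of \<open>(1/3)^k\<close> makes consecutive terms differ by at most
    \<open>(1/3)^k\<close>, the rate required by \<open>L2_complete_fast\<close>.\<close>
  have ex: "\<exists>t>0. l2norm (Rn n) (\<lambda>x. heat n z t u x - u x) < (1/3) ^ k / 2 \<and> l2norm (Rn n) (\<lambda>x. heat n z t w x - w x) < (1/3) ^ k / 2" for k :: nat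
  proof -
    have p: "(1/3) ^ k / 2 > (0::real)" by simp
    have "\<forall>\<^sub>F t in at_right 0. 0 < t \<and> l2norm (Rn n) (\<lambda>x. heat n z t u x - u x) < (1/3) ^ k / 2 \<and> l2norm (Rn n) (\<lambda>x. heat n z t w x - w x) < (1/3) ^ k / 2"
      using eventually_at_right_less[of "0::real"] tendstoD[OF heat_continuous_0[OF z(1) uL] p] tendstoD[OF heat_continuous_0[OF z(1) wL] p]
      by eventually_elim (simp add: dist_real_def)
    then show ?thesis using eventually_happens'[of "at_right (0::real)"] by (metis (no_types, lifting) trivial_limit_at_right_real)
  qed
  then have "\<forall>k. \<exists>t. 0 < t \<and> l2norm (Rn n) (\<lambda>x. heat n z t u x - u x) < (1/3) ^ k / 2 \<and> l2norm (Rn n) (\<lambda>x. heat n z t w x - w x) < (1/3) ^ k / 2"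
    by (intro allI ex)
  from choice[OF this] obtain t where
    t0: "\<forall>k. 0 < t k \<and> l2norm (Rn n) (\<lambda>x. heat n z (t k) u x - u x) < (1/3) ^ k / 2 \<and> l2norm (Rn n) (\<lambda>x. heat n z (t k) w x - w x) < (1/3) ^ k / 2"
    by (rule exE)
  then have t: "\<And>k. t k > 0" "\<And>k. l2norm (Rn n) (\<lambda>x. heat n z (t k) u x - u x) < (1/3) ^ k / 2"
    "\<And>k. l2norm (Rn n) (\<lambda>x. heat n z (t k) w x - w x) < (1/3) ^ k / 2" by simp_all
  define U W G where "U k = heat n z (t k) u" and "W k = heat n z (t k) w" and "G k = hgrad n z (t k) u" for k
  have L: "lapg n z (U k) (G k) (W k)" for k
    unfolding U_def W_def G_def by (rule lapg_heat_of_generator[OF z(1) uL wL t(1) gen])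
  note UL = lapgD(1)[OF L] and WL = lapgD(2)[OF L] and GW = lapgD(3)[OF L]
  have step: "l2norm (Rn n) (\<lambda>x. V (Suc k) x - V k x) \<le> (1/3) ^ k"
    if "\<And>k. V k \<in> L2 (Rn n)" "v \<in> L2 (Rn n)" "\<And>k. l2norm (Rn n) (\<lambda>x. V k x - v x) < (1/3) ^ k / 2" for V v k
  proof -
    have "l2norm (Rn n) (\<lambda>x. V (Suc k) x - V k x) \<le> l2norm (Rn n) (\<lambda>x. V (Suc k) x - v x) + l2norm (Rn n) (\<lambda>x. v x - V k x)"
      by (rule l2norm_triangle_mid[OF that(1,2,1)])
    also have "\<dots> \<le> (1/3) ^ Suc k / 2 + (1/3) ^ k / 2"
      using that(3)[of "Suc k"] that(3)[of k] by (simp add: l2norm_minus_commute[of _ v])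
    also have "\<dots> \<le> (1/3) ^ k" by simp
    finally show ?thesis .
  qed
  \<comment> \<open>Energy identity for the difference of two members: the squared gradient is at
    most a product of two norms of size \<open>(1/3)^k\<close>; this uses
    \<open>|z| = 1\<close>.\<close>
  have G_fast: "l2norm (Rn n) (\<lambda>x. G (Suc k) i x - G k i x) \<le> (1/3) ^ k" if i: "i < n" for k i
  proof -
    let ?S = "\<Sum>i<n. (l2norm (Rn n) (\<lambda>x. G (Suc k) i x - G k i x))\<^sup>2"
    have S0: "?S \<ge> 0" by (simp add: sum_nonneg)
    have "(l2norm (Rn n) (\<lambda>x. G (Suc k) i x - G k i x))\<^sup>2 \<le> ?S"
      using i by (intro member_le_sum) auto
    also have "?S = cmod (z * of_real ?S)" using S0 by (simp only: norm_mult z(2) norm_of_real abs_of_nonneg mult_1)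
    also have "\<dots> = cmod (pairing (Rn n) (\<lambda>x. W (Suc k) x - W k x) (\<lambda>x. cnj (U (Suc k) x - U k x)))"
      unfolding lapg_energy[OF lapg_diff[OF L L]] by simp
    also have "\<dots> \<le> l2norm (Rn n) (\<lambda>x. W (Suc k) x - W k x) * l2norm (Rn n) (\<lambda>x. cnj (U (Suc k) x - U k x))"
      by (intro pairing_bound L2_diff WL L2_cnj UL)
    also have "\<dots> = l2norm (Rn n) (\<lambda>x. W (Suc k) x - W k x) * l2norm (Rn n) (\<lambda>x. U (Suc k) x - U k x)"
      by (simp only: l2norm_cnj)
    also have "\<dots> \<le> (1/3) ^ k * (1/3) ^ k"
      by (intro mult_mono step[of W w] step[of U u] UL WL uL wL) (use t in \<open>auto simp: U_def W_def\<close>)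
    finally have "(l2norm (Rn n) (\<lambda>x. G (Suc k) i x - G k i x))\<^sup>2 \<le> ((1/3) ^ k)\<^sup>2" by (simp add: power2_eq_square)
    then show ?thesis by (rule power2_le_imp_le) simp
  qed
  have ex_g: "\<exists>h. i < n \<longrightarrow> h \<in> L2 (Rn n) \<and> (\<lambda>k. l2norm (Rn n) (\<lambda>x. G k i x - h x)) \<longlonglongrightarrow> 0" for i
  proof (cases "i < n")
    case True
    obtain h where "h \<in> L2 (Rn n)" "(\<lambda>k. l2norm (Rn n) (\<lambda>x. G k i x - h x)) \<longlonglongrightarrow> 0"
      using L2_complete_fast[of "\<lambda>k. G k i" "Rn n", OF wgrad_L2[OF GW True] G_fast[OF True]] .
    then show ?thesis by blast
  qed simp
  have "\<forall>i. \<exists>h. i < n \<longrightarrow> h \<in> L2 (Rn n) \<and> (\<lambda>k. l2norm (Rn n) (\<lambda>x. G k i x - h x)) \<longlonglongrightarrow> 0"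
    by (intro allI ex_g)
  from choice[OF this] obtain g where
    g0: "\<forall>i. i < n \<longrightarrow> g i \<in> L2 (Rn n) \<and> (\<lambda>k. l2norm (Rn n) (\<lambda>x. G k i x - g i x)) \<longlonglongrightarrow> 0"
    by (rule exE)
  then have g: "\<And>i. i < n \<Longrightarrow> g i \<in> L2 (Rn n)" "\<And>i. i < n \<Longrightarrow> (\<lambda>k. l2norm (Rn n) (\<lambda>x. G k i x - g i x)) \<longlonglongrightarrow> 0"
    by simp_all
  have pow: "(\<lambda>k. (1/3) ^ k / 2) \<longlonglongrightarrow> (0::real)"
    using tendsto_divide[OF LIMSEQ_realpow_zero[of "1/3"] tendsto_const[of "2::real"]] by simp
  have Ulim: "(\<lambda>k. l2norm (Rn n) (\<lambda>x. U k x - u x)) \<longlonglongrightarrow> 0"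
    by (rule Lim_null_comparison[OF _ pow]) (use less_imp_le[OF t(2)] in \<open>simp add: U_def\<close>)
  have Wlim: "(\<lambda>k. l2norm (Rn n) (\<lambda>x. W k x - w x)) \<longlonglongrightarrow> 0"
    by (rule Lim_null_comparison[OF _ pow]) (use less_imp_le[OF t(3)] in \<open>simp add: W_def\<close>)
  have gw: "wgrad n u g" by (rule wgrad_closed[OF GW UL uL g(1) Ulim g(2)])
  have "lapg n z u g w"
    unfolding lapg_def
  proof safe
    fix v h assume v: "v \<in> L2 (Rn n)" "wgrad n v h"
    have "(\<lambda>k. z * (\<Sum>i<n. pairing (Rn n) (G k i) (h i))) \<longlonglongrightarrow> z * (\<Sum>i<n. pairing (Rn n) (g i) (h i))"
    proof (intro tendsto_mult tendsto_const tendsto_sum)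
      fix i assume "i \<in> {..<n}"
      then have i: "i < n" by simp
      show "(\<lambda>k. pairing (Rn n) (G k i) (h i)) \<longlonglongrightarrow> pairing (Rn n) (g i) (h i)"
        by (rule pairing_tendsto[OF g(1)[OF i] wgrad_L2[OF GW i] wgrad_L2[OF v(2) i] g(2)[OF i]])
    qed
    moreover have "(\<lambda>k. - pairing (Rn n) (W k) v) \<longlonglongrightarrow> - pairing (Rn n) w v"
      by (rule tendsto_minus[OF pairing_tendsto[OF wL WL v(1) Wlim]])
    ultimately show "z * (\<Sum>i<n. pairing (Rn n) (g i) (h i)) = - pairing (Rn n) w v"
      unfolding lapgD(4)[OF L v] by (rule LIMSEQ_unique)
  qed (use uL wL gw in auto)
  then show ?thesis by blast
qed

subsection \<open>Identification with the operator associated with the form\<close>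

lemma scalar_matrix_sprod:
  fixes z :: complex
  assumes "v \<in> carrier_vec n" "w \<in> carrier_vec n"
  shows "((z \<cdot>\<^sub>m 1\<^sub>m n) *\<^sub>v v) \<bullet>c w = z * (\<Sum>i<n. vec_index v i * cnj (vec_index w i))"
proof -
  have "(z \<cdot>\<^sub>m 1\<^sub>m n) *\<^sub>v v = z \<cdot>\<^sub>v v" using assms by (intro eq_vecI) auto
  then have "((z \<cdot>\<^sub>m 1\<^sub>m n) *\<^sub>v v) \<bullet>c w = z * (v \<bullet>c w)" using assms by simp
  also have "v \<bullet>c w = (\<Sum>i<n. vec_index v i * cnj (vec_index w i))"
    using assms by (simp add: scalar_prod_def atLeast0LessThan conjugate_complex_def)
  finally show ?thesis .
qed

lemma div_form_scalar:
  assumes "u \<in> H1 n" "v \<in> H1 n"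
  shows "div_form n (\<lambda>_. z \<cdot>\<^sub>m 1\<^sub>m n) u v
    = z * (\<Sum>i<n. pairing (Rn n) (\<lambda>x. vec_index (grad n u x) i) (\<lambda>x. cnj (vec_index (grad n v x) i)))"
proof -
  have "div_form n (\<lambda>_. z \<cdot>\<^sub>m 1\<^sub>m n) u v = (\<integral>x. z * (\<Sum>i<n. vec_index (grad n u x) i * cnj (vec_index (grad n v x) i)) \<partial>Rn n)"
    unfolding div_form_def
    by (intro Bochner_Integration.integral_cong[OF refl] scalar_matrix_sprod weak_gradient_carrier[OF grad_weak] assms)
  also have "\<dots> = z * (\<Sum>i<n. \<integral>x. vec_index (grad n u x) i * cnj (vec_index (grad n v x) i) \<partial>Rn n)"
    using wgrad_L2[OF wgrad_grad[OF assms(1)]] wgrad_L2[OF wgrad_grad[OF assms(2)]]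
    by (subst integral_mult_right_zero, subst Bochner_Integration.integral_sum) (auto intro!: L2_mult_integrable L2_cnj)
  finally show ?thesis by (simp add: pairing_def)
qed

text \<open>Replacing \<open>v\<close> by its conjugate turns the sesquilinear form into the
  bilinear relation, and uniqueness of weak gradients allows any gradient in place of the one chosen
  by \<open>grad\<close>.\<close>

lemma div_op_iff_lapg:
  "div_op n (\<lambda>_. z \<cdot>\<^sub>m 1\<^sub>m n) u (\<lambda>x. - w x) \<longleftrightarrow> (\<exists>g. lapg n z u g w)"
proof
  let ?A = "\<lambda>_. z \<cdot>\<^sub>m 1\<^sub>m n"
  assume d: "div_op n ?A u (\<lambda>x. - w x)"
  then have u: "u \<in> H1 n" and w: "w \<in> L2 (Rn n)"
    and f: "\<And>v. v \<in> H1 n \<Longrightarrow> div_form n ?A u v = L2_inner n (\<lambda>x. - w x) v"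
    using L2_uminus[of "\<lambda>x. - w x" "Rn n"] by (auto simp: div_op_def Lp_2)
  let ?g = "\<lambda>i x. vec_index (grad n u x) i"
  have "lapg n z u ?g w"
    unfolding lapg_def
  proof safe
    show "u \<in> L2 (Rn n)" "wgrad n u ?g" using u H1_L2 wgrad_grad by auto
    fix v h assume v: "v \<in> L2 (Rn n)" "wgrad n v h"
    let ?v = "\<lambda>x. cnj (v x)"
    have v': "?v \<in> H1 n" using L2_cnj[OF v(1)] wgrad_cnj[OF v(2)] by (auto simp: H1_iff)
    have "pairing (Rn n) (?g i) (\<lambda>x. cnj (vec_index (grad n ?v x) i)) = pairing (Rn n) (?g i) (h i)" if i: "i < n" for i
    proof (rule pairing_cong_AE)
      show "AE x in Rn n. cnj (vec_index (grad n ?v x) i) = h i x"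
        using wgrad_unique[OF wgrad_grad[OF v'] wgrad_cnj[OF v(2)] i] by eventually_elim simp
    qed (use wgrad_L2[OF wgrad_grad[OF u] i] wgrad_L2[OF v(2) i] L2_cnj[OF wgrad_L2[OF wgrad_grad[OF v'] i]] in \<open>auto dest: L2_measurable\<close>)
    then have "z * (\<Sum>i<n. pairing (Rn n) (?g i) (h i)) = div_form n ?A u ?v"
      unfolding div_form_scalar[OF u v'] by simp
    also have "\<dots> = - pairing (Rn n) w v" unfolding f[OF v'] by (simp add: L2_inner_def pairing_def)
    finally show "z * (\<Sum>i<n. pairing (Rn n) (?g i) (h i)) = - pairing (Rn n) w v" .
  qed (rule w)
  then show "\<exists>g. lapg n z u g w" by blast
next
  let ?A = "\<lambda>_. z \<cdot>\<^sub>m 1\<^sub>m n"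
  assume "\<exists>g. lapg n z u g w"
  then obtain g where g: "lapg n z u g w" by blast
  then have u: "u \<in> H1 n" by (auto simp: H1_iff lapg_def)
  note l = lapg_cong[OF g wgrad_grad[OF u]]
  show "div_op n ?A u (\<lambda>x. - w x)"
    unfolding div_op_def
  proof safe
    show "u \<in> H1 n" by (rule u)
    show "(\<lambda>x. - w x) \<in> Lp n 2" unfolding Lp_2 by (rule L2_uminus[OF lapgD(2)[OF g]])
    fix v assume v: "v \<in> H1 n"
    show "div_form n ?A u v = L2_inner n (\<lambda>x. - w x) v"
      unfolding div_form_scalar[OF u v] lapgD(4)[OF l L2_cnj[OF H1_L2[OF v]] wgrad_cnj[OF wgrad_grad[OF v]]]
      by (simp add: L2_inner_def pairing_def)
  qed
qed

lemma heat_C0_semigroup: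
  assumes z: "Re z > 0" shows "L2_C0_semigroup n (heat n z)"
  unfolding L2_C0_semigroup_def L2_bounded_linear_def Lp_2 Lp_norm_2
proof (intro conjI allI impI ballI)
  show "\<exists>C. \<forall>f\<in>L2 (Rn n). l2norm (Rn n) (heat n z t f) \<le> C * l2norm (Rn n) f" for t
    using heat_contraction[OF z] by (intro exI[of _ 1]) auto
  show "((\<lambda>t. l2norm (Rn n) (\<lambda>x. heat n z t f x - f x)) \<longlongrightarrow> 0) (at_right 0)" if "f \<in> L2 (Rn n)" for f
    by (rule heat_continuous_0[OF z that])
qed (use z in \<open>auto simp: heat_lin heat_heat intro!: heat_L2\<close>)

lemma heat_generator_iff:
  assumes "Re z > 0" "cmod z = 1"
  shows "L2_generator n (heat n z) u w \<longleftrightarrow> div_op n (\<lambda>_. z \<cdot>\<^sub>m 1\<^sub>m n) u (\<lambda>x. - w x)"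
  unfolding div_op_iff_lapg L2_generator_def Lp_2 Lp_norm_2
  using lapg_of_heat_generator[OF assms] heat_generator_of_lapg[OF assms(1)] lapgD(1,2) by blast

text \<open>The convolution semigroup witnesses that the choice is made from a nonempty set, so the
  chosen semigroup has the stated properties.\<close>

lemma heat_semigroup_spec:
  assumes "Re z > 0" "cmod z = 1"
  shows "L2_C0_semigroup n (heat_semigroup n (\<lambda>_. z \<cdot>\<^sub>m 1\<^sub>m n))"
    and "L2_generator n (heat_semigroup n (\<lambda>_. z \<cdot>\<^sub>m 1\<^sub>m n)) u w \<longleftrightarrow> (\<exists>g. lapg n z u g w)"
proof -
  let ?A = "\<lambda>_. z \<cdot>\<^sub>m 1\<^sub>m n"
  have "L2_C0_semigroup n (heat_semigroup n ?A) \<and>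
      (\<forall>u w. L2_generator n (heat_semigroup n ?A) u w \<longleftrightarrow> div_op n ?A u (\<lambda>x. - w x))"
    unfolding heat_semigroup_def
    by (rule someI[of _ "heat n z"]) (use heat_C0_semigroup[OF assms(1)] heat_generator_iff[OF assms] in auto)
  then show "L2_C0_semigroup n (heat_semigroup n ?A)"
      "L2_generator n (heat_semigroup n ?A) u w \<longleftrightarrow> (\<exists>g. lapg n z u g w)"
    unfolding div_op_iff_lapg by auto
qed

section \<open>A semigroup is determined by its generator\<close>

context
  fixes n :: nat and T :: "real \<Rightarrow> scalar_field \<Rightarrow> scalar_field"
  assumes T: "L2_C0_semigroup n T"
begin

lemma C0_L2: "t \<ge> 0 \<Longrightarrow> f \<in> L2 (Rn n) \<Longrightarrow> T t f \<in> L2 (Rn n)"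
  using T by (auto simp: L2_C0_semigroup_def L2_bounded_linear_def Lp_2)

lemma C0_bounded: "t \<ge> 0 \<Longrightarrow> \<exists>C\<ge>0. \<forall>f\<in>L2 (Rn n). l2norm (Rn n) (T t f) \<le> C * l2norm (Rn n) f"
proof -
  assume "t \<ge> 0"
  then obtain C where C: "\<forall>f\<in>L2 (Rn n). l2norm (Rn n) (T t f) \<le> C * l2norm (Rn n) f"
    using T by (auto simp: L2_C0_semigroup_def L2_bounded_linear_def Lp_2 Lp_norm_2)
  show ?thesis
  proof (intro exI[of _ "\<bar>C\<bar>"] conjI ballI)
    fix f assume "f \<in> L2 (Rn n)"
    then have "l2norm (Rn n) (T t f) \<le> C * l2norm (Rn n) f" using C by blast
    also have "\<dots> \<le> \<bar>C\<bar> * l2norm (Rn n) f" by (intro mult_right_mono) auto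
    finally show "l2norm (Rn n) (T t f) \<le> \<bar>C\<bar> * l2norm (Rn n) f" .
  qed simp
qed

lemma C0_lin:
  "t \<ge> 0 \<Longrightarrow> f \<in> L2 (Rn n) \<Longrightarrow> g \<in> L2 (Rn n) \<Longrightarrow>
     AE x in Rn n. T t (\<lambda>y. a * f y + b * g y) x = a * T t f x + b * T t g x"
  using T by (auto simp: L2_C0_semigroup_def L2_bounded_linear_def Lp_2)

lemma C0_semigroup: "s \<ge> 0 \<Longrightarrow> t \<ge> 0 \<Longrightarrow> f \<in> L2 (Rn n) \<Longrightarrow> AE x in Rn n. T (s + t) f x = T s (T t f) x"
  using T by (auto simp: L2_C0_semigroup_def Lp_2)

lemma C0_zero: "f \<in> L2 (Rn n) \<Longrightarrow> AE x in Rn n. T 0 f x = f x"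
  using T by (auto simp: L2_C0_semigroup_def Lp_2)

lemma C0_tendsto_0: "f \<in> L2 (Rn n) \<Longrightarrow> ((\<lambda>t. l2norm (Rn n) (\<lambda>x. T t f x - f x)) \<longlongrightarrow> 0) (at_right 0)"
  using T by (auto simp: L2_C0_semigroup_def Lp_2 Lp_norm_2)

lemma C0_diff:
  "t \<ge> 0 \<Longrightarrow> f \<in> L2 (Rn n) \<Longrightarrow> g \<in> L2 (Rn n) \<Longrightarrow> AE x in Rn n. T t (\<lambda>y. f y - g y) x = T t f x - T t g x"
  using C0_lin[of t f g 1 "-1"] by simp

lemma C0_norm_cmult:
  assumes "t \<ge> 0" "f \<in> L2 (Rn n)"
  shows "l2norm (Rn n) (T t (\<lambda>x. a * f x)) = cmod a * l2norm (Rn n) (T t f)"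
proof -
  have "l2norm (Rn n) (T t (\<lambda>x. a * f x)) = l2norm (Rn n) (\<lambda>x. a * T t f x)"
    using C0_lin[OF assms assms(2), of a 0] C0_L2[OF assms] C0_L2[OF assms(1) L2_cmult[OF assms(2), of a]]
    by (intro l2norm_cong_AE) auto
  then show ?thesis by (simp add: l2norm_cmult)
qed

lemma C0_norm_diff:
  assumes "t \<ge> 0" "f \<in> L2 (Rn n)" "g \<in> L2 (Rn n)"
  shows "l2norm (Rn n) (\<lambda>x. T t f x - T t g x) = l2norm (Rn n) (T t (\<lambda>x. f x - g x))"
proof (rule l2norm_cong_AE)
  show "AE x in Rn n. T t f x - T t g x = T t (\<lambda>x. f x - g x) x"
    using C0_diff[OF assms] by eventually_elim simp
  show "(\<lambda>x. T t f x - T t g x) \<in> borel_measurable (Rn n)"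
    by (intro L2_measurable L2_diff C0_L2 assms)
  show "T t (\<lambda>x. f x - g x) \<in> borel_measurable (Rn n)"
    by (intro L2_measurable C0_L2 L2_diff assms)
qed

lemma C0_norm_add:
  assumes "s \<ge> 0" "t \<ge> 0" "f \<in> L2 (Rn n)" "g \<in> L2 (Rn n)"
  shows "l2norm (Rn n) (\<lambda>x. T (s + t) f x - g x) = l2norm (Rn n) (\<lambda>x. T s (T t f) x - g x)"
proof (rule l2norm_cong_AE)
  show "AE x in Rn n. T (s + t) f x - g x = T s (T t f) x - g x"
    using C0_semigroup[OF assms(1-3)] by eventually_elim simp
  show "(\<lambda>x. T (s + t) f x - g x) \<in> borel_measurable (Rn n)" "(\<lambda>x. T s (T t f) x - g x) \<in> borel_measurable (Rn n)"
    using assms by (auto intro!: L2_measurable L2_diff C0_L2)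
qed

text \<open>The best operator bound at time \<open>t\<close>; requiring \<open>0 \<le> C\<close>
  keeps the set bounded below, so that \<open>Inf\<close> behaves.\<close>

definition op_norm :: "real \<Rightarrow> real" where
  "op_norm t = Inf {C. 0 \<le> C \<and> (\<forall>f\<in>L2 (Rn n). l2norm (Rn n) (T t f) \<le> C * l2norm (Rn n) f)}"

section \<open>A bound on the operator norms uniform near time zero\<close>

lemma op_norm_bound:
  assumes "t \<ge> 0" "f \<in> L2 (Rn n)"
  shows "l2norm (Rn n) (T t f) \<le> op_norm t * l2norm (Rn n) f"
proof -
  let ?S = "{C. 0 \<le> C \<and> (\<forall>f\<in>L2 (Rn n). l2norm (Rn n) (T t f) \<le> C * l2norm (Rn n) f)}"
  have ne: "?S \<noteq> {}" using C0_bounded[OF assms(1)] by blast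
  show ?thesis
  proof (cases "l2norm (Rn n) f = 0")
    case True
    obtain C where "C \<in> ?S" using ne by blast
    then have "l2norm (Rn n) (T t f) \<le> C * l2norm (Rn n) f" using assms(2) by blast
    then show ?thesis using True by simp
  next
    case False
    then have p: "l2norm (Rn n) f > 0" using l2norm_nonneg[of "Rn n" f] by linarith
    have "l2norm (Rn n) (T t f) / l2norm (Rn n) f \<le> Inf ?S"
    proof (rule cInf_greatest[OF ne])
      fix C assume "C \<in> ?S"
      then have "l2norm (Rn n) (T t f) \<le> C * l2norm (Rn n) f" using assms(2) by blast
      then show "l2norm (Rn n) (T t f) / l2norm (Rn n) f \<le> C" using p by (simp add: pos_divide_le_eq)
    qed
    then show ?thesis using p by (simp add: op_norm_def pos_divide_le_eq)
  qed
qed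

lemma op_norm_approx:
  assumes "0 \<le> c" "c < op_norm t"
  obtains f where "f \<in> L2 (Rn n)" "c * l2norm (Rn n) f < l2norm (Rn n) (T t f)"
proof -
  let ?S = "{C. 0 \<le> C \<and> (\<forall>f\<in>L2 (Rn n). l2norm (Rn n) (T t f) \<le> C * l2norm (Rn n) f)}"
  have "c \<notin> ?S"
  proof
    assume "c \<in> ?S"
    moreover have "bdd_below ?S" by (rule bdd_belowI[of _ 0]) auto
    ultimately have "Inf ?S \<le> c" by (rule cInf_lower)
    then show False using assms(2) by (simp add: op_norm_def)
  qed
  then show thesis using assms(1) that by (auto simp: not_le)
qed

text \<open>The uniform boundedness principle, following Sokal's gliding hump without Baire's theorem.\<close>

lemma op_norm_step:
  assumes t: "t \<ge> 0" and N: "op_norm t > 0" and x: "x \<in> L2 (Rn n)" and r: "r > 0"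
  shows "\<exists>y\<in>L2 (Rn n). l2norm (Rn n) (\<lambda>u. y u - x u) \<le> r \<and> 2 / 3 * op_norm t * r \<le> l2norm (Rn n) (T t y)"
proof -
  let ?c = "2 / 3 * op_norm t"
  \<comment> \<open>The factor \<open>2 / 3\<close> leaves room below the operator norm, which need
    not be attained.\<close>
  obtain f where f: "f \<in> L2 (Rn n)" "?c * l2norm (Rn n) f < l2norm (Rn n) (T t f)"
    using op_norm_approx[of ?c t] N by auto
  have "l2norm (Rn n) f \<noteq> 0" using op_norm_bound[OF t f(1)] f(2) by auto
  then have p: "l2norm (Rn n) f > 0" using l2norm_nonneg[of "Rn n" f] by linarith
  define a where "a = complex_of_real (r / l2norm (Rn n) f)"
  have ca: "cmod a = r / l2norm (Rn n) f"
    unfolding a_def norm_of_real using r p by (intro abs_of_nonneg) simp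
  define e where "e u = a * f u" for u
  have e: "e \<in> L2 (Rn n)" unfolding e_def[abs_def] by (rule L2_cmult[OF f(1)])
  have ne: "l2norm (Rn n) e = r" unfolding e_def[abs_def] l2norm_cmult ca using p by simp
  have Te: "?c * r \<le> l2norm (Rn n) (T t e)"
  proof -
    have "l2norm (Rn n) (T t e) = r / l2norm (Rn n) f * l2norm (Rn n) (T t f)"
      unfolding e_def[abs_def] C0_norm_cmult[OF t f(1)] ca ..
    also have "\<dots> \<ge> r / l2norm (Rn n) f * (?c * l2norm (Rn n) f)"
      using f(2) r p by (intro mult_left_mono) auto
    finally show ?thesis using p by (simp add: field_simps)
  qed
  \<comment> \<open>Since \<open>y1 - y2 = 2 e\<close>, one of these two points of distance
    \<open>r\<close> from \<open>x\<close> is mapped to a vector of norm at least that of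
    \<open>T t e\<close>.\<close>
  define y1 y2 where "y1 u = x u + e u" and "y2 u = x u - e u" for u
  have y: "y1 \<in> L2 (Rn n)" "y2 \<in> L2 (Rn n)" unfolding y1_def[abs_def] y2_def[abs_def] by (intro L2_add L2_diff x e)+
  have "2 * l2norm (Rn n) (T t e) = l2norm (Rn n) (T t (\<lambda>u. 2 * e u))"
    using C0_norm_cmult[OF t e, of 2] by simp
  also have "(\<lambda>u. 2 * e u) = (\<lambda>u. y1 u - y2 u)" by (simp add: y1_def y2_def)
  also have "l2norm (Rn n) (T t (\<lambda>u. y1 u - y2 u)) = l2norm (Rn n) (\<lambda>u. T t y1 u - T t y2 u)"
    by (rule C0_norm_diff[OF t y, symmetric])
  also have "\<dots> \<le> l2norm (Rn n) (T t y1) + l2norm (Rn n) (T t y2)"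
    by (intro l2norm_triangle_diff C0_L2 t y)
  finally have "l2norm (Rn n) (T t e) \<le> l2norm (Rn n) (T t y1) \<or> l2norm (Rn n) (T t e) \<le> l2norm (Rn n) (T t y2)"
    by linarith
  then show ?thesis
  proof
    assume "l2norm (Rn n) (T t e) \<le> l2norm (Rn n) (T t y1)"
    moreover have "l2norm (Rn n) (\<lambda>u. y1 u - x u) = r" using ne by (simp add: y1_def)
    ultimately show ?thesis using Te y by (intro bexI[of _ y1]) auto
  next
    assume "l2norm (Rn n) (T t e) \<le> l2norm (Rn n) (T t y2)"
    moreover have "l2norm (Rn n) (\<lambda>u. y2 u - x u) = r" using ne by (simp add: y2_def)
    ultimately show ?thesis using Te y by (intro bexI[of _ y2]) auto
  qed
qed

text \<open>Otherwise there are times tending to 0 with norms above \<open>9^k\<close>. Steps of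
  length \<open>3^(-k)\<close> build a convergent sequence whose limit \<open>g\<close> has images
  of norm at least \<open>3^k / 6\<close> at these times, against strong continuity at 0.\<close>

lemma op_norm_locally_bounded: "\<exists>d>0. \<exists>M. \<forall>t. 0 \<le> t \<longrightarrow> t \<le> d \<longrightarrow> op_norm t \<le> M"
proof (rule ccontr)
  assume "\<not> ?thesis"
  then have unb: "\<exists>t. 0 \<le> t \<and> t \<le> d \<and> M < op_norm t" if "d > 0" for d M
    using that by (meson not_le)
  have "\<forall>k. \<exists>t. 0 \<le> t \<and> t \<le> 1 / real (Suc k) \<and> 9 ^ k < op_norm t"
    by (intro allI unb) simp
  from choice[OF this] obtain \<tau> where \<tau>0: "\<forall>k. 0 \<le> \<tau> k \<and> \<tau> k \<le> 1 / real (Suc k) \<and> 9 ^ k < op_norm (\<tau> k)"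
    by (rule exE)
  then have \<tau>: "\<And>k. 0 \<le> \<tau> k" "\<And>k. \<tau> k \<le> 1 / real (Suc k)" "\<And>k. 9 ^ k < op_norm (\<tau> k)"
    by blast+
  have \<tau>p: "op_norm (\<tau> k) > 0" for k using \<tau>(3)[of k] zero_less_power[of "9::real" k] by linarith
  have "\<exists>x. \<forall>k. x k \<in> L2 (Rn n) \<and> l2norm (Rn n) (\<lambda>u. x (Suc k) u - x k u) \<le> (1/3) ^ k \<and>
      2 / 3 * op_norm (\<tau> k) * (1/3) ^ k \<le> l2norm (Rn n) (T (\<tau> k) (x (Suc k)))"
  proof (rule dependent_nat_choice)
    show "\<exists>x. x \<in> L2 (Rn n)" using L2_zero by blast
    fix x k assume "x \<in> L2 (Rn n)"
    from op_norm_step[OF \<tau>(1) \<tau>p this, of "(1/3) ^ k" k]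
    show "\<exists>y. y \<in> L2 (Rn n) \<and> l2norm (Rn n) (\<lambda>u. y u - x u) \<le> (1/3) ^ k \<and>
      2 / 3 * op_norm (\<tau> k) * (1/3) ^ k \<le> l2norm (Rn n) (T (\<tau> k) y)" by auto
  qed
  then obtain x where x: "\<And>k. x k \<in> L2 (Rn n)" "\<And>k. l2norm (Rn n) (\<lambda>u. x (Suc k) u - x k u) \<le> (1/3) ^ k"
      "\<And>k. 2 / 3 * op_norm (\<tau> k) * (1/3) ^ k \<le> l2norm (Rn n) (T (\<tau> k) (x (Suc k)))"
    by auto
  obtain g where g: "g \<in> L2 (Rn n)" "(\<lambda>k. l2norm (Rn n) (\<lambda>u. x k u - g u)) \<longlonglongrightarrow> 0"
    using L2_complete_fast[OF x(1,2)] .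
  have dist: "l2norm (Rn n) (\<lambda>u. x (k + m) u - x k u) \<le> 3 / 2 * (1/3) ^ k * (1 - (1/3) ^ m)" for k m
  proof (induction m)
    case (Suc m)
    have "l2norm (Rn n) (\<lambda>u. x (k + Suc m) u - x k u)
        \<le> l2norm (Rn n) (\<lambda>u. x (Suc (k + m)) u - x (k + m) u) + l2norm (Rn n) (\<lambda>u. x (k + m) u - x k u)"
      using l2norm_triangle_mid[OF x(1,1,1)] by simp
    also have "\<dots> \<le> (1/3) ^ (k + m) + 3 / 2 * (1/3) ^ k * (1 - (1/3) ^ m)"
      using x(2) Suc by (rule add_mono)
    also have "\<dots> = 3 / 2 * (1/3) ^ k * (1 - (1/3) ^ Suc m)"
    proof -
      have "a * b + 3 / 2 * a * (1 - b) = 3 / 2 * a * (1 - 1 / 3 * b)" for a b :: real by (simp add: field_simps)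
      then show ?thesis by (simp only: power_add power_Suc)
    qed
    finally show ?case .
  qed simp
  \<comment> \<open>The remaining steps sum to at most \<open>3/2 (1/3)^k\<close>, a geometric
    series.\<close>
  have xg: "l2norm (Rn n) (\<lambda>u. x k u - g u) \<le> 3 / 2 * (1/3) ^ k" for k
  proof (rule LIMSEQ_le_const)
    have "(\<lambda>m. 3 / 2 * (1/3) ^ k + l2norm (Rn n) (\<lambda>u. x (k + m) u - g u)) \<longlonglongrightarrow> 3 / 2 * (1/3) ^ k + 0"
      using LIMSEQ_ignore_initial_segment[OF g(2), of k] by (intro tendsto_intros) (simp add: add.commute)
    then show "(\<lambda>m. 3 / 2 * (1/3) ^ k + l2norm (Rn n) (\<lambda>u. x (k + m) u - g u)) \<longlonglongrightarrow> 3 / 2 * (1/3) ^ k" by simp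
    have "l2norm (Rn n) (\<lambda>u. x k u - g u) \<le> 3 / 2 * (1/3) ^ k + l2norm (Rn n) (\<lambda>u. x (k + m) u - g u)" for m
    proof -
      have "l2norm (Rn n) (\<lambda>u. x k u - g u) \<le> l2norm (Rn n) (\<lambda>u. x k u - x (k + m) u) + l2norm (Rn n) (\<lambda>u. x (k + m) u - g u)"
        by (rule l2norm_triangle_mid[OF x(1,1) g(1)])
      moreover have "3 / 2 * (1/3) ^ k * (1 - (1/3) ^ m) \<le> 3 / 2 * (1/3) ^ k * (1::real)"
        by (intro mult_left_mono) auto
      ultimately show ?thesis
        using dist[of k m] l2norm_minus_commute[of "Rn n" "x k" "x (k + m)"] by linarith
    qed
    then show "\<exists>N. \<forall>m\<ge>N. l2norm (Rn n) (\<lambda>u. x k u - g u) \<le> 3 / 2 * (1/3) ^ k + l2norm (Rn n) (\<lambda>u. x (k + m) u - g u)" by blast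
  qed
  \<comment> \<open>At stage \<open>k\<close> the hump is worth \<open>2/3\<close>, while all later
    steps can undo at most \<open>1/2\<close>, both in units of
    \<open>op_norm (\<tau> k) (1/3)^k\<close>; the difference is the factor
    \<open>1 / 6\<close>.\<close>
  have big: "1 / 6 * 3 ^ k \<le> l2norm (Rn n) (T (\<tau> k) g)" for k
  proof -
    have "l2norm (Rn n) (\<lambda>u. T (\<tau> k) (x (Suc k)) u - T (\<tau> k) g u) = l2norm (Rn n) (T (\<tau> k) (\<lambda>u. x (Suc k) u - g u))"
      by (rule C0_norm_diff[OF \<tau>(1) x(1) g(1)])
    also have "\<dots> \<le> op_norm (\<tau> k) * l2norm (Rn n) (\<lambda>u. x (Suc k) u - g u)"
      by (intro op_norm_bound \<tau> L2_diff x g)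
    also have "\<dots> \<le> op_norm (\<tau> k) * (3 / 2 * (1/3) ^ Suc k)"
      using \<tau>p[of k] by (intro mult_left_mono xg) simp
    finally have "l2norm (Rn n) (\<lambda>u. T (\<tau> k) (x (Suc k)) u - T (\<tau> k) g u) \<le> 1 / 2 * op_norm (\<tau> k) * (1/3) ^ k" by simp
    moreover have "l2norm (Rn n) (T (\<tau> k) (x (Suc k))) - l2norm (Rn n) (T (\<tau> k) g) \<le> l2norm (Rn n) (\<lambda>u. T (\<tau> k) (x (Suc k)) u - T (\<tau> k) g u)"
      using l2norm_triangle_abs[OF C0_L2[OF \<tau>(1) x(1)] C0_L2[OF \<tau>(1) g(1)]] abs_ge_self order_trans by blast
    ultimately have "1 / 6 * (op_norm (\<tau> k) * (1/3) ^ k) \<le> l2norm (Rn n) (T (\<tau> k) g)" using x(3)[of k] by simp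
    moreover have "9 ^ k * (1/3) ^ k \<le> op_norm (\<tau> k) * (1/3) ^ k" using \<tau>(3)[of k] by (intro mult_right_mono) auto
    moreover have "9 ^ k * (1/3) ^ k = (3::real) ^ k" by (simp flip: power_mult_distrib)
    ultimately show ?thesis by linarith
  qed
  obtain d where d: "d > 0" "\<And>t. 0 < t \<Longrightarrow> t < d \<Longrightarrow> l2norm (Rn n) (\<lambda>u. T t g u - g u) < 1"
    using tendstoD[OF C0_tendsto_0[OF g(1)], of 1] by (auto simp: eventually_at_right_field dist_real_def)
  obtain k where k: "real k > max (6 * (l2norm (Rn n) g + 1)) (1 / d)" using reals_Archimedean2 by blast
  have "\<tau> k < d"
  proof -
    have "1 / d < real (Suc k)" using k by simp
    then have "1 / real (Suc k) < d" using d(1) by (simp add: field_simps)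
    then show ?thesis using \<tau>(2)[of k] by linarith
  qed
  have "l2norm (Rn n) (\<lambda>u. T (\<tau> k) g u - g u) < 1"
  proof (cases "\<tau> k = 0")
    case True
    have "l2norm (Rn n) (\<lambda>u. T 0 g u - g u) = l2norm (Rn n) (\<lambda>u. 0)"
      using C0_zero[OF g(1)] C0_L2[OF _ g(1), of 0] g(1) by (intro l2norm_cong_AE) (auto dest: L2_measurable)
    then show ?thesis using True by simp
  next
    case False
    then show ?thesis using \<tau>(1)[of k] \<open>\<tau> k < d\<close> by (intro d) auto
  qed
  then have small: "l2norm (Rn n) (T (\<tau> k) g) < l2norm (Rn n) g + 1"
    using l2norm_triangle_abs[OF C0_L2[OF \<tau>(1) g(1)] g(1), of k] by linarith
  have "real k > 6 * (l2norm (Rn n) g + 1)" using k by simp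
  moreover have "p < q" if "1 / 6 * p \<le> x" "x < y + 1" "6 * (y + 1) < q" for p q x y :: real
  proof -
    have "p \<le> 6 * x" using that(1) by simp
    also have "\<dots> < 6 * (y + 1)" using that(2) by simp
    also note that(3)
    finally show ?thesis .
  qed
  \<comment> \<open>For this \<open>k\<close> the lower bound \<open>3^k / 6\<close> meets the upper
    bound \<open>|g| + 1\<close>, which is less than \<open>k / 6\<close>.\<close>
  ultimately have "(3::real) ^ k < real k" using big[of k] small by blast
  moreover have "real k < 3 ^ k"
  proof -
    have "real k < 2 ^ k" by (rule of_nat_less_two_power)
    also have "(2::real) ^ k \<le> 3 ^ k" by (intro power_mono) auto
    finally show ?thesis .
  qed
  ultimately show False by (rule less_asym)
qed

section \<open>Strong continuity at every time\<close>

lemma C0_right_continuous: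
  assumes "u \<in> L2 (Rn n)" "t \<ge> 0"
  shows "((\<lambda>h. l2norm (Rn n) (\<lambda>x. T (t + h) u x - T t u x)) \<longlongrightarrow> 0) (at_right 0)"
proof (rule Lim_null_comparison)
  show "((\<lambda>h. op_norm t * l2norm (Rn n) (\<lambda>x. T h u x - u x)) \<longlongrightarrow> 0) (at_right 0)"
    using tendsto_mult_right_zero[OF C0_tendsto_0[OF assms(1)]] by simp
  show "\<forall>\<^sub>F h in at_right 0. norm (l2norm (Rn n) (\<lambda>x. T (t + h) u x - T t u x)) \<le> op_norm t * l2norm (Rn n) (\<lambda>x. T h u x - u x)"
    using eventually_at_right_less[of "0::real"]
  proof eventually_elim
    case (elim h)
    have Th: "T h u \<in> L2 (Rn n)" using elim by (intro C0_L2 assms) simp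
    have "l2norm (Rn n) (\<lambda>x. T (t + h) u x - T t u x) = l2norm (Rn n) (T t (\<lambda>x. T h u x - u x))"
      using elim assms C0_norm_add[of t h u "T t u"] C0_norm_diff[OF assms(2) Th assms(1)] C0_L2 by simp
    then show ?case using op_norm_bound[OF assms(2) L2_diff[OF Th assms(1)]] by simp
  qed
qed

text \<open>The increment is \<open>T (t - h)\<close> applied to \<open>T h u - u\<close>, and the
  operator varies with \<open>h\<close>. This is where the uniform bound near time 0 is
  indispensable.\<close>

lemma C0_left_continuous:
  assumes u: "u \<in> L2 (Rn n)" and t: "t > 0"
  shows "((\<lambda>h. l2norm (Rn n) (\<lambda>x. T (t - h) u x - T t u x)) \<longlongrightarrow> 0) (at_right 0)"
proof -
  obtain d M0 where d: "d > 0" "\<And>s. 0 \<le> s \<Longrightarrow> s \<le> d \<Longrightarrow> op_norm s \<le> M0"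
    using op_norm_locally_bounded by blast
  define M where "M = max 1 M0"
  have M: "M \<ge> 1" "\<And>s. 0 \<le> s \<Longrightarrow> s \<le> d \<Longrightarrow> op_norm s \<le> M" using d(2) by (auto simp: M_def le_max_iff_disj)
  obtain C0 where C0: "\<And>f. t \<ge> d \<Longrightarrow> f \<in> L2 (Rn n) \<Longrightarrow> l2norm (Rn n) (T (t - d) f) \<le> C0 * l2norm (Rn n) f"
    using C0_bounded[of "t - d"] by (cases "t \<ge> d") auto
  define C where "C = max 1 C0"
  \<comment> \<open>For \<open>t \<ge> d\<close> split \<open>t - h = (d - h) + (t - d)\<close>: the
    first time lies in the range of the uniform bound and the second no longer depends on
    \<open>h\<close>.\<close>
  have bound: "l2norm (Rn n) (T (t - h) f) \<le> M * C * l2norm (Rn n) f" if h: "0 \<le> h" "h \<le> d" "h \<le> t" and f: "f \<in> L2 (Rn n)" for h f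
  proof (cases "t \<ge> d")
    case True
    have TL: "T (t - d) f \<in> L2 (Rn n)" using True by (intro C0_L2 f) simp
    have "l2norm (Rn n) (T (t - h) f) = l2norm (Rn n) (T (d - h) (T (t - d) f))"
      using C0_norm_add[of "d - h" "t - d" f "\<lambda>_. 0"] h True f by simp
    also have "\<dots> \<le> op_norm (d - h) * l2norm (Rn n) (T (t - d) f)" using h by (intro op_norm_bound TL) simp
    also have "\<dots> \<le> M * l2norm (Rn n) (T (t - d) f)" using h by (intro mult_right_mono M) auto
    also have "\<dots> \<le> M * (C0 * l2norm (Rn n) f)" using M(1) by (intro mult_left_mono C0 True f) simp
    also have "\<dots> \<le> M * (C * l2norm (Rn n) f)" using M(1) by (intro mult_left_mono mult_right_mono) (auto simp: C_def)
    finally show ?thesis by (simp add: mult.assoc)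
  next
    case False
    have "l2norm (Rn n) (T (t - h) f) \<le> op_norm (t - h) * l2norm (Rn n) f" using h by (intro op_norm_bound f) simp
    also have "\<dots> \<le> M * l2norm (Rn n) f" using h False by (intro mult_right_mono M) auto
    also have "\<dots> \<le> M * C * l2norm (Rn n) f"
      using M(1) mult_left_mono[of 1 C M] by (intro mult_right_mono) (auto simp: C_def)
    finally show ?thesis .
  qed
  show ?thesis
  proof (rule Lim_null_comparison)
    show "((\<lambda>h. M * C * l2norm (Rn n) (\<lambda>x. T h u x - u x)) \<longlongrightarrow> 0) (at_right 0)"
      using tendsto_mult_right_zero[OF C0_tendsto_0[OF u]] by simp
    have "0 < min d t" using d t by simp
    from eventually_at_right_real[OF this]
    show "\<forall>\<^sub>F h in at_right 0. norm (l2norm (Rn n) (\<lambda>x. T (t - h) u x - T t u x)) \<le> M * C * l2norm (Rn n) (\<lambda>x. T h u x - u x)"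
    proof eventually_elim
      case (elim h)
      then have h: "0 < h" "h < d" "h < t" by auto
      have Th: "T h u \<in> L2 (Rn n)" using h by (intro C0_L2 u) simp
      have TL: "T (t - h) u \<in> L2 (Rn n)" using h by (intro C0_L2 u) simp
      have "l2norm (Rn n) (\<lambda>x. T (t - h) u x - T t u x) = l2norm (Rn n) (\<lambda>x. T ((t - h) + h) u x - T (t - h) u x)"
        by (simp add: l2norm_minus_commute)
      also have "\<dots> = l2norm (Rn n) (\<lambda>x. T (t - h) (T h u) x - T (t - h) u x)"
        using h by (intro C0_norm_add u TL) auto
      also have "\<dots> = l2norm (Rn n) (T (t - h) (\<lambda>x. T h u x - u x))"
        using h by (intro C0_norm_diff Th u) auto
      also have "\<dots> \<le> M * C * l2norm (Rn n) (\<lambda>x. T h u x - u x)"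
        using h by (intro bound L2_diff Th u) auto
      finally show ?case by simp
    qed
  qed
qed

lemma C0_continuous:
  assumes u: "u \<in> L2 (Rn n)" and t: "t \<ge> 0"
  shows "((\<lambda>s. l2norm (Rn n) (\<lambda>x. T s u x - T t u x)) \<longlongrightarrow> 0) (at t within {0..})"
proof (rule tendstoI)
  fix e :: real assume e: "e > 0"
  obtain d1 where d1: "d1 > 0" "\<And>h. 0 < h \<Longrightarrow> h < d1 \<Longrightarrow> l2norm (Rn n) (\<lambda>x. T (t + h) u x - T t u x) < e"
    using tendstoD[OF C0_right_continuous[OF u t] e] by (auto simp: eventually_at_right_field dist_real_def)
  obtain d2 where d2: "d2 > 0" "\<And>h. 0 < h \<Longrightarrow> h < d2 \<Longrightarrow> t > 0 \<Longrightarrow> l2norm (Rn n) (\<lambda>x. T (t - h) u x - T t u x) < e"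
  proof (cases "t > 0")
    case True
    then show thesis using tendstoD[OF C0_left_continuous[OF u True] e] that
      by (auto simp: eventually_at_right_field dist_real_def)
  qed (use that[of 1] in auto)
  have "l2norm (Rn n) (\<lambda>x. T s u x - T t u x) < e" if s: "s \<ge> 0" "s \<noteq> t" "\<bar>s - t\<bar> < min d1 d2" for s
  proof (cases "s > t")
    case True
    then show ?thesis using d1(2)[of "s - t"] s by simp
  next
    case False
    then show ?thesis using d2(2)[of "t - s"] s by simp
  qed
  then show "\<forall>\<^sub>F s in at t within {0..}. dist (l2norm (Rn n) (\<lambda>x. T s u x - T t u x)) 0 < e"
    unfolding eventually_at using d1(1) d2(1)
    by (intro exI[of _ "min d1 d2"]) (auto simp: dist_real_def)
qed

section \<open>Uniqueness for the dissipative Cauchy problem\<close>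

lemma C0_generator_deriv:
  assumes g: "L2_generator n T u w" and t: "t \<ge> 0"
  shows "((\<lambda>h. l2norm (Rn n) (\<lambda>x. (T (t + h) u x - T t u x) / of_real h - T t w x)) \<longlongrightarrow> 0) (at_right 0)"
    and "L2_generator n T (T t u) (T t w)"
proof -
  have u: "u \<in> L2 (Rn n)" and w: "w \<in> L2 (Rn n)"
    and lim: "((\<lambda>h. l2norm (Rn n) (\<lambda>x. (T h u x - u x) / of_real h - w x)) \<longlongrightarrow> 0) (at_right 0)"
    using g by (auto simp: L2_generator_def Lp_2 Lp_norm_2)
  note Tu = C0_L2[OF t u] and Tw = C0_L2[OF t w]
  show 1: "((\<lambda>h. l2norm (Rn n) (\<lambda>x. (T (t + h) u x - T t u x) / of_real h - T t w x)) \<longlongrightarrow> 0) (at_right 0)"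
  proof (rule Lim_null_comparison)
    show "((\<lambda>h. op_norm t * l2norm (Rn n) (\<lambda>x. (T h u x - u x) / of_real h - w x)) \<longlongrightarrow> 0) (at_right 0)"
      using tendsto_mult_right_zero[OF lim] by simp
    show "\<forall>\<^sub>F h in at_right 0. norm (l2norm (Rn n) (\<lambda>x. (T (t + h) u x - T t u x) / of_real h - T t w x))
        \<le> op_norm t * l2norm (Rn n) (\<lambda>x. (T h u x - u x) / of_real h - w x)"
      using eventually_at_right_less[of "0::real"]
    proof eventually_elim
      case (elim h)
      let ?a = "1 / complex_of_real h"
      have Th: "T h u \<in> L2 (Rn n)" and Tth: "T (t + h) u \<in> L2 (Rn n)" using elim t by (auto intro: C0_L2 u)
      have q: "(\<lambda>x. T h u x - u x) \<in> L2 (Rn n)" by (intro L2_diff Th u)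
      have Q: "(\<lambda>x. (T h u x - u x) / of_real h - w x) \<in> L2 (Rn n)" by (intro L2_diff L2_divide Th u w)
      have "l2norm (Rn n) (\<lambda>x. (T (t + h) u x - T t u x) / of_real h - T t w x) = l2norm (Rn n) (T t (\<lambda>x. (T h u x - u x) / of_real h - w x))"
      proof (rule l2norm_cong_AE)
        have A: "AE x in Rn n. T t (\<lambda>x. ?a * (T h u x - u x) + (-1) * w x) x = ?a * T t (\<lambda>x. T h u x - u x) x + (-1) * T t w x"
          by (rule C0_lin[OF t q w])
        have B: "AE x in Rn n. T t (\<lambda>x. T h u x - u x) x = T t (T h u) x - T t u x" by (rule C0_diff[OF t Th u])
        have C: "AE x in Rn n. T (t + h) u x = T t (T h u) x" using elim by (intro C0_semigroup t u) simp
        from A B C show "AE x in Rn n. (T (t + h) u x - T t u x) / of_real h - T t w x = T t (\<lambda>x. (T h u x - u x) / of_real h - w x) x"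
          by eventually_elim simp
        show "(\<lambda>x. (T (t + h) u x - T t u x) / of_real h - T t w x) \<in> borel_measurable (Rn n)"
          by (intro L2_measurable L2_diff L2_divide Tth Tu Tw)
        show "T t (\<lambda>x. (T h u x - u x) / of_real h - w x) \<in> borel_measurable (Rn n)" by (intro L2_measurable C0_L2 t Q)
      qed
      then show ?case using op_norm_bound[OF t Q] by simp
    qed
  qed
  have "((\<lambda>h. l2norm (Rn n) (\<lambda>x. (T h (T t u) x - T t u x) / of_real h - T t w x)) \<longlongrightarrow> 0) (at_right 0)"
  proof (rule Lim_transform_eventually[OF 1])
    show "\<forall>\<^sub>F h in at_right 0. l2norm (Rn n) (\<lambda>x. (T (t + h) u x - T t u x) / of_real h - T t w x)
        = l2norm (Rn n) (\<lambda>x. (T h (T t u) x - T t u x) / of_real h - T t w x)"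
      using eventually_at_right_less[of "0::real"]
    proof eventually_elim
      case (elim h)
      have Tth: "T (t + h) u \<in> L2 (Rn n)" "T h (T t u) \<in> L2 (Rn n)" using elim t by (auto intro!: C0_L2 u)
      show ?case
      proof (rule l2norm_cong_AE)
        have "AE x in Rn n. T (h + t) u x = T h (T t u) x" using elim by (intro C0_semigroup t u) simp
        then show "AE x in Rn n. (T (t + h) u x - T t u x) / of_real h - T t w x = (T h (T t u) x - T t u x) / of_real h - T t w x"
          by eventually_elim (simp add: add.commute)
      qed (intro L2_measurable L2_diff L2_divide Tth Tu Tw)+
    qed
  qed
  then show "L2_generator n T (T t u) (T t w)" using Tu Tw by (simp add: L2_generator_def Lp_2 Lp_norm_2)
qed

end

text \<open>Semigroups provide right difference quotients only, so the mean value theorem is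
  replaced by a last-time argument: after adding a small slope \<open>c\<close>, the function cannot
  leave the set where it is at most its initial value.\<close>

lemma nonincreasing_of_right_derivative:
  fixes N :: "real \<Rightarrow> real"
  assumes t: "t \<ge> 0" and cont: "continuous_on {0..t} N"
    and D: "\<And>s e. 0 \<le> s \<Longrightarrow> s < t \<Longrightarrow> e > 0 \<Longrightarrow> \<forall>\<^sub>F h in at_right 0. N (s + h) \<le> N s + e * h"
  shows "N t \<le> N 0"
proof (rule field_le_epsilon)
  fix e :: real assume e: "e > 0"
  define c where "c = e / (t + 1)"
  have c: "c > 0" "c * t \<le> e" using e t by (auto simp: c_def field_simps)
  define g where "g s = N s - N 0 - c * s" for s
  have "g t \<le> 0"
  proof (rule ccontr)
    assume gt: "\<not> g t \<le> 0"
    let ?S = "{s \<in> {0..t}. g s \<le> 0}"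
    have cg: "continuous_on {0..t} g" unfolding g_def by (intro continuous_intros cont)
    then have "closed ({0..t} \<inter> g -` {..0})" by (intro continuous_closed_preimage) auto
    then have "compact ({0..t} \<inter> ({0..t} \<inter> g -` {..0}))" by (intro compact_Int_closed) auto
    moreover have "{0..t} \<inter> ({0..t} \<inter> g -` {..0}) = ?S" by auto
    ultimately have "compact ?S" by simp
    moreover have "?S \<noteq> {}" using t by (auto simp: g_def intro!: exI[of _ 0])
    \<comment> \<open>The last time at which \<open>g\<close> is nonpositive. The right-hand
      estimate produces a later one.\<close>
    ultimately obtain s where s: "s \<in> ?S" "\<And>r. r \<in> ?S \<Longrightarrow> r \<le> s" using compact_attains_sup[of ?S] by metis
    have st: "0 \<le> s" "s < t"
    proof -
      show "0 \<le> s" using s(1) by simp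
      have "s \<noteq> t" using s(1) gt by auto
      then show "s < t" using s(1) by simp
    qed
    have "\<forall>\<^sub>F h in at_right 0. N (s + h) \<le> N s + c * h \<and> 0 < h \<and> h < t - s"
      using D[OF st c(1)] eventually_at_right_real[of 0 "t - s"] st by (auto elim: eventually_elim2)
    from eventually_happens'[OF trivial_limit_at_right_real this]
    obtain h where h: "N (s + h) \<le> N s + c * h" "0 < h" "h < t - s" by blast
    have "g (s + h) \<le> g s" using h(1) by (simp add: g_def algebra_simps)
    then have "s + h \<in> ?S" using s(1) h st by auto
    from s(2)[OF this] show False using h(2) by simp
  qed
  then show "N t \<le> N 0 + e" using c by (simp add: g_def)
qed

text \<open>In the expansion of the square the term linear in \<open>h\<close> is
  \<open>2 h Re \<langle>b, a\<rangle>\<close>, nonpositive by assumption; a step in a dissipative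
  direction increases the squared norm only to second order.\<close>

lemma l2norm_add_cmult_le:
  assumes a: "a \<in> L2 M" and b: "b \<in> L2 M" and h: "h \<ge> 0"
    and dis: "Re (pairing M b (\<lambda>x. cnj (a x))) \<le> 0"
  shows "(l2norm M (\<lambda>x. a x + of_real h * b x))\<^sup>2 \<le> (l2norm M a)\<^sup>2 + h\<^sup>2 * (l2norm M b)\<^sup>2"
proof -
  let ?ac = "\<lambda>x. cnj (a x)" and ?bc = "\<lambda>x. cnj (b x)"
  note L = a b L2_cnj[OF a] L2_cnj[OF b] L2_cmult[OF b, of "of_real h"] L2_cmult[OF L2_cnj[OF b], of "of_real h"]
  have "of_real ((l2norm M (\<lambda>x. a x + of_real h * b x))\<^sup>2) = pairing M (\<lambda>x. a x + of_real h * b x) (\<lambda>x. ?ac x + of_real h * ?bc x)"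
    unfolding pairing_cnj_self[symmetric] by simp
  also have "\<dots> = pairing M a ?ac + of_real h * (pairing M b ?ac + pairing M a ?bc) + (of_real h)\<^sup>2 * pairing M b ?bc"
    using L by (simp add: pairing_add_left pairing_add_right L2_add pairing_cmult_left pairing_cmult_right algebra_simps power2_eq_square)
  also have "pairing M a ?bc = cnj (pairing M b ?ac)" unfolding pairing_cnj by (simp add: pairing_commute)
  also have "pairing M b ?ac + cnj (pairing M b ?ac) = of_real (2 * Re (pairing M b ?ac))" by (rule complex_add_cnj)
  finally have "of_real ((l2norm M (\<lambda>x. a x + of_real h * b x))\<^sup>2)
      = complex_of_real ((l2norm M a)\<^sup>2 + h * (2 * Re (pairing M b ?ac)) + h\<^sup>2 * (l2norm M b)\<^sup>2)"
    by (simp only: pairing_cnj_self of_real_add of_real_mult of_real_power)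
  then have "(l2norm M (\<lambda>x. a x + of_real h * b x))\<^sup>2 = (l2norm M a)\<^sup>2 + h * (2 * Re (pairing M b ?ac)) + h\<^sup>2 * (l2norm M b)\<^sup>2"
    by (rule of_real_eq_iff[THEN iffD1])
  moreover have "h * (2 * Re (pairing M b ?ac)) \<le> 0" using h dis by (simp add: mult_nonneg_nonpos)
  ultimately show ?thesis by linarith
qed

text \<open>The difference \<open>W\<close> of the two orbits has right derivative
  \<open>W'\<close>, its image under the generator. The energy identity makes the generator
  dissipative because \<open>Re z > 0\<close>, so the squared norm of \<open>W\<close> cannot grow
  from its initial value 0.\<close>

theorem heat_semigroup_eq:
  assumes z: "Re z > 0" "cmod z = 1" and u: "lapg n z u g w" and t: "t \<ge> 0"
  shows "AE x in Rn n. heat_semigroup n (\<lambda>_. z \<cdot>\<^sub>m 1\<^sub>m n) t u x = heat n z t u x"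
proof -
  define T where "T = heat_semigroup n (\<lambda>_. z \<cdot>\<^sub>m 1\<^sub>m n)"
  have T: "L2_C0_semigroup n T" and Tg: "\<And>u w. L2_generator n T u w \<longleftrightarrow> (\<exists>g. lapg n z u g w)"
    unfolding T_def by (rule heat_semigroup_spec[OF z])+
  have K: "L2_C0_semigroup n (heat n z)" and Kg: "\<And>u w. L2_generator n (heat n z) u w \<longleftrightarrow> (\<exists>g. lapg n z u g w)"
    using heat_C0_semigroup[OF z(1)] heat_generator_iff[OF z] div_op_iff_lapg by auto
  have gT: "L2_generator n T u w" and gK: "L2_generator n (heat n z) u w" using Tg Kg u by blast+
  note uL = lapgD(1)[OF u] and wL = lapgD(2)[OF u]
  define W W' where "W s x = T s u x - heat n z s u x" and "W' s x = T s w x - heat n z s w x" for s x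
  have WL: "W s \<in> L2 (Rn n)" "W' s \<in> L2 (Rn n)" if "s \<ge> 0" for s
    unfolding W_def[abs_def] W'_def[abs_def] using that by (auto intro!: L2_diff C0_L2[OF T] C0_L2[OF K] uL wL)
  \<comment> \<open>Both orbits stay in the domain of the common generator, so the energy identity
    applies to their difference.\<close>
  have dis: "Re (pairing (Rn n) (W' s) (\<lambda>x. cnj (W s x))) \<le> 0" if s: "s \<ge> 0" for s
  proof -
    obtain g1 g2 where "lapg n z (T s u) g1 (T s w)" "lapg n z (heat n z s u) g2 (heat n z s w)"
      using C0_generator_deriv(2)[OF T gT s] C0_generator_deriv(2)[OF K gK s] Tg Kg by blast
    from lapg_energy[OF lapg_diff[OF this]]
    have "pairing (Rn n) (W' s) (\<lambda>x. cnj (W s x)) = - (z * of_real (\<Sum>i<n. (l2norm (Rn n) (\<lambda>x. g1 i x - g2 i x))\<^sup>2))"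
      unfolding W_def W'_def by (simp add: minus_equation_iff)
    then show ?thesis using z(1) by (simp add: sum_nonneg)
  qed
  \<comment> \<open>The error of the first-order expansion
    \<open>W (s + h) = W s + h W' s + h r\<close>, which tends to 0 in norm.\<close>
  define R where "R s h = l2norm (Rn n) (\<lambda>x. (W (s + h) x - W s x) / of_real h - W' s x)" for s h
  have R: "(R s \<longlongrightarrow> 0) (at_right 0)" if s: "s \<ge> 0" for s
  proof (rule Lim_null_comparison)
    let ?t = "\<lambda>h. l2norm (Rn n) (\<lambda>x. (T (s + h) u x - T s u x) / of_real h - T s w x)"
    let ?k = "\<lambda>h. l2norm (Rn n) (\<lambda>x. (heat n z (s + h) u x - heat n z s u x) / of_real h - heat n z s w x)"
    show "((\<lambda>h. ?t h + ?k h) \<longlongrightarrow> 0) (at_right 0)"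
      using tendsto_add[OF C0_generator_deriv(1)[OF T gT s] C0_generator_deriv(1)[OF K gK s]] by simp
    show "\<forall>\<^sub>F h in at_right 0. norm (R s h) \<le> ?t h + ?k h"
      using eventually_at_right_less[of "0::real"]
    proof eventually_elim
      case (elim h)
      have "(\<lambda>x. (T (s + h) u x - T s u x) / of_real h - T s w x) \<in> L2 (Rn n)"
        "(\<lambda>x. (heat n z (s + h) u x - heat n z s u x) / of_real h - heat n z s w x) \<in> L2 (Rn n)"
        using elim s by (auto intro!: L2_diff L2_divide C0_L2[OF T] C0_L2[OF K] uL wL)
      moreover have "(\<lambda>x. (W (s + h) x - W s x) / of_real h - W' s x) = (\<lambda>x. ((T (s + h) u x - T s u x) / of_real h - T s w x)
          - ((heat n z (s + h) u x - heat n z s u x) / of_real h - heat n z s w x))"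
        by (simp add: fun_eq_iff W_def W'_def diff_divide_distrib)
      ultimately show ?case unfolding R_def using l2norm_triangle_diff by simp
    qed
  qed
  define N where "N s = (l2norm (Rn n) (W s))\<^sup>2" for s
  have cont: "continuous_on {0..t} N"
  proof -
    have "continuous_on {0..} (\<lambda>s. l2norm (Rn n) (W s))"
      unfolding continuous_on_def
    proof
      fix s :: real assume "s \<in> {0..}"
      then have s: "s \<ge> 0" by simp
      have "((\<lambda>r. l2norm (Rn n) (W r) - l2norm (Rn n) (W s)) \<longlongrightarrow> 0) (at s within {0..})"
      proof (rule Lim_null_comparison)
        show "((\<lambda>r. l2norm (Rn n) (\<lambda>x. T r u x - T s u x) + l2norm (Rn n) (\<lambda>x. heat n z r u x - heat n z s u x)) \<longlongrightarrow> 0) (at s within {0..})"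
          using tendsto_add[OF C0_continuous[OF T uL s] C0_continuous[OF K uL s]] by simp
        show "\<forall>\<^sub>F r in at s within {0..}. norm (l2norm (Rn n) (W r) - l2norm (Rn n) (W s))
            \<le> l2norm (Rn n) (\<lambda>x. T r u x - T s u x) + l2norm (Rn n) (\<lambda>x. heat n z r u x - heat n z s u x)"
          unfolding eventually_at
        proof (intro exI[of _ 1] conjI ballI impI)
          fix r :: real assume "r \<in> {0..}"
          then have r: "r \<ge> 0" by simp
          have L: "(\<lambda>x. T r u x - T s u x) \<in> L2 (Rn n)" "(\<lambda>x. heat n z r u x - heat n z s u x) \<in> L2 (Rn n)"
            using r s by (auto intro!: L2_diff C0_L2[OF T] C0_L2[OF K] uL)
          have "norm (l2norm (Rn n) (W r) - l2norm (Rn n) (W s)) \<le> l2norm (Rn n) (\<lambda>x. W r x - W s x)"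
            using l2norm_triangle_abs[OF WL(1)[OF r] WL(1)[OF s]] by simp
          also have "(\<lambda>x. W r x - W s x) = (\<lambda>x. (T r u x - T s u x) - (heat n z r u x - heat n z s u x))"
            by (simp add: W_def fun_eq_iff algebra_simps)
          also have "l2norm (Rn n) \<dots> \<le> l2norm (Rn n) (\<lambda>x. T r u x - T s u x) + l2norm (Rn n) (\<lambda>x. heat n z r u x - heat n z s u x)"
            by (rule l2norm_triangle_diff[OF L])
          finally show "norm (l2norm (Rn n) (W r) - l2norm (Rn n) (W s))
            \<le> l2norm (Rn n) (\<lambda>x. T r u x - T s u x) + l2norm (Rn n) (\<lambda>x. heat n z r u x - heat n z s u x)" .
        qed simp
      qed
      then show "((\<lambda>s. l2norm (Rn n) (W s)) \<longlongrightarrow> l2norm (Rn n) (W s)) (at s within {0..})" by (simp add: LIM_zero_iff)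
    qed
    then have "continuous_on {0..t} (\<lambda>s. l2norm (Rn n) (W s))" by (rule continuous_on_subset) auto
    then show ?thesis unfolding N_def by (intro continuous_intros)
  qed
  have "N t \<le> N 0"
  proof (rule nonincreasing_of_right_derivative[OF t cont])
    fix s e :: real assume s: "0 \<le> s" "s < t" and e: "e > 0"
    define A B where "A = l2norm (Rn n) (W s)" and "B = l2norm (Rn n) (W' s)"
    have AB: "A \<ge> 0" "B \<ge> 0" by (auto simp: A_def B_def)
    have id0: "((\<lambda>h::real. h) \<longlongrightarrow> 0) (at_right 0)" by (rule tendsto_ident_at)
    have "((\<lambda>h. h * B\<^sup>2 + 2 * R s h * (A + h * B) + h * (R s h)\<^sup>2) \<longlongrightarrow> 0 * B\<^sup>2 + 2 * 0 * (A + 0 * B) + 0 * 0\<^sup>2) (at_right 0)"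
      by (intro tendsto_intros R s id0)
    then have "((\<lambda>h. h * B\<^sup>2 + 2 * R s h * (A + h * B) + h * (R s h)\<^sup>2) \<longlongrightarrow> 0) (at_right 0)" by simp
    from order_tendstoD(2)[OF this e]
    show "\<forall>\<^sub>F h in at_right 0. N (s + h) \<le> N s + e * h"
      using eventually_at_right_less[of "0::real"]
    proof eventually_elim
      case (elim h)
      have h: "h > 0" using elim by simp
      have sh: "s + h \<ge> 0" using s h by simp
      define r where "r x = (W (s + h) x - W s x) / of_real h - W' s x" for x
      have rL: "r \<in> L2 (Rn n)" unfolding r_def[abs_def] by (intro L2_diff L2_divide WL s(1) sh)
      have Rr: "R s h = l2norm (Rn n) r" by (simp add: R_def r_def[abs_def])
      let ?P = "\<lambda>x. W s x + of_real h * W' s x"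
      have PL: "?P \<in> L2 (Rn n)" by (intro L2_add L2_cmult WL s)
      have P2: "(l2norm (Rn n) ?P)\<^sup>2 \<le> A\<^sup>2 + h\<^sup>2 * B\<^sup>2"
        unfolding A_def B_def using h by (intro l2norm_add_cmult_le WL s dis) auto
      have P1: "l2norm (Rn n) ?P \<le> A + h * B"
        using l2norm_triangle[OF WL(1)[OF s(1)] L2_cmult[OF WL(2)[OF s(1)], of "of_real h"]] h
        by (simp add: l2norm_cmult A_def B_def)
      have Weq: "W (s + h) = (\<lambda>x. ?P x + of_real h * r x)" using h by (simp add: r_def fun_eq_iff field_simps)
      have "l2norm (Rn n) (W (s + h)) \<le> l2norm (Rn n) ?P + h * R s h"
        unfolding Weq Rr using l2norm_triangle[OF PL L2_cmult[OF rL, of "of_real h"]] h by (simp add: l2norm_cmult)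
      then have "N (s + h) \<le> (l2norm (Rn n) ?P + h * R s h)\<^sup>2" unfolding N_def by (intro power_mono) auto
      also have "\<dots> = (l2norm (Rn n) ?P)\<^sup>2 + 2 * (h * R s h) * l2norm (Rn n) ?P + h\<^sup>2 * (R s h)\<^sup>2"
        by (simp add: power2_sum power_mult_distrib)
      also have "\<dots> \<le> (A\<^sup>2 + h\<^sup>2 * B\<^sup>2) + 2 * (h * R s h) * (A + h * B) + h\<^sup>2 * (R s h)\<^sup>2"
        using P1 P2 h by (intro add_mono mult_left_mono) (auto simp: R_def)
      also have "\<dots> = N s + h * (h * B\<^sup>2 + 2 * R s h * (A + h * B) + h * (R s h)\<^sup>2)"
        by (simp add: N_def A_def algebra_simps power2_eq_square)
      also have "\<dots> \<le> N s + h * e" using h elim by (intro add_mono mult_left_mono) auto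
      finally show ?case by (simp add: mult.commute)
    qed
  qed
  moreover have "N 0 = 0"
  proof -
    have "l2norm (Rn n) (W 0) = l2norm (Rn n) (\<lambda>x. 0)"
      using C0_zero[OF T uL] WL(1)[of 0] by (intro l2norm_cong_AE) (auto simp: W_def dest: L2_measurable)
    then show ?thesis by (simp add: N_def)
  qed
  ultimately have "(l2norm (Rn n) (W t))\<^sup>2 \<le> 0" by (simp only: N_def)
  then have "l2norm (Rn n) (W t) = 0" by simp
  from l2norm_eq_0_AE[OF WL(1)[OF t] this] show ?thesis unfolding W_def T_def by simp
qed

section \<open>The bilinear embedding controls the semigroup\<close>

lemma cvec_norm_L2_set: "v \<in> carrier_vec n \<Longrightarrow> cvec_norm v = L2_set (\<lambda>i. cmod (vec_index v i)) {..<n}"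
  by (auto simp: cvec_norm_def L2_set_def)

text \<open>Cauchy-Schwarz in \<open>\<complex>^n\<close> at each point, so the full product of
  gradient norms dominates the integrated inner product.\<close>

lemma norm_pairing_sum_le:
  assumes "\<And>x. x \<in> space (Rn n) \<Longrightarrow> F x \<in> carrier_vec n" "\<And>x. x \<in> space (Rn n) \<Longrightarrow> G x \<in> carrier_vec n"
    and "\<And>i. i < n \<Longrightarrow> (\<lambda>x. vec_index (F x) i) \<in> L2 (Rn n)" "\<And>i. i < n \<Longrightarrow> (\<lambda>x. vec_index (G x) i) \<in> L2 (Rn n)"
  shows "ennreal (cmod (\<Sum>i<n. pairing (Rn n) (\<lambda>x. vec_index (F x) i) (\<lambda>x. cnj (vec_index (G x) i))))
    \<le> (\<integral>\<^sup>+x. ennreal (cvec_norm (F x) * cvec_norm (G x)) \<partial>Rn n)"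
proof -
  have int: "integrable (Rn n) (\<lambda>x. vec_index (F x) i * cnj (vec_index (G x) i))" if "i < n" for i
    using assms(3,4)[OF that] by (intro L2_mult_integrable L2_cnj)
  have "(\<Sum>i<n. pairing (Rn n) (\<lambda>x. vec_index (F x) i) (\<lambda>x. cnj (vec_index (G x) i)))
      = (\<integral>x. (\<Sum>i<n. vec_index (F x) i * cnj (vec_index (G x) i)) \<partial>Rn n)"
    unfolding pairing_def by (rule Bochner_Integration.integral_sum[symmetric]) (simp add: int)
  also have "ennreal (cmod \<dots>) \<le> (\<integral>\<^sup>+x. ennreal (cmod (\<Sum>i<n. vec_index (F x) i * cnj (vec_index (G x) i))) \<partial>Rn n)"
    by (intro integral_norm_bound_ennreal Bochner_Integration.integrable_sum int) simp
  also have "\<dots> \<le> (\<integral>\<^sup>+x. ennreal (cvec_norm (F x) * cvec_norm (G x)) \<partial>Rn n)"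
  proof (intro nn_integral_mono ennreal_leI)
    fix x assume x: "x \<in> space (Rn n)"
    have "cmod (\<Sum>i<n. vec_index (F x) i * cnj (vec_index (G x) i)) \<le> (\<Sum>i<n. cmod (vec_index (F x) i * cnj (vec_index (G x) i)))"
      by (rule norm_sum)
    also have "\<dots> = (\<Sum>i<n. \<bar>cmod (vec_index (F x) i)\<bar> * \<bar>cmod (vec_index (G x) i)\<bar>)" by (simp add: norm_mult)
    also have "\<dots> \<le> cvec_norm (F x) * cvec_norm (G x)"
      unfolding cvec_norm_L2_set[OF assms(1)[OF x]] cvec_norm_L2_set[OF assms(2)[OF x]] by (rule L2_set_mult_ineq)
    finally show "cmod (\<Sum>i<n. vec_index (F x) i * cnj (vec_index (G x) i)) \<le> cvec_norm (F x) * cvec_norm (G x)" .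
  qed
  finally show ?thesis .
qed

lemma pairing_heat_continuous:
  assumes z: "Re z > 0" and f: "f \<in> L2 (Rn n)" and v: "v \<in> L2 (Rn n)"
  shows "continuous_on {0..} (\<lambda>t. pairing (Rn n) (heat n z t f) v)"
  unfolding continuous_on_def
proof
  fix t :: real assume "t \<in> {0..}"
  then have t: "t \<ge> 0" by simp
  have "((\<lambda>s. pairing (Rn n) (heat n z s f) v - pairing (Rn n) (heat n z t f) v) \<longlongrightarrow> 0) (at t within {0..})"
  proof (rule Lim_null_comparison)
    show "((\<lambda>s. l2norm (Rn n) (\<lambda>x. heat n z s f x - heat n z t f x) * l2norm (Rn n) v) \<longlongrightarrow> 0) (at t within {0..})"
      using tendsto_mult_left_zero[OF C0_continuous[OF heat_C0_semigroup[OF z] f t]] by simp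
    show "\<forall>\<^sub>F s in at t within {0..}. norm (pairing (Rn n) (heat n z s f) v - pairing (Rn n) (heat n z t f) v)
        \<le> l2norm (Rn n) (\<lambda>x. heat n z s f x - heat n z t f x) * l2norm (Rn n) v"
    proof (rule always_eventually, rule allI)
      fix s
      show "norm (pairing (Rn n) (heat n z s f) v - pairing (Rn n) (heat n z t f) v)
        \<le> l2norm (Rn n) (\<lambda>x. heat n z s f x - heat n z t f x) * l2norm (Rn n) v"
        using pairing_bound[OF L2_diff[OF heat_L2[OF z f] heat_L2[OF z f]] v] heat_L2[OF z f] v
        by (simp add: pairing_diff_left)
    qed
  qed
  then show "((\<lambda>s. pairing (Rn n) (heat n z s f) v) \<longlongrightarrow> pairing (Rn n) (heat n z t f) v) (at t within {0..})"
    by (simp add: LIM_zero_iff)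
qed

text \<open>Half the increment of \<open>\<Psi>\<close> is the integral of its derivative at
  \<open>2 t\<close>, and that derivative is, up to the unimodular factor \<open>- z\<close>, the
  integrated inner product of the two gradients at time \<open>t\<close>.\<close>

lemma embedding_lower_bound:
  fixes \<tau> :: real
  assumes z: "Re z > 0" "cmod z = 1" and \<tau>: "\<tau> > 0"
    and h: "\<And>i. i < n \<Longrightarrow> h i \<in> bumps" and k: "\<And>i. i < n \<Longrightarrow> k i \<in> bumps"
  defines "f \<equiv> tens n h" and "g \<equiv> tens n k"
  shows "ennreal (cmod (pairing (Rn n) (heat n z (2 * \<tau>) f) (\<lambda>x. cnj (g x)) - pairing (Rn n) f (\<lambda>x. cnj (g x))) / 2)
    \<le> (\<integral>\<^sup>+t\<in>{0<..}. (\<integral>\<^sup>+x. ennreal (cvec_norm (grad n (heat_semigroup n (\<lambda>_. z \<cdot>\<^sub>m 1\<^sub>m n) t f) x) *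
          cvec_norm (grad n (heat_semigroup n (\<lambda>_. cnj z \<cdot>\<^sub>m 1\<^sub>m n) t g) x)) \<partial>Rn n) \<partial>lborel)"
proof -
  define J where "J t = (\<integral>\<^sup>+x. ennreal (cvec_norm (grad n (heat_semigroup n (\<lambda>_. z \<cdot>\<^sub>m 1\<^sub>m n) t f) x) *
          cvec_norm (grad n (heat_semigroup n (\<lambda>_. cnj z \<cdot>\<^sub>m 1\<^sub>m n) t g) x)) \<partial>Rn n)" for t
  have zc: "Re (cnj z) > 0" "cmod (cnj z) = 1" using z by auto
  let ?gc = "\<lambda>x. cnj (g x)"
  have fL: "f \<in> L2 (Rn n)" and gL: "g \<in> L2 (Rn n)"
    unfolding f_def g_def using h k by (auto intro!: test_functions_L2 tens_bumps_test)
  have gcL: "?gc \<in> L2 (Rn n)" by (rule L2_cnj[OF gL])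
  obtain gf w where lf: "lapg n z f gf w" using lapg_tens[of n h z, OF h] by (auto simp: f_def)
  obtain gg wg where lg: "lapg n (cnj z) g gg wg" using lapg_tens[of n k "cnj z", OF k] by (auto simp: g_def)
  note wL = lapgD(2)[OF lf]
  define \<Psi> where "\<Psi> t = pairing (Rn n) (heat n z t f) ?gc" for t
  \<comment> \<open>Since \<open>f\<close> lies in the domain of the generator, the derivative of
    \<open>\<Psi>\<close> can be written without gradients. In this form it is visibly continuous in
    time, as the fundamental theorem requires.\<close>
  define D where "D t = pairing (Rn n) (heat n z t ?gc) w" for t
  have \<Psi>': "(\<Psi> has_vector_derivative D t) (at t)" if "t > 0" for t
  proof -
    have "\<Psi> = (\<lambda>t. pairing (Rn n) (heat n z t ?gc) f)"
      using heat_pairing[OF z(1) fL gcL] by (simp add: \<Psi>_def fun_eq_iff pairing_commute)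
    then show ?thesis unfolding D_def using lapg_heat_deriv[OF z(1) that gcL lf] by simp
  qed
  have D_le: "ennreal (cmod (D (2 * t))) \<le> J t" if t: "t > 0" for t
  proof -
    define fa where "fa = heat_semigroup n (\<lambda>_. z \<cdot>\<^sub>m 1\<^sub>m n) t f"
    define ga where "ga = heat_semigroup n (\<lambda>_. cnj z \<cdot>\<^sub>m 1\<^sub>m n) t g"
    have t0: "t \<ge> 0" using t by simp
    have faL: "fa \<in> L2 (Rn n)" unfolding fa_def by (rule C0_L2[OF heat_semigroup_spec(1)[OF z] t0 fL])
    have gaL: "ga \<in> L2 (Rn n)" unfolding ga_def by (rule C0_L2[OF heat_semigroup_spec(1)[OF zc] t0 gL])
    have fae: "AE x in Rn n. fa x = heat n z t f x" unfolding fa_def by (rule heat_semigroup_eq[OF z lf t0])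
    have gae: "AE x in Rn n. ga x = heat n (cnj z) t g x" unfolding ga_def by (rule heat_semigroup_eq[OF zc lg t0])
    have hfL: "heat n z t f \<in> L2 (Rn n)" and hgL: "heat n (cnj z) t g \<in> L2 (Rn n)" and hgcL: "heat n z t ?gc \<in> L2 (Rn n)"
      using z zc by (auto intro!: heat_L2 fL gL gcL)
    have faW: "wgrad n fa (hgrad n z t f)"
      by (rule wgrad_cong_AE[OF heat_wgrad[OF z(1) t fL]]) (use faL hfL fae in \<open>auto dest: L2_measurable\<close>)
    have gaW: "wgrad n ga (hgrad n (cnj z) t g)"
      by (rule wgrad_cong_AE[OF heat_wgrad[OF zc(1) t gL]]) (use gaL hgL gae in \<open>auto dest: L2_measurable\<close>)
    have faH: "fa \<in> H1 n" and gaH: "ga \<in> H1 n" using faW gaW faL gaL by (auto simp: H1_iff)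
    let ?F = "grad n fa" and ?G = "grad n ga"
    have WG: "wgrad n (heat n z t ?gc) (\<lambda>i x. cnj (vec_index (?G x) i))"
    proof (rule wgrad_cong_AE[OF wgrad_cnj[OF wgrad_grad[OF gaH]]])
      show "AE x in Rn n. heat n z t ?gc x = cnj (ga x)"
        using gae by eventually_elim (simp add: heat_cnj[OF zc(1)])
    qed (use L2_cnj[OF gaL] hgcL in \<open>auto dest: L2_measurable\<close>)
    have dv: "((\<lambda>r. pairing (Rn n) (heat n z r f) (heat n z t ?gc)) has_vector_derivative
        - z * (\<Sum>i<n. pairing (Rn n) (hgrad n z t f i) (\<lambda>x. cnj (vec_index (?G x) i)))) (at t)"
      by (rule heat_deriv[OF z(1) t fL hgcL WG])
    \<comment> \<open>The time \<open>2 t\<close> is split evenly: one half stays on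
      \<open>f\<close> and is varied, the other is moved to the conjugate of \<open>g\<close> and
      kept fixed.\<close>
    have "((\<lambda>r. \<Psi> (r + t)) has_vector_derivative
        - z * (\<Sum>i<n. pairing (Rn n) (hgrad n z t f i) (\<lambda>x. cnj (vec_index (?G x) i)))) (at t)"
    proof (rule has_vector_derivative_transform_within_open[OF dv, of "{0<..}"])
      fix r :: real assume r: "r \<in> {0<..}"
      have "pairing (Rn n) (heat n z r f) (heat n z t ?gc) = pairing (Rn n) (heat n z t (heat n z r f)) ?gc"
        by (rule heat_pairing[OF z(1) heat_L2[OF z(1) fL] gcL, symmetric])
      also have "heat n z t (heat n z r f) = heat n z (t + r) f"
        using r t by (intro ext heat_heat z fL) auto
      finally show "pairing (Rn n) (heat n z r f) (heat n z t ?gc) = \<Psi> (r + t)" by (simp add: \<Psi>_def add.commute)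
    qed (use t in auto)
    moreover have "((\<lambda>r. \<Psi> (r + t)) has_vector_derivative D (2 * t)) (at t)"
    proof -
      have "((\<lambda>r. r + t) has_vector_derivative 1) (at t)" by (auto intro!: derivative_eq_intros)
      moreover have "(\<Psi> has_vector_derivative D (2 * t)) (at (t + t))" using \<Psi>'[of "2 * t"] t by simp
      ultimately have "((\<Psi> \<circ> (\<lambda>r. r + t)) has_vector_derivative 1 *\<^sub>R D (2 * t)) (at t)"
        by (rule vector_diff_chain_at)
      then show ?thesis by (simp add: o_def)
    qed
    ultimately have "D (2 * t) = - z * (\<Sum>i<n. pairing (Rn n) (hgrad n z t f i) (\<lambda>x. cnj (vec_index (?G x) i)))"
      by (rule vector_derivative_unique_at[symmetric])
    then have "cmod (D (2 * t)) = cmod (\<Sum>i<n. pairing (Rn n) (hgrad n z t f i) (\<lambda>x. cnj (vec_index (?G x) i)))"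
      by (simp only: norm_mult norm_minus_cancel z(2) mult_1)
    also have "(\<Sum>i<n. pairing (Rn n) (hgrad n z t f i) (\<lambda>x. cnj (vec_index (?G x) i)))
        = (\<Sum>i<n. pairing (Rn n) (\<lambda>x. vec_index (?F x) i) (\<lambda>x. cnj (vec_index (?G x) i)))"
    proof (rule sum.cong[OF refl])
      fix i assume "i \<in> {..<n}"
      then have i: "i < n" by simp
      show "pairing (Rn n) (hgrad n z t f i) (\<lambda>x. cnj (vec_index (?G x) i))
        = pairing (Rn n) (\<lambda>x. vec_index (?F x) i) (\<lambda>x. cnj (vec_index (?G x) i))"
        using wgrad_unique[OF faW wgrad_grad[OF faH] i] wgrad_L2[OF faW i] wgrad_L2[OF wgrad_grad[OF faH] i]
          L2_cnj[OF wgrad_L2[OF wgrad_grad[OF gaH] i]]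
        by (intro pairing_cong_AE L2_measurable) auto
    qed
    finally have "cmod (D (2 * t)) = cmod (\<Sum>i<n. pairing (Rn n) (\<lambda>x. vec_index (?F x) i) (\<lambda>x. cnj (vec_index (?G x) i)))" .
    then show ?thesis
      unfolding J_def fa_def[symmetric] ga_def[symmetric]
      using norm_pairing_sum_le[of n ?F ?G, OF weak_gradient_carrier[OF grad_weak[OF faH]] weak_gradient_carrier[OF grad_weak[OF gaH]]
          wgrad_L2[OF wgrad_grad[OF faH]] wgrad_L2[OF wgrad_grad[OF gaH]]] by simp
  qed
  \<comment> \<open>The derivative is available at positive times only; the lower end
    \<open>e\<close> is sent to 0 afterwards, using continuity of \<open>\<Psi>\<close> at
    0.\<close>
  have part: "ennreal (cmod (\<Psi> (2 * \<tau>) - \<Psi> (2 * e)) / 2) \<le> (\<integral>\<^sup>+t\<in>{0<..}. J t \<partial>lborel)" if e: "0 < e" "e < \<tau>" for e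
  proof -
    define G where "G t = \<Psi> (2 * t) / 2" for t
    have dG: "(G has_vector_derivative D (2 * t)) (at t)" if t: "t > 0" for t
    proof -
      have "((\<lambda>t. 2 * t) has_vector_derivative 2) (at t)" by (auto intro!: derivative_eq_intros)
      moreover have "(\<Psi> has_vector_derivative D (2 * t)) (at (2 * t))" using \<Psi>'[of "2 * t"] t by simp
      ultimately have "((\<Psi> \<circ> (\<lambda>t. 2 * t)) has_vector_derivative 2 *\<^sub>R D (2 * t)) (at t)"
        by (rule vector_diff_chain_at)
      from has_vector_derivative_divide[OF this, of 2] show ?thesis
        by (simp add: G_def[abs_def] o_def scaleR_conv_of_real)
    qed
    have cD: "continuous_on {e..\<tau>} (\<lambda>t. D (2 * t))"
      unfolding D_def using e
      by (intro continuous_on_compose2[OF pairing_heat_continuous[OF z(1) gcL wL]] continuous_intros) auto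
    have iD: "integrable lborel (\<lambda>t. indicator {e..\<tau>} t *\<^sub>R D (2 * t))"
      using borel_integrable_atLeastAtMost'[OF cD] by (simp add: set_integrable_def)
    have "(\<integral>t. indicator {e..\<tau>} t *\<^sub>R D (2 * t) \<partial>lborel) = G \<tau> - G e"
      using e dG cD by (intro integral_FTC_atLeastAtMost) (auto intro: has_vector_derivative_at_within)
    then have "ennreal (cmod (G \<tau> - G e)) \<le> (\<integral>\<^sup>+t. ennreal (cmod (indicator {e..\<tau>} t *\<^sub>R D (2 * t))) \<partial>lborel)"
      using integral_norm_bound_ennreal[OF iD] by simp
    \<comment> \<open>The pointwise bound \<open>D_le\<close> on the interval, extended by 0 to all
      positive times.\<close>
    also have "\<dots> \<le> (\<integral>\<^sup>+t\<in>{0<..}. J t \<partial>lborel)"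
      using e D_le by (intro nn_integral_mono) (auto simp: indicator_def)
    also have "cmod (G \<tau> - G e) = cmod (\<Psi> (2 * \<tau>) - \<Psi> (2 * e)) / 2"
      by (simp add: G_def norm_divide flip: diff_divide_distrib)
    finally show ?thesis .
  qed
  have "((\<lambda>e. \<Psi> (2 * e)) \<longlongrightarrow> \<Psi> (2 * 0)) (at 0 within {0..})"
  proof -
    have "continuous_on {0..} (\<lambda>e. \<Psi> (2 * e))"
      unfolding \<Psi>_def
      by (intro continuous_on_compose2[OF pairing_heat_continuous[OF z(1) fL gcL]] continuous_intros) auto
    from this[unfolded continuous_on_def, rule_format, of 0] show ?thesis by simp
  qed
  then have "((\<lambda>e. \<Psi> (2 * e)) \<longlongrightarrow> \<Psi> 0) (at_right 0)"
    by (auto intro: tendsto_within_subset)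
  then have "((\<lambda>e. ennreal (cmod (\<Psi> (2 * \<tau>) - \<Psi> (2 * e)) / 2)) \<longlongrightarrow> ennreal (cmod (\<Psi> (2 * \<tau>) - \<Psi> 0) / 2)) (at_right 0)"
    by (intro tendsto_intros) auto
  moreover have "\<forall>\<^sub>F e in at_right 0. ennreal (cmod (\<Psi> (2 * \<tau>) - \<Psi> (2 * e)) / 2) \<le> (\<integral>\<^sup>+t\<in>{0<..}. J t \<partial>lborel)"
    using eventually_at_right_real[OF \<tau>] by eventually_elim (use part in auto)
  ultimately have "ennreal (cmod (\<Psi> (2 * \<tau>) - \<Psi> 0) / 2) \<le> (\<integral>\<^sup>+t\<in>{0<..}. J t \<partial>lborel)"
    by (intro tendsto_upperbound) auto
  then show ?thesis by (simp add: \<Psi>_def J_def)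
qed

section \<open>Gaussians on the real line\<close>

definition lp1 :: "real \<Rightarrow> (real \<Rightarrow> complex) \<Rightarrow> real" where
  "lp1 p f = (\<integral>x. cmod (f x) powr p \<partial>lborel) powr (1 / p)"

definition hpair :: "complex \<Rightarrow> real \<Rightarrow> (real \<Rightarrow> complex) \<Rightarrow> (real \<Rightarrow> complex) \<Rightarrow> complex" where
  "hpair z t f g = (\<integral>x. (\<integral>y. gk z t (x - y) * f y \<partial>lborel) * g x \<partial>lborel)"

lemma Lp_norm_tens:
  assumes "f \<in> bumps" "p > 0"
  shows "Lp_norm n p (tens n (\<lambda>_. f)) = lp1 p f ^ n"
proof -
  let ?I = "\<integral>x. cmod (f x) powr p \<partial>lborel"
  have I: "?I \<ge> 0" by simp
  have "(\<integral>x. cmod (tens n (\<lambda>_. f) x) powr p \<partial>Rn n) = (\<integral>x. (\<Prod>i<n. cmod (f (x i)) powr p) \<partial>Rn n)"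
    by (simp add: norm_tens prod_powr_distrib)
  also have "\<dots> = (\<Prod>i<n. ?I)"
    using assms by (intro Rn_product.product_integral_prod bumps_integrable_powr) auto
  also have "\<dots> = ?I ^ n" by simp
  finally show ?thesis
    using prod_powr_distrib[of "\<lambda>_. ?I" "{..<n}" "1 / p"] by (simp add: Lp_norm_def lp1_def)
qed

text \<open>Two Gaussian integrations. Evolving \<open>exp (- a x^2)\<close> changes the rate to
  \<open>e = a c / (a + c)\<close>, the harmonic combination with the kernel's rate
  \<open>c\<close>, and \<open>a + b = 1\<close> collapses the product of the two determinants to
  \<open>a b + c\<close>.\<close>

lemma hpair_cgauss:
  assumes z: "Re z > 0" and t: "t > 0" and a: "Re a > 0" and b: "Re b > 0" and ab: "a + b = 1"
  shows "cmod (hpair z t (cgauss a 0) (cgauss b 0)) = sqrt pi / sqrt (cmod (1 + 4 * of_real t * z * a * b))"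
proof -
  define c where "c = 1 / (4 * z * of_real t)"
  have c: "Re c > 0" unfolding c_def using z t by (intro Re_one_divide_pos) simp
  have z0: "z \<noteq> 0" using z by auto
  have nz: "a \<noteq> 0" "c \<noteq> 0" using a c by auto
  have ac: "Re (a + c) > 0" using a c by simp
  then have ac0: "a + c \<noteq> 0" by (metis less_irrefl zero_complex.sel(1))
  define e where "e = a * c / (a + c)"
  have e: "Re e > 0"
  proof -
    have "e = 1 / (1 / a + 1 / c)" using nz ac0 by (simp add: e_def field_simps)
    moreover have "Re (1 / a + 1 / c) > 0" using Re_one_divide_pos[OF a] Re_one_divide_pos[OF c] by simp
    ultimately show ?thesis using Re_one_divide_pos by simp
  qed
  define N where "N = 2 * csqrt z * complex_of_real (sqrt (pi * t))"
  have inner: "(\<integral>y. gk z t (x - y) * cgauss a 0 y \<partial>lborel) = (of_real (sqrt pi) / csqrt (a + c) / N) * cgauss e 0 x" for x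
  proof -
    have "gk z t (x - y) * cgauss a 0 y = (exp (- c * of_real (x\<^sup>2)) / N) * cgauss (a + c) (2 * c * of_real x) y" for y
    proof -
      have "cgauss c 0 (x - y) * cgauss a 0 y = exp (- c * of_real (x\<^sup>2)) * cgauss (a + c) (2 * c * of_real x) y"
        unfolding cgauss_def mult_exp_exp by (rule arg_cong[of _ _ exp]) (simp add: algebra_simps power2_eq_square)
      then show ?thesis by (simp add: gk_def c_def[symmetric] N_def[symmetric])
    qed
    then have "(\<integral>y. gk z t (x - y) * cgauss a 0 y \<partial>lborel)
        = (exp (- c * of_real (x\<^sup>2)) / N) * (of_real (sqrt pi) / csqrt (a + c) * exp ((2 * c * of_real x)\<^sup>2 / (4 * (a + c))))"
      using ac by (simp add: cgauss_integral)
    also have "\<dots> = (of_real (sqrt pi) / csqrt (a + c) / N) * (exp (- c * of_real (x\<^sup>2)) * exp ((2 * c * of_real x)\<^sup>2 / (4 * (a + c))))"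
      by (simp only: times_divide_eq_left times_divide_eq_right divide_divide_eq_left mult_ac)
    also have "exp (- c * of_real (x\<^sup>2)) * exp ((2 * c * of_real x)\<^sup>2 / (4 * (a + c))) = cgauss e 0 x"
    proof -
      have "- c * y\<^sup>2 + (2 * c * y)\<^sup>2 / (4 * (a + c)) = - e * y\<^sup>2" for y
      proof -
        have "(2 * c * y)\<^sup>2 / (4 * (a + c)) = c\<^sup>2 / (a + c) * y\<^sup>2"
          by (simp add: power_mult_distrib del: distrib_left_numeral)
        moreover have "c\<^sup>2 = c * (a + c) - a * c" by (simp add: algebra_simps power2_eq_square)
        then have "c\<^sup>2 / (a + c) = c - e" using ac0 by (simp add: e_def diff_divide_distrib)
        ultimately show ?thesis by (simp add: algebra_simps)
      qed
      from this[of "of_real x"] show ?thesis by (simp only: mult_exp_exp cgauss_def) simp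
    qed
    finally show ?thesis .
  qed
  have "hpair z t (cgauss a 0) (cgauss b 0) = (of_real (sqrt pi) / csqrt (a + c) / N) * (\<integral>x. cgauss (e + b) 0 x \<partial>lborel)"
  proof -
    have "cgauss e 0 x * cgauss b 0 x = cgauss (e + b) 0 x" for x
      unfolding cgauss_def mult_exp_exp by (rule arg_cong[of _ _ exp]) (simp add: algebra_simps)
    then show ?thesis unfolding hpair_def inner by (simp add: mult.assoc)
  qed
  also have "\<dots> = (of_real (sqrt pi) / csqrt (a + c) / N) * (of_real (sqrt pi) / csqrt (e + b))"
    using e b by (simp add: cgauss_integral)
  finally have "cmod (hpair z t (cgauss a 0) (cgauss b 0)) = pi / (sqrt (cmod (a + c)) * (2 * sqrt (cmod z) * sqrt (pi * t)) * sqrt (cmod (e + b)))"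
    using t by (simp add: norm_mult norm_divide N_def)
  also have "sqrt (cmod (a + c)) * (2 * sqrt (cmod z) * sqrt (pi * t)) * sqrt (cmod (e + b)) = sqrt pi * sqrt (cmod (1 + 4 * of_real t * z * a * b))"
  proof -
    have "(a + c) * (e + b) = a * b + c"
    proof -
      have "(a + c) * (e + b) = a * b + c * (a + b)"
        using ac0 by (simp add: e_def distrib_left) (simp add: algebra_simps)
      then show ?thesis by (simp add: ab)
    qed
    moreover have "4 * z * of_real t * (a * b + c) = 1 + 4 * of_real t * z * a * b"
      using z0 t by (simp add: c_def field_simps)
    ultimately have "4 * z * of_real t * ((a + c) * (e + b)) = 1 + 4 * of_real t * z * a * b" by simp
    then have "cmod (1 + 4 * of_real t * z * a * b) = 4 * cmod z * t * (cmod (a + c) * cmod (e + b))"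
      using t by (simp add: norm_mult flip: \<open>4 * z * of_real t * ((a + c) * (e + b)) = 1 + 4 * of_real t * z * a * b\<close>)
    then show ?thesis using t by (simp add: real_sqrt_mult mult_ac)
  qed
  also have "pi / (sqrt pi * sqrt (cmod (1 + 4 * of_real t * z * a * b))) = sqrt pi / sqrt (cmod (1 + 4 * of_real t * z * a * b))"
    by (metis divide_divide_eq_left pi_ge_zero real_div_sqrt)
  finally show ?thesis .
qed

text \<open>The normalisation makes the \<open>p\<close>-th power of the modulus equal to
  \<open>exp (- x^2)\<close>, whatever the imaginary part of \<open>a\<close>: oscillation is free
  in the \<open>L\<^sup>p\<close> norm but not in the evolution.\<close>

lemma cgauss_lp_integral:
  assumes "p * Re a = 1" "p > 0"
  shows "(\<integral>x. cmod (cgauss a 0 x) powr p \<partial>lborel) = sqrt pi"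
proof -
  have "cmod (cgauss a 0 x) powr p = exp (- x\<^sup>2)" for x
  proof -
    have "cmod (cgauss a 0 x) powr p = exp (p * (- Re a * x\<^sup>2))"
      by (simp add: cgauss_def norm_exp_eq_Re powr_def)
    also have "p * (- Re a * x\<^sup>2) = - ((p * Re a) * x\<^sup>2)" by (simp add: mult_ac)
    finally show ?thesis using assms by simp
  qed
  moreover have "(\<integral>x. exp (- x\<^sup>2) \<partial>lborel) = sqrt pi"
  proof -
    have "(\<integral>x. sqrt pi * normal_density 0 (sqrt (1/2)) x \<partial>lborel) = sqrt pi" by simp
    moreover have "sqrt pi * normal_density 0 (sqrt (1/2)) x = exp (- x\<^sup>2)" for x
      by (simp add: normal_density_def)
    ultimately show ?thesis by simp
  qed
  ultimately show ?thesis by simp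
qed

text \<open>Gaussians are not compactly supported; these are admissible substitutes, bounded by a
  fixed multiple of the Gaussian uniformly in \<open>k\<close>.\<close>

definition cut_gauss :: "nat \<Rightarrow> complex \<Rightarrow> real \<Rightarrow> complex" where
  "cut_gauss k a x = cutoff (0 + (1 / real (Suc k)) * x) * cgauss a 0 x"

lemma cut_gauss_bumps: "cut_gauss k a \<in> bumps"
  unfolding cut_gauss_def[abs_def] by (intro bumps_mult bumps_scale cutoff_bumps smooth_cgauss) simp

lemma cut_gauss_tendsto: "(\<lambda>k. cut_gauss k a x) \<longlonglongrightarrow> cgauss a 0 x"
proof -
  have 1: "(\<lambda>k. 0 + (1 / real (Suc k)) * x) \<longlonglongrightarrow> 0 + 0 * x"
    using LIMSEQ_Suc[OF lim_1_over_n[where 'a = real]] by (intro tendsto_intros) simp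
  have "isCont cutoff 0"
    using smooth_continuous[OF bumps_smooth[OF cutoff_bumps], of UNIV] by (simp add: continuous_on_eq_continuous_at)
  from isCont_tendsto_compose[OF this, of "\<lambda>k. 0 + (1 / real (Suc k)) * x"] 1
  have "(\<lambda>k. cutoff (0 + (1 / real (Suc k)) * x)) \<longlonglongrightarrow> 1" by (simp add: cutoff_0)
  from tendsto_mult[OF this tendsto_const[of "cgauss a 0 x"]] show ?thesis by (simp add: cut_gauss_def)
qed

lemma cut_gauss_bound: obtains C where "C > 0" "\<And>k a x. cmod (cut_gauss k a x) \<le> C * cmod (cgauss a 0 x)"
proof -
  obtain C where C: "C > 0" "\<And>x. cmod (cutoff x) \<le> C" using bumps_bounded[OF cutoff_bumps] by blast
  have "cmod (cut_gauss k a x) \<le> C * cmod (cgauss a 0 x)" for k a x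
    unfolding cut_gauss_def norm_mult by (intro mult_right_mono C(2)) simp
  then show thesis using C(1) that by blast
qed

section \<open>Norms and pairings of truncated Gaussians converge\<close>

lemma cgauss_integrable: "Re a > 0 \<Longrightarrow> integrable lborel (cgauss a 0)"
  using cgauss_moment_integrable[of a 0 0] by simp

lemma cut_gauss_measurable [measurable]: "cut_gauss k a \<in> borel_measurable borel"
  using cut_gauss_bumps by measurable

lemma lp1_cut_gauss_tendsto:
  assumes "p * Re a = 1" "p > 0"
  shows "(\<lambda>k. lp1 p (cut_gauss k a)) \<longlonglongrightarrow> sqrt pi powr (1 / p)"
proof -
  obtain C where C: "C > 0" "\<And>k a x. cmod (cut_gauss k a x) \<le> C * cmod (cgauss a 0 x)" by (rule cut_gauss_bound) blast
  have "(\<lambda>k. \<integral>x. cmod (cut_gauss k a x) powr p \<partial>lborel) \<longlonglongrightarrow> (\<integral>x. cmod (cgauss a 0 x) powr p \<partial>lborel)"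
  proof (rule integral_dominated_convergence)
    have "integrable lborel (\<lambda>x. cmod (cgauss a 0 x) powr p)"
    \<comment> \<open>A non-integrable function would have integral 0 by convention, but the value
      is known to be \<open>sqrt pi\<close>.\<close>
    proof (rule ccontr)
      assume "\<not> ?thesis"
      then have "(\<integral>x. cmod (cgauss a 0 x) powr p \<partial>lborel) = 0" by (rule not_integrable_integral_eq)
      then show False using cgauss_lp_integral[OF assms] by simp
    qed
    then show "integrable lborel (\<lambda>x. C powr p * cmod (cgauss a 0 x) powr p)" by simp
    show "AE x in lborel. (\<lambda>k. cmod (cut_gauss k a x) powr p) \<longlonglongrightarrow> cmod (cgauss a 0 x) powr p"
      using assms(2) by (intro AE_I2 tendsto_powr' tendsto_norm cut_gauss_tendsto tendsto_const) auto
    show "AE x in lborel. norm (cmod (cut_gauss k a x) powr p) \<le> C powr p * cmod (cgauss a 0 x) powr p" for k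
    proof (rule AE_I2)
      fix x
      have "cmod (cut_gauss k a x) powr p \<le> (C * cmod (cgauss a 0 x)) powr p"
        using assms(2) C(2) by (intro powr_mono2) auto
      then show "norm (cmod (cut_gauss k a x) powr p) \<le> C powr p * cmod (cgauss a 0 x) powr p"
        using C(1) by (simp add: powr_mult)
    qed
  qed measurable
  then have "(\<lambda>k. lp1 p (cut_gauss k a)) \<longlonglongrightarrow> (\<integral>x. cmod (cgauss a 0 x) powr p \<partial>lborel) powr (1 / p)"
    unfolding lp1_def by (rule tendsto_powr) (auto simp: cgauss_lp_integral[OF assms])
  then show ?thesis by (simp add: cgauss_lp_integral[OF assms])
qed

lemma cut_gauss_pairing_tendsto:
  assumes "Re a > 0" "Re b > 0"
  shows "(\<lambda>k. \<integral>x. cut_gauss k a x * cut_gauss k b x \<partial>lborel) \<longlonglongrightarrow> (\<integral>x. cgauss (a + b) 0 x \<partial>lborel)"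
proof -
  obtain C where C: "C > 0" "\<And>k a x. cmod (cut_gauss k a x) \<le> C * cmod (cgauss a 0 x)" by (rule cut_gauss_bound) blast
  have eq: "cgauss a 0 x * cgauss b 0 x = cgauss (a + b) 0 x" for x
    unfolding cgauss_def mult_exp_exp by (rule arg_cong[of _ _ exp]) (simp add: algebra_simps)
  show ?thesis
  proof (rule integral_dominated_convergence)
    show "integrable lborel (\<lambda>x. C * C * cmod (cgauss (a + b) 0 x))" using cgauss_integrable[of "a + b"] assms by simp
    show "AE x in lborel. (\<lambda>k. cut_gauss k a x * cut_gauss k b x) \<longlonglongrightarrow> cgauss (a + b) 0 x"
      unfolding eq[symmetric] by (intro AE_I2 tendsto_mult cut_gauss_tendsto)
    show "AE x in lborel. norm (cut_gauss k a x * cut_gauss k b x) \<le> C * C * cmod (cgauss (a + b) 0 x)" for k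
    proof (rule AE_I2)
      fix x
      have "cmod (cut_gauss k a x) * cmod (cut_gauss k b x) \<le> (C * cmod (cgauss a 0 x)) * (C * cmod (cgauss b 0 x))"
        using C by (intro mult_mono) auto
      then show "norm (cut_gauss k a x * cut_gauss k b x) \<le> C * C * cmod (cgauss (a + b) 0 x)"
        by (simp add: eq[symmetric] norm_mult mult_ac)
    qed
  qed measurable
qed

text \<open>The kernel is bounded, so the truncated Gaussian alone dominates the inner integrand
  uniformly in \<open>x\<close>; the outer integral is then dominated by the second
  Gaussian.\<close>

lemma hpair_cut_gauss_tendsto:
  assumes z: "Re z > 0" and t: "t > 0" and a: "Re a > 0" and b: "Re b > 0"
  shows "(\<lambda>k. hpair z t (cut_gauss k a) (cut_gauss k b)) \<longlonglongrightarrow> hpair z t (cgauss a 0) (cgauss b 0)"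
proof -
  obtain C where C: "C > 0" "\<And>k a x. cmod (cut_gauss k a x) \<le> C * cmod (cgauss a 0 x)" by (rule cut_gauss_bound) blast
  obtain B where B: "B > 0" "\<And>x. cmod (gk z t x) \<le> B" using kern_bounded[OF kern_gk(1)[OF z t]] by blast
  define w where "w y = B * (C * cmod (cgauss a 0 y))" for y
  have w: "integrable lborel w" unfolding w_def using cgauss_integrable[OF a] by simp
  have bd: "cmod (gk z t (x - y) * cut_gauss k a y) \<le> w y" for k x y
    unfolding norm_mult w_def using B C by (intro mult_mono) auto
  define I where "I k x = (\<integral>y. gk z t (x - y) * cut_gauss k a y \<partial>lborel)" for k x
  have Ib: "cmod (I k x) \<le> (\<integral>y. w y \<partial>lborel)" for k x
    unfolding I_def
  proof (rule Bochner_Integration.integral_norm_bound_integral[OF _ w bd])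
    show "integrable lborel (\<lambda>y. gk z t (x - y) * cut_gauss k a y)"
      by (rule Bochner_Integration.integrable_bound[OF w]) (auto intro!: AE_I2 order_trans[OF bd abs_ge_self])
  qed
  show ?thesis
    unfolding hpair_def I_def[symmetric]
  proof (rule integral_dominated_convergence)
    show "integrable lborel (\<lambda>x. (\<integral>y. w y \<partial>lborel) * (C * cmod (cgauss b 0 x)))" using cgauss_integrable[OF b] by simp
    show "AE x in lborel. (\<lambda>k. I k x * cut_gauss k b x) \<longlonglongrightarrow> (\<integral>y. gk z t (x - y) * cgauss a 0 y \<partial>lborel) * cgauss b 0 x"
    proof (intro AE_I2 tendsto_mult cut_gauss_tendsto)
      show "(\<lambda>k. I k x) \<longlonglongrightarrow> (\<integral>y. gk z t (x - y) * cgauss a 0 y \<partial>lborel)" for x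
        unfolding I_def
        by (rule integral_dominated_convergence[OF _ _ w])
           (auto intro!: AE_I2 tendsto_mult tendsto_const cut_gauss_tendsto bd)
    qed
    show "AE x in lborel. norm (I k x * cut_gauss k b x) \<le> (\<integral>y. w y \<partial>lborel) * (C * cmod (cgauss b 0 x))" for k
      unfolding norm_mult using Ib[of k] C by (intro AE_I2 mult_mono) (auto intro: order_trans[OF norm_ge_zero])
    show "(\<lambda>x. I k x * cut_gauss k b x) \<in> borel_measurable lborel" for k
      unfolding I_def by measurable
  qed measurable
qed

text \<open>
  With \<open>p Re a = q Re b = 1\<close> and \<open>a + b = 1\<close>, the Gaussians \<open>exp (- a x\<^sup>2)\<close> and \<open>exp (- b x\<^sup>2)\<close> are
  extremal in Hoelder's inequality, and the choice of \<open>s = Im a = - Im b\<close> makes \<open>Re (z a b)\<close> minimal.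
\<close>

lemma gaussian_parameters:
  fixes p \<phi> :: real
  assumes p: "1 < p" and c0: "cos \<phi> > 0" and cd: "(cos \<phi>)\<^sup>2 < (1 - 2 / p)\<^sup>2"
  obtains a b t where "p * Re a = 1" "p / (p - 1) * Re b = 1" "a + b = 1" "t > 0"
    "cmod (1 + 4 * of_real t * cis \<phi> * a * b) < 1" "cmod (1 + 4 * of_real t * cis \<phi> * a * b) > 0"
proof -
  define d where "d = 1 - 2 / p"
  \<comment> \<open>The minimiser of
    \<open>Re (z a b) = cos \<phi> (P + s^2) - sin \<phi> s d\<close>, a quadratic polynomial in
    \<open>s\<close>.\<close>
  define s where "s = sin \<phi> * d / (2 * cos \<phi>)"
  define a where "a = Complex (1 / p) s"
  define b where "b = Complex (1 - 1 / p) (- s)"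
  define w where "w = cis \<phi> * a * b"
  define P where "P = 1 / p * (1 - 1 / p)"
  have P4: "4 * P = 1 - d\<^sup>2" using p by (simp add: P_def d_def field_simps power2_eq_square)
  have ab: "a * b = Complex (P + s\<^sup>2) (s * d)"
    using p by (simp add: a_def b_def P_def d_def complex_eq_iff power2_eq_square field_simps)
  have "Re w = cos \<phi> * (P + s\<^sup>2) - sin \<phi> * (s * d)" by (simp add: w_def mult.assoc ab)
  also have "\<dots> = (4 * (cos \<phi>)\<^sup>2 * P - (sin \<phi>)\<^sup>2 * d\<^sup>2) / (4 * cos \<phi>)"
    using c0 by (simp add: s_def field_simps power2_eq_square)
  also have "4 * (cos \<phi>)\<^sup>2 * P - (sin \<phi>)\<^sup>2 * d\<^sup>2 = (cos \<phi>)\<^sup>2 - d\<^sup>2"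
  proof -
    have "4 * (cos \<phi>)\<^sup>2 * P - (sin \<phi>)\<^sup>2 * d\<^sup>2 = (cos \<phi>)\<^sup>2 * (4 * P) - (1 - (cos \<phi>)\<^sup>2) * d\<^sup>2"
      by (simp add: sin_squared_eq)
    then show ?thesis unfolding P4 by (simp add: algebra_simps)
  qed
  finally have Rw: "Re w < 0" using cd c0 by (simp add: d_def divide_less_0_iff)
  then have w0: "cmod w > 0" by auto
  \<comment> \<open>Half of the minimiser \<open>- Re w / |w|^2\<close> of \<open>|1 + e w|\<close>.
    The minimiser itself could give the value 0, namely when \<open>w\<close> is a negative
    real.\<close>
  define e where "e = - Re w / (2 * (cmod w)\<^sup>2)"
  have e: "e > 0" using Rw w0 by (simp add: e_def divide_neg_pos)
  have sq: "(cmod (1 + of_real e * w))\<^sup>2 = 1 + 2 * e * Re w + e\<^sup>2 * (cmod w)\<^sup>2"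
    unfolding cmod_power2 by (simp add: power2_eq_square algebra_simps)
  have ew: "e * (cmod w)\<^sup>2 = - Re w / 2" using w0 by (simp add: e_def)
  have "e\<^sup>2 * (cmod w)\<^sup>2 = e * (- Re w / 2)" unfolding ew[symmetric] by (simp add: power2_eq_square)
  then have sq2: "(cmod (1 + of_real e * w))\<^sup>2 = 1 + 3 / 2 * (e * Re w)" unfolding sq by simp
  have eR: "e * Re w < 0" using e Rw by (simp add: mult_pos_neg)
  have lt: "cmod (1 + of_real e * w) < 1"
  proof (rule power2_less_imp_less)
    show "(cmod (1 + of_real e * w))\<^sup>2 < 1\<^sup>2" unfolding sq2 using eR by simp
  qed simp
  have gt: "cmod (1 + of_real e * w) > 0"
  proof -
    have "(Re w)\<^sup>2 \<le> (cmod w)\<^sup>2" by (simp add: cmod_power2)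
    have "- (e * Re w) = (Re w)\<^sup>2 / (2 * (cmod w)\<^sup>2)" by (simp add: e_def power2_eq_square)
    also have "\<dots> \<le> 1 / 2" using \<open>(Re w)\<^sup>2 \<le> (cmod w)\<^sup>2\<close> w0 by (simp add: field_simps)
    finally have "(cmod (1 + of_real e * w))\<^sup>2 > 0" unfolding sq2 by simp
    then show ?thesis by simp
  qed
  have eq: "4 * of_real (e / 4) * cis \<phi> * a * b = of_real e * w" by (simp add: w_def mult.assoc)
  show thesis
  proof (rule that[of a b "e / 4"])
    show "p * Re a = 1" "p / (p - 1) * Re b = 1" "a + b = 1" "e / 4 > 0"
      using p e by (auto simp: a_def b_def complex_eq_iff field_simps)
    show "cmod (1 + 4 * of_real (e / 4) * cis \<phi> * a * b) < 1" "cmod (1 + 4 * of_real (e / 4) * cis \<phi> * a * b) > 0"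
      unfolding eq using lt gt by auto
  qed
qed

text \<open>For the untruncated Gaussians, the evolved pairing exceeds the product of the norms by
  the factor \<open>\<rho> > 1\<close>, while the pairing at time 0 equals that product. Both
  statements are limits along the truncations, so a strict gap persists for one of them.\<close>

lemma one_dimensional_gap:
  fixes p \<phi> :: real
  assumes p: "1 < p" and c0: "cos \<phi> > 0" and cd: "(cos \<phi>)\<^sup>2 < (1 - 2 / p)\<^sup>2"
  obtains f g t r r' where "f \<in> bumps" "g \<in> bumps" "t > 0" "1 < r" "0 \<le> r'" "r' < r"
    "0 < lp1 p f * lp1 (p / (p - 1)) g"
    "r * (lp1 p f * lp1 (p / (p - 1)) g) \<le> cmod (hpair (cis \<phi>) t f (\<lambda>x. cnj (g x)))"
    "cmod (\<integral>x. f x * cnj (g x) \<partial>lborel) \<le> r' * (lp1 p f * lp1 (p / (p - 1)) g)"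
proof -
  define q where "q = p / (p - 1)"
  have q: "q > 0" using p by (simp add: q_def)
  have pq: "1 / p + 1 / q = 1" using p by (simp add: q_def field_simps)
  obtain a b t where *: "p * Re a = 1" "q * Re b = 1" "a + b = 1" "t > 0"
    "cmod (1 + 4 * of_real t * cis \<phi> * a * b) < 1" "cmod (1 + 4 * of_real t * cis \<phi> * a * b) > 0"
    by (rule gaussian_parameters[OF assms, folded q_def]) blast
  have a: "Re a > 0" and b: "Re b > 0"
    using zero_less_mult_pos[of p "Re a"] zero_less_mult_pos[of q "Re b"] *(1,2) p q by auto
  have z: "Re (cis \<phi>) > 0" using c0 by simp
  define m where "m = cmod (1 + 4 * of_real t * cis \<phi> * a * b)"
  define \<rho> where "\<rho> = 1 / sqrt m"
  have \<rho>: "\<rho> > 1" using *(5,6) by (simp add: \<rho>_def m_def)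
  define F G where "F k = cut_gauss k a" and "G k x = cnj (cut_gauss k b x)" for k x
  have FG: "F k \<in> bumps" "G k \<in> bumps" for k
    unfolding F_def G_def[abs_def] by (intro cut_gauss_bumps bumps_cnj)+
  define N where "N k = lp1 p (F k) * lp1 q (G k)" for k
  have "lp1 q (G k) = lp1 q (cut_gauss k b)" for k by (simp add: G_def lp1_def)
  then have N: "N \<longlonglongrightarrow> sqrt pi powr (1 / p) * sqrt pi powr (1 / q)"
    unfolding N_def F_def using p q *(1,2) by (simp add: tendsto_mult lp1_cut_gauss_tendsto)
  also have "sqrt pi powr (1 / p) * sqrt pi powr (1 / q) = sqrt pi"
    by (simp add: powr_add[symmetric] pq)
  finally have N: "N \<longlonglongrightarrow> sqrt pi" .
  have "(\<lambda>k. cmod (hpair (cis \<phi>) t (cut_gauss k a) (cut_gauss k b))) \<longlonglongrightarrow> cmod (hpair (cis \<phi>) t (cgauss a 0) (cgauss b 0))"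
    by (intro tendsto_norm hpair_cut_gauss_tendsto z *(4) a b)
  also have "cmod (hpair (cis \<phi>) t (cgauss a 0) (cgauss b 0)) = sqrt pi * \<rho>"
    using hpair_cgauss[OF z *(4) a b *(3)] by (simp add: \<rho>_def m_def)
  finally have H: "(\<lambda>k. cmod (hpair (cis \<phi>) t (F k) (\<lambda>x. cnj (G k x)))) \<longlonglongrightarrow> sqrt pi * \<rho>"
    by (simp add: F_def G_def)
  have "(\<lambda>k. cmod (\<integral>x. cut_gauss k a x * cut_gauss k b x \<partial>lborel)) \<longlonglongrightarrow> cmod (\<integral>x. cgauss (a + b) 0 x \<partial>lborel)"
    by (intro tendsto_norm cut_gauss_pairing_tendsto a b)
  then have I: "(\<lambda>k. cmod (\<integral>x. F k x * cnj (G k x) \<partial>lborel)) \<longlonglongrightarrow> sqrt pi"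
    by (simp add: F_def G_def *(3) cgauss_integral_1)
  have sp: "sqrt pi > 0" by simp
  \<comment> \<open>The points dividing the interval from 1 to \<open>\<rho>\<close> into thirds:
    \<open>1 < r' < r < \<rho>\<close> leaves a margin at both ends for the truncation
    error.\<close>
  define r r' where "r = (1 + 2 * \<rho>) / 3" and "r' = (2 + \<rho>) / 3"
  have r: "1 < r" "0 \<le> r'" "r' < r" "r < \<rho>" "1 < r'" using \<rho> by (auto simp: r_def r'_def)
  have "(\<lambda>k. cmod (hpair (cis \<phi>) t (F k) (\<lambda>x. cnj (G k x))) - r * N k) \<longlonglongrightarrow> sqrt pi * \<rho> - r * sqrt pi"
    by (intro tendsto_intros H N)
  moreover have "sqrt pi * \<rho> - r * sqrt pi > 0" using r sp by (simp add: mult.commute)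
  ultimately have e1: "\<forall>\<^sub>F k in sequentially. cmod (hpair (cis \<phi>) t (F k) (\<lambda>x. cnj (G k x))) - r * N k > 0"
    by (rule order_tendstoD(1))
  have "(\<lambda>k. r' * N k - cmod (\<integral>x. F k x * cnj (G k x) \<partial>lborel)) \<longlonglongrightarrow> r' * sqrt pi - sqrt pi"
    by (intro tendsto_intros I N)
  moreover have "r' * sqrt pi - sqrt pi > 0" using r sp by simp
  ultimately have e2: "\<forall>\<^sub>F k in sequentially. r' * N k - cmod (\<integral>x. F k x * cnj (G k x) \<partial>lborel) > 0"
    by (rule order_tendstoD(1))
  have e3: "\<forall>\<^sub>F k in sequentially. N k > 0" using order_tendstoD(1)[OF N sp] .
  from eventually_happens'[OF sequentially_bot eventually_conj[OF e1 eventually_conj[OF e2 e3]]]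
  obtain k where k: "cmod (hpair (cis \<phi>) t (F k) (\<lambda>x. cnj (G k x))) - r * N k > 0"
    "r' * N k - cmod (\<integral>x. F k x * cnj (G k x) \<partial>lborel) > 0" "N k > 0" by blast
  show thesis
    by (rule that[of "F k" "G k" t r r']) (use FG *(4) r k in \<open>auto simp: N_def q_def\<close>)
qed

text \<open>For tensor powers everything becomes an \<open>n\<close>-th power, including the norm
  product \<open>C^n\<close>, which cancels. The initial pairing is subtracted, which is why it must
  have the smaller base \<open>r'\<close>.\<close>

lemma N_const_lower_bound:
  fixes p \<phi> :: real
  assumes p: "1 < p" and c0: "cos \<phi> > 0" and t: "t > 0" and fg: "f \<in> bumps" "g \<in> bumps"
    and C: "C = lp1 p f * lp1 (p / (p - 1)) g" "C > 0" and r: "0 \<le> r'" "0 \<le> r"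
    and H: "r * C \<le> cmod (hpair (cis \<phi>) t f (\<lambda>x. cnj (g x)))"
    and I: "cmod (\<integral>x. f x * cnj (g x) \<partial>lborel) \<le> r' * C"
  shows "ennreal ((r ^ n - r' ^ n) / 2) \<le> N_const n p (\<lambda>_. cis \<phi> \<cdot>\<^sub>m 1\<^sub>m n) (\<lambda>_. cis (- \<phi>) \<cdot>\<^sub>m 1\<^sub>m n)"
proof -
  define q where "q = p / (p - 1)"
  have q: "q > 0" using p by (simp add: q_def)
  let ?z = "cis \<phi>"
  have z: "Re ?z > 0" "cmod ?z = 1" using c0 by auto
  let ?f = "tens n (\<lambda>_. f)" and ?g = "tens n (\<lambda>_. g)"
  let ?gc = "\<lambda>x. cnj (?g x)"
  have gc: "?gc = tens n (\<lambda>_ x. cnj (g x))" by (simp add: fun_eq_iff tens_cnj)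
  have gcb: "(\<lambda>x. cnj (g x)) \<in> bumps" by (rule bumps_cnj[OF fg(2)])
  \<comment> \<open>The time is written \<open>2 * (t / 2)\<close> to match
    \<open>embedding_lower_bound\<close>, which doubles its time parameter.\<close>
  have P1: "pairing (Rn n) (heat n ?z (2 * (t / 2)) ?f) ?gc = hpair ?z t f (\<lambda>x. cnj (g x)) ^ n"
    unfolding gc using pairing_heat_tens[OF z(1) t, of n "\<lambda>_. f" "\<lambda>_ x. cnj (g x)"] fg(1) gcb by (simp add: hpair_def)
  have P0: "pairing (Rn n) ?f ?gc = (\<integral>x. f x * cnj (g x) \<partial>lborel) ^ n"
    unfolding gc using pairing_tens[of n "\<lambda>_. f" "\<lambda>_ x. cnj (g x)"] fg(1) gcb by simp
  have nrm: "Lp_norm n p ?f * Lp_norm n q ?g = C ^ n"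
    using fg p q by (simp add: Lp_norm_tens C(1) q_def power_mult_distrib)
  define E where "E = (\<integral>\<^sup>+t\<in>{0<..}. (\<integral>\<^sup>+x. ennreal (cvec_norm (grad n (heat_semigroup n (\<lambda>_. ?z \<cdot>\<^sub>m 1\<^sub>m n) t ?f) x) *
          cvec_norm (grad n (heat_semigroup n (\<lambda>_. cis (- \<phi>) \<cdot>\<^sub>m 1\<^sub>m n) t ?g) x)) \<partial>Rn n) \<partial>lborel)"
  have "(r ^ n - r' ^ n) / 2 * C ^ n = ((r * C) ^ n - (r' * C) ^ n) / 2" by (simp add: power_mult_distrib algebra_simps diff_divide_distrib)
  also have "\<dots> \<le> (cmod (hpair ?z t f (\<lambda>x. cnj (g x))) ^ n - cmod (\<integral>x. f x * cnj (g x) \<partial>lborel) ^ n) / 2"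
    using H I r C(2) by (intro divide_right_mono diff_mono power_mono) auto
  also have "\<dots> \<le> cmod (pairing (Rn n) (heat n ?z (2 * (t / 2)) ?f) ?gc - pairing (Rn n) ?f ?gc) / 2"
    unfolding P1 P0 norm_power[symmetric] by (intro divide_right_mono norm_triangle_ineq2) simp
  finally have le: "(r ^ n - r' ^ n) / 2 * C ^ n \<le> cmod (pairing (Rn n) (heat n ?z (2 * (t / 2)) ?f) ?gc - pairing (Rn n) ?f ?gc) / 2" .
  have "ennreal ((r ^ n - r' ^ n) / 2 * C ^ n) \<le> E"
    unfolding E_def cis_cnj[symmetric]
    by (rule order_trans[OF ennreal_leI[OF le] embedding_lower_bound[OF z]]) (use t fg in auto)
  then have "ennreal ((r ^ n - r' ^ n) / 2 * C ^ n) / ennreal (C ^ n) \<le> E / ennreal (C ^ n)"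
    by (rule divide_right_mono_ennreal)
  moreover have "ennreal ((r ^ n - r' ^ n) / 2 * C ^ n) / ennreal (C ^ n) = ennreal ((r ^ n - r' ^ n) / 2)"
    unfolding ennreal_mult''[OF zero_le_power[OF less_imp_le[OF C(2)]]]
    using C(2) by (intro ennreal_mult_divide_eq) (auto simp: ennreal_eq_0_iff not_le)
  moreover have "E / ennreal (C ^ n) \<le> N_const n p (\<lambda>_. cis \<phi> \<cdot>\<^sub>m 1\<^sub>m n) (\<lambda>_. cis (- \<phi>) \<cdot>\<^sub>m 1\<^sub>m n)"
  proof -
    \<comment> \<open>Admissible functions must be nonzero somewhere on the space; a nonvanishing
      norm provides a point, repeated in every coordinate.\<close>
    have ne: "\<exists>x\<in>space (Rn n). tens n (\<lambda>_. h) x \<noteq> 0" if "lp1 p' h \<noteq> 0" for h p'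
    proof -
      have "\<exists>s. h s \<noteq> 0"
      proof (rule ccontr)
        assume "\<nexists>s. h s \<noteq> 0"
        then have "lp1 p' h = 0" by (simp add: lp1_def)
        with that show False by simp
      qed
      then obtain s where "h s \<noteq> 0" by blast
      then show ?thesis
        by (intro bexI[of _ "\<lambda>i\<in>{..<n}. s"]) (auto simp: tens_def space_Rn)
    qed
    have "lp1 p f \<noteq> 0" "lp1 q g \<noteq> 0" using C by (auto simp: q_def)
    then have F: "?f \<in> {f \<in> test_functions n. \<exists>x\<in>space (Rn n). f x \<noteq> 0}"
      and G: "?g \<in> {f \<in> test_functions n. \<exists>x\<in>space (Rn n). f x \<noteq> 0}"
      using fg by (auto intro: tens_bumps_test ne)
    show ?thesis
      unfolding N_const_def Let_def q_def[symmetric]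
      by (rule SUP_upper2[OF F], rule SUP_upper2[OF G]) (simp add: nrm E_def)
  qed
  ultimately show ?thesis by simp
qed

theorem proposition1p2:
  fixes p \<phi> :: real
  assumes "1 < p" and "p \<noteq> 2"
    and "arccos \<bar>1 - 2 / p\<bar> < \<phi>" and "\<phi> < pi / 2"
  shows "(SUP n\<in>{1::nat..}. N_const n p (\<lambda>_. cis \<phi> \<cdot>\<^sub>m 1\<^sub>m n) (\<lambda>_. cis (- \<phi>) \<cdot>\<^sub>m 1\<^sub>m n)) = \<infinity>"
proof -
  define d where "d = \<bar>1 - 2 / p\<bar>"
  have d: "0 \<le> d" "d \<le> 1" using assms(1) by (auto simp: d_def abs_le_iff field_simps)
  have \<phi>: "0 \<le> \<phi>" "\<phi> \<le> pi" using assms(3,4) arccos_lbound[of d] d unfolding d_def by (auto simp: less_imp_le)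
  have c0: "cos \<phi> > 0" using assms(4) \<phi> by (intro cos_gt_zero_pi) auto
  have "cos \<phi> < cos (arccos d)"
    using assms(3) \<phi> arccos_lbound[of d] d unfolding d_def[symmetric] by (intro cos_monotone_0_pi) auto
  then have "cos \<phi> < d" using d by (simp add: cos_arccos)
  then have "(cos \<phi>)\<^sup>2 < d\<^sup>2" using c0 by (intro power_strict_mono) auto
  then have cd: "(cos \<phi>)\<^sup>2 < (1 - 2 / p)\<^sup>2" by (simp add: d_def)
  obtain f g t r r' where *: "f \<in> bumps" "g \<in> bumps" "t > 0" "1 < r" "0 \<le> r'" "r' < r"
    "0 < lp1 p f * lp1 (p / (p - 1)) g"
    "r * (lp1 p f * lp1 (p / (p - 1)) g) \<le> cmod (hpair (cis \<phi>) t f (\<lambda>x. cnj (g x)))"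
    "cmod (\<integral>x. f x * cnj (g x) \<partial>lborel) \<le> r' * (lp1 p f * lp1 (p / (p - 1)) g)"
    using one_dimensional_gap[OF assms(1) c0 cd] by blast
  have lower: "ennreal ((r ^ n - r' ^ n) / 2) \<le> N_const n p (\<lambda>_. cis \<phi> \<cdot>\<^sub>m 1\<^sub>m n) (\<lambda>_. cis (- \<phi>) \<cdot>\<^sub>m 1\<^sub>m n)" for n
    by (rule N_const_lower_bound[OF assms(1) c0 *(3,1,2) refl *(7,5) _ *(8,9)]) (use *(4) in simp)
  show ?thesis
    unfolding infinity_ennreal_def
  proof (rule ennreal_SUP_eq_top)
    fix m :: nat
    \<comment> \<open>From \<open>r'^(n+1) \<le> r' r^n\<close> one gets
      \<open>r^(n+1) - r'^(n+1) \<ge> (r - r') r^n \<ge> c r^n\<close>, which is unbounded. The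
      exponent \<open>n + 1\<close> keeps the dimension at least 1.\<close>
    define c where "c = (r - r') / r"
    have c: "c > 0" using *(4,6) by (simp add: c_def)
    obtain n where n: "2 * real m / c < r ^ n" using real_arch_pow[OF *(4)] by blast
    have rn: "r ^ n \<le> r ^ Suc n" using *(4) by (intro power_increasing) auto
    have "r' ^ Suc n \<le> r' * r ^ n"
      using *(5,6) by (simp add: mult_left_mono power_mono)
    then have "(r - r') * r ^ n \<le> r ^ Suc n - r' ^ Suc n" by (simp add: algebra_simps)
    moreover have "c * r ^ n \<le> (r - r') * r ^ n"
      using *(4,6) divide_left_mono[of 1 r "r - r'"] by (intro mult_right_mono) (auto simp: c_def)
    moreover have "2 * real m \<le> c * r ^ n" using n c by (simp add: field_simps)
    ultimately have "real m \<le> (r ^ Suc n - r' ^ Suc n) / 2" by simp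
    then have "of_nat m \<le> ennreal ((r ^ Suc n - r' ^ Suc n) / 2)"
      by (metis ennreal_leI ennreal_of_nat_eq_real_of_nat)
    then have "of_nat m \<le> N_const (Suc n) p (\<lambda>_. cis \<phi> \<cdot>\<^sub>m 1\<^sub>m (Suc n)) (\<lambda>_. cis (- \<phi>) \<cdot>\<^sub>m 1\<^sub>m (Suc n))"
      using lower[of "Suc n"] by (rule order_trans)
    then show "\<exists>n\<in>{1..}. of_nat m \<le> N_const n p (\<lambda>_. cis \<phi> \<cdot>\<^sub>m 1\<^sub>m n) (\<lambda>_. cis (- \<phi>) \<cdot>\<^sub>m 1\<^sub>m n)"
      by (intro bexI[of _ "Suc n"]) auto
  qed
qed

end
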